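(* Let $a_0,b_0$ be any unitary symmetric $2\times2$ complex matrices. Let $U,V$ be open neighborhoods of $a_0$ and $b_0$ respectively. Let $\varphi:U\cap\mathcal R_{II}\to V\cap\mathcal R_{II}$ be a biholomorphic mapping. If $\varphi(a_k)\to b_0$ for some $a_k\to a_0$, then $\varphi$ extends to an automorphism of $\mathcal R_{II}$.
   Context: $\mathcal R_{II}=\{z\in\mathcal M_{2\times2}(\mathbb C): z=z^t,\ \|z\|<1\}$ is the classical Cartan domain of the second type, where $\mathcal M_{2\times2}(\mathbb C)$ is the space of $2\times2$ complex matrices and $\|\cdot\|$ is the operator norm; it is regarded as a domain in the 3-dimensional complex space of symmetric $2\times2$ matrices, and $U,V$ are open sets in that space. Here $(a_k)$ is a sequence of points of $U\cap\mathcal R_{II}$. An automorphism of $\mathcal R_{II}$ is a biholomorphic mapping of $\mathcal R_{II}$ onto itself.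
   Formalization: The claim fails if U∩R_II is disconnected (φ may be unrelated on a component away from a_0), so the automorphism is only required to agree with φ on the component of U∩R_II having a_0 in its closure; for connected U∩R_II this is all of U∩R_II. *)

theory Defs
  imports "HOL-Analysis.Analysis"
begin

type_synonym mat2 = "complex^2^2"

text \<open>
  The three-dimensional complex vector space of symmetric matrices is represented as a subset of
  the space of all \<open>2 \<times> 2\<close> matrices; its open sets are those of the subspace topology.
\<close>

definition Sym :: "mat2 set"
  where "Sym = {z. transpose z = z}"

definition unitary_matrix :: "mat2 \<Rightarrow> bool"
  where "unitary_matrix A \<longleftrightarrow>
    A ** map_matrix cnj (transpose A) = mat 1 \<and> map_matrix cnj (transpose A) ** A = mat 1"

text \<open>
  The norm of the type \<^typ>\<open>complex^2^2\<close> is the Frobenius norm, so the operator norm with respect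
  to the Euclidean norm of \<^typ>\<open>complex^2\<close> is used explicitly.
\<close>

definition R_II :: "mat2 set"
  where "R_II = {z \<in> Sym. onorm (\<lambda>x. z *v x) < 1}"

text \<open>
  Holomorphy for \<open>S\<close> open in \<^const>\<open>Sym\<close>: the real Frechet derivative exists at every point and is
  complex linear. The derivative within \<open>S\<close> is determined only on \<^const>\<open>Sym\<close>, hence complex
  linearity is required there.
\<close>

definition holomorphic_Sym :: "(mat2 \<Rightarrow> mat2) \<Rightarrow> mat2 set \<Rightarrow> bool"
  where "holomorphic_Sym f S \<longleftrightarrow>
    (\<forall>z\<in>S. \<exists>D. (f has_derivative D) (at z within S) \<and>
      (\<forall>c. \<forall>X\<in>Sym. D (map_matrix ((*) c) X) = map_matrix ((*) c) (D X)))"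

definition biholomorphic_Sym :: "mat2 set \<Rightarrow> mat2 set \<Rightarrow> (mat2 \<Rightarrow> mat2) \<Rightarrow> bool"
  where "biholomorphic_Sym S T f \<longleftrightarrow>
    bij_betw f S T \<and> holomorphic_Sym f S \<and> holomorphic_Sym (inv_into S f) T"

definition automorphism_R_II :: "(mat2 \<Rightarrow> mat2) \<Rightarrow> bool"
  where "automorphism_R_II f \<longleftrightarrow> biholomorphic_Sym R_II R_II f"

text \<open>
  A map on a disconnected set \<open>S\<close> may be given by unrelated formulas on the components of \<open>S\<close>, so
  being the restriction of \<open>F\<close> is asked for on the part of \<open>S\<close> that touches a boundary point \<open>p\<close>.
  For connected \<open>S\<close> this is agreement on all of \<open>S\<close>.
\<close>

definition extends_from :: "mat2 \<Rightarrow> mat2 set \<Rightarrow> (mat2 \<Rightarrow> mat2) \<Rightarrow> (mat2 \<Rightarrow> mat2) \<Rightarrow> bool"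
  where "extends_from p S f F \<longleftrightarrow>
    (\<forall>C\<in>components S. p \<in> closure C \<longrightarrow> (\<forall>z\<in>C. F z = f z))"

lemma extends_from_connected:
  assumes "connected S" and "p \<in> closure S"
  shows "extends_from p S f F \<longleftrightarrow> (\<forall>z\<in>S. F z = f z)"
proof (cases "S = {}")
  case True
  then show ?thesis by (simp add: extends_from_def)
next
  case False
  with assms(1) have "components S = {S}"
    by (simp add: components_eq_sing_iff)
  with assms(2) show ?thesis by (simp add: extends_from_def)
qed

end

theory Submission
  imports Defs "HOL-Complex_Analysis.Complex_Analysis"
begin

text \<open>
  Charts centred at \<open>a0\<close> and \<open>b0\<close> turn \<open>\<phi>\<close> into a local map \<open>F\<close> of the Siegel half space near \<open>0\<close>.
  Real affine maps renormalise \<open>F\<close> at \<open>a k\<close> to a map fixing \<open>i I\<close> that is defined on ever larger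
  pieces of the half space. By the Schwarz lemma, applied to the map and to its inverse, its derivative
  at \<open>i I\<close> is almost an isometry of the operator norm, hence almost preserves the cone of singular
  matrices. Descending along \<open>i y I\<close> towards \<open>y = 0\<close>, the Schwarz--Pick lemma shows that \<open>Im F\<close> tends to \<open>0\<close> and
  that the defect of cone preservation, suitably scaled, tends to \<open>0\<close> too. That defect is holomorphic along
  slices and vanishes on the real boundary, so it vanishes: \<open>F\<close> is conformal for the cone of singular
  matrices. Liouville's theorem then writes \<open>F = N\<^sup>-\<^sup>1 R\<close> with affine \<open>N\<close> and \<open>R\<close>, reality of the boundary values makes
  the coefficients real, and such a map acts on the whole half space. The same holds for the inverse.
\<close>

unbundle no Formal_Power_Series.fps_syntax

section \<open>Two by two matrices\<close>

text \<open>The obstacle is the unitary freedom at the base point. That the derivative at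
  \<open>ii\<close> is almost an isometry shows only that the image of the identity matrix is almost
  unitary, and a rotation fixing \<open>ii\<close> may send the boundary point 0 to infinity, so a
  descent could leave every bounded set. Hence the descent starts only from maps satisfying
  \<open>pre_state\<close>, whose derivative sends the identity matrix to one with numerical values
  near 1. Such a base point is found by moving from \<open>ii\<close> along a Cayley disc almost to
  its boundary: there the disc map is almost linear with a nearly unitary coefficient, and
  renormalising at the new point removes this coefficient up to a small error. Two facts make the
  descent stable. Numerical values near 1 of a nearly unitary matrix have modulus 1 up to the square
  of the error, so one step contracts the first order error. And the imaginary part of
  \<open>F\<close> decays, so that with the domain of \<open>F\<close> fixed the renormalised maps
  live on half balls of radius tending to infinity and become as nearly isometric as
  desired.\<close>

lemma mat2_eq_iff:
 fixes A B :: mat2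
 shows "A = B \<longleftrightarrow> A$1$1 = B$1$1 & A$1$2 = B$1$2 & A$2$1 = B$2$1 & A$2$2 = B$2$2"
 by (auto simp: vec_eq_iff forall_2)

lemma vec2_eq_iff:
 fixes x y :: "'a^2"
 shows "x = y \<longleftrightarrow> x$1 = y$1 & x$2 = y$2"
 by (auto simp: vec_eq_iff forall_2)

lemma mat2_mult_nth [simp]:
 fixes A B :: mat2
 shows "(A ** B)$i$j = A$i$1 * B$1$j + A$i$2 * B$2$j"
 by (simp add: matrix_matrix_mult_def sum_2)

lemma mat2_vec_nth [simp]:
 fixes A :: mat2
 shows "(A *v x)$i = A$i$1 * x$1 + A$i$2 * x$2"
 by (simp add: matrix_vector_mult_def sum_2)

lemma mat2_one_nth [simp]:
 "(mat 1 :: mat2)$1$1 = 1" "(mat 1 :: mat2)$1$2 = 0"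
 "(mat 1 :: mat2)$2$1 = 0" "(mat 1 :: mat2)$2$2 = 1"
 by (auto simp: mat_def)

lemma transpose_nth [simp]: "transpose A $ i $ j = A $ j $ i"
 by (simp add: transpose_def)

definition cscale :: "complex => mat2 => mat2"
 where "cscale c X = map_matrix ((*) c) X"

lemma cscale_nth [simp]: "cscale c X $ i $ j = c * X $ i $ j"
 by (simp add: cscale_def)

lemma cscale_simps [simp]:
 "cscale 0 X = 0" "cscale 1 X = X" "cscale c 0 = 0"
 "cscale a (cscale b X) = cscale (a * b) X"
 by (simp_all add: mat2_eq_iff)

lemma cscale_add: "cscale (a + b) X = cscale a X + cscale b X"
 "cscale a (X + Y) = cscale a X + cscale a Y"
 "cscale (a - b) X = cscale a X - cscale b X"
 "cscale a (X - Y) = cscale a X - cscale a Y"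
 by (simp_all add: mat2_eq_iff algebra_simps)

definition symat :: "complex => complex => complex => mat2"
 where "symat a b c = (\<chi> i j. if i = 1 then (if j = 1 then a else b) else (if j = 1 then b else c))"

lemma symat_nth [simp]:
 "symat a b c $1$1 = a" "symat a b c $1$2 = b" "symat a b c $2$1 = b" "symat a b c $2$2 = c"
 by (auto simp: symat_def)

lemma Sym_iff: "Z \<in> Sym \<longleftrightarrow> Z$2$1 = Z$1$2"
 by (auto simp: Sym_def mat2_eq_iff)

lemma Sym_eq_symat: "Z \<in> Sym ==> Z = symat (Z$1$1) (Z$1$2) (Z$2$2)"
 by (simp add: Sym_iff mat2_eq_iff)

lemma Sym_simps [simp, intro]:
 "symat a b c \<in> Sym" "0 \<in> Sym" "mat 1 \<in> Sym"
 "Z \<in> Sym ==> cscale c Z \<in> Sym"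
 "Z \<in> Sym ==> W \<in> Sym ==> Z + W \<in> Sym"
 "Z \<in> Sym ==> W \<in> Sym ==> Z - W \<in> Sym"
 "Z \<in> Sym ==> - Z \<in> Sym"
 by (auto simp: Sym_iff)

lemma norm_mat2: "norm (Z::mat2) = sqrt ((cmod (Z$1$1))\<^sup>2 + (cmod (Z$1$2))\<^sup>2 + (cmod (Z$2$1))\<^sup>2 + (cmod (Z$2$2))\<^sup>2)"
 by (simp add: norm_vec_def L2_set_def sum_2)

lemma norm_vec2: "norm (x::complex^2) = sqrt ((cmod (x$1))\<^sup>2 + (cmod (x$2))\<^sup>2)"
 by (simp add: norm_vec_def L2_set_def sum_2)

lemma norm_cscale: "norm (cscale c Z) = cmod c * norm Z"
proof -
 have "norm (cscale c Z) = sqrt ((cmod c)\<^sup>2 * ((cmod (Z$1$1))\<^sup>2 + (cmod (Z$1$2))\<^sup>2 + (cmod (Z$2$1))\<^sup>2 + (cmod (Z$2$2))\<^sup>2))"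
  by (simp add: norm_mat2 norm_mult power_mult_distrib algebra_simps)
 then show ?thesis by (simp add: norm_mat2 real_sqrt_mult)
qed

lemma cmod_nth_le: "cmod ((Z::mat2)$i$j) <= norm Z"
 using Finite_Cartesian_Product.norm_nth_le[of "Z$i" j] Finite_Cartesian_Product.norm_nth_le[of Z i] by linarith

lemma norm_mat2_le: "norm (Z::mat2) <= cmod (Z$1$1) + cmod (Z$1$2) + cmod (Z$2$1) + cmod (Z$2$2)"
 unfolding norm_mat2 by (rule real_le_lsqrt) (auto simp: power2_eq_square algebra_simps)

lemma bounded_linear_nth: "bounded_linear (%Z::mat2. Z$i$j)"
 using bounded_linear_compose[OF bounded_linear_vec_nth[of j] bounded_linear_vec_nth[of i]] by (simp add: o_def)

lemma bounded_linear_cscale_left: "bounded_linear (%c. cscale c X)"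
 by (rule bounded_linear_intro[where K = "norm X"])
  (auto simp: mat2_eq_iff algebra_simps norm_cscale mult.commute)

lemma continuous_on_mat2I:
 fixes F :: "'a::topological_space => mat2"
 assumes "!!i j. continuous_on S (%z. F z $ i $ j)"
 shows "continuous_on S F"
 unfolding continuous_on_def
proof
 fix x assume "x \<in> S"
 then show "(F \<longlongrightarrow> F x) (at x within S)"
  using assms by (intro vec_tendstoI) (auto simp: continuous_on_def)
qed

lemma tendsto_mat2I:
 fixes F :: "'a => mat2"
 assumes "!!i j. ((%z. F z $ i $ j) \<longlongrightarrow> L $ i $ j) A"
 shows "(F \<longlongrightarrow> L) A"
 by (rule vec_tendstoI, rule vec_tendstoI, rule assms)

lemma tendsto_nth2:
 fixes F :: "'a => mat2"
 assumes "(F \<longlongrightarrow> L) A"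
 shows "((%z. F z $ i $ j) \<longlongrightarrow> L $ i $ j) A"
 by (rule tendsto_vec_nth, rule tendsto_vec_nth, rule assms)

lemma closed_Sym: "closed Sym"
proof -
 have "Sym = {Z. Z$2$1 = Z$1$2}" by (auto simp: Sym_iff)
 moreover have "closed {Z::mat2. Z$2$1 = Z$1$2}"
  by (intro closed_Collect_eq continuous_intros linear_continuous_on bounded_linear_nth)
 ultimately show ?thesis by simp
qed

section \<open>Holomorphic functions on open sets of symmetric matrices\<close>

abbreviation open_Sym :: "mat2 set => bool"
 where "open_Sym S \<equiv> openin (top_of_set Sym) S"

lemma open_SymI:
 assumes "S \<subseteq> Sym" "!!Z. Z \<in> S ==> \<exists>r>0. \<forall>W\<in>Sym. norm (W - Z) < r --> W \<in> S"
 shows "open_Sym S"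
 using assms by (auto simp: openin_euclidean_subtopology_iff dist_norm)

lemma open_SymD:
 assumes "open_Sym S" "Z \<in> S"
 obtains r where "r > 0" "!!W. W \<in> Sym ==> norm (W - Z) < r ==> W \<in> S"
 using assms by (auto simp: openin_euclidean_subtopology_iff dist_norm)

lemma open_line:
 assumes "open_Sym S" "Z \<in> Sym" "X \<in> Sym"
 shows "open {t. Z + cscale t X \<in> S}"
proof -
 obtain O' where O: "open O'" "S = Sym \<inter> O'" using assms(1) by (auto simp: openin_open)
 have "{t. Z + cscale t X \<in> S} = (%t. Z + cscale t X) -` O'" using O assms by auto
 moreover have "open \<dots>"
  by (intro open_vimage O continuous_intros linear_continuous_on bounded_linear_cscale_left)
 ultimately show ?thesis by simp
qed

text \<open>Local boundedness and holomorphy along complex lines (the class is closed under directional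
 derivatives, which is why it is preferred to Frechet differentiability for scalar functions).\<close>

definition gholo :: "(mat2 => complex) => mat2 set => bool"
 where "gholo f S \<longleftrightarrow> open_Sym S &
  (\<forall>Z\<in>S. \<exists>r>0. \<exists>B. \<forall>W\<in>Sym. norm (W - Z) < r --> cmod (f W) <= B) &
  (\<forall>Z\<in>S. \<forall>X\<in>Sym. (%t. f (Z + cscale t X)) field_differentiable (at 0))"

definition ddir :: "(mat2 => complex) => mat2 => mat2 => complex"
 where "ddir f X Z = deriv (%t. f (Z + cscale t X)) 0"

lemma gholo_open: "gholo f S ==> open_Sym S"
 by (simp add: gholo_def)

lemma open_Sym_subset: "open_Sym S ==> S \<subseteq> Sym"
 by (simp add: openin_euclidean_subtopology_iff)

lemma gholo_line_deriv:
 assumes "gholo f S" "Z \<in> Sym" "X \<in> Sym" "Z + cscale s X \<in> S"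
 shows "((%t. f (Z + cscale t X)) has_field_derivative ddir f X (Z + cscale s X)) (at s)"
proof -
 have "((%t. f ((Z + cscale s X) + cscale t X)) has_field_derivative ddir f X (Z + cscale s X)) (at 0)"
  using assms by (simp add: gholo_def ddir_def field_differentiable_derivI)
 then have "((%t. f (Z + cscale (s + t) X)) has_field_derivative ddir f X (Z + cscale s X)) (at 0)"
  by (simp add: cscale_add add.assoc)
 then show ?thesis
  using DERIV_shift[of "%t. f (Z + cscale t X)" _ 0 s] by (simp add: add.commute)
qed

lemma gholo_line:
 assumes "gholo f S" "Z \<in> Sym" "X \<in> Sym" "!!s. s \<in> T ==> Z + cscale s X \<in> S"
 shows "(%t. f (Z + cscale t X)) holomorphic_on T"
 unfolding holomorphic_on_def
 using gholo_line_deriv[OF assms(1-3)] assms(4) field_differentiable_at_within field_differentiable_def by blast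

lemma gholo_bdd:
 assumes "gholo f S" "Z \<in> S"
 obtains r B where "r > 0" "B > 0" "!!W. W \<in> Sym ==> norm (W - Z) < r ==> W \<in> S & cmod (f W) <= B"
proof -
 obtain r1 where r1: "r1 > 0" "!!W. W \<in> Sym ==> norm (W - Z) < r1 ==> W \<in> S"
  using open_SymD assms gholo_open by metis
 obtain r2 B where r2: "r2 > 0" "!!W. W \<in> Sym ==> norm (W - Z) < r2 ==> cmod (f W) <= B"
  using assms unfolding gholo_def by meson
 show thesis
  by (rule that[of "min r1 r2" "max B 1"]) (use r1 r2 in \<open>auto simp: max_def intro: order_trans\<close>)
qed

text \<open>Cauchy's inequality on the circle of half the radius, because holomorphy and the bound
  are given only on the open disc; this is the factor 2.\<close>

lemma deriv_bound:
 assumes "f holomorphic_on ball z r" "0 < r" "!!w. w \<in> ball z r ==> cmod (f w) <= B"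
 shows "cmod (deriv f z) <= 2 * B / r"
proof -
 have "cmod ((deriv ^^ 1) f z) <= fact 1 * B / (r/2) ^ 1"
 proof (rule Cauchy_inequality)
  show "f holomorphic_on ball z (r/2)" by (rule holomorphic_on_subset[OF assms(1)]) (use assms in auto)
  show "continuous_on (cball z (r/2)) f"
   by (rule holomorphic_on_imp_continuous_on, rule holomorphic_on_subset[OF assms(1)]) (use assms in auto)
 qed (use assms in \<open>auto simp: dist_norm norm_minus_commute\<close>)
 then show ?thesis by (simp add: field_simps)
qed

text \<open>Every point of the half disc is the centre of a disc of radius \<open>r/2\<close> inside
  the given one, so \<open>deriv_bound\<close> controls the derivative there.\<close>

lemma lipschitz_bound:
 assumes "f holomorphic_on ball z r" "0 < r" "!!w. w \<in> ball z r ==> cmod (f w) <= B"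
  and "w \<in> ball z (r/2)"
 shows "cmod (f w - f z) <= 4 * B / r * cmod (w - z)"
proof (rule field_differentiable_bound[where S = "ball z (r/2)" and f' = "deriv f"])
 fix u assume u: "u \<in> ball z (r/2)"
 have sub: "ball u (r/2) \<subseteq> ball z r"
 proof
  fix v assume "v \<in> ball u (r/2)"
  then show "v \<in> ball z r" using u dist_triangle[of z v u] by simp
 qed
 have "f holomorphic_on ball u (r/2)" using assms(1) sub holomorphic_on_subset by blast
 then show "cmod (deriv f u) <= 4 * B / r"
  using deriv_bound[of f u "r/2" B] assms(2,3) sub by (simp add: subset_iff)
 have "u \<in> ball z r" using u assms(2) by auto
 then show "(f has_field_derivative deriv f u) (at u within ball z (r/2))"
  using assms(1) holomorphic_derivI[of f "ball z r" u] has_field_derivative_at_within by blast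
qed (use assms in auto)

text \<open>The difference quotients converge uniformly to the derivative, which makes the derivative in
 one variable holomorphic in the other one.\<close>

lemma mixed_derivative:
 fixes g :: "complex => complex => complex"
 assumes r: "0 < r"
  and h1: "!!w. cmod w < r ==> (%z. g z w) holomorphic_on ball 0 r"
  and h2: "!!z. cmod z < r ==> g z holomorphic_on ball 0 r"
  and bd: "!!z w. cmod z < r ==> cmod w < r ==> cmod (g z w) <= B"
 shows "((%z. deriv (g z) 0) has_field_derivative deriv (%w. deriv (%z. g z w) 0) 0) (at 0)"
  and "(%w. deriv (%z. g z w) 0) field_differentiable (at 0)"
proof -
 \<comment> \<open>Stated for arbitrary \<open>g\<close> because it is used twice, the second time
   with the two variables interchanged. Following a sequence \<open>h\<close> allows both mixed
   derivatives to be read off from the same quotients.\<close>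
 have gen: "\<exists>D. ((%z. deriv (g z) 0) has_field_derivative D) (at 0) &
   (%n. (deriv (%z. g z (h n)) 0 - deriv (%z. g z 0) 0) / h n) \<longlonglongrightarrow> D"
  if r: "0 < r"
  and h1: "!!w. cmod w < r ==> (%z. g z w) holomorphic_on ball 0 r"
  and h2: "!!z. cmod z < r ==> g z holomorphic_on ball 0 r"
  and bd: "!!z w. cmod z < r ==> cmod w < r ==> cmod (g z w) <= B"
  and h: "h \<longlonglongrightarrow> 0" "!!n. h n ~= 0" "!!n. cmod (h n) < r / 4"
  for g :: "complex => complex => complex" and h :: "nat => complex" and B r
 proof -
  define q where "q n z = (g z (h n) - g z 0) / h n" for n z
  have B: "0 <= B" using order_trans[OF norm_ge_zero bd[of 0 0]] r by simp
  have est: "cmod (q n z - deriv (g z) 0) <= 32 * B / r^2 * cmod (h n)" if z: "cmod z < r" for n z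
  proof -
   \<comment> \<open>Without its linear part the function has as derivative the increment of
     \<open>deriv (g z)\<close>, which is of order \<open>h n\<close> by the Lipschitz bound,
     uniformly in \<open>z\<close>.\<close>
   define k where "k w = g z w - w * deriv (g z) 0" for w
   have hol: "g z holomorphic_on ball 0 r" by (rule h2[OF z])
   have der: "(k has_field_derivative (deriv (g z) w - deriv (g z) 0)) (at w)" if "w \<in> ball 0 r" for w
    unfolding k_def by (rule derivative_eq_intros refl holomorphic_derivI[OF hol _ that] | simp)+
   have dlip: "cmod (deriv (g z) w - deriv (g z) 0) <= 32 * B / r^2 * cmod (h n)"
    if w: "w \<in> cball 0 (cmod (h n))" for w
   proof -
    have h4: "cmod (h n) < r / 4" by (rule h)
    have wr: "w \<in> ball 0 (r/4)" using w h4 by simp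
    have hd: "deriv (g z) holomorphic_on ball 0 (r/2)"
     by (rule holomorphic_on_subset[OF holomorphic_deriv[OF hol]]) (use r in auto)
    have bd': "cmod (deriv (g z) u) <= 4 * B / r" if u: "u \<in> ball 0 (r/2)" for u
    proof -
     have sub: "ball u (r/2) \<subseteq> ball 0 r"
     proof
      fix v assume "v \<in> ball u (r/2)"
      then show "v \<in> ball 0 r" using u dist_triangle[of 0 v u] by simp
     qed
     have hu: "g z holomorphic_on ball u (r/2)" by (rule holomorphic_on_subset[OF hol sub])
     have bu: "cmod (g z v) <= B" if "v \<in> ball u (r/2)" for v
      using bd[OF z, of v] sub that by (simp add: subset_iff)
     show ?thesis
      using deriv_bound[OF hu _ bu] r by simp
    qed
    have "cmod (deriv (g z) w - deriv (g z) 0) <= 4 * (4 * B / r) / (r/2) * cmod (w - 0)"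
     by (rule lipschitz_bound[OF hd _ bd']) (use wr r in auto)
    also have "\<dots> = 32 * B / r^2 * cmod w" using r by (simp add: field_simps power2_eq_square)
    also have "\<dots> <= 32 * B / r^2 * cmod (h n)"
     using w B r by (intro mult_left_mono) auto
    finally show ?thesis .
   qed
   have "cmod (k (h n) - k 0) <= 32 * B / r^2 * cmod (h n) * cmod (h n - 0)"
   proof (rule field_differentiable_bound[where S = "cball 0 (cmod (h n))" and f' = "%w::complex. deriv (g z) w - deriv (g z) 0"])
    fix w :: complex assume w: "w \<in> cball 0 (cmod (h n))"
    show "(k has_field_derivative deriv (g z) w - deriv (g z) 0) (at w within cball 0 (cmod (h n)))"
     by (rule has_field_derivative_at_within, rule der) (use w h(3)[of n] r in auto)
    show "cmod (deriv (g z) w - deriv (g z) 0) <= 32 * B / r^2 * cmod (h n)" by (rule dlip[OF w])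
   qed auto
   moreover have "k (h n) - k 0 = h n * (q n z - deriv (g z) 0)"
    using h(2)[of n] by (simp add: k_def q_def field_simps)
   ultimately have "cmod (h n) * cmod (q n z - deriv (g z) 0) <= cmod (h n) * (32 * B / r^2 * cmod (h n))"
    by (simp add: norm_mult mult_ac)
   then show ?thesis by (rule mult_left_le_imp_le) (use h(2)[of n] in simp)
  qed
  have lim0: "(%n. 32 * B / r^2 * cmod (h n)) \<longlonglongrightarrow> 0"
   using tendsto_mult_right_zero[OF tendsto_norm_zero[OF h(1)], of "32 * B / r^2"] by simp
  have ul: "uniform_limit (ball 0 r) q (%z. deriv (g z) 0) sequentially"
  proof (rule uniform_limitI)
   fix e :: real assume "e > 0"
   then have "\<forall>\<^sub>F n in sequentially. 32 * B / r^2 * cmod (h n) < e"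
    using lim0 by (simp add: order_tendsto_iff)
   then show "\<forall>\<^sub>F n in sequentially. \<forall>z\<in>ball 0 r. dist (q n z) (deriv (g z) 0) < e"
   proof eventually_elim
    case (elim n)
    show ?case using order.strict_trans1[OF est elim] by (simp add: dist_norm)
   qed
  qed
  have derq: "(q n has_field_derivative (deriv (%z. g z (h n)) z - deriv (%z. g z 0) z) / h n) (at z)"
   if "z \<in> ball 0 r" for n z
  proof -
   have *: "((%z. g z w) has_field_derivative deriv (%z. g z w) z) (at z)" if "cmod w < r" for w
    by (rule holomorphic_derivI[OF h1[OF that]]) (use \<open>z \<in> ball 0 r\<close> in auto)
   show ?thesis
    unfolding q_def by (intro DERIV_cdivide DERIV_diff *) (use h(3)[of n] r in auto)
  qed
  have "\<exists>g'. \<forall>z\<in>ball 0 r. ((%z. deriv (g z) 0) has_field_derivative g' z) (at z) &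
   (%n. (deriv (%z. g z (h n)) z - deriv (%z. g z 0) z) / h n) \<longlonglongrightarrow> g' z"
  proof (rule has_complex_derivative_uniform_sequence[of "ball 0 r" q])
   show "\<exists>d>0. cball x d \<subseteq> ball 0 r & uniform_limit (cball x d) q (%z. deriv (g z) 0) sequentially"
    if x: "x \<in> ball 0 r" for x
   proof -
    obtain d where "d > 0" "cball x d \<subseteq> ball 0 r"
     using x by (metis open_ball open_contains_cball)
    then show ?thesis using ul uniform_limit_on_subset by blast
   qed
  qed (use derq in auto)
  then obtain g' where "\<forall>z\<in>ball 0 r. ((%z. deriv (g z) 0) has_field_derivative g' z) (at z) &
   (%n. (deriv (%z. g z (h n)) z - deriv (%z. g z 0) z) / h n) \<longlonglongrightarrow> g' z" by blast
  then show ?thesis using r by (intro exI[of _ "g' 0"]) auto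
 qed
 define h where "h n = complex_of_real (r / (5 + real n))" for n
 have hlim: "h \<longlonglongrightarrow> 0"
 proof -
  have "(%n. r / (5 + real n)) \<longlonglongrightarrow> 0" by real_asymp
  then have "(%n. complex_of_real (r / (5 + real n))) \<longlonglongrightarrow> complex_of_real 0"
   by (rule tendsto_of_real)
  then show ?thesis unfolding h_def of_real_0 .
 qed
 have nh: "cmod (h n) = r / (5 + real n)" for n
  unfolding h_def norm_of_real using r by simp
 have h0: "h n ~= 0" "cmod (h n) < r / 4" for n
 proof -
  have "cmod (h n) > 0" unfolding nh using r by (intro divide_pos_pos) auto
  then show "h n ~= 0" by auto
  show "cmod (h n) < r / 4" unfolding nh using r by (intro divide_strict_left_mono) auto
 qed
 obtain D where D: "((%z. deriv (g z) 0) has_field_derivative D) (at 0)"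
   "(%n. (deriv (%z. g z (h n)) 0 - deriv (%z. g z 0) 0) / h n) \<longlonglongrightarrow> D"
  using gen[of r g B h] r h1 h2 bd hlim h0 by blast
 obtain D' where D': "((%w. deriv (%z. g z w) 0) has_field_derivative D') (at 0)"
  using gen[of r "%z w. g w z" B h] r h1 h2 bd hlim h0 by blast
 \<comment> \<open>These quotients converge to \<open>D\<close> by the first use of
   \<open>gen\<close> and to the derivative \<open>D'\<close> obtained from the second; uniqueness
   of limits identifies the two.\<close>
 have "(%n. (deriv (%z. g z (h n)) 0 - deriv (%z. g z 0) 0) / h n) \<longlonglongrightarrow> D'"
 proof -
  have "((%t. (deriv (%z. g z t) 0 - deriv (%z. g z 0) 0) / t) \<longlongrightarrow> D') (at 0)"
   using D' by (simp add: has_field_derivative_iff)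
  moreover have "filterlim h (at 0) sequentially"
   using hlim h0 by (simp add: filterlim_at)
  ultimately show ?thesis by (rule filterlim_compose)
 qed
 then have "D = D'" using D(2) LIMSEQ_unique by blast
 then show "((%z. deriv (g z) 0) has_field_derivative deriv (%w. deriv (%z. g z w) 0) 0) (at 0)"
  using D D' DERIV_imp_deriv by metis
 show "(%w. deriv (%z. g z w) 0) field_differentiable (at 0)"
  using D' field_differentiable_def by blast
qed

lemma gholo_deriv:
 assumes "gholo f S" "Z \<in> S" "X \<in> Sym"
 shows "((%t. f (Z + cscale t X)) has_field_derivative ddir f X Z) (at 0)"
 using gholo_line_deriv[OF assms(1) _ assms(3), of Z 0] assms open_Sym_subset[OF gholo_open[OF assms(1)]]
 by auto

lemma gholo_differentiable:
 "gholo f S ==> Z \<in> S ==> X \<in> Sym ==> (%t. f (Z + cscale t X)) field_differentiable (at 0)"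
 by (simp add: gholo_def)

text \<open>On the complex line through the two points, parametrised by a unit direction, this is
  \<open>lipschitz_bound\<close>. Local boundedness is thus what makes holomorphy along lines imply
  continuity.\<close>

lemma gholo_lipschitz:
 assumes f: "gholo f S" and r: "r > 0"
  and bd: "!!W. W \<in> Sym ==> norm (W - Z) < r ==> W \<in> S & cmod (f W) <= B"
  and Z: "Z \<in> Sym" and W: "W \<in> Sym" "norm (W - Z) < r / 2"
 shows "cmod (f W - f Z) <= 4 * B / r * norm (W - Z)"
proof (cases "W = Z")
 case False
 define d where "d = norm (W - Z)"
 have d: "d > 0" using False by (simp add: d_def)
 define X where "X = cscale (of_real (1/d)) (W - Z)"
 have X: "X \<in> Sym" "norm X = 1" "W = Z + cscale (of_real d) X"
  using Z W d by (auto simp: X_def norm_cscale d_def norm_divide)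
 have *: "Z + cscale t X \<in> S & cmod (f (Z + cscale t X)) <= B" if "t \<in> ball 0 r" for t
  using bd[of "Z + cscale t X"] that X Z by (auto simp: norm_cscale)
 have "cmod (f (Z + cscale (of_real d) X) - f (Z + cscale 0 X)) <= 4 * B / r * cmod (of_real d - 0)"
 proof (rule lipschitz_bound)
  show "(%t. f (Z + cscale t X)) holomorphic_on ball 0 r"
   by (rule gholo_line[OF f Z X(1)]) (use * in blast)
  show "cmod (f (Z + cscale w X)) <= B" if "w \<in> ball 0 r" for w using * that by blast
  show "complex_of_real d \<in> ball 0 (r/2)" using W d by (simp add: d_def)
 qed (rule r)
 then show ?thesis unfolding X(3)[symmetric] using d by (simp flip: d_def)
qed auto

lemma gholo_continuous:
 assumes f: "gholo f S"
 shows "continuous_on S f"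
proof -
 have "(f \<longlongrightarrow> f Z) (at Z within S)" if Z: "Z \<in> S" for Z
 proof -
  obtain r B where r: "r > 0" "B > 0" and
   bd: "!!W. W \<in> Sym ==> norm (W - Z) < r ==> W \<in> S & cmod (f W) <= B"
   using gholo_bdd[OF f Z] by blast
  have sub: "S \<subseteq> Sym" using open_Sym_subset gholo_open f by blast
  have "((%W. 4 * B / r * norm (W - Z)) \<longlongrightarrow> 4 * B / r * norm (Z - Z)) (at Z within S)"
   by (intro tendsto_intros)
  then have lim: "((%W. 4 * B / r * norm (W - Z)) \<longlongrightarrow> 0) (at Z within S)" by simp
  have ev: "\<forall>\<^sub>F W in at Z within S. norm (f W - f Z) <= 4 * B / r * norm (W - Z)"
   unfolding eventually_at
  proof (intro exI[of _ "r/2"] conjI ballI impI)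
   fix W assume "W \<in> S" "W ~= Z & dist W Z < r / 2"
   then show "norm (f W - f Z) <= 4 * B / r * norm (W - Z)"
    using sub Z by (intro gholo_lipschitz[OF f r(1) bd]) (auto simp: dist_norm)
  qed (use r in simp)
  have "((%W. f W - f Z) \<longlongrightarrow> 0) (at Z within S)"
   by (rule Lim_null_comparison[OF ev lim])
  then show ?thesis by (simp add: LIM_zero_iff)
 qed
 then show ?thesis by (simp add: continuous_on_def)
qed

lemma gholoI:
 assumes "open_Sym S" "continuous_on S f"
  "!!Z X. Z \<in> S ==> X \<in> Sym ==> (%t. f (Z + cscale t X)) field_differentiable (at 0)"
 shows "gholo f S"
proof -
 have "\<exists>r>0. \<exists>B. \<forall>W\<in>Sym. norm (W - Z) < r --> cmod (f W) <= B" if Z: "Z \<in> S" for Z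
 proof -
  obtain r1 where r1: "r1 > 0" "!!W. W \<in> Sym ==> norm (W - Z) < r1 ==> W \<in> S"
   using open_SymD[OF assms(1) Z] by metis
  obtain d where d: "d > 0" "!!W. W \<in> S ==> dist W Z < d ==> dist (f W) (f Z) < 1"
   using assms(2) Z unfolding continuous_on_iff by (metis zero_less_one)
  have "cmod (f W) <= cmod (f Z) + 1" if "W \<in> Sym" "norm (W - Z) < min r1 d" for W
  proof -
   have "cmod (f W - f Z) < 1" using d(2)[of W] r1(2)[of W] that by (auto simp: dist_norm)
   then show ?thesis using norm_triangle_ineq2[of "f W" "f Z"] by linarith
  qed
  then show ?thesis using r1(1) d(1) by (intro exI[of _ "min r1 d"]) auto
 qed
 then show ?thesis using assms unfolding gholo_def by blast
qed

lemma gholo_subset: "gholo f S ==> T \<subseteq> S ==> open_Sym T ==> gholo f T"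
 unfolding gholo_def by (meson subsetD)

lemma ddir_cong:
 assumes "open_Sym S" "Z \<in> S" "X \<in> Sym" "!!Z. Z \<in> S ==> f Z = g Z"
 shows "ddir f X Z = ddir g X Z"
proof -
 have "open {t. Z + cscale t X \<in> S}" by (rule open_line) (use assms open_Sym_subset in auto)
 then have "\<forall>\<^sub>F t in nhds 0. Z + cscale t X \<in> S"
  using assms(2) eventually_nhds_in_open by fastforce
 then have "\<forall>\<^sub>F t in nhds 0. f (Z + cscale t X) = g (Z + cscale t X)"
  by eventually_elim (use assms in auto)
 then show ?thesis unfolding ddir_def by (rule deriv_cong_ev) simp
qed

lemma gholo_const: "open_Sym S ==> gholo (%Z. c) S"
 by (rule gholoI) (auto)

lemma gholo_nth: "open_Sym S ==> gholo (%Z. Z$i$j) S"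
 by (rule gholoI) (auto intro!: derivative_intros linear_continuous_on bounded_linear_nth)

lemma gholo_add: "gholo f S ==> gholo g S ==> gholo (%Z. f Z + g Z) S"
 by (rule gholoI)
  (auto intro!: continuous_intros field_differentiable_add gholo_differentiable dest: gholo_open gholo_continuous)

lemma gholo_diff: "gholo f S ==> gholo g S ==> gholo (%Z. f Z - g Z) S"
 by (rule gholoI)
  (auto intro!: continuous_intros field_differentiable_diff gholo_differentiable dest: gholo_open gholo_continuous)

lemma gholo_minus: "gholo f S ==> gholo (%Z. - f Z) S"
 by (rule gholoI)
  (auto intro!: continuous_intros field_differentiable_minus gholo_differentiable dest: gholo_open gholo_continuous)

lemma gholo_mult: "gholo f S ==> gholo g S ==> gholo (%Z. f Z * g Z) S"
 by (rule gholoI)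
  (auto intro!: continuous_intros field_differentiable_mult gholo_differentiable dest: gholo_open gholo_continuous)

lemma gholo_divide:
 assumes "gholo f S" "gholo g S" "!!Z. Z \<in> S ==> g Z ~= 0"
 shows "gholo (%Z. f Z / g Z) S"
proof (rule gholoI)
 show "open_Sym S" using assms gholo_open by blast
 show "continuous_on S (%Z. f Z / g Z)"
  using assms by (intro continuous_intros gholo_continuous) auto
 fix Z X assume Z: "Z \<in> S" "X \<in> Sym"
 show "(%t. f (Z + cscale t X) / g (Z + cscale t X)) field_differentiable (at 0)"
  by (rule field_differentiable_divide[OF gholo_differentiable[OF assms(1) Z] gholo_differentiable[OF assms(2) Z]])
   (use assms(3) Z in simp)
qed

lemma gholo_compose:
 assumes f: "gholo f S" and h: "h holomorphic_on T" "open T" "!!Z. Z \<in> S ==> f Z \<in> T"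
 shows "gholo (%Z. h (f Z)) S"
proof (rule gholoI)
 show "open_Sym S" using f gholo_open by blast
 show "continuous_on S (%Z. h (f Z))"
  by (rule continuous_on_compose2[OF holomorphic_on_imp_continuous_on[OF h(1)] gholo_continuous[OF f]])
   (use h in auto)
 fix Z X assume Z: "Z \<in> S" "X \<in> Sym"
 have "h field_differentiable (at (f Z))" using h Z holomorphic_on_imp_differentiable_at by blast
 then have "h field_differentiable at ((%t. f (Z + cscale t X)) 0)" by simp
 then have "h \<circ> (%t. f (Z + cscale t X)) field_differentiable (at 0)"
  using f Z by (intro field_differentiable_compose) (auto simp: gholo_def)
 then show "(%t. h (f (Z + cscale t X))) field_differentiable (at 0)" by (simp add: o_def)
qed

text \<open>In the plane spanned by \<open>X\<close> and \<open>Y\<close> the function satisfies the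
  hypotheses of \<open>mixed_derivative\<close>. The derivative appears with the two directions in
  the opposite order, which also yields the symmetry of second derivatives.\<close>

lemma gholo_ddir_aux:
 assumes f: "gholo f S" and Z: "Z \<in> S" and X: "X \<in> Sym" and Y: "Y \<in> Sym"
 shows "((%t. ddir f X (Z + cscale t Y)) has_field_derivative ddir (ddir f Y) X Z) (at 0)"
proof -
 obtain r0 B where r0: "r0 > 0" "B > 0" and
   bd: "!!W. W \<in> Sym ==> norm (W - Z) < r0 ==> W \<in> S & cmod (f W) <= B"
  using gholo_bdd[OF f Z] by blast
 have Z': "Z \<in> Sym" using Z open_Sym_subset gholo_open f by blast
 \<comment> \<open>Scaled so that parameters below \<open>r\<close> stay within distance
   \<open>r0\<close> of \<open>Z\<close>; the added 1 covers the case that both directions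
   vanish.\<close>
 define r where "r = r0 / (norm X + norm Y + 1)"
 have r: "r > 0" using r0 by (simp add: r_def add_nonneg_pos)
 have in_S: "Z + cscale s Y + cscale t X \<in> S & cmod (f (Z + cscale s Y + cscale t X)) <= B"
  if "cmod s < r" "cmod t < r" for s t
 proof (rule bd)
  have "norm (Z + cscale s Y + cscale t X - Z) <= cmod s * norm Y + cmod t * norm X"
   using norm_triangle_ineq[of "cscale s Y" "cscale t X"] by (simp add: norm_cscale)
  also have "\<dots> <= r * norm Y + r * norm X"
   using that by (intro add_mono mult_right_mono) auto
  also have "\<dots> < r * (norm X + norm Y + 1)" using r by (simp add: algebra_simps)
  also have "\<dots> = r0"
  proof -
   have "norm X + norm Y + 1 > 0" by (simp add: add_nonneg_pos)
   then show ?thesis by (simp add: r_def)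
  qed
  finally show "norm (Z + cscale s Y + cscale t X - Z) < r0" .
 qed (use Z' X Y in auto)
 define g where "g s t = f (Z + cscale s Y + cscale t X)" for s t
 have h2: "g s holomorphic_on ball 0 r" if "cmod s < r" for s
  unfolding g_def by (rule gholo_line[OF f _ X]) (use in_S that Z' Y in auto)
 have h1: "(%s. g s t) holomorphic_on ball 0 r" if "cmod t < r" for t
 proof -
  have "(%s. f ((Z + cscale t X) + cscale s Y)) holomorphic_on ball 0 r"
  proof (rule gholo_line[OF f _ Y])
   fix s assume "s \<in> ball (0::complex) r"
   then show "Z + cscale t X + cscale s Y \<in> S"
    using in_S[of s t] that by (simp add: add_ac)
  qed (use Z' X in auto)
  then show ?thesis by (simp add: g_def add_ac)
 qed
 have "((%z. deriv (g z) 0) has_field_derivative deriv (%w. deriv (%z. g z w) 0) 0) (at 0)"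
  by (rule mixed_derivative(1)[OF r h1 h2, of B]) (use in_S in \<open>auto simp: g_def\<close>)
 moreover have "deriv (g z) 0 = ddir f X (Z + cscale z Y)" for z
  by (simp add: ddir_def g_def[abs_def])
 moreover have "deriv (%z. g z w) 0 = ddir f Y (Z + cscale w X)" for w
  by (simp add: ddir_def g_def add_ac)
 ultimately show ?thesis by (simp add: ddir_def)
qed

text \<open>Local boundedness of the derivative is Cauchy's estimate on a ball of half the radius;
  differentiability along lines is \<open>gholo_ddir_aux\<close>.\<close>

lemma gholo_ddir:
 assumes f: "gholo f S" and X: "X \<in> Sym"
 shows "gholo (ddir f X) S"
 unfolding gholo_def
proof (intro conjI ballI)
 show "open_Sym S" using f gholo_open by blast
 fix Z assume Z: "Z \<in> S"
 have Z': "Z \<in> Sym" using Z open_Sym_subset gholo_open f by blast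
 obtain r0 B where r0: "r0 > 0" "B > 0" and
   bd: "!!W. W \<in> Sym ==> norm (W - Z) < r0 ==> W \<in> S & cmod (f W) <= B"
  using gholo_bdd[OF f Z] by blast
 define r where "r = r0 / 2 / (norm X + 1)"
 have r: "r > 0" using r0 by (simp add: r_def add_nonneg_pos)
 have "cmod (ddir f X W) <= 2 * B / r" if W: "W \<in> Sym" "norm (W - Z) < r0 / 2" for W
  unfolding ddir_def
 proof (rule deriv_bound[OF _ r])
  have in_S: "W + cscale t X \<in> S & cmod (f (W + cscale t X)) <= B" if "t \<in> ball 0 r" for t
  proof (rule bd)
   have "norm (W + cscale t X - Z) <= norm (W - Z) + cmod t * norm X"
    using norm_triangle_ineq[of "W - Z" "cscale t X"] by (simp add: norm_cscale algebra_simps)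
   moreover have "cmod t * norm X <= r * (norm X + 1)" using that r by (intro mult_mono) auto
   moreover have "r * (norm X + 1) = r0 / 2"
   proof -
    have "norm X + 1 > 0" by (simp add: add_nonneg_pos)
    then show ?thesis unfolding r_def by (simp only: nonzero_eq_divide_eq times_divide_eq_left) (simp add: field_simps)
   qed
   ultimately show "norm (W + cscale t X - Z) < r0" using W by linarith
  qed (use W X in auto)
  show "(%t. f (W + cscale t X)) holomorphic_on ball 0 r"
   by (rule gholo_line[OF f W(1) X]) (use in_S in auto)
  show "cmod (f (W + cscale w X)) <= B" if "w \<in> ball 0 r" for w using in_S that by blast
 qed
 then show "\<exists>r>0. \<exists>B. \<forall>W\<in>Sym. norm (W - Z) < r --> cmod (ddir f X W) <= B"
  using r0 by (intro exI[of _ "r0/2"]) auto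
next
 fix Z Y assume "Z \<in> S" "Y \<in> Sym"
 then show "(%t. ddir f X (Z + cscale t Y)) field_differentiable (at 0)"
  using gholo_ddir_aux[OF f _ X] field_differentiable_def by blast
qed

lemma ddir_commute:
 assumes f: "gholo f S" and "Z \<in> S" "X \<in> Sym" "Y \<in> Sym"
 shows "ddir (ddir f X) Y Z = ddir (ddir f Y) X Z"
 using gholo_ddir_aux[OF assms] by (simp add: ddir_def DERIV_imp_deriv)

section \<open>Identity theorems on convex and on connected sets\<close>

lemma convex_Sym_ball: "convex {W \<in> Sym. norm (W - Z) < r}"
proof -
 have "{W \<in> Sym. norm (W - Z) < r} = Sym \<inter> ball Z r" by (auto simp: dist_norm norm_minus_commute)
 moreover have "convex Sym" unfolding convex_def by (auto simp: Sym_iff)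
 ultimately show ?thesis by (simp add: convex_Int)
qed

text \<open>The complex line through a point of \<open>U\<close> and \<open>W\<close> meets the
  convex set in a convex, hence connected, planar set, where analytic continuation in one variable
  applies.\<close>

lemma gholo_zero_convex:
 assumes f: "gholo f S" and S: "convex S" and U: "open_Sym U" "U \<subseteq> S" "U ~= {}"
  and z: "!!Z. Z \<in> U ==> f Z = 0" and W: "W \<in> S"
 shows "f W = 0"
proof -
 obtain Z where Z: "Z \<in> U" using U by blast
 have ZS: "Z \<in> Sym" "W \<in> Sym" using Z W U open_Sym_subset gholo_open f by blast+
 define X where "X = W - Z"
 have X: "X \<in> Sym" using ZS by (simp add: X_def)
 define T where "T = {t. Z + cscale t X \<in> S}"
 have T: "open T" unfolding T_def by (rule open_line[OF gholo_open[OF f] ZS(1) X])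
 have cvx: "convex T"
  unfolding convex_def
 proof (intro ballI allI impI)
  fix s t u v assume st: "s \<in> T" "t \<in> T" "0 <= (u::real)" "0 <= v" "u + v = 1"
  have "u *\<^sub>R (Z + cscale s X) + v *\<^sub>R (Z + cscale t X) \<in> S"
   using st S unfolding convex_def T_def by blast
  moreover have "u *\<^sub>R (Z + cscale s X) + v *\<^sub>R (Z + cscale t X) = Z + cscale (u *\<^sub>R s + v *\<^sub>R t) X"
  proof -
   have "u *\<^sub>R Z + v *\<^sub>R Z = Z" using st by (metis scaleR_add_left scaleR_one)
   moreover have "u *\<^sub>R cscale s X + v *\<^sub>R cscale t X = cscale (u *\<^sub>R s + v *\<^sub>R t) X"
    by (simp add: mat2_eq_iff algebra_simps)
   ultimately show ?thesis by (simp add: scaleR_add_right algebra_simps)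
  qed
  ultimately show "u *\<^sub>R s + v *\<^sub>R t \<in> T" by (simp add: T_def)
 qed
 define T0 where "T0 = {t. Z + cscale t X \<in> U}"
 have T0: "open T0" "0 \<in> T0" unfolding T0_def using open_line[OF U(1) ZS(1) X] Z by auto
 have sub: "T0 \<subseteq> T" using U by (auto simp: T0_def T_def)
 have hol: "(%t. f (Z + cscale t X)) holomorphic_on T"
  by (rule gholo_line[OF f ZS(1) X]) (simp add: T_def)
 have "f (Z + cscale 1 X) = 0"
 proof (rule analytic_continuation_open[where f = "%t. f (Z + cscale t X)" and g = "%t. 0" and s = T0 and s' = T])
  show "T0 ~= {}" using T0(2) by blast
  show "connected T" by (rule convex_connected[OF cvx])
  show "f (Z + cscale t X) = 0" if "t \<in> T0" for t using that z by (simp add: T0_def)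
  show "1 \<in> T" using W by (simp add: T_def X_def)
 qed (use T0 T sub hol in auto)
 then show ?thesis by (simp add: X_def)
qed

lemma open_Sym_ball: "open_Sym {W \<in> Sym. norm (W - Z) < r}"
proof -
 have "{W \<in> Sym. norm (W - Z) < r} = Sym \<inter> ball Z r" by (auto simp: dist_norm norm_minus_commute)
 then show ?thesis by (auto intro: openin_open_Int)
qed

text \<open>The interior of the zero set is open and closed in \<open>S\<close>: a ball in
  \<open>S\<close> that meets it lies in it by the convex case.\<close>

lemma gholo_zero_connected:
 assumes f: "gholo f S" and S: "connected S" and U: "open_Sym U" "U \<subseteq> S" "U ~= {}"
  and z: "!!Z. Z \<in> U ==> f Z = 0" and W: "W \<in> S"
 shows "f W = 0"
proof -
 define A where "A = {Z \<in> S. \<exists>r>0. \<forall>W\<in>Sym. norm (W - Z) < r --> W \<in> S & f W = 0}"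
 have So: "open_Sym S" "S \<subseteq> Sym" using gholo_open[OF f] open_Sym_subset by auto
 have "open_Sym A"
 proof (rule open_SymI)
  show "A \<subseteq> Sym" using So by (auto simp: A_def)
  fix Z assume "Z \<in> A"
  then obtain r where r: "r > 0" "!!W. W \<in> Sym ==> norm (W - Z) < r ==> W \<in> S & f W = 0"
   by (auto simp: A_def)
  have "W \<in> A" if W: "W \<in> Sym" "norm (W - Z) < r / 2" for W
  proof -
   have "V \<in> S & f V = 0" if V: "V \<in> Sym" "norm (V - W) < r / 2" for V
    using r(2)[of V] V W norm_triangle_ineq[of "V - W" "W - Z"] by (simp add: algebra_simps)
   then show ?thesis using r W unfolding A_def by (auto intro!: exI[of _ "r/2"])
  qed
  then show "\<exists>r>0. \<forall>W\<in>Sym. norm (W - Z) < r --> W \<in> A" using r(1) by (intro exI[of _ "r/2"]) auto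
 qed
 then have oA: "openin (top_of_set S) A"
  using So by (metis (no_types, lifting) A_def mem_Collect_eq openin_subset_trans subsetI)
 have "open_Sym (S - A)"
 proof (rule open_SymI)
  show "S - A \<subseteq> Sym" using So by auto
  fix Z assume Z: "Z \<in> S - A"
  obtain r where r: "r > 0" "!!W. W \<in> Sym ==> norm (W - Z) < r ==> W \<in> S"
   using open_SymD[OF So(1), of Z] Z by auto
  define Bl where "Bl = {W \<in> Sym. norm (W - Z) < r}"
  have Bl: "open_Sym Bl" "convex Bl" "Bl \<subseteq> S" "Z \<in> Bl"
   using r Z So by (auto simp: Bl_def open_Sym_ball convex_Sym_ball)
  have zA: "f V = 0" if "V \<in> A" for V
  proof -
   have "V \<in> Sym" using that So by (auto simp: A_def)
   then show ?thesis using that by (force simp: A_def)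
  qed
  have "Bl \<inter> A = {}"
  proof (rule ccontr)
   assume "Bl \<inter> A ~= {}"
   have "f V = 0" if "V \<in> Bl" for V
    by (rule gholo_zero_convex[OF gholo_subset[OF f Bl(3,1)] Bl(2) _ _ \<open>Bl \<inter> A ~= {}\<close>])
     (use \<open>open_Sym A\<close> Bl that zA in \<open>auto simp: openin_Int\<close>)
   then have "Z \<in> A" using Bl r Z by (auto simp: A_def Bl_def)
   then show False using Z by simp
  qed
  then show "\<exists>r>0. \<forall>W\<in>Sym. norm (W - Z) < r --> W \<in> S - A"
   using r unfolding Bl_def by (intro exI[of _ r]) auto
 qed
 then have "openin (top_of_set S) (S - A)"
  using So by (metis Diff_subset openin_subset_trans)
 then have "closedin (top_of_set S) A" using oA by (auto simp: closedin_def A_def)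
 moreover have "A ~= {}"
 proof -
  obtain Z where Z: "Z \<in> U" using U by blast
  obtain r where "r > 0" "!!W. W \<in> Sym ==> norm (W - Z) < r ==> W \<in> U"
   using open_SymD[OF U(1) Z] by auto
  then have "Z \<in> A" using Z U z unfolding A_def by blast
  then show ?thesis by auto
 qed
 ultimately have "A = S" using oA S unfolding connected_clopen by blast
 then have "W \<in> A" using W by simp
 then show ?thesis using So by (force simp: A_def)
qed

text \<open>The scalar form of \<open>holomorphic_Sym\<close>. Frechet differentiability supports
  the chain rule for maps and curves, whereas \<open>gholo\<close> is stable under
  \<open>ddir\<close>; \<open>shol_gholo\<close> passes from the former to the latter.\<close>

definition shol :: "(mat2 => complex) => mat2 set => bool"
 where "shol f S \<longleftrightarrow> open_Sym S & (\<forall>Z\<in>S. \<exists>D. (f has_derivative D) (at Z within S) &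
  (\<forall>c. \<forall>X\<in>Sym. D (cscale c X) = c * D X))"

lemma shol_open: "shol f S ==> open_Sym S"
 by (simp add: shol_def)

lemma sholE:
 assumes "shol f S" "Z \<in> S"
 obtains D where "(f has_derivative D) (at Z within S)" "!!c X. X \<in> Sym ==> D (cscale c X) = c * D X"
 using assms unfolding shol_def by blast

lemma sholI:
 assumes "open_Sym S" "!!Z. Z \<in> S ==> (f has_derivative D Z) (at Z within S)"
  "!!Z c X. Z \<in> S ==> X \<in> Sym ==> D Z (cscale c X) = c * D Z X"
 shows "shol f S"
 using assms unfolding shol_def by blast

lemma shol_const: "open_Sym S ==> shol (%Z. c) S"
 by (rule sholI[where D = "%Z X. 0"]) auto

lemma shol_nth: "open_Sym S ==> shol (%Z. Z$i$j) S"
 by (rule sholI[where D = "%Z X. X$i$j"])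
  (auto intro: bounded_linear_imp_has_derivative bounded_linear_nth)

lemma shol_add:
 assumes "shol f S" "shol g S" shows "shol (%Z. f Z + g Z) S"
 unfolding shol_def
proof (intro conjI ballI)
 show "open_Sym S" using assms shol_open by blast
 fix Z assume Z: "Z \<in> S"
 obtain D1 where D1: "(f has_derivative D1) (at Z within S)" "!!c X. X \<in> Sym ==> D1 (cscale c X) = c * D1 X"
  using sholE[OF assms(1) Z] by blast
 obtain D2 where D2: "(g has_derivative D2) (at Z within S)" "!!c X. X \<in> Sym ==> D2 (cscale c X) = c * D2 X"
  using sholE[OF assms(2) Z] by blast
 show "\<exists>D. ((%Z. f Z + g Z) has_derivative D) (at Z within S) & (\<forall>c. \<forall>X\<in>Sym. D (cscale c X) = c * D X)"
  by (rule exI, rule conjI, rule has_derivative_add[OF D1(1) D2(1)]) (auto simp: D1 D2 algebra_simps)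
qed

lemma shol_mult:
 assumes "shol f S" "shol g S" shows "shol (%Z. f Z * g Z) S"
 unfolding shol_def
proof (intro conjI ballI)
 show "open_Sym S" using assms shol_open by blast
 fix Z assume Z: "Z \<in> S"
 obtain D1 where D1: "(f has_derivative D1) (at Z within S)" "!!c X. X \<in> Sym ==> D1 (cscale c X) = c * D1 X"
  using sholE[OF assms(1) Z] by blast
 obtain D2 where D2: "(g has_derivative D2) (at Z within S)" "!!c X. X \<in> Sym ==> D2 (cscale c X) = c * D2 X"
  using sholE[OF assms(2) Z] by blast
 show "\<exists>D. ((%Z. f Z * g Z) has_derivative D) (at Z within S) & (\<forall>c. \<forall>X\<in>Sym. D (cscale c X) = c * D X)"
  by (rule exI, rule conjI, rule has_derivative_mult[OF D1(1) D2(1)]) (auto simp: D1 D2 algebra_simps)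
qed

lemma shol_minus: "shol f S ==> shol (%Z. - f Z) S"
 using shol_mult[OF shol_const[of S "-1"], of f] shol_open by auto

lemma shol_diff: "shol f S ==> shol g S ==> shol (%Z. f Z - g Z) S"
 using shol_add[of f S "%Z. - g Z"] shol_minus by auto

lemma shol_divide:
 assumes "shol f S" "shol g S" "!!Z. Z \<in> S ==> g Z ~= 0" shows "shol (%Z. f Z / g Z) S"
 unfolding shol_def
proof (intro conjI ballI)
 show "open_Sym S" using assms shol_open by blast
 fix Z assume Z: "Z \<in> S"
 obtain D1 where D1: "(f has_derivative D1) (at Z within S)" "!!c X. X \<in> Sym ==> D1 (cscale c X) = c * D1 X"
  using sholE[OF assms(1) Z] by blast
 obtain D2 where D2: "(g has_derivative D2) (at Z within S)" "!!c X. X \<in> Sym ==> D2 (cscale c X) = c * D2 X"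
  using sholE[OF assms(2) Z] by blast
 show "\<exists>D. ((%Z. f Z / g Z) has_derivative D) (at Z within S) & (\<forall>c. \<forall>X\<in>Sym. D (cscale c X) = c * D X)"
  by (rule exI, rule conjI, rule has_derivative_divide'[OF D1(1) D2(1)])
   (use assms(3) Z in \<open>auto simp: D1 D2 field_simps\<close>)
qed

lemmas shol_intros = shol_const shol_nth shol_add shol_mult shol_minus shol_diff shol_divide

lemma shol_subset:
 assumes "shol f S" "T \<subseteq> S" "open_Sym T" shows "shol f T"
 using assms unfolding shol_def by (meson has_derivative_subset subsetD)

lemma has_derivative_mat2I:
 fixes F :: "mat2 => mat2"
 assumes "!!i j. ((%Z. F Z $ i $ j) has_derivative (%X. D X $ i $ j)) (at Z within S)"
 shows "(F has_derivative D) (at Z within S)"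
proof -
 define E :: "2 => 2 => mat2" where "E i j = (\<chi> k l. if k = i & l = j then 1 else 0)" for i j
 have *: "W = (\<Sum>i\<in>UNIV. \<Sum>j\<in>UNIV. cscale (W$i$j) (E i j))" for W
  by (simp add: sum_2 mat2_eq_iff E_def)
 have "((%Z. \<Sum>i\<in>UNIV. \<Sum>j\<in>UNIV. cscale (F Z$i$j) (E i j)) has_derivative
   (%X. \<Sum>i\<in>UNIV. \<Sum>j\<in>UNIV. cscale (D X$i$j) (E i j))) (at Z within S)"
  by (intro has_derivative_sum bounded_linear.has_derivative[OF bounded_linear_cscale_left] assms)
 then show ?thesis by (simp flip: *)
qed

lemma holomorphic_Sym_iff:
 assumes "open_Sym S"
 shows "holomorphic_Sym F S \<longleftrightarrow> (\<forall>i j. shol (%Z. F Z $ i $ j) S)"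
proof
 assume F: "holomorphic_Sym F S"
 show "\<forall>i j. shol (%Z. F Z $ i $ j) S"
  unfolding shol_def
 proof (intro allI conjI ballI assms)
  fix i j :: 2 and Z assume "Z \<in> S"
  then obtain D where D: "(F has_derivative D) (at Z within S)" "\<forall>c. \<forall>X\<in>Sym. D (cscale c X) = cscale c (D X)"
   using F unfolding holomorphic_Sym_def cscale_def by blast
  show "\<exists>D. ((%Z. F Z $ i $ j) has_derivative D) (at Z within S) & (\<forall>c. \<forall>X\<in>Sym. D (cscale c X) = c * D X)"
   by (rule exI, rule conjI, rule bounded_linear.has_derivative[OF bounded_linear_nth D(1)]) (use D in auto)
 qed
next
 assume *: "\<forall>i j. shol (%Z. F Z $ i $ j) S"
 show "holomorphic_Sym F S"
  unfolding holomorphic_Sym_def cscale_def[symmetric]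
 proof
  fix Z assume Z: "Z \<in> S"
  have "\<forall>i j. \<exists>D. ((%Z. F Z $ i $ j) has_derivative D) (at Z within S) & (\<forall>c. \<forall>X\<in>Sym. D (cscale c X) = c * D X)"
   using * Z unfolding shol_def by blast
  then obtain D where D: "!!i j. ((%Z. F Z $ i $ j) has_derivative D i j) (at Z within S)"
   "!!i j c X. X \<in> Sym ==> D i j (cscale c X) = c * D i j X" by metis
  have "(F has_derivative (%X. \<chi> i j. D i j X)) (at Z within S)"
   by (rule has_derivative_mat2I) (simp add: D)
  then show "\<exists>D. (F has_derivative D) (at Z within S) & (\<forall>c. \<forall>X\<in>Sym. D (cscale c X) = cscale c (D X))"
   by (intro exI conjI) (assumption, use D in \<open>auto simp: mat2_eq_iff\<close>)
 qed
qed

text \<open>The curve has real derivative \<open>%h. cscale h X\<close> with symmetric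
  \<open>X\<close>, and there the complex linearity of \<open>D\<close> is available, so the
  composite has a complex derivative.\<close>

lemma shol_curve_aux:
 assumes D: "(f has_derivative D) (at (c s) within S)" "!!c X. X \<in> Sym ==> D (cscale c X) = c * D X"
  and T: "open T" "s \<in> T" "!!t. t \<in> T ==> c t \<in> S"
  and c: "!!i j. ((%t. c t $ i $ j) has_field_derivative X $ i $ j) (at s)" and X: "X \<in> Sym"
 shows "((%t. f (c t)) has_field_derivative D X) (at s)"
proof -
 have ent: "((%t. c t $ i $ j) has_derivative (%h. h * X $ i $ j)) (at s within T)" for i j
 proof -
  have "(%h. h * X $ i $ j) = (*) (X $ i $ j)" by (simp add: fun_eq_iff)
  then show ?thesis
   using has_derivative_at_withinI[OF has_field_derivative_imp_has_derivative[OF c[of i j]], of T] by simp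
 qed
 define E :: "2 => 2 => mat2" where "E i j = (\<chi> k l. if k = i & l = j then 1 else 0)" for i j
 have *: "W = (\<Sum>i\<in>UNIV. \<Sum>j\<in>UNIV. cscale (W$i$j) (E i j))" for W
  by (simp add: sum_2 mat2_eq_iff E_def)
 have "((%t. \<Sum>i\<in>UNIV. \<Sum>j\<in>UNIV. cscale (c t$i$j) (E i j)) has_derivative
   (%h. \<Sum>i\<in>UNIV. \<Sum>j\<in>UNIV. cscale (cscale h X$i$j) (E i j))) (at s within T)"
  unfolding cscale_nth
  by (intro has_derivative_sum bounded_linear.has_derivative[OF bounded_linear_cscale_left] ent)
 then have cd: "(c has_derivative (%h. cscale h X)) (at s within T)" by (simp only: *[symmetric])
 have "((%t. f (c t)) has_derivative (%h. D (cscale h X))) (at s within T)"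
  by (rule has_derivative_in_compose[OF cd], rule has_derivative_subset[OF D(1)]) (use T in auto)
 moreover have "(%h. D (cscale h X)) = (*) (D X)"
  using D(2)[OF X] by (simp add: fun_eq_iff mult.commute)
 moreover have "at s within T = at s" by (rule at_within_open[OF T(2,1)])
 ultimately show ?thesis by (simp add: has_field_derivative_def)
qed

lemma has_derivative_ddir:
 assumes D: "(f has_derivative D) (at Z within S)" "!!c X. X \<in> Sym ==> D (cscale c X) = c * D X"
  and S: "open_Sym S" "Z \<in> S" and X: "X \<in> Sym"
 shows "((%t. f (Z + cscale t X)) has_field_derivative D X) (at 0)" "ddir f X Z = D X"
proof -
 show *: "((%t. f (Z + cscale t X)) has_field_derivative D X) (at 0)"
 proof (rule shol_curve_aux[where S = S and T = "{t. Z + cscale t X \<in> S}"])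
  show "open {t. Z + cscale t X \<in> S}" using open_line[OF S(1) _ X] S open_Sym_subset by blast
  show "((%t. (Z + cscale t X) $ i $ j) has_field_derivative X $ i $ j) (at 0)" for i j
   by (auto intro!: derivative_eq_intros)
 qed (use D S X in auto)
 then show "ddir f X Z = D X" unfolding ddir_def by (rule DERIV_imp_deriv)
qed

lemma shol_gholo:
 assumes "shol f S" shows "gholo f S"
proof (rule gholoI)
 show "open_Sym S" using assms shol_open by blast
 show "continuous_on S f"
  using assms unfolding shol_def by (meson has_derivative_continuous_on has_derivative_continuous continuous_on_eq_continuous_within)
 fix Z X assume "Z \<in> S" "X \<in> Sym"
 then show "(%t. f (Z + cscale t X)) field_differentiable (at 0)"
  using has_derivative_ddir(1)[of f _ Z S X] sholE[OF assms] shol_open[OF assms] field_differentiable_def by metis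
qed

lemma shol_curve:
 assumes f: "shol f S" and T: "open T" "s \<in> T" "!!t. t \<in> T ==> c t \<in> S"
  and c: "!!i j. ((%t. c t $ i $ j) has_field_derivative X $ i $ j) (at s)" and X: "X \<in> Sym"
 shows "((%t. f (c t)) has_field_derivative ddir f X (c s)) (at s)"
proof -
 have cs: "c s \<in> S" using T by blast
 obtain D where D: "(f has_derivative D) (at (c s) within S)" "!!c X. X \<in> Sym ==> D (cscale c X) = c * D X"
  using sholE[OF f cs] by blast
 show ?thesis
  using shol_curve_aux[OF D T c X] has_derivative_ddir(2)[OF D shol_open[OF f] cs X] by simp
qed

lemma ddir_linear:
 assumes f: "shol f S" and Z: "Z \<in> S" and X: "X \<in> Sym" and Y: "Y \<in> Sym"
 shows "ddir f (X + Y) Z = ddir f X Z + ddir f Y Z" "ddir f (cscale c X) Z = c * ddir f X Z"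
proof -
 obtain D where D: "(f has_derivative D) (at Z within S)" "!!c X. X \<in> Sym ==> D (cscale c X) = c * D X"
  using sholE[OF f Z] by blast
 have l: "linear D" using D(1) has_derivative_linear by blast
 note * = has_derivative_ddir(2)[OF D shol_open[OF f] Z]
 show "ddir f (X + Y) Z = ddir f X Z + ddir f Y Z"
  using X Y linear_add[OF l] by (simp add: *)
 show "ddir f (cscale c X) Z = c * ddir f X Z"
  using X D by (simp add: *)
qed

text \<open>Symmetric values are part of the notion so that maps compose and \<open>dF\<close> sends
  symmetric directions to symmetric directions.\<close>

definition hol :: "(mat2 => mat2) => mat2 set => bool"
 where "hol F S \<longleftrightarrow> open_Sym S & (\<forall>Z\<in>S. F Z \<in> Sym) & (\<forall>i j. shol (%Z. F Z $ i $ j) S)"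

definition dF :: "(mat2 => mat2) => mat2 => mat2 => mat2"
 where "dF F X Z = (\<chi> i j. ddir (%Z. F Z $ i $ j) X Z)"

lemma dF_nth [simp]: "dF F X Z $ i $ j = ddir (%Z. F Z $ i $ j) X Z"
 by (simp add: dF_def)

lemma hol_open: "hol F S ==> open_Sym S"
 by (simp add: hol_def)

lemma hol_nth: "hol F S ==> shol (%Z. F Z $ i $ j) S"
 by (simp add: hol_def)

lemma hol_in_Sym: "hol F S ==> Z \<in> S ==> F Z \<in> Sym"
 by (simp add: hol_def)

lemma hol_gholo: "hol F S ==> gholo (%Z. F Z $ i $ j) S"
 by (simp add: hol_nth shol_gholo)

lemma hol_continuous: "hol F S ==> continuous_on S F"
 by (rule continuous_on_mat2I) (simp add: hol_gholo gholo_continuous)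

lemma hol_iff_holomorphic_Sym:
 "open_Sym S ==> hol F S \<longleftrightarrow> holomorphic_Sym F S & F ` S \<subseteq> Sym"
 by (auto simp: hol_def holomorphic_Sym_iff)

lemma hol_subset: "hol F S ==> T \<subseteq> S ==> open_Sym T ==> hol F T"
 unfolding hol_def using shol_subset by blast

lemma hol_curve:
 assumes "hol F S" "open T" "s \<in> T" "!!t. t \<in> T ==> c t \<in> S"
  "!!i j. ((%t. c t $ i $ j) has_field_derivative X $ i $ j) (at s)" "X \<in> Sym"
 shows "((%t. F (c t) $ i $ j) has_field_derivative dF F X (c s) $ i $ j) (at s)"
 using shol_curve[OF hol_nth[OF assms(1)] assms(2-6)] by simp

lemma hol_line_deriv:
 assumes "hol F S" "Z \<in> S" "X \<in> Sym"
 shows "((%t. F (Z + cscale t X) $ i $ j) has_field_derivative dF F X Z $ i $ j) (at 0)"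
 using gholo_deriv[OF hol_gholo[OF assms(1)] assms(2,3)] by simp

lemma hol_dF_Sym:
 assumes F: "hol F S" and Z: "Z \<in> S" and X: "X \<in> Sym"
 shows "dF F X Z \<in> Sym"
proof -
 have "ddir (%Z. F Z $ 2 $ 1) X Z = ddir (%Z. F Z $ 1 $ 2) X Z"
  by (rule ddir_cong[OF hol_open[OF F] Z X]) (use hol_in_Sym[OF F] in \<open>auto simp: Sym_iff\<close>)
 then show ?thesis by (simp add: Sym_iff)
qed

lemma dF_add:
 assumes "hol F S" "Z \<in> S" "X \<in> Sym" "Y \<in> Sym"
 shows "dF F (X + Y) Z = dF F X Z + dF F Y Z"
 using ddir_linear(1)[OF hol_nth[OF assms(1)] assms(2-4)] by (simp add: mat2_eq_iff)

lemma dF_cscale: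
 assumes "hol F S" "Z \<in> S" "X \<in> Sym"
 shows "dF F (cscale c X) Z = cscale c (dF F X Z)"
 using ddir_linear(2)[OF hol_nth[OF assms(1)] assms(2,3,3)] by (simp add: mat2_eq_iff)

lemma shol_comp:
 assumes F: "hol F S" and f: "shol f T" and FT: "!!Z. Z \<in> S ==> F Z \<in> T"
 shows "shol (%Z. f (F Z)) S"
 unfolding shol_def
proof (intro conjI ballI)
 show So: "open_Sym S" using F hol_open by blast
 fix Z assume Z: "Z \<in> S"
 have "holomorphic_Sym F S" using F So hol_iff_holomorphic_Sym by blast
 then obtain D where D: "(F has_derivative D) (at Z within S)" "!!c X. X \<in> Sym ==> D (cscale c X) = cscale c (D X)"
  using Z unfolding holomorphic_Sym_def cscale_def by blast
 obtain D' where D': "(f has_derivative D') (at (F Z) within T)" "!!c X. X \<in> Sym ==> D' (cscale c X) = c * D' X"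
  using sholE[OF f FT[OF Z]] by blast
 have DS: "D X = dF F X Z" if "X \<in> Sym" for X
 proof -
  have "ddir (%Z. F Z $ i $ j) X Z = D X $ i $ j" for i j
   by (rule has_derivative_ddir(2)[OF bounded_linear.has_derivative[OF bounded_linear_nth D(1)] _ So Z that])
    (simp add: D)
  then show ?thesis by (simp add: mat2_eq_iff)
 qed
 have "((%Z. f (F Z)) has_derivative (%X. D' (D X))) (at Z within S)"
  by (rule has_derivative_in_compose[OF D(1), unfolded o_def], rule has_derivative_subset[OF D'(1)])
   (use FT in auto)
 moreover have "D' (D (cscale c X)) = c * D' (D X)" if "X \<in> Sym" for c X
  using that D DS hol_dF_Sym[OF F Z] D' by simp
 ultimately show "\<exists>D. ((%Z. f (F Z)) has_derivative D) (at Z within S) & (\<forall>c. \<forall>X\<in>Sym. D (cscale c X) = c * D X)"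
  by blast
qed

lemma hol_comp:
 assumes F: "hol F S" and G: "hol G T" and FT: "!!Z. Z \<in> S ==> F Z \<in> T"
 shows "hol (%Z. G (F Z)) S"
 using assms hol_open hol_in_Sym unfolding hol_def[of "%Z. G (F Z)"]
 by (auto intro!: shol_comp[OF F _ FT] hol_nth[OF G])

lemma dF_comp:
 assumes F: "hol F S" and G: "hol G T" and FT: "!!Z. Z \<in> S ==> F Z \<in> T"
  and Z: "Z \<in> S" and X: "X \<in> Sym"
 shows "dF (%Z. G (F Z)) X Z = dF G (dF F X Z) (F Z)"
proof -
 have Z': "Z \<in> Sym" using Z hol_open[OF F] open_Sym_subset by blast
 have "((%t. G (F (Z + cscale t X)) $ i $ j) has_field_derivative dF G (dF F X Z) (F (Z + cscale 0 X)) $ i $ j) (at 0)" for i j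
 proof (rule hol_curve[OF G, where c = "%t. F (Z + cscale t X)" and T = "{t. Z + cscale t X \<in> S}"])
  show "open {t. Z + cscale t X \<in> S}" by (rule open_line[OF hol_open[OF F] Z' X])
  show "((%t. F (Z + cscale t X) $ i $ j) has_field_derivative dF F X Z $ i $ j) (at 0)" for i j
   by (rule hol_line_deriv[OF F Z X])
 qed (use FT Z hol_dF_Sym[OF F Z X] in auto)
 then have "ddir (%Z. G (F Z) $ i $ j) X Z = dF G (dF F X Z) (F Z) $ i $ j" for i j
  unfolding ddir_def using DERIV_imp_deriv by fastforce
 then show ?thesis by (simp add: mat2_eq_iff)
qed

lemma hol_eqI_convex:
 assumes F: "hol F S" and G: "hol G S" and S: "convex S" and U: "open_Sym U" "U \<subseteq> S" "U ~= {}"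
  and eq: "!!Z. Z \<in> U ==> F Z = G Z" and W: "W \<in> S"
 shows "F W = G W"
proof -
 have "F W $ i $ j - G W $ i $ j = 0" for i j
  by (rule gholo_zero_convex[OF gholo_diff[OF hol_gholo[OF F] hol_gholo[OF G]] S U _ W]) (simp add: eq)
 then show ?thesis by (simp add: mat2_eq_iff)
qed

lemma hol_eqI_connected:
 assumes F: "hol F S" and G: "hol G S" and S: "connected S" and U: "open_Sym U" "U \<subseteq> S" "U ~= {}"
  and eq: "!!Z. Z \<in> U ==> F Z = G Z" and W: "W \<in> S"
 shows "F W = G W"
proof -
 have "F W $ i $ j - G W $ i $ j = 0" for i j
  by (rule gholo_zero_connected[OF gholo_diff[OF hol_gholo[OF F] hol_gholo[OF G]] S U _ W]) (simp add: eq)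
 then show ?thesis by (simp add: mat2_eq_iff)
qed

section \<open>The Siegel half space and the Cayley transform\<close>

text \<open>The hermitian inner product, conjugate linear in the first argument.\<close>

definition hin :: "complex^2 => complex^2 => complex"
 where "hin x y = cnj (x$1) * y$1 + cnj (x$2) * y$2"

lemma hin_add: "hin x (y + z) = hin x y + hin x z" "hin (x + y) z = hin x z + hin y z"
 "hin x (y - z) = hin x y - hin x z" "hin (x - y) z = hin x z - hin y z"
 "hin x (- y) = - hin x y"
 by (simp_all add: hin_def algebra_simps)

lemma hin_scale: "hin x (c *s y) = c * hin x y" "hin (c *s x) y = cnj c * hin x y"
 by (simp_all add: hin_def algebra_simps)

lemma norm_vec2_sq: "(norm (x::complex^2))\<^sup>2 = (cmod (x$1))\<^sup>2 + (cmod (x$2))\<^sup>2"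
 by (simp add: norm_vec2)

lemma hin_self: "hin x x = of_real ((norm x)\<^sup>2)"
 unfolding hin_def norm_vec2_sq of_real_add complex_norm_square by (simp add: mult.commute)

lemma hin_cnj: "hin y x = cnj (hin x y)"
 by (simp add: hin_def mult.commute)

lemma norm_smult_vec2: "norm (c *s (x::complex^2)) = cmod c * norm x"
proof -
 have "norm (c *s x) = sqrt ((cmod c)\<^sup>2 * ((cmod (x$1))\<^sup>2 + (cmod (x$2))\<^sup>2))"
  by (simp add: norm_vec2 norm_mult power_mult_distrib algebra_simps)
 then show ?thesis by (simp add: norm_vec2 real_sqrt_mult)
qed

lemma norm_add_sq: "(norm (x + y :: complex^2))\<^sup>2 = (norm x)\<^sup>2 + (norm y)\<^sup>2 + 2 * Re (hin x y)"
proof -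
 have c: "hin y x = cnj (hin x y)" by (rule hin_cnj)
 have "complex_of_real ((norm (x + y))\<^sup>2) = hin (x + y) (x + y)" by (rule hin_self[symmetric])
 also have "\<dots> = hin x x + hin y y + (hin x y + cnj (hin x y))" unfolding hin_add c by simp
 also have "\<dots> = of_real ((norm x)\<^sup>2 + (norm y)\<^sup>2 + 2 * Re (hin x y))"
  by (simp add: hin_self complex_add_cnj)
 finally show ?thesis using of_real_eq_iff by blast
qed

lemma norm_diff_sq: "(norm (x - y :: complex^2))\<^sup>2 = (norm x)\<^sup>2 + (norm y)\<^sup>2 - 2 * Re (hin x y)"
 using norm_add_sq[of x "- y"] by (simp add: hin_add)

lemma hin_bound: "cmod (hin x y) <= norm x * norm y"
proof -
 have "cmod (hin x y) <= cmod (x$1) * cmod (y$1) + cmod (x$2) * cmod (y$2)"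
  unfolding hin_def by (rule norm_triangle_le) (simp add: norm_mult)
 also have "\<dots> <= sqrt ((cmod (x$1))\<^sup>2 + (cmod (x$2))\<^sup>2) * sqrt ((cmod (y$1))\<^sup>2 + (cmod (y$2))\<^sup>2)"
 proof -
  let ?a = "cmod (x$1)" and ?b = "cmod (x$2)" and ?c = "cmod (y$1)" and ?d = "cmod (y$2)"
  have "0 <= (?a * ?d - ?b * ?c)\<^sup>2" by simp
  then have "(?a * ?c + ?b * ?d)\<^sup>2 <= (?a\<^sup>2 + ?b\<^sup>2) * (?c\<^sup>2 + ?d\<^sup>2)"
   by (simp add: power2_eq_square algebra_simps)
  then show ?thesis by (simp add: real_le_rsqrt real_sqrt_mult[symmetric])
 qed
 finally show ?thesis by (simp add: norm_vec2)
qed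

lemma mat2_vec_lin:
 fixes A B :: mat2
 shows "A *v (x + y) = A *v x + A *v y" "A *v (x - y) = A *v x - A *v y" "A *v (c *s x) = c *s (A *v x)"
  "cscale c A *v x = c *s (A *v x)" "(A + B) *v x = A *v x + B *v x" "(A - B) *v x = A *v x - B *v x"
  "A *v (- x) = - (A *v x)"
 by (simp_all add: vec2_eq_iff algebra_simps)

text \<open>For symmetric \<open>Z\<close> the imaginary part of the form is the hermitian form of
  the matrix of imaginary parts, so the condition says that this real matrix is positive
  definite.\<close>

definition siegel :: "mat2 set"
 where "siegel = {Z \<in> Sym. \<forall>x. x ~= 0 --> 0 < Im (hin x (Z *v x))}"

text \<open>The domain \<open>R_II\<close> described without a supremum; the equality is
  \<open>R_II_eq_udisc\<close>.\<close>

definition udisc :: "mat2 set"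
 where "udisc = {z \<in> Sym. \<forall>x. x ~= 0 --> norm (z *v x) < norm x}"

lemma Im_hin:
 assumes "Z \<in> Sym"
 shows "Im (hin x (Z *v x)) = Im (Z$1$1) * (cmod (x$1))\<^sup>2 + Im (Z$2$2) * (cmod (x$2))\<^sup>2
  + 2 * Im (Z$1$2) * Re (cnj (x$1) * x$2)"
 using assms by (simp add: hin_def Sym_iff cmod_power2) (simp add: power2_eq_square algebra_simps)

lemma vec2_nonzero: "(x::complex^2) ~= 0 \<longleftrightarrow> x$1 ~= 0 \<or> x$2 ~= 0"
 by (auto simp: vec2_eq_iff)

definition cvec :: "complex => complex => complex^2"
 where "cvec a b = (\<chi> i. if i = 1 then a else b)"

lemma cvec_nth [simp]: "cvec a b $ 1 = a" "cvec a b $ 2 = b"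
 by (auto simp: cvec_def)

text \<open>Sylvester's criterion. The second test vector is the one for which only the determinant
  survives; conversely, completing the square gives positivity.\<close>

lemma siegel_iff:
 "Z \<in> siegel \<longleftrightarrow> Z \<in> Sym & 0 < Im (Z$1$1) & (Im (Z$1$2))\<^sup>2 < Im (Z$1$1) * Im (Z$2$2)"
proof (intro iffI conjI)
 assume Z: "Z \<in> siegel"
 then show S: "Z \<in> Sym" by (simp add: siegel_def)
 have pos: "0 < Im (hin x (Z *v x))" if "x ~= 0" for x using Z that by (simp add: siegel_def)
 show p1: "0 < Im (Z$1$1)"
  using pos[of "cvec 1 0"] by (simp add: Im_hin[OF S] vec2_nonzero)
 have "0 < Im (hin (cvec (of_real (Im (Z$1$2))) (- of_real (Im (Z$1$1)))) (Z *v cvec (of_real (Im (Z$1$2))) (- of_real (Im (Z$1$1)))))"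
  by (rule pos) (use p1 in \<open>simp add: vec2_nonzero\<close>)
 also have "\<dots> = Im (Z$1$1) * (Im (Z$1$1) * Im (Z$2$2) - (Im (Z$1$2))\<^sup>2)"
  by (simp add: Im_hin[OF S]) (simp add: power2_eq_square algebra_simps)
 finally show "(Im (Z$1$2))\<^sup>2 < Im (Z$1$1) * Im (Z$2$2)"
  using p1 by (simp add: zero_less_mult_iff)
next
 assume *: "Z \<in> Sym & 0 < Im (Z$1$1) & (Im (Z$1$2))\<^sup>2 < Im (Z$1$1) * Im (Z$2$2)"
 have "0 < Im (hin x (Z *v x))" if x: "x ~= 0" for x
 proof -
  let ?a = "Im (Z$1$1)" and ?b = "Im (Z$1$2)" and ?c = "Im (Z$2$2)"
  have eq: "?a * Im (hin x (Z *v x)) = (cmod (of_real ?a * x$1 + of_real ?b * x$2))\<^sup>2 + (?a * ?c - ?b\<^sup>2) * (cmod (x$2))\<^sup>2"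
   using * by (simp add: Im_hin cmod_power2) (simp add: power2_eq_square algebra_simps)
  have "0 < ?a * Im (hin x (Z *v x))"
  proof (cases "x$2 = 0")
   case True
   then have "x$1 ~= 0" using x by (simp add: vec2_nonzero)
   then show ?thesis unfolding eq using True * by simp
  next
   case False
   then show ?thesis unfolding eq using * by (intro add_nonneg_pos mult_pos_pos) auto
  qed
  then show ?thesis using * by (simp add: zero_less_mult_iff)
 qed
 then show "Z \<in> siegel" using * by (simp add: siegel_def)
qed

lemma siegel_Sym: "Z \<in> siegel ==> Z \<in> Sym"
 by (simp add: siegel_def)

lemma siegel_pos: "Z \<in> siegel ==> x ~= 0 ==> 0 < Im (hin x (Z *v x))"
 by (simp add: siegel_def)

lemma open_Sym_siegel: "open_Sym siegel"
proof -
 define U where "U = {Z::mat2. 0 < Im (Z$1$1)} \<inter> {Z. (Im (Z$1$2))\<^sup>2 < Im (Z$1$1) * Im (Z$2$2)}"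
 have "open U" unfolding U_def
  by (intro open_Int open_Collect_less continuous_intros)
 moreover have "siegel = Sym \<inter> U" by (auto simp: siegel_iff U_def)
 ultimately show ?thesis by (metis openin_open)
qed

lemma convex_siegel: "convex siegel"
 unfolding convex_def
proof (intro ballI allI impI)
 fix Z W and u v :: real assume Z: "Z \<in> siegel" "W \<in> siegel" "0 <= u" "0 <= v" "u + v = 1"
 have S: "u *\<^sub>R Z + v *\<^sub>R W \<in> Sym" using siegel_Sym[OF Z(1)] siegel_Sym[OF Z(2)] by (simp add: Sym_iff)
 have "0 < Im (hin x ((u *\<^sub>R Z + v *\<^sub>R W) *v x))" if x: "x ~= 0" for x
 proof -
  have "Im (hin x ((u *\<^sub>R Z + v *\<^sub>R W) *v x)) = u * Im (hin x (Z *v x)) + v * Im (hin x (W *v x))"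
   by (simp add: hin_def algebra_simps)
  moreover have "0 < u * Im (hin x (Z *v x)) + v * Im (hin x (W *v x))"
  proof (cases "u = 0")
   case True
   then show ?thesis using Z x siegel_pos by simp
  next
   case False
   then show ?thesis using Z x siegel_pos[OF Z(1) x] siegel_pos[OF Z(2) x]
    by (intro add_pos_nonneg mult_pos_pos mult_nonneg_nonneg) auto
  qed
  ultimately show ?thesis by simp
 qed
 then show "u *\<^sub>R Z + v *\<^sub>R W \<in> siegel" using S by (simp add: siegel_def)
qed

lemma ii_siegel: "cscale \<i> (mat 1) \<in> siegel"
 by (simp add: siegel_iff)

subsection \<open>Determinants and operator bounds\<close>

text \<open>An upper bound for the operator norm, kept as a predicate so that no supremum has to be
  handled.\<close>

definition opb :: "real => mat2 => bool"
 where "opb c z \<longleftrightarrow> (\<forall>x. norm (z *v x) <= c * norm x)"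

abbreviation dt :: "mat2 => complex"
 where "dt z \<equiv> z$1$1 * z$2$2 - z$1$2 * z$2$1"

text \<open>The vector inside the norm is the adjugate of \<open>z\<close> applied to
  \<open>y\<close>. For symmetric \<open>z\<close> the adjugate differs from \<open>z\<close> by
  quarter turns on both sides.\<close>

lemma dt_adj_norm:
 fixes y :: "complex^2"
 assumes "z \<in> Sym"
 shows "\<exists>y'. norm y' = norm y & norm (cvec (z$2$2 * y$1 - z$1$2 * y$2) (z$1$1 * y$2 - z$1$2 * y$1)) = norm (z *v y')"
 using assms by (intro exI[of _ "cvec (y$2) (- y$1)"]) (auto simp: norm_vec2 Sym_iff norm_minus_commute add.commute)

text \<open>The adjugate maps \<open>z *v x\<close> to the determinant times \<open>x\<close> and
  obeys the same operator bound as \<open>z\<close>. Thus a single vector on which \<open>z\<close>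
  is small forces a small determinant.\<close>

lemma dt_le:
 assumes z: "z \<in> Sym" and c: "opb c z"
 shows "cmod (dt z) * norm x <= c * norm (z *v x)"
proof -
 let ?w = "z *v x"
 obtain y' where y': "norm y' = norm ?w"
  "norm (cvec (z$2$2 * ?w$1 - z$1$2 * ?w$2) (z$1$1 * ?w$2 - z$1$2 * ?w$1)) = norm (z *v y')"
  using dt_adj_norm[OF z] by blast
 have "cvec (z$2$2 * ?w$1 - z$1$2 * ?w$2) (z$1$1 * ?w$2 - z$1$2 * ?w$1) = dt z *s x"
  using z by (simp add: vec2_eq_iff Sym_iff algebra_simps)
 then have "cmod (dt z) * norm x = norm (z *v y')" using y' by (simp only: norm_smult_vec2)
 also have "\<dots> <= c * norm ?w" using c y' unfolding opb_def by metis
 finally show ?thesis .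
qed

text \<open>The adjugate inherits lower bounds as well, so applying it to \<open>z *v x\<close> uses
  the lower bound twice.\<close>

lemma dt_ge:
 assumes z: "z \<in> Sym" and s: "!!x. s * norm x <= norm (z *v x)" "0 <= s"
 shows "s\<^sup>2 <= cmod (dt z)"
proof -
 let ?x = "cvec 1 0"
 let ?w = "z *v ?x"
 obtain y' where y': "norm y' = norm ?w"
  "norm (cvec (z$2$2 * ?w$1 - z$1$2 * ?w$2) (z$1$1 * ?w$2 - z$1$2 * ?w$1)) = norm (z *v y')"
  using dt_adj_norm[OF z] by blast
 have "cvec (z$2$2 * ?w$1 - z$1$2 * ?w$2) (z$1$1 * ?w$2 - z$1$2 * ?w$1) = dt z *s ?x"
  using z by (simp add: vec2_eq_iff Sym_iff algebra_simps)
 then have "cmod (dt z) * norm ?x = norm (z *v y')" using y' by (simp only: norm_smult_vec2)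
 then have "cmod (dt z) = norm (z *v y')" by (simp add: norm_vec2)
 moreover have "s * (s * norm ?x) <= s * norm ?w" using s by (intro mult_left_mono) auto
 moreover have "s * norm ?w <= norm (z *v y')" using s(1)[of y'] y' by simp
 ultimately show ?thesis by (simp add: norm_vec2 power2_eq_square)
qed

lemma opb_dt:
 assumes "z \<in> Sym" "opb c z" "0 <= c" shows "cmod (dt z) <= c\<^sup>2"
proof -
 have "cmod (dt z) * norm (cvec 1 0) <= c * norm (z *v cvec 1 0)" by (rule dt_le[OF assms(1,2)])
 also have "\<dots> <= c * (c * norm (cvec 1 0))" using assms by (intro mult_left_mono) (auto simp: opb_def)
 finally show ?thesis by (simp add: norm_vec2 power2_eq_square)
qed

lemma opb_nth:
 assumes "opb c z" shows "cmod (z$i$j) <= c"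
proof -
 have *: "cmod (z$i$1) <= c" "cmod (z$i$2) <= c" for i
  using assms[unfolded opb_def, rule_format, of "cvec 1 0"] assms[unfolded opb_def, rule_format, of "cvec 0 1"]
   Finite_Cartesian_Product.norm_nth_le[of "z *v cvec 1 0" i] Finite_Cartesian_Product.norm_nth_le[of "z *v cvec 0 1" i]
  by (auto simp: norm_vec2[of "cvec _ _"])
 show ?thesis using *[of i] exhaust_2[of j] by auto
qed

lemma norm_vec2_le: "norm (x::complex^2) <= cmod (x$1) + cmod (x$2)"
 unfolding norm_vec2 by (rule real_le_lsqrt) (auto simp: power2_eq_square algebra_simps)

lemma norm_opb: "norm (z *v x) <= 4 * norm (z::mat2) * norm x"
proof -
 have *: "cmod ((z *v x)$i) <= 2 * norm z * norm x" for i
 proof -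
  have "cmod ((z *v x)$i) <= cmod (z$i$1) * cmod (x$1) + cmod (z$i$2) * cmod (x$2)"
   by (simp add: norm_mult[symmetric] norm_triangle_ineq)
  also have "\<dots> <= norm z * norm x + norm z * norm x"
   by (intro add_mono mult_mono cmod_nth_le Finite_Cartesian_Product.norm_nth_le) auto
  finally show ?thesis by (simp add: mult_ac)
 qed
 show ?thesis using norm_vec2_le[of "z *v x"] *[of 1] *[of 2] by linarith
qed

lemma opb_mono: "opb c z ==> c <= d ==> opb d z"
 unfolding opb_def by (meson mult_right_mono norm_ge_zero order_trans)

lemma opb_cscale: "opb c z ==> opb (cmod a * c) (cscale a z)"
 unfolding opb_def by (simp add: mat2_vec_lin norm_smult_vec2 mult.assoc mult_left_mono)

lemma dt_zero_kernel:
 assumes "dt z = 0" obtains v where "v ~= 0" "z *v v = 0"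
proof (cases "z$1$1 = 0 & z$1$2 = 0")
 case True
 show thesis
 proof (cases "z$2$1 = 0 & z$2$2 = 0")
  case True
  then show thesis using \<open>z$1$1 = 0 & z$1$2 = 0\<close> by (intro that[of "cvec 1 0"]) (auto simp: vec2_eq_iff)
 next
  case False
  then show thesis using \<open>z$1$1 = 0 & z$1$2 = 0\<close>
   by (intro that[of "cvec (- z$2$2) (z$2$1)"]) (auto simp: vec2_eq_iff)
 qed
next
 case False
 then show thesis using assms
  by (intro that[of "cvec (- z$1$2) (z$1$1)"]) (auto simp: vec2_eq_iff algebra_simps)
qed

subsection \<open>The Cayley transform\<close>

definition den :: "mat2 => complex"
 where "den z = 1 + (z$1$1 + z$2$2) + dt z"

text \<open>This is \<open>(1 - z) (1 + z)\<^sup>-\<^sup>1\<close>, with the inverse written out by Cramer's rule.\<close>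

definition cay :: "mat2 => mat2"
 where "cay z = cscale (1 / den z) (cscale (1 + (z$1$1 + z$2$2) - dt z) (mat 1) - cscale 2 z)"

lemma den_dt: "den z = dt (mat 1 + z)"
 by (simp add: den_def algebra_simps)

lemma cay_Sym: "z \<in> Sym ==> cay z \<in> Sym"
 unfolding cay_def by (intro Sym_simps)

text \<open>By Cayley-Hamilton the numerator in \<open>cay\<close> times \<open>1 + z\<close> is
  \<open>den z\<close> times \<open>1 - z\<close>. Most later properties of \<open>cay\<close> are
  read off from this relation on vectors.\<close>

lemma cay_mult:
 assumes "den z ~= 0" shows "cay z *v (v + z *v v) = v - z *v v"
proof -
 let ?N = "cscale (1 + (z$1$1 + z$2$2) - dt z) (mat 1) - cscale 2 z"
 have e: "?N *v (v + z *v v) = den z *s (v - z *v v)"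
  by (simp add: vec2_eq_iff den_def algebra_simps)
 show ?thesis
  unfolding cay_def mat2_vec_lin(4) e vector_smult_assoc using assms by simp
qed

lemma den_nonzeroI:
 assumes "!!v. v ~= 0 ==> z *v v ~= - v" shows "den z ~= 0"
proof
 assume "den z = 0"
 then obtain v where "v ~= 0" "(mat 1 + z) *v v = 0" using dt_zero_kernel[of "mat 1 + z"] den_dt by metis
 then have "z *v v = - v" by (simp add: vec2_eq_iff algebra_simps eq_neg_iff_add_eq_0)
 then show False using assms \<open>v ~= 0\<close> by blast
qed

lemma cay_nth:
 "cay z $1$1 = (1 - z$1$1 + z$2$2 - dt z) / den z" "cay z $1$2 = - 2 * z$1$2 / den z"
 "cay z $2$1 = - 2 * z$2$1 / den z" "cay z $2$2 = (1 + z$1$1 - z$2$2 - dt z) / den z"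
 by (simp_all add: cay_def divide_inverse algebra_simps)

text \<open>Adding 1 to the Cayley transform gives \<open>2 (1 + z)^-1\<close>, and
  \<open>den\<close> is the determinant of \<open>1 + z\<close>.\<close>

lemma den_cay: assumes "den z ~= 0" shows "den (cay z) = 4 / den z"
proof -
 define d a e p q where "d = den z" and "a = z$1$1" and "e = z$2$2" and "p = z$1$2" and "q = z$2$1"
 have d: "d ~= 0" "d = 1 + (a + e) + (a * e - p * q)"
  using assms by (simp_all add: den_def d_def a_def e_def p_def q_def)
 have "den (cay z) = 1 + ((1 - a + e - (a*e - p*q)) / d + (1 + a - e - (a*e - p*q)) / d)
  + ((1 - a + e - (a*e - p*q)) / d * ((1 + a - e - (a*e - p*q)) / d) - (- 2 * p / d) * (- 2 * q / d))"
  unfolding den_def[of "cay z"] cay_nth d_def a_def e_def p_def q_def ..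
 also have "\<dots> = (d * d + (2 - 2 * (a*e - p*q)) * d
   + ((1 - a + e - (a*e - p*q)) * (1 + a - e - (a*e - p*q)) - 4 * (p * q))) / (d * d)"
  using d(1) by (simp add: divide_simps) (simp add: algebra_simps)
 also have "d * d + (2 - 2 * (a*e - p*q)) * d
   + ((1 - a + e - (a*e - p*q)) * (1 + a - e - (a*e - p*q)) - 4 * (p * q)) = 4 * d"
  unfolding d(2) by (simp add: algebra_simps)
 finally show ?thesis using d(1) by (simp add: d_def)
qed

lemma cay_cay: assumes "den z ~= 0" shows "cay (cay z) = z"
proof -
 have d: "den (cay z) ~= 0" "den (cay z) = 4 / den z" using assms by (simp_all add: den_cay)
 have "cay (cay z) *v w = z *v w" for w
 proof -
  define v where "v = cscale (1/2) (mat 1) *v (w + z *v w)"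
  have c: "cay z *v (w + z *v w) = w - z *v w" by (rule cay_mult[OF assms])
  then have cv: "cay z *v v = cscale (1/2) (mat 1) *v (w - z *v w)"
   by (simp add: v_def mat2_vec_lin vec2_eq_iff algebra_simps)
  have "v + cay z *v v = w" "v - cay z *v v = z *v w"
   unfolding cv unfolding v_def by (simp_all add: vec2_eq_iff field_simps)
  then show ?thesis using cay_mult[OF d(1), of v] by simp
 qed
 then show ?thesis by (metis matrix_eq)
qed

text \<open>The difference of the squared norms of \<open>x + W x\<close> and
  \<open>x - W x\<close>: positive real part of \<open>W\<close> corresponds to a contractive Cayley
  transform.\<close>

lemma cay_Re:
 assumes "den W ~= 0"
 shows "4 * Re (hin x (W *v x)) = (norm (x + W *v x))\<^sup>2 - (norm (cay W *v (x + W *v x)))\<^sup>2"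
 unfolding cay_mult[OF assms] norm_add_sq norm_diff_sq by simp

lemma udisc_Sym: "z \<in> udisc ==> z \<in> Sym"
 by (simp add: udisc_def)

lemma udisc_den: "z \<in> udisc ==> den z ~= 0"
 by (rule den_nonzeroI) (metis (mono_tags, lifting) mem_Collect_eq norm_minus_cancel order_less_irrefl udisc_def)

lemma hin_ii: "hin x (cscale \<i> W *v x) = \<i> * hin x (W *v x)" "hin x (cscale (-\<i>) W *v x) = - \<i> * hin x (W *v x)"
 by (simp_all only: mat2_vec_lin hin_scale)

lemma cay_udisc_siegel:
 assumes z: "z \<in> udisc" shows "cscale \<i> (cay z) \<in> siegel"
proof -
 let ?W = "cay z"
 have d: "den ?W ~= 0" "cay ?W = z" using udisc_den[OF z] by (simp_all add: den_cay cay_cay)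
 have "0 < Im (hin x (cscale \<i> ?W *v x))" if x: "x ~= 0" for x
 proof -
  let ?v = "x + ?W *v x"
  have "?v ~= 0"
  proof
   assume v: "?v = 0"
   then have "x - ?W *v x = 0" using cay_mult[OF d(1), of x] by (simp add: vec2_eq_iff)
   then show False using v x by (simp add: vec2_eq_iff algebra_simps)
  qed
  then have "norm (z *v ?v) < norm ?v" using z by (simp add: udisc_def)
  then have "(norm (z *v ?v))\<^sup>2 < (norm ?v)\<^sup>2" by (simp add: power_strict_mono)
  then show ?thesis using cay_Re[OF d(1), of x] d(2) by (simp add: hin_ii)
 qed
 then show ?thesis using cay_Sym[OF udisc_Sym[OF z]] by (simp add: siegel_def)
qed

lemma siegel_den:
 assumes "Z \<in> siegel" shows "den (cscale (-\<i>) Z) ~= 0"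
proof (rule den_nonzeroI)
 fix v :: "complex^2" assume v: "v ~= 0"
 show "cscale (-\<i>) Z *v v ~= - v"
 proof
  assume "cscale (-\<i>) Z *v v = - v"
  then have "- \<i> * hin v (Z *v v) = - hin v v" using hin_ii(2)[of v Z] by (simp add: hin_add)
  then have "hin v (Z *v v) = - \<i> * hin v v" by (simp add: complex_eq_iff)
  then have "Im (hin v (Z *v v)) = - (norm v)\<^sup>2" by (simp add: hin_self)
  then show False using siegel_pos[OF assms v] by (simp add: not_le[symmetric])
 qed
qed

lemma cay_siegel_udisc:
 assumes Z: "Z \<in> siegel" shows "cay (cscale (-\<i>) Z) \<in> udisc"
proof -
 let ?W = "cscale (-\<i>) Z"
 let ?z = "cay ?W"
 have d: "den ?W ~= 0" by (rule siegel_den[OF Z])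
 have dz: "den ?z ~= 0" "cay ?z = ?W" using d by (simp_all add: den_cay cay_cay)
 have "norm (?z *v v) < norm v" if v: "v ~= 0" for v
 proof -
  let ?x = "v + ?z *v v"
  have Wx: "?W *v ?x = v - ?z *v v" using cay_mult[OF dz(1), of v] dz(2) by simp
  have x0: "?x ~= 0"
  proof
   assume x: "?x = 0"
   then have "v - ?z *v v = 0" using Wx by (simp add: vec2_eq_iff)
   then show False using x v by (simp add: vec2_eq_iff algebra_simps)
  qed
  have "0 < Re (hin ?x (?W *v ?x))" using siegel_pos[OF Z x0] unfolding hin_ii by simp
  moreover have "4 * Re (hin ?x (?W *v ?x)) = (norm (2 *s v))\<^sup>2 - (norm (?z *v (2 *s v)))\<^sup>2"
  proof -
   have "?x + ?W *v ?x = 2 *s v" unfolding Wx by (simp add: vec2_eq_iff)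
   then show ?thesis using cay_Re[OF d, of ?x] by simp
  qed
  ultimately have "(norm (?z *v v))\<^sup>2 < (norm v)\<^sup>2"
   by (simp add: mat2_vec_lin norm_smult_vec2 power_mult_distrib)
  then show ?thesis using power2_less_imp_less norm_ge_zero by blast
 qed
 then show ?thesis using cay_Sym[of ?W] siegel_Sym[OF Z] by (simp add: udisc_def)
qed

text \<open>The denominator is at least \<open>(1 - s)^2\<close> by \<open>dt_ge\<close> for
  \<open>mat 1 + z\<close>. Entries and determinant of a contraction are at most 1, so each of the
  four numerators is at most 6, which gives the 24 that recurs below.\<close>

lemma cay_bound:
 assumes z: "z \<in> Sym" "opb s z" "0 <= s" "s < 1"
 shows "norm (cay z) <= 24 / (1 - s)\<^sup>2"
proof -
 have "(1 - s)\<^sup>2 <= cmod (dt (mat 1 + z))"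
 proof (rule dt_ge)
  fix x :: "complex^2"
  have "norm x - norm (z *v x) <= norm (x + z *v x)"
   using norm_triangle_ineq2[of x "- (z *v x)"] by simp
  moreover have "(mat 1 + z) *v x = x + z *v x" by (simp add: vec2_eq_iff algebra_simps)
  moreover have "norm (z *v x) <= s * norm x" using z(2) by (simp add: opb_def)
  moreover have "(1 - s) * norm x = norm x - s * norm x" by (simp add: left_diff_distrib)
  ultimately show "(1 - s) * norm x <= norm ((mat 1 + z) *v x)" by simp
 qed (use z in auto)
 then have d: "(1 - s)\<^sup>2 <= cmod (den z)" by (simp only: den_dt)
 have p: "0 < (1 - s)\<^sup>2" using z by simp
 have e: "cmod (z$i$j) <= 1" for i j using opb_nth[OF z(2), of i j] z by linarith
 have dtb: "cmod (dt z) <= 1"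
  using opb_dt[OF z(1-3)] z power_le_one[of s 2] by linarith
 have q: "cmod (N / den z) <= 6 / (1 - s)\<^sup>2" if "cmod N <= 6" for N
  unfolding norm_divide using that d p by (intro frac_le) auto
 have "cmod (cay z$1$1) <= 6 / (1 - s)\<^sup>2" unfolding cay_nth
 proof (rule q)
  show "cmod (1 - z$1$1 + z$2$2 - dt z) <= 6"
   using e[of 1 1] e[of 2 2] dtb norm_triangle_ineq4[of "1 - z$1$1 + z$2$2" "dt z"]
    norm_triangle_ineq[of "1 - z$1$1" "z$2$2"] norm_triangle_ineq4[of 1 "z$1$1"] by simp
 qed
 moreover have "cmod (cay z$2$2) <= 6 / (1 - s)\<^sup>2" unfolding cay_nth
 proof (rule q)
  show "cmod (1 + z$1$1 - z$2$2 - dt z) <= 6"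
   using e[of 1 1] e[of 2 2] dtb norm_triangle_ineq4[of "1 + z$1$1 - z$2$2" "dt z"]
    norm_triangle_ineq4[of "1 + z$1$1" "z$2$2"] norm_triangle_ineq[of 1 "z$1$1"] by simp
 qed
 moreover have "cmod (cay z$1$2) <= 6 / (1 - s)\<^sup>2" "cmod (cay z$2$1) <= 6 / (1 - s)\<^sup>2" unfolding cay_nth
  using e[of 1 2] e[of 2 1] by (auto intro!: q simp: norm_mult)
 ultimately show ?thesis using norm_mat2_le[of "cay z"] by simp
qed

lemma open_Sym_den: "open_Sym {z \<in> Sym. den z ~= 0}"
proof -
 have "open {z. den z ~= 0}"
  unfolding den_def by (intro open_Collect_neq continuous_intros linear_continuous_on bounded_linear_nth)
 moreover have "{z \<in> Sym. den z ~= 0} = Sym \<inter> {z. den z ~= 0}" by auto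
 ultimately show ?thesis by auto
qed

lemma hol_cay: "hol cay {z \<in> Sym. den z ~= 0}"
 unfolding hol_def forall_2 cay_nth
proof (intro conjI open_Sym_den ballI)
 have d: "shol den {z \<in> Sym. den z ~= 0}" unfolding den_def[abs_def] den_def
  using open_Sym_den[unfolded den_def] by (intro shol_intros) auto
 show "shol (%z. (1 - z$1$1 + z$2$2 - dt z) / den z) {z \<in> Sym. den z ~= 0}"
  "shol (%z. - 2 * z$1$2 / den z) {z \<in> Sym. den z ~= 0}"
  "shol (%z. - 2 * z$2$1 / den z) {z \<in> Sym. den z ~= 0}"
  "shol (%z. (1 + z$1$1 - z$2$2 - dt z) / den z) {z \<in> Sym. den z ~= 0}"
  using open_Sym_den d by (intro shol_intros; simp)+
qed (auto intro: cay_Sym)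

lemma hol_cscale: "open_Sym S ==> hol (cscale c) S"
 unfolding hol_def using open_Sym_subset by (auto intro!: shol_intros)

lemma dF_linear_cscale:
 shows "dF (cscale c) X Z = cscale c X"
proof -
 have "((%t. c * (Z$i$j + t * X$i$j)) has_field_derivative c * X$i$j) (at 0)" for i j
  by (auto intro!: derivative_eq_intros)
 then show ?thesis by (simp add: mat2_eq_iff ddir_def DERIV_imp_deriv)
qed

text \<open>The derivative of the identity \<open>cay_mult\<close> in the direction
  \<open>X\<close>, with \<open>v\<close> held fixed.\<close>

lemma dF_cay:
 assumes z: "z \<in> Sym" "den z ~= 0" and X: "X \<in> Sym"
 shows "dF cay X z *v (v + z *v v) = - (X *v v + cay z *v (X *v v))"
proof -
 let ?S = "{z \<in> Sym. den z ~= 0}"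
 let ?T = "{t. z + cscale t X \<in> ?S}"
 have T: "open ?T" by (rule open_line[OF open_Sym_den z(1) X])
 have cd: "((%t. cay (z + cscale t X) $ i $ j) has_field_derivative dF cay X z $ i $ j) (at 0)" for i j
  using hol_line_deriv[OF hol_cay, of z X i j] z X by simp
 have "(dF cay X z *v (v + z *v v)) $ i = - ((X *v v) $ i + (cay z *v (X *v v)) $ i)" for i
 proof -
  have "((%t. (cay (z + cscale t X) *v (v + (z + cscale t X) *v v)) $ i) has_field_derivative
   (dF cay X z *v (v + z *v v)) $ i + (cay z *v (X *v v)) $ i) (at 0)"
   by (auto intro!: derivative_eq_intros cd simp: algebra_simps)
  moreover have "((%t. (cay (z + cscale t X) *v (v + (z + cscale t X) *v v)) $ i) has_field_derivative
   - ((X *v v) $ i)) (at 0)"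
  proof (rule has_field_derivative_transform_within_open[OF _ T])
   show "((%t. (v - (z + cscale t X) *v v) $ i) has_field_derivative - ((X *v v) $ i)) (at 0)"
    by (auto intro!: derivative_eq_intros simp: algebra_simps)
  qed (use z in \<open>auto simp: cay_mult\<close>)
  ultimately have "(dF cay X z *v (v + z *v v)) $ i + (cay z *v (X *v v)) $ i = - ((X *v v) $ i)"
   by (rule DERIV_unique)
  then show ?thesis by (simp add: algebra_simps eq_neg_iff_add_eq_0)
 qed
 then show ?thesis by (simp add: vec2_eq_iff)
qed

lemma mat2_eqI_vec: "(!!v. A *v v = B *v v) ==> A = (B::mat2)"
 by (metis matrix_eq)

lemma cay_simps [simp]: "cay 0 = mat 1" "cay (mat 1) = 0" "den 0 = 1" "den (mat 1) = 4"
 by (simp_all add: mat2_eq_iff cay_nth den_def)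

lemma dF_cay_0: assumes "X \<in> Sym" shows "dF cay X 0 = cscale (-2) X"
proof (rule mat2_eqI_vec)
 fix v :: "complex^2"
 show "dF cay X 0 *v v = cscale (-2) X *v v"
  using dF_cay[of 0 X v] assms by (simp add: vec2_eq_iff)
qed

lemma dF_cay_1: assumes "X \<in> Sym" shows "dF cay X (mat 1) = cscale (-1/2) X"
proof (rule mat2_eqI_vec)
 fix v :: "complex^2"
 show "dF cay X (mat 1) *v v = cscale (-1/2) X *v v"
  using dF_cay[of "mat 1" X "cscale (1/2) (mat 1) *v v"] assms by (simp add: vec2_eq_iff field_simps)
qed

lemma udisc_iff: "z \<in> udisc \<longleftrightarrow> z \<in> Sym & den z ~= 0 & cscale \<i> (cay z) \<in> siegel"
 using udisc_Sym udisc_den cay_udisc_siegel cay_siegel_udisc[of "cscale \<i> (cay z)"] by (auto simp: cay_cay)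

lemma open_Sym_udisc: "open_Sym udisc"
proof -
 let ?S = "{z \<in> Sym. den z ~= 0}"
 have "hol (%z. cscale \<i> (cay z)) ?S"
  by (rule hol_comp[OF hol_cay hol_cscale[of Sym]]) (auto intro: cay_Sym)
 then have "continuous_on ?S (%z. cscale \<i> (cay z))" by (rule hol_continuous)
 then have "openin (top_of_set ?S) (?S \<inter> (%z. cscale \<i> (cay z)) -` siegel)"
  by (rule continuous_openin_preimage[OF _ _ open_Sym_siegel]) (auto intro: cay_Sym)
 then have "open_Sym (?S \<inter> (%z. cscale \<i> (cay z)) -` siegel)"
  using open_Sym_den openin_trans by blast
 moreover have "?S \<inter> (%z. cscale \<i> (cay z)) -` siegel = udisc" by (auto simp: udisc_iff)
 ultimately show ?thesis by simp
qed

text \<open>The centre 0 goes to \<open>ii\<close> and the boundary point \<open>mat 1\<close> goes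
  to 0, so boundary behaviour near \<open>mat 1\<close> becomes behaviour near the origin.\<close>

definition C_map :: "mat2 => mat2" where "C_map z = cscale \<i> (cay z)"
definition C_inv :: "mat2 => mat2" where "C_inv Z = cay (cscale (-\<i>) Z)"

lemma C_map_siegel: "z \<in> udisc ==> C_map z \<in> siegel"
 by (simp add: C_map_def cay_udisc_siegel)

lemma C_inv_udisc: "Z \<in> siegel ==> C_inv Z \<in> udisc"
 by (simp add: C_inv_def cay_siegel_udisc)

lemma C_inv_C_map: "z \<in> udisc ==> C_inv (C_map z) = z"
 by (simp add: C_map_def C_inv_def cay_cay udisc_den)

lemma C_map_C_inv: "Z \<in> siegel ==> C_map (C_inv Z) = Z"
 using siegel_den by (simp add: C_map_def C_inv_def cay_cay)

lemma hol_C_map: "hol C_map {z \<in> Sym. den z ~= 0}"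
 unfolding C_map_def[abs_def] by (rule hol_comp[OF hol_cay hol_cscale[of Sym]]) (auto intro: cay_Sym)

lemma open_Sym_C_inv: "open_Sym {Z \<in> Sym. den (cscale (-\<i>) Z) ~= 0}"
proof -
 have "open {z. den (cscale (-\<i>) z) ~= 0}"
  unfolding den_def cscale_nth by (intro open_Collect_neq continuous_intros linear_continuous_on bounded_linear_nth)
 moreover have "{z \<in> Sym. den (cscale (-\<i>) z) ~= 0} = Sym \<inter> {z. den (cscale (-\<i>) z) ~= 0}" by auto
 ultimately show ?thesis by auto
qed

lemma hol_C_inv: "hol C_inv {Z \<in> Sym. den (cscale (-\<i>) Z) ~= 0}"
 unfolding C_inv_def[abs_def] by (rule hol_comp[OF hol_cscale hol_cay]) (auto simp: open_Sym_C_inv)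

section \<open>Normalised local maps\<close>

definition tri :: "real => real => real => mat2 => mat2"
 where "tri a b c Z = symat (of_real (a\<^sup>2) * Z$1$1) (of_real (a * b) * Z$1$1 + of_real (a * c) * Z$1$2)
  (of_real (b\<^sup>2) * Z$1$1 + of_real (2 * b * c) * Z$1$2 + of_real (c\<^sup>2) * Z$2$2)"

text \<open>\<^term>\<open>tri a b c Z\<close> is \<open>L Z L\<^sup>T\<close> for the lower triangular matrix \<open>L\<close> with rows \<open>(a, 0)\<close> and \<open>(b, c)\<close>.\<close>

lemma tri_Sym [simp, intro]: "tri a b c Z \<in> Sym"
 by (simp add: tri_def)

lemma tri_linear: "tri a b c (Z + W) = tri a b c Z + tri a b c W"
 "tri a b c (Z - W) = tri a b c Z - tri a b c W"
 "tri a b c (cscale t Z) = cscale t (tri a b c Z)" "tri a b c 0 = 0"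
 by (simp_all add: tri_def mat2_eq_iff algebra_simps)

lemma tri_inv:
 assumes "a ~= 0" "c ~= 0" "Z \<in> Sym"
 shows "tri (1/a) (- (b / (a * c))) (1/c) (tri a b c Z) = Z" "tri a b c (tri (1/a) (- (b / (a * c))) (1/c) Z) = Z"
 using assms
 by (simp_all add: tri_def mat2_eq_iff Sym_iff field_simps power2_eq_square)

lemma tri_dt: "Z \<in> Sym ==> dt (tri a b c Z) = of_real ((a * c)\<^sup>2) * dt Z"
 by (simp add: tri_def Sym_iff power2_eq_square algebra_simps)

text \<open>The transposed triangular matrix applied to \<open>x\<close>; since that matrix is real,
  \<open>hin_tri\<close> moves it across the hermitian form.\<close>

definition trv :: "real => real => real => complex^2 => complex^2"
 where "trv a b c x = cvec (of_real a * x$1 + of_real b * x$2) (of_real c * x$2)"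

lemma hin_tri: "Z \<in> Sym ==> hin x (tri a b c Z *v x) = hin (trv a b c x) (Z *v trv a b c x)"
 by (simp add: hin_def tri_def trv_def Sym_iff power2_eq_square algebra_simps)

lemma trv_nonzero: "a ~= 0 ==> c ~= 0 ==> x ~= 0 ==> trv a b c x ~= 0"
 by (auto simp: trv_def vec2_nonzero)

text \<open>The real symmetric matrices: the finite part of the Shilov boundary of the half
  space.\<close>

definition realm :: "mat2 => bool" where "realm X \<longleftrightarrow> X \<in> Sym & (\<forall>i j. Im (X$i$j) = 0)"

lemma realm_Sym: "realm X ==> X \<in> Sym"
 by (simp add: realm_def)

lemma realm_hin: "realm X ==> Im (hin x (X *v x)) = 0"
 using Im_hin[of X x] by (simp add: realm_def)

definition imm :: "mat2 => mat2"
 where "imm Z = symat (of_real (Im (Z$1$1))) (of_real (Im (Z$1$2))) (of_real (Im (Z$2$2)))"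

definition rem :: "mat2 => mat2"
 where "rem Z = symat (of_real (Re (Z$1$1))) (of_real (Re (Z$1$2))) (of_real (Re (Z$2$2)))"

lemma rem_realm [simp, intro]: "realm (rem Z)" and imm_Sym [simp, intro]: "imm Z \<in> Sym"
 by (auto simp: realm_def rem_def imm_def forall_2)

lemma rem_imm: "Z \<in> Sym ==> cscale \<i> (imm Z) + rem Z = Z"
 by (simp add: mat2_eq_iff imm_def rem_def Sym_iff complex_eq_iff)

lemma hin_imm: "Z \<in> Sym ==> hin x (imm Z *v x) = of_real (Im (hin x (Z *v x)))"
 by (auto simp: complex_eq_iff Im_hin hin_def imm_def cmod_power2 Sym_iff) (simp_all add: power2_eq_square algebra_simps)

lemma tri_siegel:
 assumes Z: "Z \<in> siegel" and "a ~= 0" "c ~= 0" and X: "realm X"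
 shows "tri a b c Z + X \<in> siegel" "tri a b c (Z - X) \<in> siegel"
proof -
 have S: "Z \<in> Sym" "X \<in> Sym" using Z X siegel_Sym realm_Sym by auto
 have *: "0 < Im (hin (trv a b c x) (Z *v trv a b c x))" if "x ~= 0" for x
  using trv_nonzero[OF assms(2,3) that] siegel_pos[OF Z] by blast
 show "tri a b c Z + X \<in> siegel"
  unfolding siegel_def using S * realm_hin[OF X] by (auto simp: mat2_vec_lin hin_add hin_tri)
 show "tri a b c (Z - X) \<in> siegel"
  unfolding siegel_def using S * realm_hin[OF X] by (auto simp: hin_tri mat2_vec_lin hin_add)
qed

text \<open>Cholesky factorisation of the imaginary part. The affine map
  \<open>%V. tri a b c V + rem Z\<close> then moves \<open>ii\<close> to \<open>Z\<close>, and the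
  trace identity controls its size through \<open>norm_tri\<close>.\<close>

lemma chol:
 assumes Z: "Z \<in> siegel"
 obtains a b c where "a > 0" "c > 0" "tri a b c (mat 1) = imm Z"
  "a\<^sup>2 + b\<^sup>2 + c\<^sup>2 = Im (Z$1$1) + Im (Z$2$2)"
proof -
 have y: "0 < Im (Z$1$1)" "(Im (Z$1$2))\<^sup>2 < Im (Z$1$1) * Im (Z$2$2)" using Z siegel_iff by auto
 define a where "a = sqrt (Im (Z$1$1))"
 define b where "b = Im (Z$1$2) / a"
 have a: "a > 0" "a\<^sup>2 = Im (Z$1$1)" using y by (auto simp: a_def)
 have "b\<^sup>2 < Im (Z$2$2)" using y a by (simp add: b_def power_divide divide_simps mult.commute)
 define c where "c = sqrt (Im (Z$2$2) - b\<^sup>2)"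
 have c: "c > 0" "c\<^sup>2 = Im (Z$2$2) - b\<^sup>2" using \<open>b\<^sup>2 < _\<close> by (auto simp: c_def)
 have "tri a b c (mat 1) = imm Z"
  unfolding tri_def imm_def using a c by (simp add: b_def flip: of_real_power)
 then show thesis using that[of a c b] a c by simp
qed

lemma norm_tri: "norm (tri a b c W) <= 3 * (a\<^sup>2 + b\<^sup>2 + c\<^sup>2) * norm W"
proof -
 let ?n = "norm W"
 have e: "cmod (W$i$j) <= ?n" for i j by (rule cmod_nth_le)
 have 1: "cmod (tri a b c W$1$1) <= a\<^sup>2 * ?n"
  using e[of 1 1] by (simp add: tri_def norm_mult norm_power mult_left_mono)
 have 2: "cmod (of_real (a * b) * W$1$1 + of_real (a * c) * W$1$2) <= (\<bar>a\<bar> * \<bar>b\<bar>) * ?n + (\<bar>a\<bar> * \<bar>c\<bar>) * ?n"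
  by (rule norm_triangle_le) (use e[of 1 1] e[of 1 2] in \<open>simp add: norm_mult abs_mult add_mono mult_left_mono\<close>)
 have 3: "cmod (of_real (b\<^sup>2) * W$1$1 + of_real (2 * b * c) * W$1$2 + of_real (c\<^sup>2) * W$2$2)
  <= b\<^sup>2 * ?n + (2 * \<bar>b\<bar> * \<bar>c\<bar>) * ?n + c\<^sup>2 * ?n"
  by (rule order_trans[OF norm_triangle_ineq add_mono[OF norm_triangle_le]])
   (use e[of 1 1] e[of 1 2] e[of 2 2] in \<open>simp_all add: norm_mult norm_power abs_mult add_mono mult_left_mono\<close>)
 have "norm (tri a b c W) <= a\<^sup>2 * ?n + ((\<bar>a\<bar> * \<bar>b\<bar>) * ?n + (\<bar>a\<bar> * \<bar>c\<bar>) * ?n)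
   + ((\<bar>a\<bar> * \<bar>b\<bar>) * ?n + (\<bar>a\<bar> * \<bar>c\<bar>) * ?n) + (b\<^sup>2 * ?n + (2 * \<bar>b\<bar> * \<bar>c\<bar>) * ?n + c\<^sup>2 * ?n)"
  by (rule order_trans[OF norm_mat2_le], intro add_mono) (use 1 2 3 in \<open>simp_all add: tri_def\<close>)
 also have "\<dots> = (\<bar>a\<bar> + \<bar>b\<bar> + \<bar>c\<bar>)\<^sup>2 * ?n"
  by (simp add: power2_eq_square algebra_simps)
 also have "\<dots> <= 3 * (a\<^sup>2 + b\<^sup>2 + c\<^sup>2) * ?n"
 proof (rule mult_right_mono)
  have "0 <= (\<bar>a\<bar> - \<bar>b\<bar>)\<^sup>2 + (\<bar>b\<bar> - \<bar>c\<bar>)\<^sup>2 + (\<bar>a\<bar> - \<bar>c\<bar>)\<^sup>2" by simp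
  then show "(\<bar>a\<bar> + \<bar>b\<bar> + \<bar>c\<bar>)\<^sup>2 <= 3 * (a\<^sup>2 + b\<^sup>2 + c\<^sup>2)"
   by (simp add: power2_eq_square algebra_simps)
 qed simp
 finally show ?thesis .
qed

lemma hol_tri: "open_Sym S ==> X \<in> Sym ==> hol (%Z. tri a b c Z + X) S"
 "open_Sym S ==> X \<in> Sym ==> hol (%Z. tri a b c (Z - X)) S"
 unfolding hol_def forall_2 tri_def by (auto intro!: shol_intros)

lemma dF_tri: "V \<in> Sym ==> dF (%Z. tri a b c Z + X) V Z = tri a b c V" "V \<in> Sym ==> dF (%Z. tri a b c (Z - X)) V Z = tri a b c V"
 unfolding mat2_eq_iff dF_nth ddir_def tri_def
 by (auto simp: Sym_iff intro!: DERIV_imp_deriv derivative_eq_intros)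

abbreviation ii :: mat2 where "ii \<equiv> cscale \<i> (mat 1)"

section \<open>Half balls and mutually inverse local maps\<close>

definition HB :: "real => mat2 set" where "HB r = {Z \<in> siegel. norm Z < r}"

lemma HB_eq: "HB r = siegel \<inter> ball 0 r"
 by (auto simp: HB_def)

lemma open_Sym_HB: "open_Sym (HB r)"
 unfolding HB_eq by (rule openin_Int_open[OF open_Sym_siegel]) simp

lemma convex_HB: "convex (HB r)"
 unfolding HB_eq by (intro convex_Int convex_siegel convex_ball)

lemma HB_siegel: "Z \<in> HB r ==> Z \<in> siegel" and HB_Sym: "Z \<in> HB r ==> Z \<in> Sym"
 using siegel_Sym by (auto simp: HB_def)

lemma norm_ii: "norm ii < 2"
 unfolding norm_cscale norm_mat2 by (simp add: real_less_lsqrt)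

text \<open>The two maps are inverse to each other only where both are known to be defined: the
  image of a half ball need not lie in a half ball.\<close>

definition prepair :: "(mat2 => mat2) => (mat2 => mat2) => real => bool"
 where "prepair F G R \<longleftrightarrow> hol F (HB R) & F ` HB R \<subseteq> siegel & hol G (HB R) & G ` HB R \<subseteq> siegel &
  (\<forall>Z\<in>HB R. F Z \<in> HB R --> G (F Z) = Z) & (\<forall>W\<in>HB R. G W \<in> HB R --> F (G W) = W)"

definition pair :: "(mat2 => mat2) => (mat2 => mat2) => real => bool"
 where "pair F G R \<longleftrightarrow> prepair F G R & R > 2 & F ii = ii"

lemma prepair_sym: "prepair F G R ==> prepair G F R"
 by (auto simp: prepair_def)

lemma ii_HB: "R > 2 ==> ii \<in> HB R"
 using norm_ii ii_siegel by (simp add: HB_def)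

lemma pair_sym: assumes "pair F G R" shows "pair G F R"
proof -
 have "G (F ii) = ii" using assms ii_HB[of R] unfolding pair_def prepair_def by metis
 then show ?thesis using assms prepair_sym by (auto simp: pair_def)
qed

text \<open>Real affine maps act on the whole half space, so conjugation at \<open>Z\<close> and
  \<open>F Z\<close> preserves the half space and moves both base points to \<open>ii\<close>. With
  imaginary parts of trace at most \<open>s\<close> the linear parts enlarge norms by at most
  \<open>3 * s\<close>; small imaginary parts therefore buy a large radius \<rho>.\<close>

lemma normalise:
 assumes P: "prepair F G R" and Z: "Z \<in> HB (R/2)" and W: "F Z \<in> HB (R/2)"
  and s: "Im (Z$1$1) + Im (Z$2$2) <= s" "Im (F Z$1$1) + Im (F Z$2$2) <= s"
  and \<rho>: "\<rho> > 2" "3 * s * \<rho> <= R / 2"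
 obtains a b c a' b' c' F' G' where "a > 0" "c > 0" "a' > 0" "c' > 0"
  "tri a b c (mat 1) = imm Z" "tri a' b' c' (mat 1) = imm (F Z)" "pair F' G' \<rho>"
  "!!V. V \<in> Sym ==> tri a' b' c' (dF F' V ii) = dF F (tri a b c V) Z"
  "!!V. V \<in> HB \<rho> ==> tri a b c V + rem Z \<in> HB R"
  "!!V. V \<in> HB \<rho> ==> F (tri a b c V + rem Z) = tri a' b' c' (F' V) + rem (F Z)"
proof -
 obtain a b c where a: "a > 0" "c > 0" "tri a b c (mat 1) = imm Z"
  "a\<^sup>2 + b\<^sup>2 + c\<^sup>2 = Im (Z$1$1) + Im (Z$2$2)" using chol HB_siegel[OF Z] by metis
 obtain a' b' c' where a': "a' > 0" "c' > 0" "tri a' b' c' (mat 1) = imm (F Z)"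
  "a'\<^sup>2 + b'\<^sup>2 + c'\<^sup>2 = Im (F Z$1$1) + Im (F Z$2$2)" using chol HB_siegel[OF W] by metis
 note ne = a(1,2)[THEN less_imp_neq, symmetric] a'(1,2)[THEN less_imp_neq, symmetric]
 have "norm Z < R / 2" using Z by (simp add: HB_def)
 then have Rp: "R > 0" using norm_ge_zero[of Z] by linarith
 have small: "norm (tri p q r V + rem U) < R"
  if "norm U < R / 2" "U \<in> Sym" "p\<^sup>2 + q\<^sup>2 + r\<^sup>2 <= s" "norm V < \<rho>" for p q r U V
 proof -
  have "norm (tri p q r V) <= 3 * (p\<^sup>2 + q\<^sup>2 + r\<^sup>2) * norm V" by (rule norm_tri)
  also have "\<dots> <= 3 * s * \<rho>" using that by (intro mult_mono) (auto intro: order_trans[OF _ that(3)])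
  finally have 1: "norm (tri p q r V) <= R / 2" using \<rho> by linarith
  have "norm (rem U) <= norm U"
   unfolding norm_mat2 rem_def using \<open>U \<in> Sym\<close>
   by (intro real_sqrt_le_mono add_mono) (auto simp: cmod_power2 Sym_iff)
  then show ?thesis using 1 that(1) norm_triangle_ineq[of "tri p q r V" "rem U"] by linarith
 qed
 have mapF: "tri a b c V + rem Z \<in> HB R" if "V \<in> HB \<rho>" for V
  using that small[of Z a b c V] Z a s tri_siegel(1)[OF _ ne(1,2) rem_realm] HB_Sym[OF Z] by (auto simp: HB_def)
 have mapG: "tri a' b' c' V + rem (F Z) \<in> HB R" if "V \<in> HB \<rho>" for V
  using that small[of "F Z" a' b' c' V] W a' s tri_siegel(1)[OF _ ne(3,4) rem_realm] HB_Sym[OF W] by (auto simp: HB_def)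
 \<comment> \<open>\<open>T\<close> and \<open>T'\<close> invert the affine maps that move
   \<open>ii\<close> to \<open>Z\<close> and to \<open>F Z\<close>.\<close>
 define T where "T V = tri (1/a) (- (b / (a * c))) (1/c) (V - rem Z)" for V
 define T' where "T' V = tri (1/a') (- (b' / (a' * c'))) (1/c') (V - rem (F Z))" for V
 have TT: "T (tri a b c V + rem Z) = V" "tri a b c (T V) + rem Z = V"
  "T' (tri a' b' c' V + rem (F Z)) = V" "tri a' b' c' (T' V) + rem (F Z) = V" if "V \<in> Sym" for V
  using that ne by (simp_all add: T_def T'_def tri_inv realm_Sym)
 have Ts: "T V \<in> siegel" "T' V \<in> siegel" if "V \<in> siegel" for V
  unfolding T_def T'_def using that ne by (auto intro!: tri_siegel)
 define F' where "F' V = T' (F (tri a b c V + rem Z))" for V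
 define G' where "G' V = T (G (tri a' b' c' V + rem (F Z)))" for V
 have FP: "hol F (HB R)" "!!V. V \<in> HB R ==> F V \<in> siegel" "hol G (HB R)" "!!V. V \<in> HB R ==> G V \<in> siegel"
  "!!V. V \<in> HB R ==> F V \<in> HB R ==> G (F V) = V" "!!V. V \<in> HB R ==> G V \<in> HB R ==> F (G V) = V"
  using P by (auto simp: prepair_def)
 have hF1: "hol (%V. F (tri a b c V + rem Z)) (HB \<rho>)"
  by (rule hol_comp[OF hol_tri(1) FP(1) mapF]) (auto simp: open_Sym_HB realm_Sym)
 have hF: "hol F' (HB \<rho>)" unfolding F'_def T'_def
  by (rule hol_comp[OF hF1 hol_tri(2)[OF open_Sym_siegel]]) (auto simp: realm_Sym FP mapF)
 have hG1: "hol (%V. G (tri a' b' c' V + rem (F Z))) (HB \<rho>)"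
  by (rule hol_comp[OF hol_tri(1) FP(3) mapG]) (auto simp: open_Sym_HB realm_Sym)
 have hG: "hol G' (HB \<rho>)" unfolding G'_def T_def
  by (rule hol_comp[OF hG1 hol_tri(2)[OF open_Sym_siegel]]) (auto simp: realm_Sym FP mapG)
 have FF': "F (tri a b c V + rem Z) = tri a' b' c' (F' V) + rem (F Z)" if "V \<in> HB \<rho>" for V
  unfolding F'_def using TT(4) siegel_Sym[OF FP(2)[OF mapF[OF that]]] by simp
 have GG': "G (tri a' b' c' V + rem (F Z)) = tri a b c (G' V) + rem Z" if "V \<in> HB \<rho>" for V
  unfolding G'_def using TT(2) siegel_Sym[OF FP(4)[OF mapG[OF that]]] by simp
 have pre: "prepair F' G' \<rho>"
  unfolding prepair_def
 proof (intro conjI hF hG ballI impI)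
  show "F' ` HB \<rho> \<subseteq> siegel" using mapF FP Ts by (auto simp: F'_def)
  show "G' ` HB \<rho> \<subseteq> siegel" using mapG FP Ts by (auto simp: G'_def)
  show "G' (F' V) = V" if V: "V \<in> HB \<rho>" "F' V \<in> HB \<rho>" for V
  proof -
   have "G' (F' V) = T (G (F (tri a b c V + rem Z)))" by (simp add: G'_def FF'[OF V(1)])
   also have "\<dots> = T (tri a b c V + rem Z)"
    using FP(5)[OF mapF[OF V(1)]] mapG[OF V(2)] FF'[OF V(1)] by simp
   finally show ?thesis using TT(1) HB_Sym[OF V(1)] by simp
  qed
  show "F' (G' V) = V" if V: "V \<in> HB \<rho>" "G' V \<in> HB \<rho>" for V
  proof -
   have "F' (G' V) = T' (F (G (tri a' b' c' V + rem (F Z))))" by (simp add: F'_def GG'[OF V(1)])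
   also have "\<dots> = T' (tri a' b' c' V + rem (F Z))"
    using FP(6)[OF mapG[OF V(1)]] mapF[OF V(2)] GG'[OF V(1)] by simp
   finally show ?thesis using TT(3) HB_Sym[OF V(1)] by simp
  qed
 qed
 have iiZ: "tri a b c ii + rem Z = Z" "tri a' b' c' ii + rem (F Z) = F Z"
  using rem_imm HB_Sym[OF Z] HB_Sym[OF W] by (simp_all add: tri_linear a a')
 have "F' ii = ii" unfolding F'_def iiZ(1) using TT(3)[of ii] iiZ(2) by simp
 then have pr: "pair F' G' \<rho>" using pre \<rho> by (simp add: pair_def)
 have d: "tri a' b' c' (dF F' V ii) = dF F (tri a b c V) Z" if V: "V \<in> Sym" for V
 proof -
  have i: "ii \<in> HB \<rho>" using ii_HB \<rho> by simp
  have "dF F' V ii = tri (1/a') (- (b' / (a' * c'))) (1/c') (dF (%V. F (tri a b c V + rem Z)) V ii)"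
   unfolding F'_def T'_def
   by (subst dF_comp[OF hF1 hol_tri(2)[OF open_Sym_siegel] _ i V])
    (auto simp: realm_Sym FP mapF dF_tri hol_dF_Sym[OF hF1 i V])
  also have "dF (%V. F (tri a b c V + rem Z)) V ii = dF F (tri a b c V) Z"
   by (subst dF_comp[OF hol_tri(1)[OF open_Sym_HB realm_Sym[OF rem_realm]] FP(1) mapF i V])
    (auto simp: iiZ dF_tri V)
  finally have "dF F' V ii = tri (1/a') (- (b' / (a' * c'))) (1/c') (dF F (tri a b c V) Z)" .
  moreover have "Z \<in> HB R" using mapF[OF i] iiZ by simp
  ultimately show ?thesis using tri_inv(2)[OF ne(3,4)] hol_dF_Sym[OF FP(1)] by simp
 qed
 show thesis by (rule that[OF a(1,2) a'(1,2) a(3) a'(3) pr d mapF FF'])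
qed

subsection \<open>Near isometry\<close>

text \<open>The Schwarz lemma on the disc \<open>\<omega> \<mapsto> C (\<omega> X)\<close>, of which only the part \<open>\<bar>\<omega>\<bar> < \<sigma>\<close> is known to lie in the domain.\<close>

lemma cay_lift:
 assumes P: "pair F G \<rho>" and X: "X \<in> Sym" "opb 1 X" and \<sigma>: "0 < \<sigma>" "\<sigma> < 1" "24 / (1 - \<sigma>)\<^sup>2 < \<rho>"
 defines "z \<equiv> %\<omega>. C_inv (F (C_map (cscale \<omega> X)))"
 shows "!!i j. (%\<omega>. z \<omega> $ i $ j) holomorphic_on ball 0 \<sigma>"
  "!!\<omega>. cmod \<omega> < \<sigma> ==> z \<omega> \<in> udisc" "z 0 = 0"
  "!!i j. ((%\<omega>. z \<omega> $ i $ j) has_field_derivative dF F X ii $ i $ j) (at 0)"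
  "!!\<omega>. cmod \<omega> < \<sigma> ==> cscale \<omega> X \<in> udisc & C_map (cscale \<omega> X) \<in> HB \<rho>"
proof -
 define S where "S = udisc \<inter> C_map -` HB \<rho>"
 have sub: "udisc \<subseteq> {z \<in> Sym. den z ~= 0}" using udisc_Sym udisc_den by auto
 have hC: "hol C_map udisc" by (rule hol_subset[OF hol_C_map sub open_Sym_udisc])
 have FP: "hol F (HB \<rho>)" "!!V. V \<in> HB \<rho> ==> F V \<in> siegel" "F ii = ii" "\<rho> > 2"
  using P by (auto simp: pair_def prepair_def)
 have "openin (top_of_set udisc) S" unfolding S_def
  by (rule continuous_openin_preimage[OF hol_continuous[OF hC] _ open_Sym_HB])
   (use hol_in_Sym[OF hC] in auto)
 then have So: "open_Sym S" using open_Sym_udisc openin_trans by blast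
 have in_S: "cscale \<omega> X \<in> S" if "cmod \<omega> < \<sigma>" for \<omega>
 proof -
  have ob: "opb (cmod \<omega>) (cscale \<omega> X)" using opb_cscale[OF X(2), of \<omega>] by simp
  have ud: "cscale \<omega> X \<in> udisc"
   unfolding udisc_def
  proof (intro CollectI conjI allI impI)
   fix v :: "complex^2" assume "v ~= 0"
   then have "cmod \<omega> * norm v < norm v" using that \<sigma> by simp
   then show "norm (cscale \<omega> X *v v) < norm v" using ob unfolding opb_def by (meson le_less_trans)
  qed (use X in auto)
  have "norm (C_map (cscale \<omega> X)) = norm (cay (cscale \<omega> X))" by (simp add: C_map_def norm_cscale)
  also have "\<dots> <= 24 / (1 - \<sigma>)\<^sup>2"
   by (rule cay_bound) (use X \<sigma> that opb_mono[OF ob, of \<sigma>] in auto)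
  finally have "C_map (cscale \<omega> X) \<in> HB \<rho>" using C_map_siegel[OF ud] \<sigma> by (simp add: HB_def)
  then show ?thesis using ud by (simp add: S_def)
 qed
 then show "!!\<omega>. cmod \<omega> < \<sigma> ==> cscale \<omega> X \<in> udisc & C_map (cscale \<omega> X) \<in> HB \<rho>" by (auto simp: S_def)
 have hC': "hol C_map S" by (rule hol_subset[OF hC _ So]) (auto simp: S_def)
 have h1: "hol (%z. F (C_map z)) S" by (rule hol_comp[OF hC' FP(1)]) (auto simp: S_def)
 define H where "H = (%z. C_inv (F (C_map z)))"
 have H: "hol H S" unfolding H_def
  by (rule hol_comp[OF h1 hol_C_inv]) (use FP siegel_den siegel_Sym in \<open>auto simp: S_def\<close>)
 have zH: "z \<omega> = H (0 + cscale \<omega> X)" for \<omega> by (simp add: z_def H_def)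
 show "(%\<omega>. z \<omega> $ i $ j) holomorphic_on ball 0 \<sigma>" for i j
  unfolding zH by (rule gholo_line[OF hol_gholo[OF H] _ X(1)]) (use in_S in auto)
 show "z \<omega> \<in> udisc" if "cmod \<omega> < \<sigma>" for \<omega>
  unfolding z_def using in_S[OF that] FP by (auto simp: S_def intro: C_inv_udisc)
 have C0: "C_map 0 = ii" by (simp add: C_map_def)
 have z0: "0 \<in> S" using in_S[of 0] \<sigma> by simp
 show "z 0 = 0" by (simp add: z_def C0 FP C_inv_def)
 \<comment> \<open>The factor \<open>-2 * \<i>\<close> here and the factor \<open>\<i>/2\<close> for
   \<open>C_inv\<close> below multiply to 1, so the lifted disc has at 0 the derivative that
   \<open>F\<close> has at \<open>ii\<close>.\<close>
 have CX: "dF C_map X 0 = cscale (-2 * \<i>) X"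
  unfolding C_map_def[abs_def]
  by (subst dF_comp[OF hol_cay hol_cscale[of Sym] _ _ X(1)]) (auto simp: cay_Sym dF_linear_cscale dF_cay_0 X mult.commute)
 have iB: "ii \<in> HB \<rho>" using FP ii_HB by simp
 have CI: "dF C_inv Y ii = cscale (\<i>/2) Y" if "Y \<in> Sym" for Y
  unfolding C_inv_def[abs_def]
  by (subst dF_comp[OF hol_cscale[OF open_Sym_C_inv] hol_cay _ _ that])
   (auto simp: dF_linear_cscale dF_cay_1 that siegel_den ii_siegel siegel_den[OF ii_siegel, simplified])
 have "dF H X 0 = dF C_inv (dF (%z. F (C_map z)) X 0) (F (C_map 0))"
  unfolding H_def by (rule dF_comp[OF h1 hol_C_inv _ z0 X(1)])
   (use FP siegel_den siegel_Sym in \<open>auto simp: S_def\<close>)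
 also have "dF (%z. F (C_map z)) X 0 = dF F (dF C_map X 0) (C_map 0)"
  by (rule dF_comp[OF hC' FP(1) _ z0 X(1)]) (auto simp: S_def)
 finally have "dF H X 0 = cscale (\<i>/2) (dF F (cscale (-2 * \<i>) X) ii)"
  using hol_dF_Sym[OF FP(1) iB, of "cscale (-2 * \<i>) X"] X by (simp add: C0 CX FP CI)
 then have dH: "dF H X 0 = dF F X ii"
  by (simp only: dF_cscale[OF FP(1) iB X(1)]) simp
 show "((%\<omega>. z \<omega> $ i $ j) has_field_derivative dF F X ii $ i $ j) (at 0)" for i j
  unfolding zH dH[symmetric] by (rule hol_line_deriv[OF H z0 X(1)])
qed

lemma hin_deriv:
 fixes z :: "complex => mat2"
 assumes "!!i j. ((%\<omega>. z \<omega> $ i $ j) has_field_derivative D $ i $ j) (at s)"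
 shows "((%\<omega>. hin u (z \<omega> *v v)) has_field_derivative hin u (D *v v)) (at s)"
 unfolding hin_def mat2_vec_nth
 by (auto intro!: derivative_eq_intros assms simp: algebra_simps)

lemma hin_holomorphic:
 fixes z :: "complex => mat2"
 assumes "!!i j. (%\<omega>. z \<omega> $ i $ j) holomorphic_on S"
 shows "(%\<omega>. hin u (z \<omega> *v v)) holomorphic_on S"
 unfolding hin_def mat2_vec_nth by (intro holomorphic_intros assms)

text \<open>Schwarz's lemma for the scalar function that pairs the lifted disc, applied to
  \<open>v\<close>, with the fixed vector \<open>dF F X ii *v v\<close>. The loss
  \<open>1/\<sigma>\<close> arises because the disc is available only up to radius \<sigma>.\<close>

lemma near_contraction:
 assumes P: "pair F G \<rho>" and X: "X \<in> Sym" "opb 1 X" and \<sigma>: "0 < \<sigma>" "\<sigma> < 1" "24 / (1 - \<sigma>)\<^sup>2 < \<rho>"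
 shows "opb (1/\<sigma>) (dF F X ii)"
 unfolding opb_def
proof
 fix v :: "complex^2"
 define z where "z \<omega> = C_inv (F (C_map (cscale \<omega> X)))" for \<omega>
 note z = cay_lift[OF P X \<sigma>, folded z_def]
 let ?u = "dF F X ii *v v"
 show "norm ?u <= 1/\<sigma> * norm v"
 proof (cases "v = 0 \<or> ?u = 0")
  case True
  then show ?thesis using \<sigma> by (auto simp: vec2_eq_iff norm_vec2)
 next
  case False
  then have uv: "norm ?u > 0" "norm v > 0" by auto
  define g where "g \<omega> = hin ?u (z (of_real \<sigma> * \<omega>) *v v) / of_real (norm ?u * norm v)" for \<omega>
  have hz: "(%\<omega>. z (of_real \<sigma> * \<omega>) $ i $ j) holomorphic_on ball 0 1" for i j
  proof -
   have "((%\<omega>. z \<omega> $ i $ j) \<circ> (%\<omega>. of_real \<sigma> * \<omega>)) holomorphic_on ball 0 1"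
    by (rule holomorphic_on_compose_gen[OF _ z(1)]) (use \<sigma> in \<open>auto intro!: holomorphic_intros simp: norm_mult\<close>)
   then show ?thesis by (simp add: o_def)
  qed
  have "g holomorphic_on ball 0 1" unfolding g_def
   by (intro holomorphic_intros hin_holomorphic hz) (use uv in auto)
  moreover have "g 0 = 0" by (simp add: g_def z hin_def)
  moreover have "cmod (g \<omega>) < 1" if "cmod \<omega> < 1" for \<omega>
  proof -
   have "z (of_real \<sigma> * \<omega>) \<in> udisc" using z(2) that \<sigma> by (simp add: norm_mult)
   then have "norm (z (of_real \<sigma> * \<omega>) *v v) < norm v" using uv by (simp add: udisc_def)
   then have "cmod (hin ?u (z (of_real \<sigma> * \<omega>) *v v)) < norm ?u * norm v"
    using hin_bound[of ?u "z (of_real \<sigma> * \<omega>) *v v"] uv by (meson le_less_trans mult_strict_left_mono)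
   then show ?thesis using uv by (simp add: g_def norm_divide norm_mult divide_simps)
  qed
  ultimately have "cmod (deriv g 0) <= 1" using Schwarz_Lemma(2)[of g 0] by simp
  moreover have "(g has_field_derivative of_real \<sigma> * hin ?u ?u / of_real (norm ?u * norm v)) (at 0)"
  proof -
   have "((%\<omega>. hin ?u (z \<omega> *v v)) has_field_derivative hin ?u ?u) (at (of_real \<sigma> * 0))"
    using hin_deriv[OF z(4)] by simp
   then have "((%\<omega>. hin ?u (z (of_real \<sigma> * \<omega>) *v v)) has_field_derivative hin ?u ?u * of_real \<sigma>) (at 0)"
    by (rule DERIV_chain2) (auto intro!: derivative_eq_intros)
   from DERIV_cdivide[OF this, of "of_real (norm ?u * norm v)"]
   show ?thesis by (simp only: g_def[abs_def] mult.commute)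
  qed
  ultimately have "cmod (of_real \<sigma> * hin ?u ?u / of_real (norm ?u * norm v)) <= 1"
   using DERIV_imp_deriv by metis
  then have "\<sigma> * (norm ?u * norm ?u) <= norm ?u * norm v"
   using uv \<sigma> by (simp add: hin_self norm_divide norm_mult power2_eq_square divide_simps)
  then have "norm ?u * (\<sigma> * norm ?u) <= norm ?u * norm v" by (simp add: mult_ac)
  then have "\<sigma> * norm ?u <= norm v" using uv(1) by (rule mult_left_le_imp_le)
  then show ?thesis using \<sigma> by (simp add: field_simps)
 qed
qed

lemma pair_inverse:
 assumes P: "pair F G \<rho>" and X: "X \<in> Sym"
 shows "dF G (dF F X ii) ii = X"
proof -
 have FP: "hol F (HB \<rho>)" "!!V. V \<in> HB \<rho> ==> F V \<in> siegel" "F ii = ii" "\<rho> > 2" "hol G (HB \<rho>)"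
  "!!V. V \<in> HB \<rho> ==> F V \<in> HB \<rho> ==> G (F V) = V"
  using P by (auto simp: pair_def prepair_def)
 have iB: "ii \<in> HB \<rho>" using FP ii_HB by simp
 define S where "S = HB \<rho> \<inter> F -` HB \<rho>"
 have "openin (top_of_set (HB \<rho>)) S" unfolding S_def
  by (rule continuous_openin_preimage[OF hol_continuous[OF FP(1)] _ open_Sym_HB])
   (use hol_in_Sym[OF FP(1)] in auto)
 then have So: "open_Sym S" using open_Sym_HB openin_trans by blast
 have hS: "hol F S" by (rule hol_subset[OF FP(1) _ So]) (auto simp: S_def)
 have iS: "ii \<in> S" using iB FP by (simp add: S_def)
 have "dF (%V. G (F V)) X ii = dF G (dF F X ii) (F ii)"
  by (rule dF_comp[OF hS FP(5) _ iS X]) (simp add: S_def)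
 moreover have "dF (%V. G (F V)) X ii = X"
 proof -
  have "ddir (%V. G (F V) $ i $ j) X ii = ddir (%V. V $ i $ j) X ii" for i j
   by (rule ddir_cong[OF So iS X]) (simp add: S_def FP)
  moreover have "ddir (%V. V $ i $ j) X ii = X $ i $ j" for i j
   unfolding ddir_def by (rule DERIV_imp_deriv) (auto intro!: derivative_eq_intros)
  ultimately show ?thesis by (simp add: mat2_eq_iff)
 qed
 ultimately show ?thesis by (simp add: FP)
qed

subsection \<open>Linear near isometries of the operator norm\<close>

text \<open>The matrix \<open>v v^T\<close>; over the complex numbers these are exactly the singular
  symmetric matrices.\<close>

definition nl :: "complex^2 => mat2"
 where "nl v = symat ((v$1)\<^sup>2) (v$1 * v$2) ((v$2)\<^sup>2)"

lemma nl_Sym [simp, intro]: "nl v \<in> Sym"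
 by (simp add: nl_def)

lemma nl_scale: "nl (c *s v) = cscale (c\<^sup>2) (nl v)"
 by (simp add: nl_def mat2_eq_iff power2_eq_square)

lemma dt_cscale: "dt (cscale c X) = c\<^sup>2 * dt X"
 by (simp add: power2_eq_square algebra_simps)

lemma nl_vec: "nl v *v x = (v$1 * x$1 + v$2 * x$2) *s v"
 by (simp add: nl_def vec2_eq_iff power2_eq_square algebra_simps)

lemma norm_orth_add:
 assumes "hin u v = 0" shows "(norm (a *s u + b *s v))\<^sup>2 = (cmod a)\<^sup>2 * (norm u)\<^sup>2 + (cmod b)\<^sup>2 * (norm v)\<^sup>2"
 using assms by (simp add: norm_add_sq norm_smult_vec2 power_mult_distrib hin_scale)

text \<open>The vectors \<open>v\<close> and \<open>v'\<close> are orthonormal, so the matrix has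
  singular values 1 and \<open>cmod t\<close>. The unit sphere of the operator norm thus contains
  complex discs in the direction \<open>nl v\<close>.\<close>

lemma opb_null_pair:
 assumes v: "norm v = 1" and t: "cmod t <= 1"
 defines "v' \<equiv> cvec (- cnj (v$2)) (cnj (v$1))"
 shows "opb 1 (nl v' + cscale t (nl v))"
 unfolding opb_def
proof
 fix x :: "complex^2"
 have n: "(cmod (v$1))\<^sup>2 + (cmod (v$2))\<^sup>2 = 1" using v norm_vec2_sq[of v] by simp
 have o: "hin v' v = 0" by (simp add: hin_def v'_def mult.commute)
 have nv': "norm v' = 1" using n by (simp add: v'_def norm_vec2 add.commute)
 let ?p = "v'$1 * x$1 + v'$2 * x$2" and ?q = "v$1 * x$1 + v$2 * x$2"
 have "(nl v' + cscale t (nl v)) *v x = ?p *s v' + (t * ?q) *s v"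
  by (simp only: mat2_vec_lin nl_vec) (simp add: vec2_eq_iff algebra_simps)
 then have "(norm ((nl v' + cscale t (nl v)) *v x))\<^sup>2 = (cmod ?p)\<^sup>2 + (cmod t)\<^sup>2 * (cmod ?q)\<^sup>2"
  using norm_orth_add[OF o, of ?p "t * ?q"] v nv' by (simp add: norm_mult power_mult_distrib)
 also have "\<dots> <= (cmod ?p)\<^sup>2 + 1 * (cmod ?q)\<^sup>2"
  using t by (intro add_left_mono mult_right_mono) (auto simp: power_le_one)
 also have "\<dots> = ((cmod (v$1))\<^sup>2 + (cmod (v$2))\<^sup>2) * (norm x)\<^sup>2"
  unfolding norm_vec2_sq v'_def cvec_nth cmod_power2 by (simp add: power2_eq_square algebra_simps)
 finally show "norm ((nl v' + cscale t (nl v)) *v x) <= 1 * norm x"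
  using n power2_le_imp_le[of "norm ((nl v' + cscale t (nl v)) *v x)" "norm x"] by simp
qed

definition near_iso :: "real => (mat2 => mat2) => (mat2 => mat2) => bool"
 where "near_iso m A B \<longleftrightarrow>
  (\<forall>X\<in>Sym. \<forall>Y\<in>Sym. A (X + Y) = A X + A Y) & (\<forall>c. \<forall>X\<in>Sym. A (cscale c X) = cscale c (A X)) &
  (\<forall>c. \<forall>X\<in>Sym. B (cscale c X) = cscale c (B X)) &
  (\<forall>X\<in>Sym. A X \<in> Sym & B X \<in> Sym & B (A X) = X & A (B X) = X) &
  (\<forall>X\<in>Sym. opb 1 X --> opb m (A X) & opb m (B X))"

text \<open>The defect that the parallelogram law leaves in \<open>near_iso_null\<close>; it tends
  to 0 as \<open>m\<close> decreases to 1.\<close>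

definition e1 :: "real => real" where "e1 m = m * sqrt (m\<^sup>2 - 1 / m ^ 4)"

lemma opb_scaled:
 assumes A: "!!X. X \<in> Sym ==> opb 1 X ==> opb m (A X)" "!!c X. X \<in> Sym ==> A (cscale c X) = cscale c (A X)"
  and X: "X \<in> Sym" "opb k X" "k > 0"
 shows "opb (m * k) (A X)"
proof -
 have "opb 1 (cscale (of_real (1/k)) X)"
  using opb_cscale[OF X(2), of "of_real (1/k)"] X(3) by (simp add: norm_divide)
 then have "opb m (A (cscale (of_real (1/k)) X))" by (rule A(1)[rotated]) (use X in simp)
 then have "opb m (cscale (of_real (1/k)) (A X))" by (simp only: A(2)[OF X(1)])
 from opb_cscale[OF this, of "of_real k"] show ?thesis using X(3) by (simp add: mult.commute)
qed

text \<open>A near isometry must almost respect the discs of \<open>opb_null_pair\<close>. At a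
  vector \<open>x\<close> that \<open>A (nl v')\<close> hardly shortens, neither adding nor
  subtracting \<open>A (nl v)\<close> may lengthen the image much; by the parallelogram law
  \<open>A (nl v)\<close> is small at \<open>x\<close>, and \<open>dt_le\<close> turns this into a
  small determinant.\<close>

lemma near_iso_null:
 assumes I: "near_iso m A B" and m: "1 < m"
 shows "cmod (dt (A (nl v))) <= e1 m * (norm v) ^ 4"
proof -
 have A: "!!X Y. X \<in> Sym ==> Y \<in> Sym ==> A (X + Y) = A X + A Y"
  "!!c X. X \<in> Sym ==> A (cscale c X) = cscale c (A X)" "!!c X. X \<in> Sym ==> B (cscale c X) = cscale c (B X)"
  "!!X. X \<in> Sym ==> A X \<in> Sym" "!!X. X \<in> Sym ==> B (A X) = X"
  "!!X. X \<in> Sym ==> opb 1 X ==> opb m (A X)" "!!X. X \<in> Sym ==> opb 1 X ==> opb m (B X)"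
  using I unfolding near_iso_def by blast+
 have unit: "cmod (dt (A (nl v))) <= e1 m" if v: "norm v = 1" for v
 proof -
  define v' where "v' = cvec (- cnj (v$2)) (cnj (v$1))"
  have n: "(cmod (v$1))\<^sup>2 + (cmod (v$2))\<^sup>2 = 1" using v norm_vec2_sq[of v] by simp
  \<comment> \<open>Otherwise \<open>B\<close> would carry \<open>A (nl v')\<close> back to a matrix
    of norm at most \<open>1/m\<close>; but \<open>nl v'\<close> sends the conjugate of
    \<open>v'\<close> to \<open>v'\<close>, so its norm is at least 1.\<close>
  obtain x where x: "norm (A (nl v') *v x) > 1 / m\<^sup>2 * norm x"
  proof (rule ccontr)
   assume "\<not> thesis"
   then have "opb (1 / m\<^sup>2) (A (nl v'))" using that unfolding opb_def by (meson not_le)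
   then have "opb (m * (1 / m\<^sup>2)) (B (A (nl v')))"
    by (intro opb_scaled[OF A(7,3)]) (use A m in auto)
   then have ob: "opb (1/m) (nl v')" using A(5) m by (simp add: power2_eq_square)
   let ?y = "cvec (- v$2) (v$1)"
   have "v'$1 * ?y$1 + v'$2 * ?y$2 = of_real ((cmod (v$1))\<^sup>2 + (cmod (v$2))\<^sup>2)"
    unfolding of_real_add complex_norm_square by (simp add: v'_def mult.commute)
   then have "nl v' *v ?y = v'" unfolding nl_vec n by simp
   moreover have "norm v' = 1" "norm ?y = 1" using n by (simp_all add: v'_def norm_vec2 add.commute)
   ultimately have "1 <= 1 / m" using ob unfolding opb_def by (metis mult.right_neutral)
   then show False using m by simp
  qed
  let ?a = "A (nl v') *v x" and ?b = "A (nl v) *v x"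
  have p: "norm (?a + t *s ?b) <= m * norm x" if "cmod t <= 1" for t
  proof -
   have "opb m (A (nl v' + cscale t (nl v)))"
    using A(6) opb_null_pair[OF v that, folded v'_def] by auto
   then show ?thesis unfolding opb_def by (simp add: A mat2_vec_lin)
  qed
  have "(norm (?a + ?b))\<^sup>2 <= (m * norm x)\<^sup>2" "(norm (?a - ?b))\<^sup>2 <= (m * norm x)\<^sup>2"
   using p[of 1] p[of "-1"] by (auto intro!: power_mono)
  then have "(norm ?a)\<^sup>2 + (norm ?b)\<^sup>2 <= m\<^sup>2 * (norm x)\<^sup>2"
   unfolding norm_add_sq norm_diff_sq power_mult_distrib by linarith
  moreover have "(1 / m\<^sup>2 * norm x)\<^sup>2 <= (norm ?a)\<^sup>2" using x by (intro power_mono) auto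
  ultimately have "(norm ?b)\<^sup>2 <= (m\<^sup>2 - 1 / m ^ 4) * (norm x)\<^sup>2"
   by (simp add: power_mult_distrib power_divide left_diff_distrib)
  then have nb: "norm ?b <= sqrt (m\<^sup>2 - 1 / m ^ 4) * norm x"
   using real_le_rsqrt[of "norm ?b" "(m\<^sup>2 - 1 / m ^ 4) * (norm x)\<^sup>2"] by (simp add: real_sqrt_mult)
  have "cmod (dt (A (nl v))) * norm x <= m * norm ?b"
  proof (rule dt_le)
   have "opb 1 (nl v)"
    unfolding opb_def
   proof
    fix x :: "complex^2"
    have "norm (nl v *v x) = cmod (hin (cvec (cnj (v$1)) (cnj (v$2))) x)"
     by (simp only: nl_vec norm_smult_vec2 v hin_def) simp
    also have "\<dots> <= norm (cvec (cnj (v$1)) (cnj (v$2))) * norm x" by (rule hin_bound)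
    finally show "norm (nl v *v x) <= 1 * norm x" using v by (simp add: norm_vec2)
   qed
   then show "opb m (A (nl v))" by (rule A(6)[OF nl_Sym])
  qed (rule A(4)[OF nl_Sym])
  also have "\<dots> <= m * (sqrt (m\<^sup>2 - 1 / m ^ 4) * norm x)"
   by (rule mult_left_mono[OF nb]) (use m in simp)
  finally have "cmod (dt (A (nl v))) * norm x <= e1 m * norm x"
   by (simp add: e1_def mult.assoc)
  moreover have "norm x > 0"
  proof -
   have "x ~= 0" using x by auto
   then show ?thesis by simp
  qed
  ultimately show ?thesis by simp
 qed
 show ?thesis
 proof (cases "v = 0")
  case True
  then have "nl v = 0" by (simp add: nl_def mat2_eq_iff)
  moreover have "A 0 = 0" using A(2)[of 0 0] by simp
  ultimately show ?thesis using True by simp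
 next
  case False
  define u where "u = of_real (1 / norm v) *s v"
  have u: "norm u = 1" "v = of_real (norm v) *s u" using False by (auto simp: u_def norm_smult_vec2 vec2_eq_iff norm_divide)
  have "nl v = cscale (of_real (norm v ^ 2)) (nl u)"
   by (subst u(2)) (simp add: nl_scale)
  then have "dt (A (nl v)) = of_real (norm v ^ 4) * dt (A (nl u))"
   by (simp add: A dt_cscale[simplified] flip: power_mult)
  then have "cmod (dt (A (nl v))) = norm v ^ 4 * cmod (dt (A (nl u)))" by (simp add: norm_mult norm_power)
  also have "\<dots> <= norm v ^ 4 * e1 m" by (intro mult_left_mono unit u) auto
  finally show ?thesis by (simp add: mult.commute)
 qed
qed

lemma mat1_symat: "symat 1 0 1 = mat 1"
 by (simp add: mat2_eq_iff)

text \<open>The determinant after \<open>A\<close> is a quadratic form that is small on all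
  \<open>nl v\<close>, so it is almost the multiple \<open>m13\<close> of the determinant itself.
  Evaluating it at a matrix with image \<open>mat 1\<close>, whose determinant is at most
  \<open>m^2\<close>, bounds \<open>m13\<close> from below.\<close>

lemma near_iso_dt_one:
 assumes I: "near_iso m A B" and m: "1 < m"
 shows "(1 - 16 * m\<^sup>2 * e1 m) / m\<^sup>2 - 2 * e1 m <= cmod (dt (A (mat 1)))"
proof -
 have A: "!!X Y. X \<in> Sym ==> Y \<in> Sym ==> A (X + Y) = A X + A Y"
  "!!c X. X \<in> Sym ==> A (cscale c X) = cscale c (A X)"
  "!!X. X \<in> Sym ==> A X \<in> Sym" "!!X. X \<in> Sym ==> A (B X) = X" "!!X. X \<in> Sym ==> B X \<in> Sym"
  "!!X. X \<in> Sym ==> opb 1 X ==> opb m (B X)"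
  using I unfolding near_iso_def by blast+
 define e where "e = e1 m"
 have m4: "1 / m ^ 4 <= m\<^sup>2"
 proof -
  have "1 / m ^ 4 <= 1" using m by (simp add: one_le_power)
  moreover have "1 <= m\<^sup>2" using m by (simp add: one_le_power)
  ultimately show ?thesis by simp
 qed
 have e0: "0 <= e" using m m4 by (simp add: e_def e1_def)
 define A1 A2 A3 where "A1 = A (symat 1 0 0)" and "A2 = A (symat 0 1 0)" and "A3 = A (symat 0 0 1)"
 have AX: "A (symat a b c) = cscale a A1 + cscale b A2 + cscale c A3" for a b c
 proof -
  have "symat a b c = cscale a (symat 1 0 0) + cscale b (symat 0 1 0) + cscale c (symat 0 0 1)"
   by (simp add: mat2_eq_iff)
  then show ?thesis by (simp add: A A1_def A2_def A3_def)
 qed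
 have S: "A1$2$1 = A1$1$2" "A2$2$1 = A2$1$2" "A3$2$1 = A3$1$2"
  using A(3) by (auto simp: A1_def A2_def A3_def Sym_iff[symmetric])
 define m12 where "m12 = A1$1$1 * A2$2$2 + A2$1$1 * A1$2$2 - 2 * A1$1$2 * A2$1$2"
 define m13 where "m13 = A1$1$1 * A3$2$2 + A3$1$1 * A1$2$2 - 2 * A1$1$2 * A3$1$2"
 define m23 where "m23 = A2$1$1 * A3$2$2 + A3$1$1 * A2$2$2 - 2 * A2$1$2 * A3$1$2"
 define d1 d2 d3 where "d1 = dt A1" and "d2 = dt A2" and "d3 = dt A3"
 have dtA: "dt (A (symat a b c)) = a\<^sup>2 * d1 + b\<^sup>2 * d2 + c\<^sup>2 * d3 + a * b * m12 + a * c * m13 + b * c * m23" for a b c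
  unfolding AX d1_def d2_def d3_def m12_def m13_def m23_def
  by (simp add: S power2_eq_square algebra_simps)
 have nlb: "cmod (dt (A (nl v))) <= e * norm v ^ 4" for v unfolding e_def by (rule near_iso_null[OF I m])
 have b1: "cmod d1 <= e" using nlb[of "cvec 1 0"] dtA[of 1 0 0] by (simp add: nl_def norm_vec2)
 have b3: "cmod d3 <= e" using nlb[of "cvec 0 1"] dtA[of 0 0 1] by (simp add: nl_def norm_vec2)
 \<comment> \<open>On \<open>nl (cvec 1 t)\<close> the form is a polynomial of degree 4 in
   \<open>t\<close>; the factor 4 is the fourth power of the norm of \<open>cvec 1 t\<close>. Its
   values at the four fourth roots of unity isolate the coefficients.\<close>
 have bt: "cmod (d1 + t * m12 + t\<^sup>2 * (d2 + m13) + t ^ 3 * m23 + t ^ 4 * d3) <= 4 * e" if "cmod t = 1" for t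
 proof -
  have "norm (cvec 1 t) ^ 4 = ((norm (cvec 1 t))\<^sup>2)\<^sup>2" by (simp flip: power_mult)
  then have "norm (cvec 1 t) ^ 4 = 4" using that by (simp add: norm_vec2_sq)
  then have "cmod (dt (A (symat 1 t (t\<^sup>2)))) <= 4 * e" using nlb[of "cvec 1 t"] by (simp add: nl_def mult.commute)
  then show ?thesis unfolding dtA by (simp add: algebra_simps power2_eq_square power3_eq_cube power4_eq_xxxx)
 qed
 define P1 P2 P3 P4 where
  "P1 = d1 + m12 + (d2 + m13) + m23 + d3" and "P2 = d1 - m12 + (d2 + m13) - m23 + d3"
  and "P3 = d1 + \<i> * m12 - (d2 + m13) - \<i> * m23 + d3" and "P4 = d1 - \<i> * m12 - (d2 + m13) + \<i> * m23 + d3"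
 have P: "cmod P1 <= 4 * e" "cmod P2 <= 4 * e" "cmod P3 <= 4 * e" "cmod P4 <= 4 * e"
  using bt[of 1] bt[of "-1"] bt[of \<i>] bt[of "-\<i>"]
  by (simp_all add: P1_def P2_def P3_def P4_def power3_eq_cube power4_eq_xxxx power2_eq_square algebra_simps)
 have c2: "cmod (d2 + m13) <= 6 * e"
 proof -
  have "2 * (d2 + m13) = (P1 + P2) - 2 * d1 - 2 * d3" by (simp add: P1_def P2_def)
  then have "cmod (2 * (d2 + m13)) <= (cmod P1 + cmod P2) + cmod (2 * d1) + cmod (2 * d3)"
   using norm_triangle_ineq4[of "P1 + P2 - 2 * d1" "2 * d3"] norm_triangle_ineq4[of "P1 + P2" "2 * d1"]
    norm_triangle_ineq[of P1 P2] by simp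
  then show ?thesis using P b1 b3 unfolding norm_mult norm_numeral by linarith
 qed
 have c12: "cmod m12 <= 4 * e"
 proof -
  have "4 * m12 = (P1 - P2) - \<i> * (P3 - P4)" by (simp add: P1_def P2_def P3_def P4_def algebra_simps)
  then have "cmod (4 * m12) <= (cmod P1 + cmod P2) + (cmod P3 + cmod P4)"
   using norm_triangle_ineq4[of "P1 - P2" "\<i> * (P3 - P4)"] norm_triangle_ineq4[of P1 P2] norm_triangle_ineq4[of P3 P4]
   by (simp add: norm_mult)
  then show ?thesis using P by (simp add: norm_mult)
 qed
 have c23: "cmod m23 <= 4 * e"
 proof -
  have "4 * m23 = (P1 - P2) + \<i> * (P3 - P4)" by (simp add: P1_def P2_def P3_def P4_def algebra_simps)
  then have "cmod (4 * m23) <= (cmod P1 + cmod P2) + (cmod P3 + cmod P4)"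
   using norm_triangle_ineq[of "P1 - P2" "\<i> * (P3 - P4)"] norm_triangle_ineq4[of P1 P2] norm_triangle_ineq4[of P3 P4]
   by (simp add: norm_mult)
  then show ?thesis using P by (simp add: norm_mult)
 qed
 define X where "X = B (mat 1)"
 have X: "X \<in> Sym" "A X = mat 1" using A by (auto simp: X_def)
 have oX: "opb m X" unfolding X_def by (rule A(6)) (auto simp: opb_def)
 define a b c where "a = X$1$1" and "b = X$1$2" and "c = X$2$2"
 have Xe: "X = symat a b c" using Sym_eq_symat[OF X(1)] by (simp add: a_def b_def c_def)
 have abc: "cmod a <= m" "cmod b <= m" "cmod c <= m" using opb_nth[OF oX] by (auto simp: a_def b_def c_def)
 have dX: "cmod (a * c - b\<^sup>2) <= m\<^sup>2"
  using opb_dt[OF X(1) oX] m by (simp add: Xe power2_eq_square)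
 \<comment> \<open>Splitting off the multiple of the determinant leaves only small coefficients;
   their bounds 1, 6, 1, 4 and 4 add up to 16.\<close>
 have "1 - m13 * (a * c - b\<^sup>2) = a\<^sup>2 * d1 + b\<^sup>2 * (d2 + m13) + c\<^sup>2 * d3 + a * b * m12 + b * c * m23"
 proof -
  have "dt (A (symat a b c)) = 1" using X(2) by (simp add: Xe)
  then show ?thesis unfolding dtA by (simp add: algebra_simps)
 qed
 also have "cmod \<dots> <= m\<^sup>2 * e + m\<^sup>2 * (6 * e) + m\<^sup>2 * e + m\<^sup>2 * (4 * e) + m\<^sup>2 * (4 * e)"
 proof -
  have q: "cmod (p * q) <= m\<^sup>2" if "cmod p <= m" "cmod q <= m" for p q :: complex
   using mult_mono[OF that] m by (simp add: norm_mult power2_eq_square)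
  have r: "cmod (p * q) <= m\<^sup>2 * k" if "cmod p <= m\<^sup>2" "cmod q <= k" for p q k
   using mult_mono[OF that] m by (simp add: norm_mult)
  show ?thesis
   by (intro norm_triangle_mono r b1 c2 b3 c12 c23) (use q abc in \<open>auto simp: power2_eq_square\<close>)
 qed
 finally have "cmod (1 - m13 * (a * c - b\<^sup>2)) <= 16 * m\<^sup>2 * e" by (simp add: algebra_simps)
 then have "1 - 16 * m\<^sup>2 * e <= cmod (m13 * (a * c - b\<^sup>2))"
  using norm_triangle_ineq2[of 1 "m13 * (a * c - b\<^sup>2)"] norm_triangle_ineq2[of 1 "1 - m13 * (a * c - b\<^sup>2)"] by simp
 also have "\<dots> <= cmod m13 * m\<^sup>2" using dX by (simp add: norm_mult mult_left_mono)
 finally have "(1 - 16 * m\<^sup>2 * e) / m\<^sup>2 <= cmod m13" using m by (simp add: divide_simps)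
 moreover have "dt (A (mat 1)) = m13 + d1 + d3" unfolding mat1_symat[symmetric] dtA by simp
 ultimately show ?thesis
  using b1 b3 norm_diff_ineq[of m13 "d1 + d3"] norm_triangle_ineq[of d1 d3] unfolding e_def[symmetric]
  by (simp only: add.assoc)
qed

lemma pair_near_iso:
 assumes P: "pair F G \<rho>" and \<sigma>: "0 < \<sigma>" "\<sigma> < 1" "24 / (1 - \<sigma>)\<^sup>2 < \<rho>"
 shows "near_iso (1/\<sigma>) (%X. dF F X ii) (%X. dF G X ii)"
proof -
 have P': "pair G F \<rho>" by (rule pair_sym[OF P])
 have h: "hol F (HB \<rho>)" "hol G (HB \<rho>)" "ii \<in> HB \<rho>" using P ii_HB by (auto simp: pair_def prepair_def)
 show ?thesis
  unfolding near_iso_def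
  by (intro conjI ballI allI impI dF_add[OF h(1,3)] dF_cscale[OF h(1,3)] dF_cscale[OF h(2,3)]
    hol_dF_Sym[OF h(1,3)] hol_dF_Sym[OF h(2,3)] pair_inverse[OF P] pair_inverse[OF P']
    near_contraction[OF P _ _ \<sigma>] near_contraction[OF P' _ _ \<sigma>]; assumption)
qed

text \<open>For large \<rho> the radius \<sigma> may be taken close to 1, and then
  \<open>m = 1 / \<sigma>\<close> is so close to 1 that the defects fall below \<epsilon>. The lower
  bound on vectors follows from that on the determinant by \<open>dt_le\<close>.\<close>

lemma near_unitary:
 assumes \<epsilon>: "0 < \<epsilon>"
 obtains \<rho>0 where "\<rho>0 > 2" "!!F G \<rho>. pair F G \<rho> ==> \<rho>0 <= \<rho> ==>
  opb (1 + \<epsilon>) (dF F (mat 1) ii) & (\<forall>x. (1 - \<epsilon>) * norm x <= norm (dF F (mat 1) ii *v x)) &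
  (\<forall>v. cmod (dt (dF F (nl v) ii)) <= \<epsilon> * norm v ^ 4) & 1 - \<epsilon> <= cmod (dt (dF F (mat 1) ii))"
proof -
 define L where "L m = (1 - 16 * m\<^sup>2 * e1 m) / m\<^sup>2 - 2 * e1 m" for m
 have "(e1 \<longlongrightarrow> 1 * sqrt (1\<^sup>2 - 1 / 1 ^ 4)) (at_right 1)"
  unfolding e1_def[abs_def] by (intro tendsto_intros) auto
 then have t1: "(e1 \<longlongrightarrow> 0) (at_right 1)" by simp
 have "(L \<longlongrightarrow> (1 - 16 * 1\<^sup>2 * 0) / 1\<^sup>2 - 2 * 0) (at_right 1)"
  unfolding L_def[abs_def] by (intro tendsto_intros t1) auto
 then have t2: "(L \<longlongrightarrow> 1) (at_right 1)" by simp
 have "((%m. L m / m) \<longlongrightarrow> 1 / 1) (at_right 1)"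
  by (intro tendsto_intros t2) auto
 then have t3: "((%m. L m / m) \<longlongrightarrow> 1) (at_right 1)" by simp
 have t4: "((%m::real. m) \<longlongrightarrow> 1) (at_right 1)" by (rule tendsto_ident_at)
 have "\<forall>\<^sub>F m in at_right (1::real). e1 m < \<epsilon> & L m > 1 - \<epsilon> & L m / m > 1 - \<epsilon> & m < 1 + \<epsilon> & m > 1"
  using order_tendstoD(2)[OF t1 \<epsilon>] order_tendstoD(1)[OF t2, of "1 - \<epsilon>"] order_tendstoD(1)[OF t3, of "1 - \<epsilon>"]
   order_tendstoD(2)[OF t4, of "1 + \<epsilon>"] eventually_at_right_less[of 1] \<epsilon> by (auto intro!: eventually_conj)
 then obtain m where m: "e1 m < \<epsilon>" "L m > 1 - \<epsilon>" "L m / m > 1 - \<epsilon>" "m < 1 + \<epsilon>" "m > 1"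
  using eventually_happens[of _ "at_right (1::real)"] trivial_limit_at_right_real by blast
 define \<sigma> where "\<sigma> = 1 / m"
 have \<sigma>: "0 < \<sigma>" "\<sigma> < 1" using m by (auto simp: \<sigma>_def)
 define \<rho>0 where "\<rho>0 = max 3 (24 / (1 - \<sigma>)\<^sup>2 + 1)"
 show thesis
 proof (rule that[of \<rho>0])
  fix F G \<rho> assume P: "pair F G \<rho>" "\<rho>0 <= \<rho>"
  let ?A = "%X. dF F X ii"
  have I: "near_iso m ?A (%X. dF G X ii)"
   using pair_near_iso[OF P(1) \<sigma>] P(2) m by (simp add: \<rho>0_def \<sigma>_def)
  have o: "opb m (?A (mat 1))" using I unfolding near_iso_def by (force simp: opb_def)
  have S: "?A (mat 1) \<in> Sym" using I unfolding near_iso_def by force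
  have d: "L m <= cmod (dt (?A (mat 1)))" unfolding L_def by (rule near_iso_dt_one[OF I m(5)])
  have "(1 - \<epsilon>) * norm x <= norm (?A (mat 1) *v x)" for x
  proof -
   have "L m * norm x <= cmod (dt (?A (mat 1))) * norm x" using d by (simp add: mult_right_mono)
   also have "\<dots> <= m * norm (?A (mat 1) *v x)" by (rule dt_le[OF S o])
   finally have "L m / m * norm x <= norm (?A (mat 1) *v x)" using m by (simp add: divide_simps mult.commute)
   moreover have "(1 - \<epsilon>) * norm x <= L m / m * norm x" using m by (intro mult_right_mono) auto
   ultimately show ?thesis by simp
  qed
  moreover have "cmod (dt (?A (nl v))) <= \<epsilon> * norm v ^ 4" for v
   using near_iso_null[OF I m(5), of v] mult_right_mono[of "e1 m" \<epsilon> "norm v ^ 4"] m by simp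
  ultimately show "opb (1 + \<epsilon>) (?A (mat 1)) & (\<forall>x. (1 - \<epsilon>) * norm x <= norm (?A (mat 1) *v x)) &
   (\<forall>v. cmod (dt (?A (nl v))) <= \<epsilon> * norm v ^ 4) & 1 - \<epsilon> <= cmod (dt (?A (mat 1)))"
   using opb_mono[OF o] m d by auto
 qed (simp add: \<rho>0_def)
qed

subsection \<open>The scalar Schwarz--Pick step\<close>

text \<open>Schwarz-Pick for the quotient \<open>h\<close> of \<open>p\<close> by the identity,
  whose value at 0 is \<open>w\<close>: the pseudohyperbolic distance from \<open>h z\<close> to
  \<open>w\<close> is at most \<open>cmod z\<close>, and this is solved for \<open>h z - w\<close>.
  For unimodular \<open>w\<close> the function is a rotation.\<close>

lemma schwarz_linear:
 assumes p: "p holomorphic_on ball 0 1" "p 0 = 0" "!!z. cmod z < 1 ==> cmod (p z) < 1"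
  and w: "w = deriv p 0" and z: "cmod z < 1"
 shows "cmod w <= 1" "cmod (p z - w * z) <= (1 - (cmod w)\<^sup>2) * (cmod z)\<^sup>2 / (1 - cmod z)"
proof -
 show w1: "cmod w <= 1" using Schwarz_Lemma(2)[OF p(1,2), of 0] p(3) w by simp
 obtain h where h: "h holomorphic_on ball 0 1" "!!z. cmod z < 1 ==> p z = z * h z" "deriv p 0 = h 0"
  using Schwarz3[OF p(1,2)] by blast
 have rhs: "0 <= (1 - (cmod w)\<^sup>2) * (cmod z)\<^sup>2 / (1 - cmod z)" using w1 z by (simp add: power_le_one)
 show "cmod (p z - w * z) <= (1 - (cmod w)\<^sup>2) * (cmod z)\<^sup>2 / (1 - cmod z)"
 proof (cases "cmod w = 1")
  case True
  then obtain \<alpha> where \<alpha>: "!!z. cmod z < 1 ==> p z = \<alpha> * z"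
   using Schwarz_Lemma(3)[OF p(1,2), of 0] p(3) w by auto
  have "((%z. \<alpha> * z) has_field_derivative \<alpha>) (at 0)" by (auto intro!: derivative_eq_intros)
  then have "(p has_field_derivative \<alpha>) (at 0)"
   by (rule has_field_derivative_transform_within_open[of _ _ _ "ball 0 1"]) (use \<alpha> in auto)
  then have "w = \<alpha>" using w DERIV_imp_deriv by blast
  then show ?thesis using \<alpha>[OF z] rhs by simp
 next
  case False
  then have wl: "cmod w < 1" using w1 by simp
  have hb: "cmod (h z) < 1" if z: "cmod z < 1" for z
  proof (cases "z = 0")
   case True
   then show ?thesis using wl w h by simp
  next
   case False
   have "cmod (p z) <= cmod z" using Schwarz_Lemma(1)[OF p(1,2) p(3) z] by simp
   moreover have "cmod (p z) ~= cmod z"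
   proof
    assume eq: "cmod (p z) = cmod z"
    then obtain \<alpha> where \<alpha>: "!!z. cmod z < 1 ==> p z = \<alpha> * z" "cmod \<alpha> = 1"
     using Schwarz_Lemma(3)[OF p(1,2) p(3), of 0] z False by auto
    have "((%z. \<alpha> * z) has_field_derivative \<alpha>) (at 0)" by (auto intro!: derivative_eq_intros)
    then have "(p has_field_derivative \<alpha>) (at 0)"
     by (rule has_field_derivative_transform_within_open[of _ _ _ "ball 0 1"]) (use \<alpha> in auto)
    then have "w = \<alpha>" using w DERIV_imp_deriv by blast
    then show False using \<alpha>(2) wl by simp
   qed
   ultimately show ?thesis using False h(2)[OF z] by (simp add: norm_mult)
  qed
  define q where "q z = Moebius_function 0 w (h z)" for z
  have "q holomorphic_on ball 0 1"
   unfolding q_def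
  proof -
   have "h ` ball 0 1 \<subseteq> ball 0 1" using hb by auto
   then show "(%z. Moebius_function 0 w (h z)) holomorphic_on ball 0 1"
    using holomorphic_on_compose_gen[OF h(1) Moebius_function_holomorphic[OF wl, of 0]] by (simp add: o_def)
  qed
  moreover have "q 0 = 0" using w h by (simp add: q_def Moebius_function_def)
  moreover have "cmod (q z) < 1" if "cmod z < 1" for z
   unfolding q_def using Moebius_function_norm_lt_1[OF wl hb[OF that]] by simp
  ultimately have "cmod (q z) <= cmod z" using Schwarz_Lemma(1) z by blast
  moreover have "1 - cnj w * h z ~= 0"
  proof
   assume "1 - cnj w * h z = 0"
   then have "cmod (cnj w * h z) = 1" by (metis eq_iff_diff_eq_0 norm_one)
   moreover have "cmod (cnj w * h z) < 1 * 1"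
    unfolding norm_mult complex_mod_cnj by (rule mult_strict_mono') (use wl hb[OF z] in auto)
   ultimately show False by simp
  qed
  ultimately have "cmod (h z - w) <= cmod z * cmod (1 - cnj w * h z)"
   by (simp add: q_def Moebius_function_def norm_divide divide_simps)
  also have "1 - cnj w * h z = of_real (1 - (cmod w)\<^sup>2) - cnj w * (h z - w)"
   unfolding of_real_diff complex_norm_square by (simp add: algebra_simps)
  also have "cmod \<dots> <= (1 - (cmod w)\<^sup>2) + cmod (h z - w)"
  proof -
   have "cmod (of_real (1 - (cmod w)\<^sup>2)) = 1 - (cmod w)\<^sup>2"
    unfolding norm_of_real using w1 by (simp add: power_le_one)
   moreover have "cmod (cnj w * (h z - w)) <= 1 * cmod (h z - w)"
    unfolding norm_mult complex_mod_cnj using w1 by (intro mult_right_mono) auto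
   ultimately show ?thesis using norm_triangle_ineq4[of "of_real (1 - (cmod w)\<^sup>2)" "cnj w * (h z - w)"] by linarith
  qed
  finally have "cmod (h z - w) <= cmod z * ((1 - (cmod w)\<^sup>2) + cmod (h z - w))"
   by (simp add: mult_left_mono)
  then have "cmod (h z - w) * (1 - cmod z) <= (1 - (cmod w)\<^sup>2) * cmod z" by (simp add: algebra_simps)
  then have "cmod (h z - w) <= (1 - (cmod w)\<^sup>2) * cmod z / (1 - cmod z)" using z by (simp add: divide_simps)
  moreover have "p z - w * z = z * (h z - w)" using h(2)[OF z] by (simp add: algebra_simps)
  ultimately have "cmod (p z - w * z) <= cmod z * ((1 - (cmod w)\<^sup>2) * cmod z / (1 - cmod z))"
   by (simp only: norm_mult) (rule mult_left_mono, auto)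
  then show ?thesis by (simp add: power2_eq_square mult_ac)
 qed
qed

text \<open>The tolerance of the descent, small enough that in \<open>final_estimate\<close> the
  terms of order \<open>e0^2\<close> do not spoil the contraction of the first order term.\<close>

definition e0 :: real where "e0 = 1 / 10000"

lemma cayley_scalar:
 fixes u :: complex
 assumes "cmod u < 1"
 defines "\<zeta> \<equiv> \<i> * (1 - u) / (1 + u)"
 shows "1 + u ~= 0" "Im \<zeta> = (1 - (cmod u)\<^sup>2) / (cmod (1 + u))\<^sup>2" "0 < Im \<zeta>" "cmod \<zeta> <= 2 / (1 - cmod u)"
proof -
 have lb: "1 - cmod u <= cmod (1 + u)" using norm_diff_ineq[of 1 u] by simp
 then show n: "1 + u ~= 0" using assms(1) by auto
 have "\<zeta> = \<i> * ((1 - u) * cnj (1 + u)) / of_real ((cmod (1 + u))\<^sup>2)"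
 proof -
  have "cnj (1 + u) ~= 0" using n by (metis complex_cnj_zero_iff)
  then show ?thesis unfolding \<zeta>_def complex_norm_square using n by (simp del: complex_cnj_add)
 qed
 also have "Im \<dots> = Re ((1 - u) * cnj (1 + u)) / (cmod (1 + u))\<^sup>2"
  unfolding Im_divide_of_real by simp
 also have "Re ((1 - u) * cnj (1 + u)) = 1 - (cmod u)\<^sup>2"
  by (simp add: cmod_power2) (simp add: power2_eq_square algebra_simps)
 finally show i: "Im \<zeta> = (1 - (cmod u)\<^sup>2) / (cmod (1 + u))\<^sup>2" .
 have "(cmod u)\<^sup>2 < 1" using assms(1) by (simp add: abs_square_less_1)
 then show "0 < Im \<zeta>" unfolding i using n by simp
 have "cmod (1 - u) <= 2" using norm_triangle_ineq4[of 1 u] assms(1) by simp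
 then show "cmod \<zeta> <= 2 / (1 - cmod u)"
  unfolding \<zeta>_def norm_divide norm_mult using lb assms(1) by (intro frac_le) auto
qed

text \<open>The modulus of \<open>w\<close> is 1 up to second order, so its first order deviation
  from 1 is purely imaginary. That part enters the numerator with the factor 3/8 and is compared
  with \<open>(1 - (cmod z)^2) * cmod (1 + z)\<close>, which is about 9/8; hence the relative error
  does not grow beyond \<open>e0\<close>.\<close>

lemma final_estimate:
 fixes z z' w :: complex
 assumes w: "cmod (w - 1) <= e0" "1 - 5 * e0\<^sup>2 <= cmod w" "cmod w <= 1 + 2 * e0\<^sup>2"
  and z: "cmod (z - w / 2) <= 7 * e0\<^sup>2" and z': "cmod (z' - w) <= 421 * e0\<^sup>2"
 shows "cmod z < 3/5" "(1 - (cmod z)\<^sup>2) / (cmod (1 + z))\<^sup>2 <= 2 / 5"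
  "cmod (of_real (3/4) * z' / (1 + z)\<^sup>2 - of_real ((1 - (cmod z)\<^sup>2) / (cmod (1 + z))\<^sup>2))
   <= e0 * ((1 - (cmod z)\<^sup>2) / (cmod (1 + z))\<^sup>2)"
proof -
 define \<rho> \<kappa> where "\<rho> = Re (w - 1)" and "\<kappa> = Im (w - 1)"
 have w1: "w = 1 + of_real \<rho> + \<i> * of_real \<kappa>" by (simp add: \<rho>_def \<kappa>_def complex_eq_iff)
 have k: "\<bar>\<kappa>\<bar> <= e0" "\<bar>\<rho>\<bar> <= e0"
  using w(1) abs_Im_le_cmod[of "w - 1"] abs_Re_le_cmod[of "w - 1"] by (auto simp: \<rho>_def \<kappa>_def)
 have sq: "\<rho>\<^sup>2 <= e0\<^sup>2" "\<kappa>\<^sup>2 <= e0\<^sup>2" using k by (auto intro: power2_le_iff_abs_le[THEN iffD2] simp: e0_def power2_le_iff_abs_le)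
 have cw: "(cmod w)\<^sup>2 = (1 + \<rho>)\<^sup>2 + \<kappa>\<^sup>2" unfolding w1 cmod_power2 by simp
 have up: "2 * \<rho> <= 5 * e0\<^sup>2"
 proof -
  have "(cmod w)\<^sup>2 <= (1 + 2 * e0\<^sup>2)\<^sup>2" using w by (intro power_mono) auto
  then have "1 + 2 * \<rho> + \<rho>\<^sup>2 + \<kappa>\<^sup>2 <= 1 + 4 * e0\<^sup>2 + 4 * e0^4"
   unfolding cw by (simp add: power2_eq_square power4_eq_xxxx algebra_simps)
  moreover have "4 * e0^4 <= e0\<^sup>2" by (simp add: e0_def power2_eq_square power4_eq_xxxx)
  ultimately show ?thesis using zero_le_power2[of \<rho>] zero_le_power2[of \<kappa>] by linarith
 qed
 have lo: "-12 * e0\<^sup>2 <= 2 * \<rho>"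
 proof -
  have "(1 - 5 * e0\<^sup>2)\<^sup>2 <= (cmod w)\<^sup>2" using w(2) by (rule power_mono) (simp add: e0_def power2_eq_square)
  then have "1 - 10 * e0\<^sup>2 + 25 * e0^4 <= 1 + 2 * \<rho> + \<rho>\<^sup>2 + \<kappa>\<^sup>2"
   unfolding cw by (simp add: power2_eq_square power4_eq_xxxx algebra_simps)
  moreover have "0 <= e0^4" by (simp add: e0_def)
  ultimately show ?thesis using sq by linarith
 qed
 have r: "\<bar>\<rho>\<bar> <= 6 * e0\<^sup>2" using up lo zero_le_power2[of e0] by linarith
 \<comment> \<open>\<open>a\<close> and \<open>b\<close> are what remains of \<open>z\<close> and
   \<open>z'\<close> after their values to first order; both are of order
   \<open>e0^2\<close>.\<close>
 define a where "a = z - 1/2 - \<i> * of_real \<kappa> / 2"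
 define b where "b = z' - 1 - \<i> * of_real \<kappa>"
 have "a = (z - w/2) + of_real (\<rho>/2)" by (simp add: a_def w1 field_simps)
 then have "cmod a <= 7 * e0\<^sup>2 + \<bar>\<rho>/2\<bar>" using z norm_triangle_ineq[of "z - w/2" "of_real (\<rho>/2)"] unfolding norm_of_real by simp
 then have a: "cmod a <= 10 * e0\<^sup>2" using r by simp
 have "b = (z' - w) + of_real \<rho>" by (simp add: b_def w1)
 then have b: "cmod b <= 427 * e0\<^sup>2" using z' r norm_triangle_ineq[of "z' - w" "of_real \<rho>"] unfolding norm_of_real by simp
 define \<alpha> where "\<alpha> = \<i> * of_real \<kappa> / 2 + a"
 define \<beta> where "\<beta> = \<i> * of_real \<kappa> + b"
 have za: "z = 1/2 + \<alpha>" "z' = 1 + \<beta>" by (simp_all add: \<alpha>_def \<beta>_def a_def b_def)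
 have ik: "cmod (\<i> * of_real \<kappa> / 2) <= e0 / 2" "cmod (\<i> * of_real \<kappa>) <= e0"
  using k by (simp_all add: norm_mult norm_divide)
 have al: "cmod \<alpha> <= e0" using norm_triangle_ineq[of "\<i> * of_real \<kappa> / 2" a] ik a by (simp add: \<alpha>_def e0_def power2_eq_square)
 have be: "cmod \<beta> <= 2 * e0" using norm_triangle_ineq[of "\<i> * of_real \<kappa>" b] ik b by (simp add: \<beta>_def e0_def power2_eq_square)
 have z2: "(cmod z)\<^sup>2 = 1/4 + Re \<alpha> + (cmod \<alpha>)\<^sup>2"
  unfolding za cmod_power2 by (simp add: power2_eq_square algebra_simps)
 have Re\<alpha>: "\<bar>Re \<alpha>\<bar> <= e0" using abs_Re_le_cmod[of \<alpha>] al by linarith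
 have al2: "(cmod \<alpha>)\<^sup>2 <= e0\<^sup>2" using al by (intro power_mono) auto
 have mz: "\<bar>(cmod z)\<^sup>2 - 1/4\<bar> <= 1/1000"
 proof -
  have "(cmod \<alpha>)\<^sup>2 <= 1 / 10000" using al2 by (simp add: e0_def power2_eq_square)
  moreover have "Re \<alpha> <= 1 / 10000" "- Re \<alpha> <= 1 / 10000" using Re\<alpha> by (simp_all add: e0_def abs_le_iff)
  ultimately show ?thesis unfolding z2 abs_le_iff using zero_le_power2[of "cmod \<alpha>"] by linarith
 qed
 have dz: "7/10 <= 1 - (cmod z)\<^sup>2" "1 - (cmod z)\<^sup>2 <= 76/100" using mz by linarith+
 have cz: "cmod z <= 51/100" using norm_triangle_ineq[of "1/2" \<alpha>] al by (simp add: za e0_def)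
 show "cmod z < 3/5" using cz by simp
 have nz: "1 + z = 3/2 + \<alpha>" by (simp add: za)
 have lz: "149/100 <= cmod (1 + z)" using norm_diff_ineq[of "3/2" \<alpha>] al unfolding nz by (simp add: e0_def)
 then have lz2: "22/10 <= (cmod (1 + z))\<^sup>2" using power_mono[OF lz, of 2] by (simp add: power2_eq_square)
 show "(1 - (cmod z)\<^sup>2) / (cmod (1 + z))\<^sup>2 <= 2 / 5"
 proof -
  have "(1 - (cmod z)\<^sup>2) / (cmod (1 + z))\<^sup>2 <= (76/100) / (22/10)" using dz lz2 by (intro frac_le) auto
  also have "\<dots> <= 2 / 5" by simp
  finally show ?thesis .
 qed
 \<comment> \<open>Only the first summand is of order \<open>e0\<close>; everything in the large
   parentheses is of second order.\<close>
 define T where "T = \<i> * of_real (3/8 * \<kappa>) + (of_real (9/8) * b + of_real (3/4) * (cnj a - a) + of_real (3/2 * Re a)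
  + of_real (3/4) * \<beta> * cnj \<alpha> + of_real ((cmod \<alpha>)\<^sup>2) * (3/2 + \<alpha>) + of_real (Re \<alpha>) * \<alpha>)"
 have T: "of_real (3/4) * z' * cnj (1 + z) - of_real (1 - (cmod z)\<^sup>2) * (1 + z) = T"
  unfolding T_def z2 nz za(2) unfolding cmod_power2 unfolding \<beta>_def \<alpha>_def
  by (simp add: complex_eq_iff) (simp add: power2_eq_square field_simps)
 have T1: "cmod T <= 3/8 * e0 + (9/8 * (427 * e0\<^sup>2) + 3/4 * (20 * e0\<^sup>2) + 3/2 * (10 * e0\<^sup>2)
  + 3/4 * (2 * e0 * e0) + e0\<^sup>2 * 2 + 10 * e0\<^sup>2)"
  unfolding T_def
 proof (intro norm_triangle_mono)
  show "cmod (\<i> * of_real (3/8 * \<kappa>)) <= 3/8 * e0" using k by (simp add: norm_mult)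
  show "cmod (of_real (9/8) * b) <= 9/8 * (427 * e0\<^sup>2)" using b unfolding norm_mult norm_of_real by simp
  show "cmod (of_real (3/4) * (cnj a - a)) <= 3/4 * (20 * e0\<^sup>2)"
   unfolding norm_mult norm_of_real using norm_triangle_ineq4[of "cnj a" a] a by simp
  show "cmod (of_real (3/2 * Re a)) <= 3/2 * (10 * e0\<^sup>2)" unfolding norm_of_real using abs_Re_le_cmod[of a] a by simp
  show "cmod (of_real (3/4) * \<beta> * cnj \<alpha>) <= 3/4 * (2 * e0 * e0)"
   unfolding norm_mult norm_of_real complex_mod_cnj using mult_mono[OF be al] by (simp add: e0_def mult.commute)
  have "cmod (3/2 + \<alpha>) <= 2" using norm_triangle_ineq[of "3/2" \<alpha>] al by (simp add: e0_def)
  then show "cmod (of_real ((cmod \<alpha>)\<^sup>2) * (3/2 + \<alpha>)) <= e0\<^sup>2 * 2"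
   unfolding norm_mult norm_of_real using mult_mono[OF al2, of "cmod (3/2 + \<alpha>)" 2] by simp
  have "\<bar>Re \<alpha>\<bar> * cmod \<alpha> <= e0 * e0" by (rule mult_mono[OF Re\<alpha> al]) (auto simp: e0_def)
  then show "cmod (of_real (Re \<alpha>) * \<alpha>) <= 10 * e0\<^sup>2"
   unfolding norm_mult norm_of_real by (simp add: power2_eq_square e0_def)
 qed
 have T2: "3/8 * e0 + (9/8 * (427 * e0\<^sup>2) + 3/4 * (20 * e0\<^sup>2) + 3/2 * (10 * e0\<^sup>2)
  + 3/4 * (2 * e0 * e0) + e0\<^sup>2 * 2 + 10 * e0\<^sup>2) <= e0 * (7/10) * (149/100)"
  by (simp add: e0_def power2_eq_square)
 have T3: "e0 * (7/10) * (149/100) <= e0 * (1 - (cmod z)\<^sup>2) * cmod (1 + z)"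
  by (rule mult_mono) (use dz lz in \<open>auto simp: e0_def\<close>)
 have N: "cmod (of_real (3/4) * z' * cnj (1 + z) - of_real (1 - (cmod z)\<^sup>2) * (1 + z)) <= e0 * (1 - (cmod z)\<^sup>2) * cmod (1 + z)"
  unfolding T by (rule order_trans[OF T1 order_trans[OF T2 T3]])
 have n0: "1 + z ~= 0" "cmod (1 + z) > 0" using lz by auto
 have c0: "cnj (1 + z) ~= 0" using n0 by (metis complex_cnj_zero_iff)
 have "of_real (3/4) * z' / (1 + z)\<^sup>2 - of_real ((1 - (cmod z)\<^sup>2) / (cmod (1 + z))\<^sup>2)
  = (of_real (3/4) * z' * cnj (1 + z) - of_real (1 - (cmod z)\<^sup>2) * (1 + z)) / ((1 + z)\<^sup>2 * cnj (1 + z))"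
 proof -
  have gen: "A / u\<^sup>2 - B / (u * c) = (A * c - B * u) / (u\<^sup>2 * c)" if "u ~= 0" "c ~= 0" for A B u c :: complex
   using that by (simp add: power2_eq_square diff_divide_distrib)
  show ?thesis
   unfolding of_real_divide[of "1 - (cmod z)\<^sup>2"] complex_norm_square[of "1 + z"] by (rule gen[OF n0(1) c0])
 qed
 also have "cmod \<dots> <= e0 * (1 - (cmod z)\<^sup>2) * cmod (1 + z) / (cmod (1 + z)) ^ 3"
 proof -
  have e: "cmod ((1 + z)\<^sup>2 * cnj (1 + z)) = cmod (1 + z) ^ 3"
   unfolding norm_mult norm_power complex_mod_cnj by (simp add: power2_eq_square power3_eq_cube)
  show ?thesis unfolding norm_divide[of _ "(1 + z)\<^sup>2 * cnj (1 + z)"] e by (rule divide_right_mono[OF N]) simp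
 qed
 also have "\<dots> = e0 * ((1 - (cmod z)\<^sup>2) / (cmod (1 + z))\<^sup>2)"
  using n0 by (simp add: power2_eq_square power3_eq_cube)
 finally show "cmod (of_real (3/4) * z' / (1 + z)\<^sup>2 - of_real ((1 - (cmod z)\<^sup>2) / (cmod (1 + z))\<^sup>2))
   <= e0 * ((1 - (cmod z)\<^sup>2) / (cmod (1 + z))\<^sup>2)" .
qed

text \<open>In Cayley coordinates the function becomes a self-map \<open>p\<close> of the disc that
  fixes 0 with derivative close to 1, and \<open>schwarz_linear\<close> makes it almost linear. The
  point \<open>\<i> / 3\<close> has Cayley coordinate 1/2; this is why the height is divided by 3 in
  each step.\<close>

lemma scalar_step:
 assumes f: "f holomorphic_on {\<zeta>. 0 < Im \<zeta> & cmod \<zeta> < 10 ^ 9}"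
  and pos: "!!\<zeta>. 0 < Im \<zeta> ==> cmod \<zeta> < 10 ^ 9 ==> 0 < Im (f \<zeta>)"
  and fi: "f \<i> = \<i>" "(f has_field_derivative w) (at \<i>)"
  and w: "cmod (w - 1) <= e0" "1 - 5 * e0\<^sup>2 <= cmod w"
 shows "Im (f (\<i> / 3)) <= 2 / 5"
  "!!\<tau>. 1/3 <= \<tau> ==> \<tau> <= 1 ==> cmod (f (\<i> * of_real \<tau>) - \<i>) <= 3"
  "!!d. (f has_field_derivative d) (at (\<i> / 3)) ==>
   cmod (of_real (1/3) * d - of_real (Im (f (\<i> / 3)))) <= e0 * Im (f (\<i> / 3))"
proof -
 let ?H = "{\<zeta>. 0 < Im \<zeta> & cmod \<zeta> < 10 ^ 9}"
 \<comment> \<open>The disc of radius \<sigma> stays in the given half disc because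
   \<open>2 / (1 - \<sigma>)\<close> is \<open>2 * 10^8\<close>; this is the origin of the radius
   \<open>10 ^ 9\<close>. The factor \<sigma> costs only an error of second order.\<close>
 define \<sigma> :: real where "\<sigma> = 1 - e0\<^sup>2"
 have \<sigma>: "0 < \<sigma>" "\<sigma> < 1" "99/100 <= \<sigma>" by (auto simp: \<sigma>_def e0_def power2_eq_square)
 define \<zeta> where "\<zeta> u = \<i> * (1 - u) / (1 + u)" for u
 have \<zeta>H: "\<zeta> (of_real \<sigma> * u) \<in> ?H" "1 + of_real \<sigma> * u ~= 0" if "cmod u < 1" for u
 proof -
  have c: "cmod (of_real \<sigma> * u) < \<sigma>" using that \<sigma> by (simp add: norm_mult)
  then have c1: "cmod (of_real \<sigma> * u) < 1" using \<sigma> by simp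
  have "2 / (1 - cmod (of_real \<sigma> * u)) <= 2 / (1 - \<sigma>)" using c \<sigma> by (intro divide_left_mono) auto
  also have "\<dots> < 10 ^ 9" by (simp add: \<sigma>_def e0_def power2_eq_square)
  finally show "\<zeta> (of_real \<sigma> * u) \<in> ?H"
   using cayley_scalar(3,4)[OF c1] unfolding \<zeta>_def by auto
  show "1 + of_real \<sigma> * u ~= 0" by (rule cayley_scalar(1)[OF c1])
 qed
 define g where "g u = f (\<zeta> (of_real \<sigma> * u))" for u
 define p where "p u = - (g u - \<i>) / (g u + \<i>)" for u
 have gpos: "0 < Im (g u)" if "cmod u < 1" for u using \<zeta>H[OF that] pos by (simp add: g_def)
 have gi: "g u + \<i> ~= 0" if "cmod u < 1" for u using gpos[OF that] by (auto simp: complex_eq_iff)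
 have opH: "open ?H"
  by (simp only: Collect_conj_eq) (intro open_Int open_Collect_less continuous_intros)
 have dg: "(g has_field_derivative d * (- 2 * \<i> * of_real \<sigma> / (1 + of_real \<sigma> * u)\<^sup>2)) (at u)"
  if "cmod u < 1" "(f has_field_derivative d) (at (\<zeta> (of_real \<sigma> * u)))" for u d
 proof -
  have "((%u. \<zeta> (of_real \<sigma> * u)) has_field_derivative (- 2 * \<i> * of_real \<sigma> / (1 + of_real \<sigma> * u)\<^sup>2)) (at u)"
   unfolding \<zeta>_def using \<zeta>H(2)[OF that(1)]
   by (auto intro!: derivative_eq_intros simp: power2_eq_square divide_simps) (simp add: algebra_simps)
  from DERIV_chain2[OF that(2) this] show ?thesis by (simp add: g_def[abs_def])
 qed
 have fd: "(f has_field_derivative deriv f (\<zeta> (of_real \<sigma> * u))) (at (\<zeta> (of_real \<sigma> * u)))" if "cmod u < 1" for u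
  using holomorphic_derivI[OF f opH \<zeta>H(1)[OF that]] .
 have dp: "(p has_field_derivative - 2 * \<i> * D / (g u + \<i>)\<^sup>2) (at u)"
  if "cmod u < 1" "(g has_field_derivative D) (at u)" for u D
  unfolding p_def[abs_def] using gi[OF that(1)]
  by (auto intro!: derivative_eq_intros that(2) simp: power2_eq_square divide_simps) (simp add: algebra_simps)
 have ph: "p holomorphic_on ball 0 1"
  unfolding holomorphic_on_def
  using dp[OF _ dg[OF _ fd]] has_field_derivative_at_within field_differentiable_def by (metis mem_ball_0)
 have pb: "cmod (p u) < 1" if "cmod u < 1" for u
 proof -
  have "(cmod (g u - \<i>))\<^sup>2 < (cmod (g u + \<i>))\<^sup>2"
   using gpos[OF that] unfolding cmod_power2 by (simp add: power2_eq_square algebra_simps)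
  then have "cmod (g u - \<i>) < cmod (g u + \<i>)" using power2_less_imp_less norm_ge_zero by blast
  then show ?thesis unfolding p_def using gi[OF that] by (simp add: norm_divide norm_minus_commute[of "\<i>"] divide_simps)
 qed
 have z0: "\<zeta> (of_real \<sigma> * 0) = \<i>" by (simp add: \<zeta>_def)
 have g0: "g 0 = \<i>" unfolding g_def z0 fi ..
 have p0: "p 0 = 0" by (simp add: p_def g0)
 have "(p has_field_derivative - 2 * \<i> * (w * (- 2 * \<i> * of_real \<sigma> / (1 + of_real \<sigma> * 0)\<^sup>2)) / (g 0 + \<i>)\<^sup>2) (at 0)"
  by (rule dp, simp, rule dg, simp) (simp only: z0 fi)
 then have dp0: "(p has_field_derivative w * of_real \<sigma>) (at 0)" by (simp add: g0 power2_eq_square mult_ac)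
 then have wp: "w * of_real \<sigma> = deriv p 0" using DERIV_imp_deriv by metis
 have sl: "cmod u < 1 ==> cmod (w * of_real \<sigma>) <= 1"
  "cmod u < 1 ==> cmod (p u - w * of_real \<sigma> * u) <= (1 - (cmod (w * of_real \<sigma>))\<^sup>2) * (cmod u)\<^sup>2 / (1 - cmod u)" for u
  using schwarz_linear[OF ph p0 _ wp] pb by blast+
 have cws: "cmod (w * of_real \<sigma>) = cmod w * \<sigma>" using \<sigma> by (simp add: norm_mult)
 have w\<sigma>: "cmod w * \<sigma> <= 1" using sl(1)[of 0] cws by simp
 have w_up: "cmod w <= 1 + 2 * e0\<^sup>2"
 proof -
  have "1 <= (1 + 2 * e0\<^sup>2) * \<sigma>" by (simp add: \<sigma>_def e0_def power2_eq_square)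
  then have "cmod w * \<sigma> <= (1 + 2 * e0\<^sup>2) * \<sigma>" using w\<sigma> by linarith
  then show ?thesis using \<sigma> by simp
 qed
 have K: "1 - (cmod (w * of_real \<sigma>))\<^sup>2 <= 13 * e0\<^sup>2" "0 <= 1 - (cmod (w * of_real \<sigma>))\<^sup>2"
 proof -
  have "(1 - 5 * e0\<^sup>2) * \<sigma> <= cmod w * \<sigma>" using w \<sigma> by (intro mult_right_mono) auto
  then have "((1 - 5 * e0\<^sup>2) * \<sigma>)\<^sup>2 <= (cmod w * \<sigma>)\<^sup>2" by (rule power_mono) (simp add: \<sigma>_def e0_def power2_eq_square)
  moreover have "1 - 13 * e0\<^sup>2 <= ((1 - 5 * e0\<^sup>2) * \<sigma>)\<^sup>2" by (simp add: \<sigma>_def e0_def power2_eq_square)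
  ultimately show "1 - (cmod (w * of_real \<sigma>))\<^sup>2 <= 13 * e0\<^sup>2" unfolding cws by linarith
  show "0 <= 1 - (cmod (w * of_real \<sigma>))\<^sup>2" unfolding cws using w\<sigma> \<sigma> by (simp add: power_le_one)
 qed
 have ginv: "g u = \<i> * (1 - p u) / (1 + p u)" "1 + p u ~= 0" if "cmod u < 1" for u
 proof -
  show n: "1 + p u ~= 0" by (rule cayley_scalar(1)[OF pb[OF that]])
  have "p u * (g u + \<i>) = - (g u - \<i>)" using gi[OF that] by (simp add: p_def)
  then have "g u * (1 + p u) = \<i> * (1 - p u)" by (simp add: algebra_simps)
  then show "g u = \<i> * (1 - p u) / (1 + p u)" using n by (simp add: field_simps)
 qed
 show "cmod (f (\<i> * of_real \<tau>) - \<i>) <= 3" if \<tau>: "1/3 <= \<tau>" "\<tau> <= 1" for \<tau>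
 proof -
  define \<omega> where "\<omega> = (1 - \<tau>) / (1 + \<tau>)"
  have \<omega>: "0 <= \<omega>" "\<omega> <= 1/2" using \<tau> by (auto simp: \<omega>_def divide_simps)
  define u where "u = complex_of_real (\<omega> / \<sigma>)"
  have "\<omega> / \<sigma> <= (1/2) / (99/100)" using \<omega> \<sigma> by (intro frac_le) auto
  then have u: "cmod u <= 51/100" "of_real \<sigma> * u = of_real \<omega>" unfolding u_def norm_of_real using \<omega> \<sigma> by auto
  have "\<zeta> (of_real \<omega>) = \<i> * of_real ((1 - \<omega>) / (1 + \<omega>))" by (simp add: \<zeta>_def)
  also have "(1 - \<omega>) / (1 + \<omega>) = \<tau>" using \<tau> by (simp add: \<omega>_def divide_simps)
  finally have gu: "g u = f (\<i> * of_real \<tau>)" by (simp add: g_def u)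
  have u1: "cmod u < 1" using u by simp
  have pu: "cmod (p u) <= 51/100" using Schwarz_Lemma(1)[OF ph p0 pb u1] u by simp
  have "g u - \<i> = - 2 * \<i> * p u / (1 + p u)" unfolding ginv(1)[OF u1] using ginv(2)[OF u1] by (simp add: field_simps)
  then have "cmod (g u - \<i>) = 2 * cmod (p u) / cmod (1 + p u)" by (simp add: norm_mult norm_divide)
  also have "\<dots> <= 2 * (51/100) / (49/100)"
   using pu norm_diff_ineq[of 1 "p u"] by (intro frac_le) auto
  finally show ?thesis by (simp add: gu)
 qed
 define u1 where "u1 = complex_of_real (1 / (2 * \<sigma>))"
 have "1 / (2 * \<sigma>) <= 1 / (2 * (99/100))" using \<sigma> by (intro divide_left_mono) auto
 then have u1b: "cmod u1 <= 51/100" "of_real \<sigma> * u1 = 1/2" "cmod u1 < 1" unfolding u1_def norm_of_real using \<sigma> by auto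
 have zu: "\<zeta> (of_real \<sigma> * u1) = \<i> / 3" by (simp add: \<zeta>_def u1b)
 have gu: "g u1 = f (\<i> / 3)" unfolding g_def zu ..
 define z where "z = p u1"
 have z1: "cmod (z - w / 2) <= 7 * e0\<^sup>2"
 proof -
  have e: "w * of_real \<sigma> * u1 = w / 2" using u1b(2) by (simp add: mult.assoc)
  have "cmod (z - w / 2) <= (1 - (cmod (w * of_real \<sigma>))\<^sup>2) * (cmod u1)\<^sup>2 / (1 - cmod u1)"
   using sl(2)[OF u1b(3)] unfolding e z_def .
  also have "\<dots> <= (13 * e0\<^sup>2) * (51/100)\<^sup>2 / (49/100)"
   using K u1b by (intro frac_le mult_mono power_mono) auto
  finally show ?thesis by (simp add: e0_def power2_eq_square)
 qed
 \<comment> \<open>Cauchy's estimate on a disc of radius 2/10 about \<open>u1\<close> for the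
   difference of \<open>p\<close> and its linear part.\<close>
 have dpu: "cmod (deriv p u1 / of_real \<sigma> - w) <= 421 * e0\<^sup>2"
 proof -
  define k where "k u = p u - w * of_real \<sigma> * u" for u
  have sub: "ball u1 (2/10) \<subseteq> ball 0 (71/100)"
  proof
   fix v assume "v \<in> ball u1 (2/10)"
   then show "v \<in> ball 0 (71/100)" using u1b(1) norm_triangle_ineq[of u1 "v - u1"] by (simp add: dist_norm norm_minus_commute)
  qed
  have kh: "k holomorphic_on ball u1 (2/10)" unfolding k_def
   by (intro holomorphic_intros holomorphic_on_subset[OF ph]) (use sub in force)
  have "cmod (deriv k u1) <= 2 * (32 * e0\<^sup>2) / (2/10)"
  proof (rule deriv_bound[OF kh])
   fix v assume "v \<in> ball u1 (2/10)"
   then have v: "cmod v <= 71/100" using sub by fastforce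
   then have "cmod (k v) <= (1 - (cmod (w * of_real \<sigma>))\<^sup>2) * (cmod v)\<^sup>2 / (1 - cmod v)"
    using sl(2)[of v] by (simp add: k_def)
   also have "\<dots> <= (13 * e0\<^sup>2) * (71/100)\<^sup>2 / (29/100)"
    using K v by (intro frac_le mult_mono power_mono) auto
   also have "\<dots> <= 32 * e0\<^sup>2" by (simp add: e0_def power2_eq_square)
   finally show "cmod (k v) <= 32 * e0\<^sup>2" .
  qed simp
  moreover have "deriv k u1 = deriv p u1 - w * of_real \<sigma>"
  proof (rule DERIV_imp_deriv)
   have "(p has_field_derivative deriv p u1) (at u1)"
    using holomorphic_derivI[OF ph open_ball, of u1] u1b by simp
   then show "(k has_field_derivative deriv p u1 - w * of_real \<sigma>) (at u1)"
    unfolding k_def by (auto intro!: derivative_eq_intros)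
  qed
  ultimately have "cmod (deriv p u1 - w * of_real \<sigma>) <= 320 * e0\<^sup>2" by simp
  moreover have "deriv p u1 / of_real \<sigma> - w = (deriv p u1 - w * of_real \<sigma>) / of_real \<sigma>"
   using \<sigma> by (simp add: field_simps)
  ultimately have "cmod (deriv p u1 / of_real \<sigma> - w) <= 320 * e0\<^sup>2 / \<sigma>"
   using \<sigma> by (simp add: norm_divide divide_right_mono)
  also have "\<dots> <= 320 * e0\<^sup>2 / (99/100)" using \<sigma> by (intro divide_left_mono) auto
  finally show ?thesis by (simp add: e0_def power2_eq_square)
 qed
 note fe = final_estimate[OF w w_up z1 dpu]
 have Fz: "f (\<i> / 3) = \<i> * (1 - z) / (1 + z)" using ginv(1)[OF u1b(3)] by (simp add: gu z_def)
 have ImF: "Im (f (\<i> / 3)) = (1 - (cmod z)\<^sup>2) / (cmod (1 + z))\<^sup>2"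
  unfolding Fz by (rule cayley_scalar(2)) (use fe in simp)
 show "Im (f (\<i> / 3)) <= 2 / 5" unfolding ImF by (rule fe)
 fix d assume d: "(f has_field_derivative d) (at (\<i> / 3))"
 have "(g has_field_derivative d * (- 2 * \<i> * of_real \<sigma> / (1 + of_real \<sigma> * u1)\<^sup>2)) (at u1)"
  by (rule dg[OF u1b(3)]) (simp only: zu d)
 then have "deriv p u1 = - 2 * \<i> * (d * (- 2 * \<i> * of_real \<sigma> / (1 + of_real \<sigma> * u1)\<^sup>2)) / (g u1 + \<i>)\<^sup>2"
  by (intro DERIV_imp_deriv dp u1b)
 also have "g u1 + \<i> = 2 * \<i> / (1 + z)"
  unfolding ginv(1)[OF u1b(3)] z_def using ginv(2)[OF u1b(3)] by (simp add: field_simps)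
 also have "1 + of_real \<sigma> * u1 = 3/2" unfolding u1b by simp
 also have "- 2 * \<i> * (d * (- 2 * \<i> * of_real \<sigma> / (3/2)\<^sup>2)) / (2 * \<i> / (1 + z))\<^sup>2
   = of_real \<sigma> * (of_real (4/9) * d * (1 + z)\<^sup>2)"
  by (simp add: power2_eq_square field_simps)
 finally have D: "deriv p u1 / of_real \<sigma> = of_real (4/9) * d * (1 + z)\<^sup>2"
  using \<sigma> by simp
 have E: "of_real (3/4) * (deriv p u1 / of_real \<sigma>) / (1 + z)\<^sup>2 = of_real (1/3) * d"
  unfolding D using ginv(2)[OF u1b(3)] by (simp add: z_def)
 show "cmod (of_real (1/3) * d - of_real (Im (f (\<i> / 3)))) <= e0 * Im (f (\<i> / 3))"
  using fe(3) unfolding ImF E .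
qed

text \<open>For unit vectors, polarisation writes four times the pairing as a combination of four
  values of the quadratic form at vectors whose squared norms add up to 8; hence the factor
  2.\<close>

lemma numerical_radius:
 fixes B :: mat2
 assumes e: "!!x. cmod (hin x (B *v x)) <= e * (norm x)\<^sup>2"
 shows "norm (B *v x) <= 2 * e * norm x"
proof (cases "x = 0 \<or> B *v x = 0")
 case True
 have "0 <= e" using order_trans[OF norm_ge_zero e[of "cvec 1 0"]] by (simp add: norm_vec2)
 then show ?thesis using True by (auto simp: vec2_eq_iff norm_vec2)
next
 case False
 define v where "v = of_real (1 / norm x) *s x"
 define u where "u = of_real (1 / norm (B *v v)) *s (B *v v)"
 have nx: "norm x > 0" using False by simp
 have nv: "norm v = 1" using False by (simp add: v_def norm_smult_vec2 norm_divide)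
 have Bv: "B *v v = of_real (1 / norm x) *s (B *v x)" by (simp only: v_def mat2_vec_lin)
 have nBv: "norm (B *v v) = norm (B *v x) / norm x" unfolding Bv norm_smult_vec2 norm_of_real using nx by simp
 then have nBv0: "norm (B *v v) > 0" using False nx by simp
 then have nu: "norm u = 1" by (simp add: u_def norm_smult_vec2 norm_divide)
 have huB: "hin u (B *v v) = of_real (norm (B *v v))"
  unfolding u_def hin_scale hin_self using nBv0 by (simp add: power2_eq_square)
 define q where "q y = hin y (B *v y)" for y
 have "4 * hin u (B *v v) = q (v + u) - q (v - u) + \<i> * q (v + \<i> *s u) - \<i> * q (v - \<i> *s u)"
  by (simp add: q_def mat2_vec_lin hin_add hin_scale algebra_simps)
 also have "cmod \<dots> <= cmod (q (v + u)) + cmod (q (v - u)) + cmod (q (v + \<i> *s u)) + cmod (q (v - \<i> *s u))"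
 proof -
  have t: "cmod (a - b + c - d) <= cmod a + cmod b + cmod c + cmod d" for a b c d
   using norm_triangle_ineq4[of "a - b + c" d] norm_triangle_ineq[of "a - b" c] norm_triangle_ineq4[of a b] by linarith
  show ?thesis using t[of "q (v + u)" "q (v - u)" "\<i> * q (v + \<i> *s u)" "\<i> * q (v - \<i> *s u)"] by (simp add: norm_mult)
 qed
 also have "\<dots> <= e * (norm (v + u))\<^sup>2 + e * (norm (v - u))\<^sup>2 + e * (norm (v + \<i> *s u))\<^sup>2 + e * (norm (v - \<i> *s u))\<^sup>2"
  unfolding q_def by (intro add_mono e)
 also have "\<dots> = 8 * e"
  unfolding norm_add_sq norm_diff_sq norm_smult_vec2 nv nu by (simp add: algebra_simps)
 finally have "norm (B *v v) <= 2 * e" unfolding huB by (simp add: norm_mult)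
 then show ?thesis using nx unfolding nBv by (simp add: divide_simps)
qed

text \<open>Write \<open>w *v x\<close> as \<open>l *s x\<close> plus an orthogonal vector
  \<open>t\<close>. The vector \<open>t\<close> is of order \<open>e0\<close>, and by orthogonality
  it enters the length only through its square. Hence \<open>cmod l\<close> falls short of 1 only by
  second order, although \<open>l\<close> is merely known to lie within \<open>e0\<close> of
  1.\<close>

lemma near_unitary_numerical:
 fixes w :: mat2
 assumes r: "!!x. cmod (hin x (w *v x) - of_real ((norm x)\<^sup>2)) <= e0 * (norm x)\<^sup>2"
  and u: "!!x. (1 - e0\<^sup>2) * norm x <= norm (w *v x)"
 shows "(1 - 5 * e0\<^sup>2) * (norm x)\<^sup>2 <= cmod (hin x (w *v x))"
proof (cases "x = 0")
 case True then show ?thesis by simp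
next
 case False
 then have nx: "norm x > 0" by simp
 define l where "l = hin x (w *v x) / of_real ((norm x)\<^sup>2)"
 define t where "t = w *v x - l *s x"
 have o: "hin x t = 0" unfolding t_def hin_add hin_scale hin_self l_def using nx by simp
 have "(norm (w *v x))\<^sup>2 = (cmod l)\<^sup>2 * (norm x)\<^sup>2 + (norm t)\<^sup>2"
  using norm_orth_add[OF o, of l 1] by (simp add: t_def)
 moreover have "(norm t)\<^sup>2 <= (2 * e0 * norm x)\<^sup>2"
 proof -
  have "norm ((w - mat 1) *v x) <= 2 * e0 * norm x"
   by (rule numerical_radius) (use r in \<open>simp add: mat2_vec_lin hin_add hin_self\<close>)
  then have "(norm (w *v x - x))\<^sup>2 <= (2 * e0 * norm x)\<^sup>2" by (intro power_mono) (auto simp: mat2_vec_lin)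
  moreover have "(l - 1) *s x + 1 *s t = w *v x - x" by (simp add: t_def vec2_eq_iff algebra_simps)
  then have "(norm (w *v x - x))\<^sup>2 = (cmod (l - 1))\<^sup>2 * (norm x)\<^sup>2 + (norm t)\<^sup>2"
   using norm_orth_add[OF o, of "l - 1" 1] by (simp only: norm_one power_one mult_1)
  moreover have "0 <= (cmod (l - 1))\<^sup>2 * (norm x)\<^sup>2" by simp
  ultimately show ?thesis by linarith
 qed
 moreover have "((1 - e0\<^sup>2) * norm x)\<^sup>2 <= (norm (w *v x))\<^sup>2"
  by (rule power_mono[OF u]) (simp add: e0_def power2_eq_square)
 ultimately have "(1 - e0\<^sup>2)\<^sup>2 * (norm x)\<^sup>2 <= (cmod l)\<^sup>2 * (norm x)\<^sup>2 + 4 * e0\<^sup>2 * (norm x)\<^sup>2"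
  by (simp add: power_mult_distrib)
 then have "((1 - e0\<^sup>2)\<^sup>2 - 4 * e0\<^sup>2) * (norm x)\<^sup>2 <= (cmod l)\<^sup>2 * (norm x)\<^sup>2" by (simp add: left_diff_distrib)
 then have "(1 - e0\<^sup>2)\<^sup>2 - 4 * e0\<^sup>2 <= (cmod l)\<^sup>2" using nx by simp
 moreover have "(1 - 5 * e0\<^sup>2)\<^sup>2 <= (1 - e0\<^sup>2)\<^sup>2 - 4 * e0\<^sup>2" by (simp add: e0_def power2_eq_square)
 ultimately have "(1 - 5 * e0\<^sup>2)\<^sup>2 <= (cmod l)\<^sup>2" by linarith
 then have "1 - 5 * e0\<^sup>2 <= cmod l" by (rule power2_le_imp_le) simp
 moreover have "cmod l * (norm x)\<^sup>2 = cmod (hin x (w *v x))"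
  unfolding l_def norm_divide norm_of_real using nx by simp
 ultimately show ?thesis using mult_right_mono[of "1 - 5 * e0\<^sup>2" "cmod l" "(norm x)\<^sup>2"] by simp
qed

subsection \<open>Descent towards the Shilov boundary\<close>

text \<open>A condition that is invariant under real affine changes of the target: after normalising
  at \<open>iy y\<close> it says that the numerical values of the derivative on \<open>mat 1\<close>
  lie within \<open>e0\<close> of 1. It excludes the unitary freedom left by
  \<open>near_unitary\<close>.\<close>

definition state :: "(mat2 => mat2) => real => bool"
 where "state F y \<longleftrightarrow> (let Z = cscale (\<i> * of_real y) (mat 1) in
  \<forall>x. cmod (of_real y * hin x (dF F (mat 1) Z *v x) - of_real (Im (hin x (F Z *v x)))) <= e0 * Im (hin x (F Z *v x)))"

definition good :: "real => (mat2 => mat2) => (mat2 => mat2) => bool"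
 where "good R F G \<longleftrightarrow> pair F G R & state F 1"

abbreviation iy :: "real => mat2" where "iy y \<equiv> cscale (\<i> * of_real y) (mat 1)"

lemma norm_cscale_one: "norm (cscale t (mat 1)) <= 2 * cmod t"
proof -
 have "norm (mat 1 :: mat2) <= 2" by (simp add: norm_mat2 real_le_lsqrt)
 then show ?thesis unfolding norm_cscale using mult_left_mono[of "norm (mat 1 :: mat2)" 2 "cmod t"] by simp
qed

lemma cscale_one_siegel: "0 < Im t ==> cscale t (mat 1) \<in> siegel"
 by (simp add: siegel_iff)

lemma hin_ii_self: "hin x (cscale t (mat 1) *v x) = t * of_real ((norm x)\<^sup>2)"
proof -
 have "cscale t (mat 1) *v x = t *s x" by (simp add: vec2_eq_iff)
 then show ?thesis by (simp only: hin_scale hin_self)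
qed

lemma norm_hin_bound:
 assumes S: "W \<in> Sym" and b: "!!x. cmod (hin x (W *v x)) <= K * (norm x)\<^sup>2"
 shows "norm W <= 6 * K"
proof -
 have e1: "cmod (W$1$1) <= K" using b[of "cvec 1 0"] by (simp add: hin_def norm_vec2)
 have e2: "cmod (W$2$2) <= K" using b[of "cvec 0 1"] by (simp add: hin_def norm_vec2)
 have "cmod (hin (cvec 1 1) (W *v cvec 1 1)) <= 2 * K" using b[of "cvec 1 1"] by (simp add: norm_vec2_sq)
 moreover have "2 * W$1$2 = hin (cvec 1 1) (W *v cvec 1 1) - W$1$1 - W$2$2" using S by (simp add: hin_def Sym_iff)
 ultimately have "cmod (2 * W$1$2) <= 4 * K"
  using e1 e2 norm_triangle_ineq4[of "hin (cvec 1 1) (W *v cvec 1 1) - W$1$1" "W$2$2"]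
   norm_triangle_ineq4[of "hin (cvec 1 1) (W *v cvec 1 1)" "W$1$1"] by simp
 then have "cmod (W$1$2) <= 2 * K" by (simp add: norm_mult)
 then show ?thesis using norm_mat2_le[of W] e1 e2 S by (simp add: Sym_iff)
qed

text \<open>At \<open>iy y\<close> the triangular matrix of the source is the scalar
  \<open>sqrt y\<close>, so normalising only rescales the source by \<open>y\<close>. The bound 9
  puts \<open>F (iy y)\<close> into the half ball of radius \<open>R/2\<close>, since
  \<open>6 * 9\<close> is below 100.\<close>

lemma local_normal_form:
 assumes P: "pair F G R" and y: "0 < y" "y <= 1" "y <= q"
  and im: "!!x. Im (hin x (F (iy y) *v x)) <= q * (norm x)\<^sup>2"
  and b: "!!x. cmod (hin x (F (iy y) *v x)) <= 9 * (norm x)\<^sup>2"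
  and R: "12 * q * \<rho> <= R" "\<rho> > 2" "R >= 200"
 obtains a b c F' G' where "a > 0" "c > 0" "tri a b c (mat 1) = imm (F (iy y))" "pair F' G' \<rho>"
  "!!V. V \<in> Sym ==> tri a b c (dF F' V ii) = cscale (of_real y) (dF F V (iy y))"
proof -
 have FP: "hol F (HB R)" "!!V. V \<in> HB R ==> F V \<in> siegel" "prepair F G R" using P by (auto simp: pair_def prepair_def)
 have s: "iy y \<in> siegel" by (rule cscale_one_siegel) (use y in simp)
 have "norm (iy y) <= 2" using norm_cscale_one[of "\<i> * of_real y"] y by (simp add: norm_mult)
 then have Z: "iy y \<in> HB (R/2)" "iy y \<in> HB R" using s R by (auto simp: HB_def)
 have W0: "F (iy y) \<in> siegel" by (rule FP(2)[OF Z(2)])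
 have "norm (F (iy y)) <= 6 * 9" by (rule norm_hin_bound[OF siegel_Sym[OF W0] b])
 then have W: "F (iy y) \<in> HB (R/2)" using W0 R by (auto simp: HB_def)
 have t1: "Im (iy y$1$1) + Im (iy y$2$2) <= 2 * q" using y by simp
 have t2: "Im (F (iy y)$1$1) + Im (F (iy y)$2$2) <= 2 * q"
  using im[of "cvec 1 0"] im[of "cvec 0 1"] by (simp add: hin_def norm_vec2)
 have R3: "3 * (2 * q) * \<rho> <= R / 2" using R by simp
 obtain a b c a' b' c' F' G' where N: "a > 0" "c > 0" "a' > 0" "c' > 0"
  "tri a b c (mat 1) = imm (iy y)" "tri a' b' c' (mat 1) = imm (F (iy y))" "pair F' G' \<rho>"
  "!!V. V \<in> Sym ==> tri a' b' c' (dF F' V ii) = dF F (tri a b c V) (iy y)"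
  using normalise[OF FP(3) Z(1) W t1 t2 R(2) R3] by metis
 have e: "complex_of_real (a\<^sup>2) = of_real y" "complex_of_real (a * b) = 0" "complex_of_real (b\<^sup>2 + c\<^sup>2) = of_real y"
  using N(5) unfolding mat2_eq_iff tri_def imm_def by simp_all
 have "a\<^sup>2 = y" "b = 0" "c\<^sup>2 = y" using e N(1) unfolding of_real_eq_iff of_real_eq_0_iff by auto
 then have abc: "a\<^sup>2 = y" "b = 0" "a * c = y" "c\<^sup>2 = y"
  using N(1,2) by (auto simp: power2_eq_square) (metis less_imp_le power2_eq_iff_nonneg power2_eq_square)
 have "tri a b c V = cscale (of_real y) V" if "V \<in> Sym" for V
  using that unfolding tri_def abc by (simp add: mat2_eq_iff Sym_iff)
 then have "tri a' b' c' (dF F' V ii) = cscale (of_real y) (dF F V (iy y))" if "V \<in> Sym" for V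
  using N(8)[OF that] dF_cscale[OF FP(1) Z(2) that] that by simp
 then show thesis using that[of a' c' b' F' G'] N by blast
qed

lemma hol_diag_deriv:
 assumes F: "hol F (HB R)" and t: "cscale t (mat 1) \<in> HB R"
 shows "((%t. hin x (F (cscale t (mat 1)) *v x)) has_field_derivative hin x (dF F (mat 1) (cscale t (mat 1)) *v x)) (at t)"
proof (rule hin_deriv)
 fix i j
 show "((%t. F (cscale t (mat 1)) $ i $ j) has_field_derivative dF F (mat 1) (cscale t (mat 1)) $ i $ j) (at t)"
  using gholo_line_deriv[OF hol_gholo[OF F, of i j], of 0 "mat 1" t] t by simp
qed

text \<open>For each nonzero \<open>x\<close> the scalar function
  \<open>hin x (F (cscale t (mat 1)) *v x)\<close>, normalised at height \<open>y\<close>, satisfies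
  the hypotheses of \<open>scalar_step\<close>. Its derivative at \<i> is a numerical value of the
  renormalised derivative \<open>w\<close>, for which \<open>near_unitary_numerical\<close> supplies
  the second order bound on the modulus.\<close>

lemma descent_step:
 assumes P: "pair F G R" and y: "0 < y" "y <= 1" "y <= q"
  and im: "!!x. Im (hin x (F (iy y) *v x)) <= q * (norm x)\<^sup>2"
  and b: "!!x. cmod (hin x (F (iy y) *v x)) <= 9 * (norm x)\<^sup>2"
  and st: "state F y"
  and R: "12 * q * \<rho> <= R" "\<rho> > 2" "R >= 2 * 10^9"
  and nu: "!!F' G'. pair F' G' \<rho> ==> \<forall>x. (1 - e0\<^sup>2) * norm x <= norm (dF F' (mat 1) ii *v x)"
 shows "state F (y/3)"
  "!!x. Im (hin x (F (iy (y/3)) *v x)) <= 2/5 * Im (hin x (F (iy y) *v x))"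
  "!!x \<tau>. 1/3 <= \<tau> ==> \<tau> <= 1 ==> cmod (hin x (F (iy (\<tau> * y)) *v x) - hin x (F (iy y) *v x)) <= 3 * Im (hin x (F (iy y) *v x))"
proof -
 have FP: "hol F (HB R)" "!!V. V \<in> HB R ==> F V \<in> siegel" using P by (auto simp: pair_def prepair_def)
 let ?Z = "iy y"
 have HBt: "cscale (of_real y * t) (mat 1) \<in> HB R" if "0 < Im t" "cmod t < 10 ^ 9" for t
 proof -
  have "norm (cscale (of_real y * t) (mat 1)) <= 2 * (y * cmod t)"
   using norm_cscale_one[of "of_real y * t"] y by (simp add: norm_mult)
  also have "\<dots> <= 2 * (1 * cmod t)" using y by (intro mult_left_mono mult_right_mono) auto
  also have "\<dots> < R" using that R by simp
  finally show ?thesis using that y by (simp add: HB_def cscale_one_siegel)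
 qed
 have R200: "R >= 200" using R(3) by simp
 obtain a b' c F' G' where N: "a > 0" "c > 0" "tri a b' c (mat 1) = imm (F ?Z)" "pair F' G' \<rho>"
  "!!V. V \<in> Sym ==> tri a b' c (dF F' V ii) = cscale (of_real y) (dF F V ?Z)"
  using local_normal_form[OF P y im b R(1,2) R200] by metis
 define w where "w = dF F' (mat 1) ii"
 have F': "hol F' (HB \<rho>)" using N(4) by (auto simp: pair_def prepair_def)
 have iB: "ii \<in> HB \<rho>" using R ii_HB by simp
 have wS: "w \<in> Sym" unfolding w_def by (rule hol_dF_Sym[OF F' iB]) simp
 have ZB: "?Z \<in> HB R" using HBt[of \<i>] by (simp add: mult.commute)
 have FZ: "F ?Z \<in> siegel" by (rule FP(2)[OF ZB])
 have h1: "hin (trv a b' c x) (w *v trv a b' c x) = of_real y * hin x (dF F (mat 1) ?Z *v x)" for x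
  unfolding hin_tri[OF wS, symmetric] unfolding w_def N(5)[OF Sym_simps(3)] by (simp add: mat2_vec_lin hin_scale)
 have h2: "(norm (trv a b' c x))\<^sup>2 = Im (hin x (F ?Z *v x))" for x
 proof -
  have "hin (trv a b' c x) (mat 1 *v trv a b' c x) = of_real (Im (hin x (F ?Z *v x)))"
   unfolding hin_tri[OF Sym_simps(3), symmetric] N(3) by (rule hin_imm[OF siegel_Sym[OF FZ]])
  then show ?thesis unfolding matrix_vector_mul_lid hin_self of_real_eq_iff .
 qed
 \<comment> \<open>As \<open>x\<close> varies, \<open>trv a b' c x\<close> runs through all vectors,
   so the state of \<open>F\<close> controls the whole numerical range of \<open>w\<close>.\<close>
 have surj: "\<exists>x. trv a b' c x = v" for v
  using N(1,2) by (intro exI[of _ "cvec ((v$1 - of_real b' * (v$2 / of_real c)) / of_real a) (v$2 / of_real c)"])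
   (simp add: trv_def vec2_eq_iff)
 have num: "cmod (hin v (w *v v) - of_real ((norm v)\<^sup>2)) <= e0 * (norm v)\<^sup>2" for v
 proof -
  obtain x where x: "trv a b' c x = v" using surj by blast
  show ?thesis using st unfolding state_def Let_def x[symmetric] h1 h2 by blast
 qed
 have lam: "(1 - 5 * e0\<^sup>2) * (norm v)\<^sup>2 <= cmod (hin v (w *v v))" for v
  by (rule near_unitary_numerical[OF num]) (use nu[OF N(4)] in \<open>simp add: w_def\<close>)
 have main: "Im (hin x (F (iy (y/3)) *v x)) <= 2/5 * Im (hin x (F ?Z *v x)) &
  (\<forall>\<tau>. 1/3 <= \<tau> --> \<tau> <= 1 --> cmod (hin x (F (iy (\<tau> * y)) *v x) - hin x (F ?Z *v x)) <= 3 * Im (hin x (F ?Z *v x))) &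
  cmod (of_real (y/3) * hin x (dF F (mat 1) (iy (y/3)) *v x) - of_real (Im (hin x (F (iy (y/3)) *v x)))) <= e0 * Im (hin x (F (iy (y/3)) *v x))"
  if x: "x ~= 0" for x
 proof -
  define h where "h t = hin x (F (cscale t (mat 1)) *v x)" for t
  define C where "C = h (\<i> * of_real y)"
  define V where "V = Im C"
  have V: "V > 0" unfolding V_def C_def h_def using siegel_pos[OF FZ x] by simp
  \<comment> \<open>A real affine change of the values and a scaling of the argument make
    \<open>f\<close> fix \<i>.\<close>
  define f where "f t = (h (of_real y * t) - of_real (Re C)) / of_real V" for t
  have dh: "(h has_field_derivative hin x (dF F (mat 1) (cscale t (mat 1)) *v x)) (at t)" if "cscale t (mat 1) \<in> HB R" for t
   unfolding h_def[abs_def] by (rule hol_diag_deriv[OF FP(1) that])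
  have df: "(f has_field_derivative of_real y * hin x (dF F (mat 1) (cscale (of_real y * t) (mat 1)) *v x) / of_real V) (at t)"
   if "0 < Im t" "cmod t < 10 ^ 9" for t
  proof -
   have "((%t. h (of_real y * t)) has_field_derivative hin x (dF F (mat 1) (cscale (of_real y * t) (mat 1)) *v x) * of_real y) (at t)"
    by (rule DERIV_chain2[where f = h and g = "%t. of_real y * t", OF dh[OF HBt[OF that]]]) (auto intro!: derivative_eq_intros)
   then show ?thesis unfolding f_def using V by (auto intro!: derivative_eq_intros simp: mult.commute)
  qed
  have fhol: "f holomorphic_on {\<zeta>. 0 < Im \<zeta> & cmod \<zeta> < 10 ^ 9}"
   unfolding holomorphic_on_def field_differentiable_def using df has_field_derivative_at_within by blast
  have fpos: "0 < Im (f t)" if "0 < Im t" "cmod t < 10 ^ 9" for t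
  proof -
   have "0 < Im (h (of_real y * t))" unfolding h_def by (rule siegel_pos[OF FP(2)[OF HBt[OF that]] x])
   then show ?thesis using V by (simp add: f_def Im_divide_of_real)
  qed
  have C: "C = of_real (Re C) + \<i> * of_real V" by (simp add: V_def complex_eq_iff)
  have yi: "of_real y * \<i> = \<i> * of_real y" by simp
  have fi: "f \<i> = \<i>"
  proof -
   have "h (of_real y * \<i>) = of_real (Re C) + \<i> * of_real V" unfolding yi C_def[symmetric] by (rule C)
   then show ?thesis using V by (simp add: f_def)
  qed
  define \<mu> where "\<mu> = of_real y * hin x (dF F (mat 1) ?Z *v x) / of_real V"
  have dfi: "(f has_field_derivative \<mu>) (at \<i>)" using df[of \<i>] unfolding yi \<mu>_def by simp
  let ?v = "trv a b' c x"
  have nv: "(norm ?v)\<^sup>2 = V" unfolding h2 V_def C_def h_def ..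
  have lv: "\<mu> = hin ?v (w *v ?v) / of_real V" unfolding h1 \<mu>_def ..
  have l1: "cmod (\<mu> - 1) <= e0"
  proof -
   have e: "\<mu> - 1 = (hin ?v (w *v ?v) - of_real V) / of_real V" unfolding lv using V by (simp add: diff_divide_distrib)
   have "cmod (\<mu> - 1) = cmod (hin ?v (w *v ?v) - of_real V) / V" unfolding e norm_divide norm_of_real using V by simp
   also have "\<dots> <= e0 * V / V" by (rule divide_right_mono) (use num[of ?v] V in \<open>auto simp: nv simp del: of_real_power\<close>)
   finally show ?thesis using V by simp
  qed
  have l2: "1 - 5 * e0\<^sup>2 <= cmod \<mu>"
   using lam[of ?v] V unfolding nv lv norm_divide norm_of_real by (simp add: divide_simps)
  have S: "Im (f (\<i> / 3)) <= 2 / 5" "1/3 <= \<tau> ==> \<tau> <= 1 ==> cmod (f (\<i> * of_real \<tau>) - \<i>) <= 3"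
   "(f has_field_derivative d) (at (\<i> / 3)) ==>
    cmod (of_real (1/3) * d - of_real (Im (f (\<i> / 3)))) <= e0 * Im (f (\<i> / 3))" for \<tau> d
   using scalar_step[OF fhol _ fi dfi l1 l2] fpos by blast+
  have hf: "h (of_real y * t) = of_real (Re C) + of_real V * f t" for t using V by (simp add: f_def)
  have y3: "of_real y * (\<i> / 3) = \<i> * of_real (y / 3)" by simp
  have i1: "Im (h (\<i> * of_real (y/3))) = V * Im (f (\<i> / 3))" using hf[of "\<i>/3"] unfolding y3 by simp
  have "Im (h (\<i> * of_real (y/3))) <= 2/5 * V" unfolding i1 using mult_left_mono[OF S(1), of V] V by simp
  moreover have "cmod (h (\<i> * of_real (\<tau> * y)) - C) <= 3 * V" if "1/3 <= \<tau>" "\<tau> <= 1" for \<tau>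
  proof -
   have "h (\<i> * of_real (\<tau> * y)) - C = of_real V * (f (\<i> * of_real \<tau>) - \<i>)"
   proof -
    have "of_real y * (\<i> * of_real \<tau>) = \<i> * of_real (\<tau> * y)" by simp
    then have "h (\<i> * of_real (\<tau> * y)) = of_real (Re C) + of_real V * f (\<i> * of_real \<tau>)" using hf by metis
    then show ?thesis by (subst C) (simp add: algebra_simps)
   qed
   then have "cmod (h (\<i> * of_real (\<tau> * y)) - C) = V * cmod (f (\<i> * of_real \<tau>) - \<i>)" using V by (simp add: norm_mult)
   also have "\<dots> <= V * 3" using S(2)[OF that] V by (intro mult_left_mono) auto
   finally show ?thesis by simp
  qed
  moreover have "cmod (of_real (y/3) * hin x (dF F (mat 1) (iy (y/3)) *v x) - of_real (Im (h (\<i> * of_real (y/3))))) <= e0 * Im (h (\<i> * of_real (y/3)))"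
  proof -
   define d where "d = of_real y * hin x (dF F (mat 1) (iy (y/3)) *v x) / of_real V"
   have "(f has_field_derivative d) (at (\<i> / 3))" using df[of "\<i>/3"] unfolding y3 d_def by simp
   from S(3)[OF this] have "V * cmod (of_real (1/3) * d - of_real (Im (f (\<i> / 3)))) <= V * (e0 * Im (f (\<i> / 3)))"
    using V by (intro mult_left_mono) auto
   moreover have "V * cmod (of_real (1/3) * d - of_real (Im (f (\<i> / 3)))) = cmod (of_real V * (of_real (1/3) * d - of_real (Im (f (\<i> / 3)))))"
    using V by (simp add: norm_mult)
   moreover have "of_real V * (of_real (1/3) * d - of_real (Im (f (\<i> / 3)))) = of_real (y/3) * hin x (dF F (mat 1) (iy (y/3)) *v x) - of_real (Im (h (\<i> * of_real (y/3))))"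
    unfolding i1 d_def using V by (simp add: algebra_simps)
   ultimately show ?thesis unfolding i1 by (simp add: mult_ac)
  qed
  ultimately show ?thesis unfolding h_def C_def V_def by blast
 qed
 show "state F (y/3)" unfolding state_def Let_def
 proof
  fix x :: "complex^2"
  show "cmod (of_real (y/3) * hin x (dF F (mat 1) (iy (y/3)) *v x) - of_real (Im (hin x (F (iy (y/3)) *v x)))) <= e0 * Im (hin x (F (iy (y/3)) *v x))"
   using main[of x] by (cases "x = 0") (auto simp: hin_def)
 qed
 show "Im (hin x (F (iy (y/3)) *v x)) <= 2/5 * Im (hin x (F (iy y) *v x))" for x
  using main[of x] by (cases "x = 0") (auto simp: hin_def)
 show "cmod (hin x (F (iy (\<tau> * y)) *v x) - hin x (F (iy y) *v x)) <= 3 * Im (hin x (F (iy y) *v x))"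
  if "1/3 <= \<tau>" "\<tau> <= 1" for x \<tau>
  using main[of x] that by (cases "x = 0") (auto simp: hin_def)
qed

lemma power_bracket:
 fixes y :: real
 assumes "0 < y" "y <= 1"
 obtains n where "(1/3) ^ Suc n < y" "y <= (1/3) ^ n"
proof -
 obtain N where N: "(1/3) ^ N < y" using real_arch_pow_inv[OF assms(1), of "1/3"] by auto
 define m where "m = (LEAST m. (1/3) ^ m < y)"
 have m: "(1/3) ^ m < y" unfolding m_def using N by (rule LeastI)
 then obtain n where n: "m = Suc n" using assms by (cases m) auto
 then have "\<not> (1/3) ^ n < y" using not_less_Least[of n "%m. (1/3) ^ m < y"] by (simp add: m_def)
 then show thesis using that[of n] m n by simp
qed

text \<open>Normalisation multiplies both determinants by the same factor \<open>k\<close>, so their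
  ratio may be estimated for the renormalised map, where the denominator is at least 1/2 in
  modulus.\<close>

lemma state_dt:
 assumes P: "pair F G R" and y: "0 < y" "y <= 1" "y <= q"
  and im: "!!x. Im (hin x (F (iy y) *v x)) <= q * (norm x)\<^sup>2"
  and b: "!!x. cmod (hin x (F (iy y) *v x)) <= 9 * (norm x)\<^sup>2"
  and R: "12 * q * \<rho> <= R" "\<rho> > 2" "R >= 200" and \<epsilon>: "0 < \<epsilon>" "\<epsilon> <= 1/2"
  and nu: "!!F' G'. pair F' G' \<rho> ==> (\<forall>v. cmod (dt (dF F' (nl v) ii)) <= \<epsilon> * norm v ^ 4) & 1 - \<epsilon> <= cmod (dt (dF F' (mat 1) ii))"
 shows "dt (dF F (mat 1) (iy y)) ~= 0"
  "cmod (dt (dF F (nl v) (iy y))) <= 2 * \<epsilon> * norm v ^ 4 * cmod (dt (dF F (mat 1) (iy y)))"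
proof -
 obtain a b' c F' G' where N: "a > 0" "c > 0" "tri a b' c (mat 1) = imm (F (iy y))" "pair F' G' \<rho>"
  "!!V. V \<in> Sym ==> tri a b' c (dF F' V ii) = cscale (of_real y) (dF F V (iy y))"
  using local_normal_form[OF P y im b R] by metis
 have F': "hol F' (HB \<rho>)" using N(4) by (auto simp: pair_def prepair_def)
 have iB: "ii \<in> HB \<rho>" using R ii_HB by simp
 define k where "k = (a * c)\<^sup>2 / y\<^sup>2"
 have k: "k > 0" using N y by (simp add: k_def)
 have e: "dt (dF F V (iy y)) = of_real k * dt (dF F' V ii)" if V: "V \<in> Sym" for V
 proof -
  have "(of_real y)\<^sup>2 * dt (dF F V (iy y)) = dt (cscale (of_real y) (dF F V (iy y)))" by (rule dt_cscale[symmetric])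
  also have "\<dots> = of_real ((a * c)\<^sup>2) * dt (dF F' V ii)"
   unfolding N(5)[OF V, symmetric] by (rule tri_dt[OF hol_dF_Sym[OF F' iB V]])
  finally show ?thesis using y by (simp add: k_def field_simps)
 qed
 have n1: "1/2 <= cmod (dt (dF F' (mat 1) ii))" using nu[OF N(4)] \<epsilon> by linarith
 then show "dt (dF F (mat 1) (iy y)) ~= 0" unfolding e[OF Sym_simps(3)] using k by auto
 have "cmod (dt (dF F' (nl v) ii)) <= \<epsilon> * norm v ^ 4" using nu[OF N(4)] by blast
 also have "\<dots> <= \<epsilon> * norm v ^ 4 * (2 * cmod (dt (dF F' (mat 1) ii)))"
  using n1 \<epsilon> mult_left_mono[of 1 "2 * cmod (dt (dF F' (mat 1) ii))" "\<epsilon> * norm v ^ 4"] by simp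
 finally show "cmod (dt (dF F (nl v) (iy y))) <= 2 * \<epsilon> * norm v ^ 4 * cmod (dt (dF F (mat 1) (iy y)))"
  unfolding e[OF nl_Sym] e[OF Sym_simps(3)] norm_mult norm_of_real using k by (simp add: mult_ac)
qed

text \<open>At height \<open>(1/3)^n\<close> the imaginary part is at most \<open>(2/5)^n\<close>,
  so the requirement \<open>12 * q * \<rho> <= R\<close> of the normal form admits ever larger
  \<rho> with \<open>R = R0\<close> fixed, and \<open>near_unitary\<close> makes the defect tend to
  0. The bounds are uniform over all good maps, which is needed when the base point varies.\<close>

theorem descent:
 obtains R0 where "R0 > 2"
  "!!F G y x. good R0 F G ==> 0 < y ==> y <= 1 ==> cmod (hin x (F (iy y) *v x)) <= 9 * (norm x)\<^sup>2"
  "!!F G y. good R0 F G ==> 0 < y ==> y <= 1 ==> dt (dF F (mat 1) (iy y)) ~= 0"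
  "!!\<epsilon>. 0 < \<epsilon> ==> \<exists>y0>0. \<forall>F G y x v. good R0 F G --> 0 < y --> y <= y0 -->
   Im (hin x (F (iy y) *v x)) <= \<epsilon> * (norm x)\<^sup>2 &
   cmod (dt (dF F (nl v) (iy y))) <= \<epsilon> * norm v ^ 4 * cmod (dt (dF F (mat 1) (iy y)))"
proof -
 obtain \<rho>1 where \<rho>1: "\<rho>1 > 2" "!!F G \<rho>. pair F G \<rho> ==> \<rho>1 <= \<rho> ==> \<forall>x. (1 - e0\<^sup>2) * norm x <= norm (dF F (mat 1) ii *v x)"
  using near_unitary[of "e0\<^sup>2"] unfolding e0_def by (metis zero_less_divide_1_iff zero_less_numeral zero_less_power)
 obtain \<rho>2 where \<rho>2: "\<rho>2 > 2" "!!F G \<rho>. pair F G \<rho> ==> \<rho>2 <= \<rho> ==>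
   (\<forall>v. cmod (dt (dF F (nl v) ii)) <= 1/2 * norm v ^ 4) & 1 - 1/2 <= cmod (dt (dF F (mat 1) ii))"
  using near_unitary[of "1/2"] by (metis half_gt_zero_iff zero_less_one)
 \<comment> \<open>48 is 12 times the factor 4 that heights between consecutive powers of 1/3 cost;
   \<open>2 * 10^9\<close> is the room required by \<open>scalar_step\<close>.\<close>
 define R0 where "R0 = 48 * \<rho>1 + 48 * \<rho>2 + 2 * 10^9"
 have R0: "R0 >= 2 * 10^9" "R0 >= 200" "12 * \<rho>1 <= R0" "48 * \<rho>2 <= R0" "R0 > 0" using \<rho>1(1) \<rho>2(1) by (auto simp: R0_def)
 \<comment> \<open>The displacements \<open>3 * (2/5)^n\<close> sum to 5. With the starting value
   \<i> and one more displacement of at most 3 for an intermediate height this leads to the bound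
   9.\<close>
 have iter: "state F ((1/3)^n) & (\<forall>x. Im (hin x (F (iy ((1/3)^n)) *v x)) <= (2/5)^n * (norm x)\<^sup>2) &
   (\<forall>x. cmod (hin x (F (iy ((1/3)^n)) *v x) - \<i> * of_real ((norm x)\<^sup>2)) <= 5 * (1 - (2/5)^n) * (norm x)\<^sup>2) &
   (\<forall>x \<tau>. 1/3 <= \<tau> --> \<tau> <= 1 --> cmod (hin x (F (iy (\<tau> * (1/3)^n)) *v x) - hin x (F (iy ((1/3)^n)) *v x)) <= 3 * ((2/5)^n * (norm x)\<^sup>2))"
  if g: "good R0 F G" for F G n
 proof -
  have P: "pair F G R0" and Fi: "F ii = ii" and s1: "state F 1" using g by (auto simp: good_def pair_def)
  have step: "state F (y/3) & (\<forall>x. Im (hin x (F (iy (y/3)) *v x)) <= 2/5 * Im (hin x (F (iy y) *v x))) &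
   (\<forall>x \<tau>. 1/3 <= \<tau> --> \<tau> <= 1 --> cmod (hin x (F (iy (\<tau> * y)) *v x) - hin x (F (iy y) *v x)) <= 3 * Im (hin x (F (iy y) *v x)))"
   if st: "state F y" and im: "!!x. Im (hin x (F (iy y) *v x)) <= q * (norm x)\<^sup>2"
    and c: "!!x. cmod (hin x (F (iy y) *v x) - \<i> * of_real ((norm x)\<^sup>2)) <= 5 * (1 - q) * (norm x)\<^sup>2"
    and y: "0 < y" "y <= 1" "y <= q" and q: "q <= 1" for y q
  proof -
   have b: "cmod (hin x (F (iy y) *v x)) <= 9 * (norm x)\<^sup>2" for x
   proof -
    have "cmod (hin x (F (iy y) *v x)) <= cmod (\<i> * of_real ((norm x)\<^sup>2)) + 5 * (1 - q) * (norm x)\<^sup>2"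
     using c[of x] norm_triangle_sub[of "hin x (F (iy y) *v x)" "\<i> * of_real ((norm x)\<^sup>2)"] by linarith
    also have "\<dots> = (1 + 5 * (1 - q)) * (norm x)\<^sup>2" unfolding norm_mult norm_of_real by (simp add: algebra_simps)
    also have "\<dots> <= 9 * (norm x)\<^sup>2" using y by (intro mult_right_mono) auto
    finally show ?thesis .
   qed
   have "q * \<rho>1 <= 1 * \<rho>1" using q \<rho>1 by (intro mult_right_mono) auto
   then have R1: "12 * q * \<rho>1 <= R0" using R0 by linarith
   have nu: "\<forall>x. (1 - e0\<^sup>2) * norm x <= norm (dF F' (mat 1) ii *v x)" if "pair F' G' \<rho>1" for F' G'
    using \<rho>1(2)[OF that] by blast
   show ?thesis using descent_step[OF P y im b st R1 \<rho>1(1) R0(1)] nu by blast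
  qed
  have main: "state F ((1/3)^n) & (\<forall>x. Im (hin x (F (iy ((1/3)^n)) *v x)) <= (2/5)^n * (norm x)\<^sup>2) &
   (\<forall>x. cmod (hin x (F (iy ((1/3)^n)) *v x) - \<i> * of_real ((norm x)\<^sup>2)) <= 5 * (1 - (2/5)^n) * (norm x)\<^sup>2)" for n
  proof (induction n)
   case 0
   show ?case using s1 Fi by (simp add: hin_ii_self)
  next
   case (Suc n)
   let ?y = "(1/3 :: real)^n" and ?q = "(2/5 :: real)^n"
   have yq: "0 < ?y" "?y <= 1" "?y <= ?q" "?q <= 1" by (auto intro: power_le_one power_mono)
   have S: "state F (?y/3)" "!!x. Im (hin x (F (iy (?y/3)) *v x)) <= 2/5 * Im (hin x (F (iy ?y) *v x))"
    "!!x \<tau>. 1/3 <= \<tau> ==> \<tau> <= 1 ==> cmod (hin x (F (iy (\<tau> * ?y)) *v x) - hin x (F (iy ?y) *v x)) <= 3 * Im (hin x (F (iy ?y) *v x))"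
    using step[of ?y ?q] Suc yq by blast+
   have y3: "(1/3)^Suc n = ?y/3" "(2/5 :: real)^Suc n = 2/5 * ?q" by simp_all
   have "Im (hin x (F (iy (?y/3)) *v x)) <= 2/5 * ?q * (norm x)\<^sup>2" for x
   proof -
    have "2/5 * Im (hin x (F (iy ?y) *v x)) <= 2/5 * (?q * (norm x)\<^sup>2)" using Suc by (intro mult_left_mono) auto
    then show ?thesis using S(2)[of x] by simp
   qed
   moreover have "cmod (hin x (F (iy (?y/3)) *v x) - \<i> * of_real ((norm x)\<^sup>2)) <= 5 * (1 - 2/5 * ?q) * (norm x)\<^sup>2" for x
   proof -
    have e3: "1/3 * ?y = ?y/3" by simp
    have 1: "cmod (hin x (F (iy (?y/3)) *v x) - hin x (F (iy ?y) *v x)) <= 3 * Im (hin x (F (iy ?y) *v x))"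
     using S(3)[of "1/3" x] unfolding e3 by simp
    have 2: "Im (hin x (F (iy ?y) *v x)) <= ?q * (norm x)\<^sup>2"
     "cmod (hin x (F (iy ?y) *v x) - \<i> * of_real ((norm x)\<^sup>2)) <= 5 * (1 - ?q) * (norm x)\<^sup>2" using Suc by auto
    have "cmod (hin x (F (iy (?y/3)) *v x) - \<i> * of_real ((norm x)\<^sup>2)) <= 3 * (?q * (norm x)\<^sup>2) + 5 * (1 - ?q) * (norm x)\<^sup>2"
     using norm_triangle_ineq[of "hin x (F (iy (?y/3)) *v x) - hin x (F (iy ?y) *v x)"
      "hin x (F (iy ?y) *v x) - \<i> * of_real ((norm x)\<^sup>2)"] 1 2 by simp
    also have "\<dots> = 5 * (1 - 2/5 * ?q) * (norm x)\<^sup>2" by (simp add: algebra_simps)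
    finally show ?thesis .
   qed
   ultimately show ?case unfolding y3 using S(1) by blast
  qed
  have "\<forall>x \<tau>. 1/3 <= \<tau> --> \<tau> <= 1 --> cmod (hin x (F (iy (\<tau> * (1/3)^n)) *v x) - hin x (F (iy ((1/3)^n)) *v x)) <= 3 * ((2/5)^n * (norm x)\<^sup>2)"
  proof (intro allI impI)
   fix x :: "complex^2" and \<tau> :: real assume t: "1/3 <= \<tau>" "\<tau> <= 1"
   let ?y = "(1/3 :: real)^n" and ?q = "(2/5 :: real)^n"
   have yq: "0 < ?y" "?y <= 1" "?y <= ?q" "?q <= 1" by (auto intro: power_le_one power_mono)
   have "cmod (hin x (F (iy (\<tau> * ?y)) *v x) - hin x (F (iy ?y) *v x)) <= 3 * Im (hin x (F (iy ?y) *v x))"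
    using step[of ?y ?q] main[of n] yq t by blast
   also have "\<dots> <= 3 * (?q * (norm x)\<^sup>2)" using main[of n] by (intro mult_left_mono) auto
   finally show "cmod (hin x (F (iy (\<tau> * ?y)) *v x) - hin x (F (iy ?y) *v x)) <= 3 * (?q * (norm x)\<^sup>2)" .
  qed
  then show ?thesis using main[of n] by blast
 qed
 have gen: "(\<forall>x. Im (hin x (F (iy y) *v x)) <= 4 * (2/5)^n * (norm x)\<^sup>2) & (\<forall>x. cmod (hin x (F (iy y) *v x)) <= 9 * (norm x)\<^sup>2) & y <= 4 * (2/5)^n"
  if g: "good R0 F G" and y: "(1/3) ^ Suc n < y" "y <= (1/3) ^ n" for F G y n
 proof -
  let ?y = "(1/3 :: real)^n" and ?q = "(2/5 :: real)^n"
  define \<tau> where "\<tau> = y / ?y"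
  have \<tau>: "1/3 <= \<tau>" "\<tau> <= 1" "\<tau> * ?y = y" using y by (auto simp: \<tau>_def divide_simps)
  have q1: "0 < ?q" "?q <= 1" by (auto intro: power_le_one)
  have d: "cmod (hin x (F (iy y) *v x) - hin x (F (iy ?y) *v x)) <= 3 * (?q * (norm x)\<^sup>2)" for x
   using iter[OF g, of n] \<tau> by metis
  have i: "Im (hin x (F (iy ?y) *v x)) <= ?q * (norm x)\<^sup>2"
   "cmod (hin x (F (iy ?y) *v x) - \<i> * of_real ((norm x)\<^sup>2)) <= 5 * (1 - ?q) * (norm x)\<^sup>2" for x
   using iter[OF g, of n] by blast+
  have "Im (hin x (F (iy y) *v x)) <= 4 * ?q * (norm x)\<^sup>2" for x
   using d[of x] i(1)[of x] abs_Im_le_cmod[of "hin x (F (iy y) *v x) - hin x (F (iy ?y) *v x)"] by simp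
  moreover have "cmod (hin x (F (iy y) *v x)) <= 9 * (norm x)\<^sup>2" for x
  proof -
   have "cmod (hin x (F (iy y) *v x)) <= cmod (\<i> * of_real ((norm x)\<^sup>2)) + 5 * (1 - ?q) * (norm x)\<^sup>2 + 3 * (?q * (norm x)\<^sup>2)"
    using d[of x] i(2)[of x] norm_triangle_sub[of "hin x (F (iy ?y) *v x)" "\<i> * of_real ((norm x)\<^sup>2)"]
     norm_triangle_sub[of "hin x (F (iy y) *v x)" "hin x (F (iy ?y) *v x)"] by linarith
   also have "\<dots> = (6 - 2 * ?q) * (norm x)\<^sup>2" unfolding norm_mult norm_of_real by (simp add: algebra_simps)
   also have "\<dots> <= 9 * (norm x)\<^sup>2" by (rule mult_right_mono) (use q1 in linarith, simp)
   finally show ?thesis .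
  qed
  moreover have "?y <= ?q" by (intro power_mono) auto
  then have "y <= 4 * ?q" using y q1 by linarith
  ultimately show ?thesis by blast
 qed
 show thesis
 proof (rule that[of R0])
  show "R0 > 2" using R0(2) by simp
  fix F G and y :: real and x :: "complex^2" assume g: "good R0 F G" and y: "0 < y" "y <= 1"
  obtain n where n: "(1/3) ^ Suc n < y" "y <= (1/3) ^ n" using power_bracket[OF y] by blast
  show "cmod (hin x (F (iy y) *v x)) <= 9 * (norm x)\<^sup>2" using gen[OF g n] by blast
 next
  fix F G and y :: real assume g: "good R0 F G" and y: "0 < y" "y <= 1"
  obtain n where n: "(1/3) ^ Suc n < y" "y <= (1/3) ^ n" using power_bracket[OF y] by blast
  have P: "pair F G R0" using g by (simp add: good_def)
  have "(2/5 :: real)^n * \<rho>2 <= 1 * \<rho>2" using \<rho>2 by (intro mult_right_mono power_le_one) auto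
  then have R1: "12 * (4 * (2/5)^n) * \<rho>2 <= R0" using R0 by linarith
  have G: "!!x. Im (hin x (F (iy y) *v x)) <= 4 * (2/5)^n * (norm x)\<^sup>2" "!!x. cmod (hin x (F (iy y) *v x)) <= 9 * (norm x)\<^sup>2" "y <= 4 * (2/5)^n"
   using gen[OF g n] by blast+
  show "dt (dF F (mat 1) (iy y)) ~= 0"
   by (rule state_dt(1)[OF P y G(3,1,2) R1 \<rho>2(1) R0(2), of "1/2"])
    (simp, simp, use \<rho>2(2)[OF _ order_refl] in blast)
 next
  fix \<epsilon> :: real assume \<epsilon>: "0 < \<epsilon>"
  define e where "e = min (1/2) (\<epsilon>/2)"
  have e: "0 < e" "e <= 1/2" "2 * e <= \<epsilon>" using \<epsilon> by (auto simp: e_def)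
  obtain \<rho> where \<rho>: "\<rho> > 2" "!!F G \<rho>'. pair F G \<rho>' ==> \<rho> <= \<rho>' ==>
   (\<forall>v. cmod (dt (dF F (nl v) ii)) <= e * norm v ^ 4) & 1 - e <= cmod (dt (dF F (mat 1) ii))"
   using near_unitary[OF e(1)] by metis
  \<comment> \<open>The first bound makes the imaginary part small, the second lets the half ball of
    radius \<rho> fit into the domain after renormalisation.\<close>
  obtain N where N: "(2/5 :: real) ^ N < min (\<epsilon>/4) (R0 / (48 * \<rho>))"
   using real_arch_pow_inv[of "min (\<epsilon>/4) (R0 / (48 * \<rho>))" "2/5"] \<epsilon> R0 \<rho> by auto
  show "\<exists>y0>0. \<forall>F G y x v. good R0 F G --> 0 < y --> y <= y0 -->
   Im (hin x (F (iy y) *v x)) <= \<epsilon> * (norm x)\<^sup>2 &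
   cmod (dt (dF F (nl v) (iy y))) <= \<epsilon> * norm v ^ 4 * cmod (dt (dF F (mat 1) (iy y)))"
  proof (intro exI[of _ "(1/3)^N"] conjI allI impI)
   fix F G and y :: real and x v :: "complex^2" assume g: "good R0 F G" and y: "0 < y" "y <= (1/3)^N"
   have y1: "y <= 1" using y(2) power_le_one[of "1/3 :: real" N] by simp
   obtain n where n: "(1/3) ^ Suc n < y" "y <= (1/3) ^ n" using power_bracket[OF y(1) y1] by blast
   have "(1/3 :: real) ^ Suc n < (1/3) ^ N" using n y by linarith
   then have "N < Suc n" by (simp only: power_strict_decreasing_iff)
   then have le: "(2/5 :: real)^n <= (2/5)^N" by (intro power_decreasing) auto
   have "(2/5 :: real)^N < \<epsilon>/4" "(2/5 :: real)^N < R0 / (48 * \<rho>)" using N by simp_all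
   then have q: "(2/5 :: real)^n < \<epsilon>/4" "(2/5 :: real)^n < R0 / (48 * \<rho>)" using le by linarith+
   have P: "pair F G R0" using g by (simp add: good_def)
   have G: "!!x. Im (hin x (F (iy y) *v x)) <= 4 * (2/5)^n * (norm x)\<^sup>2" "!!x. cmod (hin x (F (iy y) *v x)) <= 9 * (norm x)\<^sup>2" "y <= 4 * (2/5)^n"
    using gen[OF g n] by blast+
   have "4 * (2/5)^n * (norm x)\<^sup>2 <= \<epsilon> * (norm x)\<^sup>2" using q by (intro mult_right_mono) auto
   then show "Im (hin x (F (iy y) *v x)) <= \<epsilon> * (norm x)\<^sup>2" using G(1)[of x] by linarith
   have R1: "12 * (4 * (2/5)^n) * \<rho> <= R0" using q(2) \<rho>(1) by (simp add: field_simps)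
   have "cmod (dt (dF F (nl v) (iy y))) <= 2 * e * norm v ^ 4 * cmod (dt (dF F (mat 1) (iy y)))"
    by (rule state_dt(2)[OF P y(1) y1 G(3,1,2) R1 \<rho>(1) R0(2) e(1,2)]) (use \<rho>(2) in blast)
   also have "\<dots> <= \<epsilon> * norm v ^ 4 * cmod (dt (dF F (mat 1) (iy y)))"
    using e by (intro mult_right_mono) auto
   finally show "cmod (dt (dF F (nl v) (iy y))) <= \<epsilon> * norm v ^ 4 * cmod (dt (dF F (mat 1) (iy y)))" .
  qed simp
 qed
qed

subsection \<open>Conformality\<close>

text \<open>Extended by 0 below the real axis, the function is continuous across it, hence
  holomorphic on the full rectangle by pasting across a line, and it vanishes on the lower
  half.\<close>

lemma zero_by_reflection:
 assumes t: "t holomorphic_on {\<zeta>. \<bar>Re \<zeta>\<bar> < r & 0 < Im \<zeta> & Im \<zeta> < 1}" and r: "0 < r"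
  and lim: "!!\<epsilon>. 0 < \<epsilon> ==> \<exists>y0>0. \<forall>\<zeta>. \<bar>Re \<zeta>\<bar> < r --> 0 < Im \<zeta> --> Im \<zeta> < 1 --> Im \<zeta> <= y0 --> cmod (t \<zeta>) <= \<epsilon>"
  and z: "\<bar>Re \<zeta>\<bar> < r" "0 < Im \<zeta>" "Im \<zeta> < 1"
 shows "t \<zeta> = 0"
proof -
 define S where "S = {\<zeta>. \<bar>Re \<zeta>\<bar> < r} \<inter> {\<zeta>. -1 < Im \<zeta>} \<inter> {\<zeta>. Im \<zeta> < 1}"
 define T where "T \<zeta> = (if 0 < Im \<zeta> then t \<zeta> else 0)" for \<zeta>
 have S: "open S" unfolding S_def by (intro open_Int open_Collect_less continuous_intros)
 have cS: "convex S"
 proof -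
  have "{\<zeta>. \<bar>Re \<zeta>\<bar> < r} = {\<zeta>. Re \<zeta> < r} \<inter> {\<zeta>. - r < Re \<zeta>}" by auto
  then show ?thesis unfolding S_def
   by (simp only:) (intro convex_Int convex_halfspace_Re_lt convex_halfspace_Re_gt convex_halfspace_Im_lt convex_halfspace_Im_gt)
 qed
 define P where "P = {\<zeta>. \<bar>Re \<zeta>\<bar> < r & 0 < Im \<zeta> & Im \<zeta> < 1}"
 have P: "open P" unfolding P_def
  by (simp only: Collect_conj_eq) (intro open_Int open_Collect_less continuous_intros)
 have tc: "continuous_on P t" using t unfolding P_def[symmetric] by (rule holomorphic_on_imp_continuous_on)
 have cont: "isCont T \<zeta>" if \<zeta>: "\<zeta> \<in> S" for \<zeta>
 proof -
  consider "Im \<zeta> > 0" | "Im \<zeta> < 0" | "Im \<zeta> = 0" by linarith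
  then show ?thesis
  proof cases
   case 1
   then have "\<zeta> \<in> P" using \<zeta> by (auto simp: S_def P_def)
   moreover have "continuous_on P T"
    using tc by (rule continuous_on_eq) (auto simp: T_def P_def)
   ultimately show ?thesis using P by (simp add: continuous_on_eq_continuous_at)
  next
   case 2
   have "open {\<zeta>. Im \<zeta> < 0}" by (intro open_Collect_less continuous_intros)
   moreover have "continuous_on {\<zeta>. Im \<zeta> < 0} T"
    by (rule continuous_on_eq[of _ "%_. 0"]) (auto simp: T_def)
   ultimately show ?thesis using 2 by (simp add: continuous_on_eq_continuous_at)
  next
   case 3
   have "(T \<longlongrightarrow> 0) (at \<zeta>)"
   proof (rule tendstoI)
    fix e :: real assume "e > 0"
    then obtain y0 where y0: "y0 > 0" "!!\<zeta>. \<bar>Re \<zeta>\<bar> < r ==> 0 < Im \<zeta> ==> Im \<zeta> < 1 ==> Im \<zeta> <= y0 ==> cmod (t \<zeta>) <= e / 2"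
     using lim[of "e/2"] by auto
    have "open (S \<inter> {\<zeta>. Im \<zeta> < y0})" by (intro open_Int S open_Collect_less continuous_intros)
    then have "\<forall>\<^sub>F w in at \<zeta>. w \<in> S \<inter> {\<zeta>. Im \<zeta> < y0}"
     by (rule eventually_at_in_open') (use \<zeta> 3 y0 in auto)
    then show "\<forall>\<^sub>F w in at \<zeta>. dist (T w) 0 < e"
    proof eventually_elim
     case (elim w)
     have "cmod (T w) <= e / 2" using y0(2)[of w] elim \<open>e > 0\<close> by (auto simp: T_def S_def)
     then show ?case using \<open>e > 0\<close> by simp
    qed
   qed
   then show ?thesis using 3 by (simp add: isCont_def T_def)
  qed
 qed
 have holT: "T holomorphic_on S"
 proof (rule holomorphic_on_paste_across_line[OF S, of \<i> _ 0])
  show "T holomorphic_on S \<inter> {z. \<i> \<bullet> z < 0}"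
   by (rule holomorphic_transform[of "%_. 0"]) (auto simp: T_def inner_complex_def)
  show "T holomorphic_on S \<inter> {z. 0 < \<i> \<bullet> z}"
   by (rule holomorphic_transform[OF holomorphic_on_subset[OF t]]) (auto simp: T_def inner_complex_def S_def)
  show "continuous_on S T" using cont by (simp add: continuous_at_imp_continuous_on)
 qed auto
 have "T \<zeta> = 0"
 proof (rule analytic_continuation_open[of "S \<inter> {\<zeta>. Im \<zeta> < 0}" S T "%_. 0"])
  show "T holomorphic_on S" by (rule holT)
  show "open (S \<inter> {\<zeta>. Im \<zeta> < 0})" by (intro open_Int S open_Collect_less continuous_intros)
  have "- \<i> / 2 \<in> S \<inter> {\<zeta>. Im \<zeta> < 0}" using r by (auto simp: S_def)
  then show "S \<inter> {\<zeta>. Im \<zeta> < 0} ~= {}" by blast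
 qed (use S convex_connected[OF cS] z in \<open>auto simp: T_def S_def\<close>)
 then show ?thesis using z by (simp add: T_def)
qed

text \<open>Uniqueness of the Cholesky factor with positive diagonal. Base points with the same
  imaginary part are therefore normalised by the same source map up to translation.\<close>

lemma tri_unique:
 assumes "tri a b c (mat 1) = tri a' b' c' (mat 1)" "a > 0" "c > 0" "a' > 0" "c' > 0"
 shows "a = a'" "b = b'" "c = c'"
proof -
 have "complex_of_real (a\<^sup>2) = of_real (a'\<^sup>2)" "complex_of_real (a * b) = of_real (a' * b')"
  "complex_of_real (b\<^sup>2 + c\<^sup>2) = of_real (b'\<^sup>2 + c'\<^sup>2)"
  using assms(1) unfolding mat2_eq_iff tri_def by simp_all
 then have e: "a\<^sup>2 = a'\<^sup>2" "a * b = a' * b'" "b\<^sup>2 + c\<^sup>2 = b'\<^sup>2 + c'\<^sup>2" unfolding of_real_eq_iff by auto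
 show a: "a = a'" using e(1) assms by (simp add: power2_eq_iff_nonneg)
 show b: "b = b'" using e(2) a assms by simp
 show "c = c'" using e(3) b assms by (simp add: power2_eq_iff_nonneg)
qed

text \<open>For a normalised map this is \<open>state F 1\<close> with half the tolerance; the other
  half is spent in \<open>nearby_good\<close> on moving the base point.\<close>

definition pre_state :: "(mat2 => mat2) => bool"
 where "pre_state F \<longleftrightarrow> (\<forall>x. cmod (hin x (dF F (mat 1) ii *v x) - of_real ((norm x)\<^sup>2)) <= e0 / 2 * (norm x)\<^sup>2)"

lemma hin_mat_bound: "cmod (hin x (A *v x)) <= 4 * norm A * (norm x)\<^sup>2"
 using order_trans[OF hin_bound mult_left_mono[OF norm_opb[of A x] norm_ge_zero[of x]]]
 by (simp add: power2_eq_square mult_ac)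

lemma dF_symat:
 assumes "hol F S" "Z \<in> S"
 shows "dF F (symat p q r) Z = cscale p (dF F (symat 1 0 0) Z) + cscale q (dF F (symat 0 1 0) Z) + cscale r (dF F (symat 0 0 1) Z)"
proof -
 have "symat p q r = cscale p (symat 1 0 0) + cscale q (symat 0 1 0) + cscale r (symat 0 0 1)"
  by (simp add: mat2_eq_iff)
 then show ?thesis using assms by (simp only: dF_add dF_cscale Sym_simps)
qed

lemma continuous_dF_imm:
 assumes F: "hol F S"
 shows "continuous_on S (%Z. dF F (imm Z) Z)"
proof (rule continuous_on_mat2I)
 fix i j
 have c: "continuous_on S (%Z. dF F X Z $ i $ j)" if "X \<in> Sym" for X
  unfolding dF_nth by (intro gholo_continuous gholo_ddir hol_gholo[OF F] that)
 have n: "continuous_on S (%Z. Z$k$l)" for k l :: 2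
  by (intro linear_continuous_on bounded_linear_nth)
 have "continuous_on S (%Z. of_real (Im (Z$1$1)) * dF F (symat 1 0 0) Z $ i $ j + of_real (Im (Z$1$2)) * dF F (symat 0 1 0) Z $ i $ j
   + of_real (Im (Z$2$2)) * dF F (symat 0 0 1) Z $ i $ j)"
  by (intro continuous_intros c n) auto
 then show "continuous_on S (%Z. dF F (imm Z) Z $ i $ j)"
 proof (rule continuous_on_eq)
  fix Z assume "Z \<in> S"
  from dF_symat[OF F this, of "of_real (Im (Z$1$1))" "of_real (Im (Z$1$2))" "of_real (Im (Z$2$2))"]
  show "of_real (Im (Z$1$1)) * dF F (symat 1 0 0) Z $ i $ j + of_real (Im (Z$1$2)) * dF F (symat 0 1 0) Z $ i $ j
   + of_real (Im (Z$2$2)) * dF F (symat 0 0 1) Z $ i $ j = dF F (imm Z) Z $ i $ j"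
   unfolding imm_def by simp
 qed
qed

lemma continuous_imm: assumes "continuous_on S F" shows "continuous_on S (%Z. imm (F Z))"
proof (rule continuous_on_mat2I)
 fix i j :: 2
 have n: "continuous_on S (%Z. F Z$k$l)" for k l :: 2
  by (rule continuous_on_compose2[OF linear_continuous_on[OF bounded_linear_nth] assms]) auto
 show "continuous_on S (%Z. imm (F Z) $ i $ j)"
  by (cases "i = 1"; cases "j = 1"; simp add: imm_def symat_def; intro continuous_intros n)
qed

lemma hin_imm_norm: "hin x (imm ii *v x) = of_real ((norm x)\<^sup>2)" "imm ii = mat 1"
proof -
 show *: "imm ii = mat 1" by (simp add: imm_def mat2_eq_iff)
 show "hin x (imm ii *v x) = of_real ((norm x)\<^sup>2)" unfolding * matrix_vector_mul_lid hin_self ..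
qed

text \<open>The condition compares \<open>dF F (imm Z) Z\<close> with \<open>imm (F Z)\<close>, and
  the difference \<open>M\<close> is continuous in the base point, so it persists near
  \<open>ii\<close>. The traces of the imaginary parts are at most 3 there, whence
  \<open>18 * R0\<close>; the added 8 keeps \<open>Z\<close> and \<open>F Z\<close> in the half ball
  of radius \<open>R/2\<close>.\<close>

lemma nearby_good:
 assumes P: "pair F G R" and st: "pre_state F" and R: "R >= 18 * R0 + 8" "R0 > 2"
 obtains r where "r > 0" "r < 1/4" "!!Z. Z \<in> Sym ==> norm (Z - ii) < r ==> Z \<in> HB R &
  (\<exists>a b c a' b' c' F' G'. a > 0 & c > 0 & a' > 0 & c' > 0 & tri a b c (mat 1) = imm Z &
   tri a' b' c' (mat 1) = imm (F Z) & good R0 F' G' &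
   (\<forall>V\<in>HB R0. tri a b c V + rem Z \<in> HB R & F (tri a b c V + rem Z) = tri a' b' c' (F' V) + rem (F Z)))"
proof -
 have FP: "hol F (HB R)" "!!V. V \<in> HB R ==> F V \<in> siegel" "F ii = ii" "prepair F G R"
  using P by (auto simp: pair_def prepair_def)
 have iB: "ii \<in> HB R" using R ii_HB by simp
 have contF: "continuous_on (HB R) F" by (rule hol_continuous[OF FP(1)])
 define M where "M Z = dF F (imm Z) Z - imm (F Z)" for Z
 have contM: "continuous_on (HB R) M" unfolding M_def
  by (intro continuous_intros continuous_dF_imm[OF FP(1)] continuous_imm contF)
 have e40: "e0/40 > 0" by (simp add: e0_def)
 obtain d1 where d1: "d1 > 0" "!!Z. Z \<in> HB R ==> dist Z ii < d1 ==> dist (M Z) (M ii) < e0/40"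
  using contM iB e40 unfolding continuous_on_iff by blast
 obtain d2 where d2: "d2 > 0" "!!Z. Z \<in> HB R ==> dist Z ii < d2 ==> dist (F Z) (F ii) < e0/40"
  using contF iB e40 unfolding continuous_on_iff by blast
 obtain d3 where d3: "d3 > 0" "!!W. W \<in> Sym ==> norm (W - ii) < d3 ==> W \<in> HB R"
  using open_SymD[OF open_Sym_HB iB] by metis
 define r where "r = min (min d1 d2) (min d3 (1/5))"
 show thesis
 proof (rule that[of r])
  show "r > 0" "r < 1/4" using d1 d2 d3 by (auto simp: r_def)
  fix Z assume Z: "Z \<in> Sym" "norm (Z - ii) < r"
  have ZB: "Z \<in> HB R" using d3(2)[OF Z(1)] Z(2) by (simp add: r_def)
  have dM: "norm (M Z - M ii) < e0/40" using d1(2)[OF ZB] Z(2) by (simp add: r_def dist_norm)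
  have dF': "norm (F Z - ii) < e0/40" using d2(2)[OF ZB] Z(2) by (simp add: r_def dist_norm FP)
  have nZ: "norm Z < 4" using norm_triangle_ineq[of "Z - ii" ii] norm_ii Z(2) by (simp add: r_def)
  have nF: "norm (F Z) < 4" using norm_triangle_ineq[of "F Z - ii" ii] norm_ii dF' by (simp add: e0_def)
  have ZB2: "Z \<in> HB (R/2)" "F Z \<in> HB (R/2)" using ZB FP(2)[OF ZB] nZ nF R by (auto simp: HB_def)
  have tr: "Im (W$1$1) + Im (W$2$2) <= 3" if "norm (W - ii) < 1/2" for W
  proof -
   have "Im ((W - ii)$i$i) < 1/2" for i using abs_ge_self[of "Im ((W - ii)$i$i)"] abs_Im_le_cmod[of "(W - ii)$i$i"] cmod_nth_le[of "W - ii" i i] that by linarith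
   from this[of 1] this[of 2] show ?thesis by simp
  qed
  have t1: "Im (Z$1$1) + Im (Z$2$2) <= 3" by (rule tr) (use Z(2) in \<open>simp add: r_def\<close>)
  have t2: "Im (F Z$1$1) + Im (F Z$2$2) <= 3" by (rule tr) (use dF' in \<open>simp add: e0_def\<close>)
  have R3: "3 * 3 * R0 <= R / 2" using R by simp
  obtain a b c a' b' c' F' G' where N: "a > 0" "c > 0" "a' > 0" "c' > 0"
   "tri a b c (mat 1) = imm Z" "tri a' b' c' (mat 1) = imm (F Z)" "pair F' G' R0"
   "!!V. V \<in> Sym ==> tri a' b' c' (dF F' V ii) = dF F (tri a b c V) Z"
   "!!V. V \<in> HB R0 ==> tri a b c V + rem Z \<in> HB R"
   "!!V. V \<in> HB R0 ==> F (tri a b c V + rem Z) = tri a' b' c' (F' V) + rem (F Z)"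
   using normalise[OF FP(4) ZB2 t1 t2 R(2) R3] by metis
  have F': "hol F' (HB R0)" "F' ii = ii" using N(7) by (auto simp: pair_def prepair_def)
  have iB0: "ii \<in> HB R0" using R ii_HB by simp
  \<comment> \<open>The shares \<open>e0/2\<close> from \<open>pre_state\<close> and
    \<open>e0/10\<close> from continuity add up to \<open>6/10 * e0\<close>, while the imaginary
    part of the form of \<open>F Z\<close> is at least 6/10 of the squared norm.\<close>
  have key: "cmod (hin x (dF F (imm Z) Z *v x) - of_real (Im (hin x (F Z *v x)))) <= e0 * Im (hin x (F Z *v x))" for x
  proof -
   have e: "hin x (dF F (imm Z) Z *v x) - of_real (Im (hin x (F Z *v x))) = hin x (M Z *v x)"
    unfolding M_def mat2_vec_lin hin_add hin_imm[OF siegel_Sym[OF FP(2)[OF ZB]]] ..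
   have "hin x (M Z *v x) = hin x ((M Z - M ii) *v x) + hin x (M ii *v x)" by (simp add: mat2_vec_lin hin_add)
   moreover have "cmod (hin x ((M Z - M ii) *v x)) <= e0/10 * (norm x)\<^sup>2"
    using order_trans[OF hin_mat_bound[of x "M Z - M ii"] mult_right_mono[of "4 * norm (M Z - M ii)" "e0/10" "(norm x)\<^sup>2"]] dM by simp
   moreover have "cmod (hin x (M ii *v x)) <= e0/2 * (norm x)\<^sup>2"
    using st unfolding pre_state_def M_def FP(3) mat2_vec_lin hin_add hin_imm_norm(1) unfolding hin_imm_norm(2) by blast
   ultimately have l: "cmod (hin x (M Z *v x)) <= 6/10 * e0 * (norm x)\<^sup>2"
    using norm_triangle_ineq[of "hin x ((M Z - M ii) *v x)" "hin x (M ii *v x)"] by (simp add: algebra_simps)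
   have "hin x (F Z *v x) = hin x (ii *v x) + hin x ((F Z - ii) *v x)" by (simp add: mat2_vec_lin hin_add)
   then have "Im (hin x (F Z *v x)) = (norm x)\<^sup>2 + Im (hin x ((F Z - ii) *v x))" by (simp add: hin_ii_self)
   moreover have "cmod (hin x ((F Z - ii) *v x)) <= e0/10 * (norm x)\<^sup>2"
    using order_trans[OF hin_mat_bound[of x "F Z - ii"] mult_right_mono[of "4 * norm (F Z - ii)" "e0/10" "(norm x)\<^sup>2"]] dF' by simp
   ultimately have "(1 - e0/10) * (norm x)\<^sup>2 <= Im (hin x (F Z *v x))"
    using abs_Im_le_cmod[of "hin x ((F Z - ii) *v x)"] by (simp add: algebra_simps)
   moreover have "6/10 * (norm x)\<^sup>2 <= (1 - e0/10) * (norm x)\<^sup>2"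
    by (rule mult_right_mono) (simp_all add: e0_def)
   ultimately have "6/10 * (norm x)\<^sup>2 <= Im (hin x (F Z *v x))" by linarith
   then have "e0 * (6/10 * (norm x)\<^sup>2) <= e0 * Im (hin x (F Z *v x))" by (intro mult_left_mono) (auto simp: e0_def)
   then show ?thesis unfolding e using l by simp
  qed
  have "state F' 1"
   unfolding state_def Let_def
  proof
   fix v :: "complex^2"
   obtain x where x: "trv a' b' c' x = v"
   proof
    show "trv a' b' c' (cvec ((v$1 - of_real b' * (v$2 / of_real c')) / of_real a') (v$2 / of_real c')) = v"
     using N(3,4) by (simp add: trv_def vec2_eq_iff)
   qed
   have S: "dF F' (mat 1) ii \<in> Sym" by (rule hol_dF_Sym[OF F'(1) iB0]) simp
   have 1: "hin v (dF F' (mat 1) ii *v v) = hin x (dF F (imm Z) Z *v x)"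
    unfolding x[symmetric] hin_tri[OF S, symmetric] N(8)[OF Sym_simps(3)] N(5) ..
   have "of_real ((norm v)\<^sup>2) = hin x (imm (F Z) *v x)"
    unfolding N(6)[symmetric] hin_tri[OF Sym_simps(3)] x matrix_vector_mul_lid hin_self ..
   then have 2: "(norm v)\<^sup>2 = Im (hin x (F Z *v x))"
    unfolding hin_imm[OF siegel_Sym[OF FP(2)[OF ZB]]] of_real_eq_iff .
   have i1: "iy 1 = ii" by simp
   have 3: "Im (hin v (F' ii *v v)) = (norm v)\<^sup>2" unfolding F'(2) hin_ii_self by simp
   show "cmod (of_real 1 * hin v (dF F' (mat 1) (iy 1) *v v) - of_real (Im (hin v (F' (iy 1) *v v)))) <= e0 * Im (hin v (F' (iy 1) *v v))"
    unfolding i1 3 1 2 using key[of x] by simp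
  qed
  then have gd: "good R0 F' G'" using N(7) by (simp add: good_def)
  show "Z \<in> HB R &
  (\<exists>a b c a' b' c' F' G'. a > 0 & c > 0 & a' > 0 & c' > 0 & tri a b c (mat 1) = imm Z &
   tri a' b' c' (mat 1) = imm (F Z) & good R0 F' G' &
   (\<forall>V\<in>HB R0. tri a b c V + rem Z \<in> HB R & F (tri a b c V + rem Z) = tri a' b' c' (F' V) + rem (F Z)))"
   by (rule conjI[OF ZB], rule exI[of _ a], rule exI[of _ b], rule exI[of _ c], rule exI[of _ a'],
     rule exI[of _ b'], rule exI[of _ c'], rule exI[of _ F'], rule exI[of _ G'])
    (simp add: N gd)
 qed
qed

lemma dF_normalised:
 assumes F: "hol F (HB R)" and F': "hol F' (HB R0)" "!!V. V \<in> HB R0 ==> F' V \<in> siegel"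
  and eq: "!!V. V \<in> HB R0 ==> tri a b c V + X \<in> HB R & F (tri a b c V + X) = tri a' b' c' (F' V) + X'"
  and X: "X \<in> Sym" "X' \<in> Sym" and W: "W \<in> HB R0" and V: "V \<in> Sym"
 shows "dF F (tri a b c V) (tri a b c W + X) = tri a' b' c' (dF F' V W)"
proof -
 have "dF (%V. F (tri a b c V + X)) V W = dF F (dF (%V. tri a b c V + X) V W) (tri a b c W + X)"
  by (rule dF_comp[OF hol_tri(1)[OF open_Sym_HB X(1)] F _ W V]) (use eq in blast)
 moreover have "dF (%V. F (tri a b c V + X)) V W = dF (%V. tri a' b' c' (F' V) + X') V W"
 proof -
  have "ddir (%V. F (tri a b c V + X) $ i $ j) V W = ddir (%V. (tri a' b' c' (F' V) + X') $ i $ j) V W" for i j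
   by (rule ddir_cong[OF open_Sym_HB W V]) (use eq in simp)
  then show ?thesis by (simp add: mat2_eq_iff)
 qed
 moreover have "dF (%V. tri a' b' c' (F' V) + X') V W = dF (%Z. tri a' b' c' Z + X') (dF F' V W) (F' W)"
  by (rule dF_comp[OF F'(1) hol_tri(1)[OF open_Sym_siegel X(2)] F'(2) W V])
 ultimately show ?thesis using V hol_dF_Sym[OF F'(1) W V] by (simp add: dF_tri)
qed

lemma tri_nl: "tri a b c (nl v) = nl (cvec (of_real a * v$1) (of_real b * v$1 + of_real c * v$2))"
 by (simp add: tri_def nl_def mat2_eq_iff power2_eq_square algebra_simps)

text \<open>Below a base point with real part \<open>X\<close> and imaginary part \<open>Y\<close>,
  the vertical segments over its translates by small real multiples of \<open>Y\<close> fill a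
  rectangle in the slice \<open>X + cscale \<zeta> Y\<close>. The quotient of
  \<open>dt (dF F (nl u))\<close> by \<open>dt (dF F Y)\<close> is free of the unknown normalising
  factors of the target and tends to 0 uniformly at the real edge by \<open>descent\<close>, so it
  vanishes.\<close>

theorem conformal_near:
 obtains R1 where "R1 > 2" "!!F G R. pair F G R ==> R1 <= R ==> pre_state F ==>
  \<exists>r>0. \<forall>Z\<in>Sym. norm (Z - ii) < r --> Z \<in> HB R & (\<forall>u. dt (dF F (nl u) Z) = 0) &
   (\<forall>y. 0 < y --> y <= 1 --> rem Z + cscale (\<i> * of_real y) (imm Z) \<in> HB R) &
   (\<exists>K. \<forall>y. 0 < y --> y <= 1 --> norm (F (rem Z + cscale (\<i> * of_real y) (imm Z))) <= K) &
   (\<forall>\<epsilon>>0. \<exists>y0>0. \<forall>y x. 0 < y --> y <= y0 --> Im (hin x (F (rem Z + cscale (\<i> * of_real y) (imm Z)) *v x)) <= \<epsilon> * (norm x)\<^sup>2)"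
proof -
 obtain R0 where R0: "R0 > 2"
  "!!F G y x. good R0 F G ==> 0 < y ==> y <= 1 ==> cmod (hin x (F (iy y) *v x)) <= 9 * (norm x)\<^sup>2"
  "!!F G y. good R0 F G ==> 0 < y ==> y <= 1 ==> dt (dF F (mat 1) (iy y)) ~= 0"
  "!!\<epsilon>. 0 < \<epsilon> ==> \<exists>y0>0. \<forall>F G y x v. good R0 F G --> 0 < y --> y <= y0 -->
   Im (hin x (F (iy y) *v x)) <= \<epsilon> * (norm x)\<^sup>2 &
   cmod (dt (dF F (nl v) (iy y))) <= \<epsilon> * norm v ^ 4 * cmod (dt (dF F (mat 1) (iy y)))"
  by (rule descent) (rule that, blast+)
 show thesis
 proof (rule that[of "18 * R0 + 8"])
  show "18 * R0 + 8 > 2" using R0 by simp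
  fix F G R assume P: "pair F G R" and R: "18 * R0 + 8 <= R" and st: "pre_state F"
  have FP: "hol F (HB R)" "!!V. V \<in> HB R ==> F V \<in> siegel" using P by (auto simp: pair_def prepair_def)
  obtain r0 where r0: "r0 > 0" "r0 < 1/4" "!!Z. Z \<in> Sym ==> norm (Z - ii) < r0 ==> Z \<in> HB R &
  (\<exists>a b c a' b' c' F' G'. a > 0 & c > 0 & a' > 0 & c' > 0 & tri a b c (mat 1) = imm Z &
   tri a' b' c' (mat 1) = imm (F Z) & good R0 F' G' &
   (\<forall>V\<in>HB R0. tri a b c V + rem Z \<in> HB R & F (tri a b c V + rem Z) = tri a' b' c' (F' V) + rem (F Z)))"
   using nearby_good[OF P st R R0(1)] by metis
  have iyB: "iy y \<in> HB R0" if "0 < y" "y <= 1" for y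
  proof -
   have "norm (iy y) <= 2 * y" using norm_cscale_one[of "\<i> * of_real y"] that by (simp add: norm_mult)
   then show ?thesis using that R0(1) cscale_one_siegel[of "\<i> * of_real y"] by (simp add: HB_def)
  qed
  \<comment> \<open>\<open>Q\<close> collects normalising data at \<open>Z\<close> together with
    their effect along the whole segment below \<open>Z\<close>; the determinant relation shows that
    one factor serves every direction.\<close>
  define Q where "Q Z a b c a' b' c' F' G' \<longleftrightarrow> a > 0 & c > 0 & a' > 0 & c' > 0 & tri a b c (mat 1) = imm Z &
    tri a' b' c' (mat 1) = imm (F Z) & good R0 F' G' & (\<forall>y. 0 < y --> y <= 1 -->
     rem Z + cscale (\<i> * of_real y) (imm Z) \<in> HB R &
     F (rem Z + cscale (\<i> * of_real y) (imm Z)) = tri a' b' c' (F' (iy y)) + rem (F Z) & F' (iy y) \<in> Sym &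
     (\<forall>V\<in>Sym. dt (dF F (tri a b c V) (rem Z + cscale (\<i> * of_real y) (imm Z))) = of_real ((a' * c')\<^sup>2) * dt (dF F' V (iy y))))" for Z a b c a' b' c' F' G'
  have base: "\<exists>a b c a' b' c' F' G'. Q Z a b c a' b' c' F' G'"
   if Z: "Z \<in> Sym" "norm (Z - ii) < r0" for Z
  proof -
   obtain a b c a' b' c' F' G' where N: "a > 0" "c > 0" "a' > 0" "c' > 0" "tri a b c (mat 1) = imm Z"
    "tri a' b' c' (mat 1) = imm (F Z)" "good R0 F' G'"
    "!!V. V \<in> HB R0 ==> tri a b c V + rem Z \<in> HB R & F (tri a b c V + rem Z) = tri a' b' c' (F' V) + rem (F Z)"
    using r0(3)[OF Z] by blast
   have F': "hol F' (HB R0)" "!!V. V \<in> HB R0 ==> F' V \<in> siegel" using N(7) by (auto simp: good_def pair_def prepair_def)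
   have t: "tri a b c (iy y) + rem Z = rem Z + cscale (\<i> * of_real y) (imm Z)" for y
    by (simp add: tri_linear N(5))
   have "rem Z + cscale (\<i> * of_real y) (imm Z) \<in> HB R &
     F (rem Z + cscale (\<i> * of_real y) (imm Z)) = tri a' b' c' (F' (iy y)) + rem (F Z) & F' (iy y) \<in> Sym &
     (\<forall>V\<in>Sym. dt (dF F (tri a b c V) (rem Z + cscale (\<i> * of_real y) (imm Z))) = of_real ((a' * c')\<^sup>2) * dt (dF F' V (iy y)))"
    if y: "0 < y" "y <= 1" for y
   proof (intro conjI ballI)
    show "rem Z + cscale (\<i> * of_real y) (imm Z) \<in> HB R" "F (rem Z + cscale (\<i> * of_real y) (imm Z)) = tri a' b' c' (F' (iy y)) + rem (F Z)"
     using N(8)[OF iyB[OF y]] unfolding t by auto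
    show "F' (iy y) \<in> Sym" using F'(2)[OF iyB[OF y]] siegel_Sym by blast
    fix V :: mat2 assume V: "V \<in> Sym"
    have "dF F (tri a b c V) (tri a b c (iy y) + rem Z) = tri a' b' c' (dF F' V (iy y))"
     by (rule dF_normalised[OF FP(1) F' N(8) _ _ iyB[OF y] V]) (auto simp: realm_Sym)
    then show "dt (dF F (tri a b c V) (rem Z + cscale (\<i> * of_real y) (imm Z))) = of_real ((a' * c')\<^sup>2) * dt (dF F' V (iy y))"
     unfolding t using tri_dt[OF hol_dF_Sym[OF F'(1) iyB[OF y] V]] by simp
   qed
   then have "Q Z a b c a' b' c' F' G'" unfolding Q_def using N(1-7) by blast
   then show ?thesis by blast
  qed
  define r where "r = r0 / 2"
  have r: "r > 0" "r <= r0" using r0 by (auto simp: r_def)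
  have main: "Z \<in> HB R & (\<forall>u. dt (dF F (nl u) Z) = 0) &
   (\<forall>y. 0 < y --> y <= 1 --> rem Z + cscale (\<i> * of_real y) (imm Z) \<in> HB R) &
   (\<exists>K. \<forall>y. 0 < y --> y <= 1 --> norm (F (rem Z + cscale (\<i> * of_real y) (imm Z))) <= K) &
   (\<forall>\<epsilon>>0. \<exists>y0>0. \<forall>y x. 0 < y --> y <= y0 --> Im (hin x (F (rem Z + cscale (\<i> * of_real y) (imm Z)) *v x)) <= \<epsilon> * (norm x)\<^sup>2)"
   if Z: "Z \<in> Sym" "norm (Z - ii) < r" for Z
  proof (intro conjI allI impI)
   have Zr0: "norm (Z - ii) < r0" using Z r by simp
   show ZB: "Z \<in> HB R" using r0(3)[OF Z(1) Zr0] by blast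
   obtain a b c a' b' c' F' G' where N: "a > 0" "c > 0" "a' > 0" "c' > 0" "tri a b c (mat 1) = imm Z"
    "tri a' b' c' (mat 1) = imm (F Z)" "good R0 F' G'" and
    Ny: "!!y. 0 < y ==> y <= 1 ==> rem Z + cscale (\<i> * of_real y) (imm Z) \<in> HB R &
     F (rem Z + cscale (\<i> * of_real y) (imm Z)) = tri a' b' c' (F' (iy y)) + rem (F Z) & F' (iy y) \<in> Sym"
   proof -
    obtain a b c a' b' c' F' G' where "Q Z a b c a' b' c' F' G'" using base[OF Z(1) Zr0] by blast
    then show thesis unfolding Q_def by (intro that[of a c a' c' b b' F' G']) blast+
   qed
   show "rem Z + cscale (\<i> * of_real y) (imm Z) \<in> HB R" if "0 < y" "y <= 1" for y using Ny that by blast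
   show "\<exists>K. \<forall>y. 0 < y --> y <= 1 --> norm (F (rem Z + cscale (\<i> * of_real y) (imm Z))) <= K"
   proof (intro exI[of _ "3 * (a'\<^sup>2 + b'\<^sup>2 + c'\<^sup>2) * (6 * 9) + norm (rem (F Z))"] allI impI)
    fix y :: real assume y: "0 < y" "y <= 1"
    have "norm (F' (iy y)) <= 6 * 9"
     by (rule norm_hin_bound) (use Ny[OF y] R0(2)[OF N(7) y] in auto)
    then have "3 * (a'\<^sup>2 + b'\<^sup>2 + c'\<^sup>2) * norm (F' (iy y)) <= 3 * (a'\<^sup>2 + b'\<^sup>2 + c'\<^sup>2) * (6 * 9)"
     by (intro mult_left_mono) auto
    then show "norm (F (rem Z + cscale (\<i> * of_real y) (imm Z))) <= 3 * (a'\<^sup>2 + b'\<^sup>2 + c'\<^sup>2) * (6 * 9) + norm (rem (F Z))"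
     using Ny[OF y] norm_tri[of a' b' c' "F' (iy y)"] norm_triangle_ineq[of "tri a' b' c' (F' (iy y))" "rem (F Z)"] by simp
   qed
   show "\<exists>y0>0. \<forall>y x. 0 < y --> y <= y0 --> Im (hin x (F (rem Z + cscale (\<i> * of_real y) (imm Z)) *v x)) <= \<epsilon> * (norm x)\<^sup>2"
    if \<epsilon>: "\<epsilon> > 0" for \<epsilon>
   proof -
    define k where "k = 4 * norm (F Z) + 1"
    have k: "k > 0" by (simp add: k_def add_nonneg_pos)
    obtain y0 where y0: "y0 > 0" "!!y x. 0 < y ==> y <= y0 ==> Im (hin x (F' (iy y) *v x)) <= \<epsilon>/k * (norm x)\<^sup>2"
     using R0(4)[of "\<epsilon>/k"] \<epsilon> k N(7) by (meson divide_pos_pos)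
    show ?thesis
    proof (intro exI[of _ "min y0 1"] conjI allI impI)
     fix y :: real and x :: "complex^2" assume y: "0 < y" "y <= min y0 1"
     let ?x = "trv a' b' c' x"
     have y1: "y <= 1" "y <= y0" using y by auto
     have "Im (hin x (F (rem Z + cscale (\<i> * of_real y) (imm Z)) *v x)) = Im (hin ?x (F' (iy y) *v ?x))"
      using Ny[OF y(1) y1(1)] realm_hin[OF rem_realm[of "F Z"]] by (simp add: mat2_vec_lin hin_add hin_tri)
     also have "\<dots> <= \<epsilon>/k * (norm ?x)\<^sup>2" by (rule y0(2)[OF y(1) y1(2)])
     also have "(norm ?x)\<^sup>2 = Im (hin x (F Z *v x))"
     proof -
      have "of_real ((norm ?x)\<^sup>2) = hin x (imm (F Z) *v x)"
       unfolding N(6)[symmetric] hin_tri[OF Sym_simps(3)] matrix_vector_mul_lid hin_self ..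
      then show ?thesis unfolding hin_imm[OF siegel_Sym[OF FP(2)[OF ZB]]] of_real_eq_iff .
     qed
     also have "\<epsilon>/k * Im (hin x (F Z *v x)) <= \<epsilon>/k * (k * (norm x)\<^sup>2)"
     proof (rule mult_left_mono)
      have "Im (hin x (F Z *v x)) <= 4 * norm (F Z) * (norm x)\<^sup>2"
       using hin_mat_bound[of x "F Z"] abs_Im_le_cmod[of "hin x (F Z *v x)"] by linarith
      also have "\<dots> <= k * (norm x)\<^sup>2" by (intro mult_right_mono) (auto simp: k_def)
      finally show "Im (hin x (F Z *v x)) <= k * (norm x)\<^sup>2" .
     qed (use \<epsilon> k in simp)
     finally show "Im (hin x (F (rem Z + cscale (\<i> * of_real y) (imm Z)) *v x)) <= \<epsilon> * (norm x)\<^sup>2"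
      using k by simp
    qed (use y0 in simp)
   qed
   fix u :: "complex^2"
   define Y X where "Y = imm Z" and "X = rem Z"
   have XY: "X \<in> Sym" "Y \<in> Sym" "X + cscale \<i> Y = Z" using rem_imm[OF Z(1)] by (auto simp: X_def Y_def realm_Sym add.commute)
   have rY: "Im (Y$i$j) = 0" "Im (X$i$j) = 0" for i j
    using exhaust_2[of i] exhaust_2[of j] by (auto simp: X_def Y_def imm_def rem_def)
   \<comment> \<open>\<open>v\<close> is the preimage of \<open>u\<close> under the triangular
     matrix, so the source normalisation takes \<open>nl v\<close> to \<open>nl u\<close>.\<close>
   define v where "v = cvec (u$1 / of_real a) ((u$2 - of_real b * (u$1 / of_real a)) / of_real c)"
   have nlu: "tri a b c (nl v) = nl u" unfolding tri_nl v_def using N(1,2) by (simp add: nl_def)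
   define r' where "r' = r / (norm Y + 1)"
   have nY: "norm Y + 1 > 0" by (simp add: add_nonneg_pos)
   have r': "r' > 0" "r' * norm Y < r"
   proof -
    show "r' > 0" using r nY by (simp add: r'_def)
    then have "r' * norm Y < r' * (norm Y + 1)" by simp
    also have "\<dots> = r" using nY by (simp add: r'_def)
    finally show "r' * norm Y < r" .
   qed
   text \<open>\<^term>\<open>X + cscale \<zeta> Y\<close> is the point over height \<open>Im \<zeta>\<close> for the base point with real part shifted by \<open>Re \<zeta>\<close>.\<close>
   define Zs where "Zs s = X + cscale (of_real s) Y + cscale \<i> Y" for s
   have Zs: "Zs s \<in> Sym" "norm (Zs s - ii) < r0" "rem (Zs s) = X + cscale (of_real s) Y" "imm (Zs s) = Y" if "\<bar>s\<bar> < r'" for s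
   proof -
    show S: "Zs s \<in> Sym" using XY by (simp add: Zs_def)
    have "norm (Zs s - ii) <= norm (Z - ii) + \<bar>s\<bar> * norm Y"
    proof -
     have e: "Zs s - ii = (Z - ii) + cscale (of_real s) Y" by (simp add: Zs_def XY(3)[symmetric] algebra_simps)
     show ?thesis unfolding e using norm_triangle_ineq[of "Z - ii" "cscale (of_real s) Y"]
      by (simp only: norm_cscale[of "of_real s"] norm_of_real)
    qed
    also have "\<bar>s\<bar> * norm Y <= r' * norm Y" using that by (intro mult_right_mono) auto
    finally show "norm (Zs s - ii) < r0" using Z(2) r'(2) by (simp add: r_def)
    have "complex_of_real (Re (X$i$j + of_real s * Y$i$j + \<i> * Y$i$j)) = X$i$j + of_real s * Y$i$j"
     "complex_of_real (Im (X$i$j + of_real s * Y$i$j + \<i> * Y$i$j)) = Y$i$j" for i j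
     using rY[of i j] by (simp_all add: complex_eq_iff)
    then show "rem (Zs s) = X + cscale (of_real s) Y" "imm (Zs s) = Y"
     using XY(1,2) by (simp_all add: mat2_eq_iff rem_def imm_def Zs_def Sym_iff)
   qed
   have pt: "rem (Zs s) + cscale (\<i> * of_real y) (imm (Zs s)) = X + cscale (Complex s y) Y" if "\<bar>s\<bar> < r'" for s y
    unfolding Zs(3,4)[OF that] by (simp add: mat2_eq_iff Complex_eq algebra_simps)
   have sl: "X + cscale \<zeta> Y \<in> HB R & dt (dF F Y (X + cscale \<zeta> Y)) ~= 0"
    if \<zeta>: "\<bar>Re \<zeta>\<bar> < r'" "0 < Im \<zeta>" "Im \<zeta> <= 1" for \<zeta>
   proof -
    obtain a1 b1 c1 a1' b1' c1' F1 G1 where N1: "a1' > 0" "c1' > 0" "tri a1 b1 c1 (mat 1) = Y" "good R0 F1 G1"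
     "X + cscale \<zeta> Y \<in> HB R"
     "\<forall>V\<in>Sym. dt (dF F (tri a1 b1 c1 V) (X + cscale \<zeta> Y)) = of_real ((a1' * c1')\<^sup>2) * dt (dF F1 V (iy (Im \<zeta>)))"
    proof -
     obtain a1 b1 c1 a1' b1' c1' F1 G1 where q: "Q (Zs (Re \<zeta>)) a1 b1 c1 a1' b1' c1' F1 G1"
      using base[OF Zs(1,2)[OF \<zeta>(1)]] by blast
     show thesis using q \<zeta>(2,3) pt[OF \<zeta>(1), of "Im \<zeta>"] unfolding Q_def Zs(4)[OF \<zeta>(1)] complex_surj
      by (intro that[of a1' c1' a1 b1 c1 F1 G1]) auto
    qed
    have "dt (dF F Y (X + cscale \<zeta> Y)) = of_real ((a1' * c1')\<^sup>2) * dt (dF F1 (mat 1) (iy (Im \<zeta>)))"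
     using N1(6) N1(3) Sym_simps(3) by metis
    then show ?thesis using N1 R0(3)[OF N1(4) \<zeta>(2,3)] by simp
   qed
   define n d where "n \<zeta> = dt (dF F (nl u) (X + cscale \<zeta> Y))" and "d \<zeta> = dt (dF F Y (X + cscale \<zeta> Y))" for \<zeta>
   have holdt: "(%\<zeta>. dt (dF F V (X + cscale \<zeta> Y))) holomorphic_on T"
    if "V \<in> Sym" "!!\<zeta>. \<zeta> \<in> T ==> X + cscale \<zeta> Y \<in> HB R" for V T
    unfolding dF_nth
    by (intro holomorphic_intros gholo_line[OF gholo_ddir[OF hol_gholo[OF FP(1)] that(1)] XY(1,2)] that(2))
   have "n \<zeta> / d \<zeta> = 0" if \<zeta>: "\<bar>Re \<zeta>\<bar> < r'" "0 < Im \<zeta>" "Im \<zeta> < 1" for \<zeta>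
   proof (rule zero_by_reflection[of "%\<zeta>. n \<zeta> / d \<zeta>" r', OF _ r'(1) _ \<zeta>])
    show "(%\<zeta>. n \<zeta> / d \<zeta>) holomorphic_on {\<zeta>. \<bar>Re \<zeta>\<bar> < r' & 0 < Im \<zeta> & Im \<zeta> < 1}"
     unfolding n_def d_def by (intro holomorphic_on_divide holdt) (use sl XY in auto)
    fix \<epsilon> :: real assume \<epsilon>: "0 < \<epsilon>"
    define e where "e = \<epsilon> / (norm v ^ 4 + 1)"
    have v4: "norm v ^ 4 + 1 > 0" by (simp add: add_nonneg_pos)
    have e: "e > 0" "e * norm v ^ 4 <= \<epsilon>"
    proof -
     show "e > 0" using \<epsilon> v4 by (simp add: e_def)
     then have "e * norm v ^ 4 <= e * (norm v ^ 4 + 1)" by (intro mult_left_mono) auto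
     also have "\<dots> = \<epsilon>" using v4 by (simp add: e_def)
     finally show "e * norm v ^ 4 <= \<epsilon>" .
    qed
    obtain y0 where y0: "y0 > 0" "!!F G y v. good R0 F G ==> 0 < y ==> y <= y0 ==>
     cmod (dt (dF F (nl v) (iy y))) <= e * norm v ^ 4 * cmod (dt (dF F (mat 1) (iy y)))"
     using R0(4)[OF e(1)] by blast
    show "\<exists>y0>0. \<forall>\<zeta>. \<bar>Re \<zeta>\<bar> < r' --> 0 < Im \<zeta> --> Im \<zeta> < 1 --> Im \<zeta> <= y0 --> cmod (n \<zeta> / d \<zeta>) <= \<epsilon>"
    proof (intro exI[of _ y0] conjI allI impI y0(1))
     fix \<zeta> assume \<zeta>: "\<bar>Re \<zeta>\<bar> < r'" "0 < Im \<zeta>" "Im \<zeta> < 1" "Im \<zeta> <= y0"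
     have \<zeta>1: "Im \<zeta> <= 1" using \<zeta> by simp
     obtain a1 b1 c1 a1' b1' c1' F1 G1 where N1: "a1 > 0" "c1 > 0" "a1' > 0" "c1' > 0" "tri a1 b1 c1 (mat 1) = Y" "good R0 F1 G1"
      "\<forall>V\<in>Sym. dt (dF F (tri a1 b1 c1 V) (X + cscale \<zeta> Y)) = of_real ((a1' * c1')\<^sup>2) * dt (dF F1 V (iy (Im \<zeta>)))"
     proof -
      obtain a1 b1 c1 a1' b1' c1' F1 G1 where q: "Q (Zs (Re \<zeta>)) a1 b1 c1 a1' b1' c1' F1 G1"
       using base[OF Zs(1,2)[OF \<zeta>(1)]] by blast
      show thesis using q \<zeta>(2) \<zeta>1 pt[OF \<zeta>(1), of "Im \<zeta>"] unfolding Q_def Zs(4)[OF \<zeta>(1)] complex_surj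
       by (intro that[of a1 c1 a1' c1' b1 F1 G1]) auto
     qed
     \<comment> \<open>The source factor does not depend on \<open>Re \<zeta>\<close>, so one vector
       \<open>v\<close> serves the whole rectangle.\<close>
     have "a1 = a" "b1 = b" "c1 = c"
      using tri_unique[of a1 b1 c1 a b c] N1(1,2,5) N(1,2,5) by (auto simp: Y_def)
     then have nn: "n \<zeta> = of_real ((a1' * c1')\<^sup>2) * dt (dF F1 (nl v) (iy (Im \<zeta>)))"
      "d \<zeta> = of_real ((a1' * c1')\<^sup>2) * dt (dF F1 (mat 1) (iy (Im \<zeta>)))"
      using N1(7) nlu N1(5) unfolding n_def d_def by (metis nl_Sym, metis Sym_simps(3))
     have d0: "dt (dF F1 (mat 1) (iy (Im \<zeta>))) ~= 0" by (rule R0(3)[OF N1(6) \<zeta>(2) \<zeta>1])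
     have nd: "n \<zeta> / d \<zeta> = dt (dF F1 (nl v) (iy (Im \<zeta>))) / dt (dF F1 (mat 1) (iy (Im \<zeta>)))"
      unfolding nn using N1(3,4) by simp
     have "cmod (dt (dF F1 (nl v) (iy (Im \<zeta>)))) <= e * norm v ^ 4 * cmod (dt (dF F1 (mat 1) (iy (Im \<zeta>))))"
      by (rule y0(2)[OF N1(6) \<zeta>(2,4)])
     then have "cmod (n \<zeta> / d \<zeta>) <= e * norm v ^ 4" unfolding nd norm_divide
      by (rule pos_divide_le_eq[THEN iffD2, rotated]) (use d0 in \<open>simp only: zero_less_norm_iff not_False_eq_True\<close>)
     then show "cmod (n \<zeta> / d \<zeta>) <= \<epsilon>" using e(2) by linarith
    qed
   qed
   then have n0: "n \<zeta> = 0" if "\<bar>Re \<zeta>\<bar> < r'" "0 < Im \<zeta>" "Im \<zeta> < 1" for \<zeta>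
    using that sl[of \<zeta>] by (force simp: d_def)
   \<comment> \<open>The point \<open>Z\<close> belongs to \<open>\<zeta> = \<i>\<close>, on the
     upper edge of the open rectangle, and is reached by continuity.\<close>
   have "(n \<longlongrightarrow> n \<i>) (at \<i>)"
   proof -
    define T where "T = {\<zeta>. X + cscale \<zeta> Y \<in> HB R}"
    have T: "open T" unfolding T_def by (rule open_line[OF open_Sym_HB XY(1,2)])
    have "n holomorphic_on T" unfolding n_def by (rule holdt) (auto simp: T_def)
    moreover have "\<i> \<in> T" using ZB XY(3) by (simp add: T_def)
    ultimately show ?thesis using T holomorphic_on_imp_continuous_on continuous_on_eq_continuous_at isCont_def by blast
   qed
   moreover have "filterlim (%k. \<i> * of_real (1 - 1 / (real k + 2))) (at \<i>) sequentially"
    unfolding filterlim_at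
   proof (intro conjI always_eventually allI)
    have "(%k. 1 - 1 / (real k + 2)) \<longlonglongrightarrow> 1" by real_asymp
    then have "(%k. \<i> * complex_of_real (1 - 1 / (real k + 2))) \<longlonglongrightarrow> \<i> * of_real 1"
     by (intro tendsto_intros)
    then show "(%k. \<i> * complex_of_real (1 - 1 / (real k + 2))) \<longlonglongrightarrow> \<i>" by simp
    show "\<i> * complex_of_real (1 - 1 / (real k + 2)) ~= \<i>" for k
    proof -
     have "complex_of_real (1 - 1 / (real k + 2)) ~= of_real 1" unfolding of_real_eq_iff by (simp add: field_simps)
     then show ?thesis by simp
    qed
   qed auto
   ultimately have "(%k. n (\<i> * of_real (1 - 1 / (real k + 2)))) \<longlonglongrightarrow> n \<i>" by (rule filterlim_compose)
   moreover have "n (\<i> * of_real (1 - 1 / (real k + 2))) = 0" for k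
    by (rule n0) (use r' in \<open>auto simp: field_simps\<close>)
   ultimately have "n \<i> = 0" by (simp add: LIMSEQ_const_iff)
   then show "dt (dF F (nl u) Z) = 0" unfolding n_def XY(3) .
  qed
  then show "\<exists>r>0. \<forall>Z\<in>Sym. norm (Z - ii) < r --> Z \<in> HB R & (\<forall>u. dt (dF F (nl u) Z) = 0) &
   (\<forall>y. 0 < y --> y <= 1 --> rem Z + cscale (\<i> * of_real y) (imm Z) \<in> HB R) &
   (\<exists>K. \<forall>y. 0 < y --> y <= 1 --> norm (F (rem Z + cscale (\<i> * of_real y) (imm Z))) <= K) &
   (\<forall>\<epsilon>>0. \<exists>y0>0. \<forall>y x. 0 < y --> y <= y0 --> Im (hin x (F (rem Z + cscale (\<i> * of_real y) (imm Z)) *v x)) <= \<epsilon> * (norm x)\<^sup>2)"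
   by (intro exI[of _ r] conjI[OF r(1)] ballI impI) (rule main)
 qed
qed

section \<open>Liouville's theorem\<close>

abbreviation E1 :: mat2 where "E1 \<equiv> symat 1 0 0"
abbreviation E2 :: mat2 where "E2 \<equiv> symat 0 1 0"
abbreviation E3 :: mat2 where "E3 \<equiv> symat 0 0 1"

section \<open>Calculus of directional derivatives and affine systems\<close>

lemma ddir_add:
 assumes "gholo f S" "gholo g S" "Z \<in> S" "X \<in> Sym"
 shows "ddir (%Z. f Z + g Z) X Z = ddir f X Z + ddir g X Z"
 unfolding ddir_def[of "%Z. f Z + g Z"]
 by (rule DERIV_imp_deriv, rule DERIV_add) (rule gholo_deriv; use assms in blast)+

lemma ddir_diff:
 assumes "gholo f S" "gholo g S" "Z \<in> S" "X \<in> Sym"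
 shows "ddir (%Z. f Z - g Z) X Z = ddir f X Z - ddir g X Z"
 unfolding ddir_def[of "%Z. f Z - g Z"]
 by (rule DERIV_imp_deriv, rule DERIV_diff) (rule gholo_deriv; use assms in blast)+

lemma ddir_mult:
 assumes "gholo f S" "gholo g S" "Z \<in> S" "X \<in> Sym"
 shows "ddir (%Z. f Z * g Z) X Z = ddir f X Z * g Z + f Z * ddir g X Z"
proof -
 have "((%t. f (Z + cscale t X) * g (Z + cscale t X)) has_field_derivative
  ddir f X Z * g (Z + cscale 0 X) + ddir g X Z * f (Z + cscale 0 X)) (at 0)"
  by (rule DERIV_mult) (rule gholo_deriv; use assms in blast)+
 then show ?thesis unfolding ddir_def[of "%Z. f Z * g Z"] by (simp add: DERIV_imp_deriv mult.commute)
qed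

lemma ddir_divide:
 assumes f: "gholo f S" and g: "gholo g S" "!!Z. Z \<in> S ==> g Z ~= 0" and Z: "Z \<in> S" and X: "X \<in> Sym"
 shows "ddir (%Z. f Z / g Z) X Z = (ddir f X Z * g Z - f Z * ddir g X Z) / (g Z)\<^sup>2"
proof -
 have "((%t. f (Z + cscale t X) / g (Z + cscale t X)) has_field_derivative
  (ddir f X Z * g (Z + cscale 0 X) - f (Z + cscale 0 X) * ddir g X Z) / (g (Z + cscale 0 X) * g (Z + cscale 0 X))) (at 0)"
  by (rule DERIV_divide[OF gholo_deriv[OF f Z X] gholo_deriv[OF g(1) Z X]]) (use g(2)[OF Z] in simp)
 then show ?thesis unfolding ddir_def[of "%Z. f Z / g Z"] by (simp add: DERIV_imp_deriv power2_eq_square)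
qed

lemma ddir_const: "ddir (%Z. c) X Z = 0"
 by (simp add: ddir_def)

lemma ddir_nth: "ddir (%Z. Z $ i $ j) X Z = X $ i $ j"
 unfolding ddir_def by (rule DERIV_imp_deriv) (auto intro!: derivative_eq_intros)

lemma ddir_minus:
 assumes "gholo f S" "Z \<in> S" "X \<in> Sym"
 shows "ddir (%Z. - f Z) X Z = - ddir f X Z"
 unfolding ddir_def[of "%Z. - f Z"]
 by (rule DERIV_imp_deriv, rule DERIV_minus) (rule gholo_deriv; use assms in blast)

lemma constant_line:
 assumes f: "gholo f S" and Z: "Z \<in> Sym" and X: "X \<in> Sym"
  and S: "!!t. cmod t <= cmod s ==> Z + cscale t X \<in> S" and d: "!!W. W \<in> S ==> ddir f X W = 0"
 shows "f (Z + cscale s X) = f Z"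
proof -
 have "\<exists>c. \<forall>t\<in>cball 0 (cmod s). f (Z + cscale t X) = c"
 proof (rule has_field_derivative_zero_constant[OF convex_cball])
  fix t :: complex assume "t \<in> cball 0 (cmod s)"
  then have t: "Z + cscale t X \<in> S" using S by simp
  show "((%t. f (Z + cscale t X)) has_field_derivative 0) (at t within cball 0 (cmod s))"
   using gholo_line_deriv[OF f Z X t] d[OF t] has_field_derivative_at_within by fastforce
 qed
 then have "f (Z + cscale s X) = f (Z + cscale 0 X)" by (metis mem_cball_0 norm_zero norm_ge_zero order_refl)
 then show ?thesis by simp
qed

text \<open>The point is reached from the centre along \<open>E1\<close>, \<open>E2\<close> and
  \<open>E3\<close> in turn. Their norms are at most 1, 2 and 1, which explains the quarter of the
  radius.\<close>

lemma constant_ball: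
 assumes f: "gholo f S" and S: "S = {W \<in> Sym. norm (W - Z0) < r}" and Z0: "Z0 \<in> Sym"
  and d: "!!W. W \<in> S ==> ddir f E1 W = 0" "!!W. W \<in> S ==> ddir f E2 W = 0" "!!W. W \<in> S ==> ddir f E3 W = 0"
  and W: "W \<in> Sym" "norm (W - Z0) < r / 4"
 shows "f W = f Z0"
proof -
 let ?d = "norm (W - Z0)"
 define x y z where "x = (W - Z0)$1$1" and "y = (W - Z0)$1$2" and "z = (W - Z0)$2$2"
 have c: "cmod x <= ?d" "cmod y <= ?d" "cmod z <= ?d" unfolding x_def y_def z_def by (rule cmod_nth_le)+
 have n: "norm E1 <= 1" "norm E2 <= 2" "norm E3 <= 1"
  by (simp_all add: norm_mat2 real_le_lsqrt)
 have b: "norm (cscale p E1 + cscale q E2 + cscale s E3) < r" if "cmod p <= ?d" "cmod q <= ?d" "cmod s <= ?d" for p q s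
 proof -
  have "norm (cscale p E1 + cscale q E2 + cscale s E3) <= norm (cscale p E1) + norm (cscale q E2) + norm (cscale s E3)"
   using norm_triangle_ineq[of "cscale p E1 + cscale q E2" "cscale s E3"] norm_triangle_ineq[of "cscale p E1" "cscale q E2"] by linarith
  also have "\<dots> <= ?d * 1 + ?d * 2 + ?d * 1"
   unfolding norm_cscale using that n by (intro add_mono mult_mono) auto
  also have "\<dots> < r" using W(2) by simp
  finally show ?thesis .
 qed
 have in_S: "Z0 + (cscale p E1 + cscale q E2 + cscale s E3) \<in> S" if "cmod p <= ?d" "cmod q <= ?d" "cmod s <= ?d" for p q s
  using b[OF that] Z0 by (auto simp: S intro!: Sym_simps)
 have "f (Z0 + cscale x E1) = f Z0"
  by (rule constant_line[OF f Z0 _ _ d(1)]) (use in_S[of _ 0 0] c in \<open>auto intro: order_trans\<close>)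
 moreover have "f ((Z0 + cscale x E1) + cscale y E2) = f (Z0 + cscale x E1)"
  by (rule constant_line[OF f _ _ _ d(2)]) (use in_S[of x _ 0] c Z0 in \<open>auto intro: order_trans simp: add.assoc\<close>)
 moreover have "f ((Z0 + cscale x E1 + cscale y E2) + cscale z E3) = f (Z0 + cscale x E1 + cscale y E2)"
  by (rule constant_line[OF f _ _ _ d(3)]) (use in_S[of x y] c Z0 in \<open>auto intro: order_trans simp: add.assoc\<close>)
 moreover have "(Z0 + cscale x E1 + cscale y E2) + cscale z E3 = W"
  using W(1) Z0 by (simp add: mat2_eq_iff x_def y_def z_def Sym_iff)
 ultimately show ?thesis by simp
qed

text \<open>The hypotheses say that the column with entries \<open>f\<close> and \<open>g\<close>
  has derivative \<open>X k\<close> in every direction \<open>X\<close>, for some vector function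
  \<open>k\<close>. Symmetry of second derivatives makes \<open>k\<close> constant, so the column is
  a constant plus \<open>W k\<close>.\<close>

lemma affine_pair:
 assumes f: "gholo f S" and g: "gholo g S" and S: "S = {W \<in> Sym. norm (W - Z0) < r}" and Z0: "Z0 \<in> Sym" and r: "r > 0"
  and d: "!!W. W \<in> S ==> ddir f E3 W = 0" "!!W. W \<in> S ==> ddir g E1 W = 0"
   "!!W. W \<in> S ==> ddir f E1 W = ddir g E2 W" "!!W. W \<in> S ==> ddir f E2 W = ddir g E3 W"
 shows "\<exists>k0 l0 k1 k2. \<forall>W\<in>Sym. norm (W - Z0) < r / 16 -->
  f W = k0 + (W$1$1 * k1 + W$1$2 * k2) & g W = l0 + (W$2$1 * k1 + W$2$2 * k2)"
proof -
 have So: "open_Sym S" unfolding S by (rule open_Sym_ball)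
 have gd: "gholo (ddir f X) S" "gholo (ddir g X) S" if "X \<in> Sym" for X
  using gholo_ddir[OF f that] gholo_ddir[OF g that] by auto
 have z: "ddir h X W = 0" if "W \<in> S" "X \<in> Sym" "!!W. W \<in> S ==> h W = 0" for h X W
 proof -
  have "ddir h X W = ddir (%_. 0) X W" by (rule ddir_cong[OF So that(1,2)]) (use that in auto)
  then show ?thesis by (simp add: ddir_const)
 qed
 have A1: "ddir (ddir f E1) E1 W = 0" "ddir (ddir f E1) E2 W = 0" "ddir (ddir f E1) E3 W = 0"
  and A2: "ddir (ddir f E2) E1 W = 0" "ddir (ddir f E2) E2 W = 0" "ddir (ddir f E2) E3 W = 0" if W: "W \<in> S" for W
 proof -
  have "ddir (ddir f E1) E1 W = ddir (ddir g E2) E1 W" by (rule ddir_cong[OF So W _ d(3)]) auto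
  also have "\<dots> = ddir (ddir g E1) E2 W" by (rule ddir_commute[OF g W]) auto
  also have "\<dots> = 0" by (rule z[OF W _ d(2)]) auto
  finally show "ddir (ddir f E1) E1 W = 0" .
  have "ddir (ddir f E1) E2 W = ddir (ddir f E2) E1 W" by (rule ddir_commute[OF f W]) auto
  also have e: "\<dots> = ddir (ddir g E3) E1 W" by (rule ddir_cong[OF So W _ d(4)]) auto
  also have "\<dots> = ddir (ddir g E1) E3 W" by (rule ddir_commute[OF g W]) auto
  also have z1: "\<dots> = 0" by (rule z[OF W _ d(2)]) auto
  finally show 12: "ddir (ddir f E1) E2 W = 0" .
  have "ddir (ddir f E1) E3 W = ddir (ddir f E3) E1 W" by (rule ddir_commute[OF f W]) auto
  also have "\<dots> = 0" by (rule z[OF W _ d(1)]) auto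
  finally show 13: "ddir (ddir f E1) E3 W = 0" .
  have "ddir (ddir f E2) E1 W = ddir (ddir f E1) E2 W" by (rule ddir_commute[OF f W]) auto
  then show "ddir (ddir f E2) E1 W = 0" using 12 by simp
  have "ddir (ddir f E2) E2 W = ddir (ddir g E3) E2 W" by (rule ddir_cong[OF So W _ d(4)]) auto
  also have "\<dots> = ddir (ddir g E2) E3 W" by (rule ddir_commute[OF g W]) auto
  also have "\<dots> = ddir (ddir f E1) E3 W" by (rule ddir_cong[OF So W _ d(3)[symmetric]]) auto
  finally show "ddir (ddir f E2) E2 W = 0" using 13 by simp
  have "ddir (ddir f E2) E3 W = ddir (ddir f E3) E2 W" by (rule ddir_commute[OF f W]) auto
  also have "\<dots> = 0" by (rule z[OF W _ d(1)]) auto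
  finally show "ddir (ddir f E2) E3 W = 0" .
 qed
 define k1 k2 where "k1 = ddir f E1 Z0" and "k2 = ddir f E2 Z0"
 define T where "T = {W \<in> Sym. norm (W - Z0) < r / 4}"
 have T: "open_Sym T" "T \<subseteq> S" unfolding T_def by (rule open_Sym_ball) (use r in \<open>auto simp: S\<close>)
 have k1: "ddir f E1 W = k1" if "W \<in> T" for W
  unfolding k1_def by (rule constant_ball[OF gd(1) S Z0 A1]) (use that in \<open>auto simp: T_def\<close>)
 have k2: "ddir f E2 W = k2" if "W \<in> T" for W
  unfolding k2_def by (rule constant_ball[OF gd(1) S Z0 A2]) (use that in \<open>auto simp: T_def\<close>)
 define f' where "f' W = f W - (W$1$1 * k1 + W$1$2 * k2)" for W
 define g' where "g' W = g W - (W$2$1 * k1 + W$2$2 * k2)" for W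
 note gi = gholo_add gholo_mult gholo_nth gholo_const gholo_diff
 have fT: "gholo f T" "gholo g T" using f g T gholo_subset by auto
 have lin: "gholo (%W. W$i$j * k1 + W$k$l * k2) T" for i j k l using T(1) by (intro gi)
 have dlin: "ddir (%W. W$i$j * k1 + W$k$l * k2) X W = X$i$j * k1 + X$k$l * k2" for i j k l X W
  unfolding ddir_def by (rule DERIV_imp_deriv) (auto intro!: derivative_eq_intros)
 have gf: "gholo f' T" "gholo g' T" unfolding f'_def[abs_def] g'_def[abs_def] using fT lin by (auto intro!: gholo_diff)
 have df: "ddir f' X W = ddir f X W - (X$1$1 * k1 + X$1$2 * k2)" "ddir g' X W = ddir g X W - (X$2$1 * k1 + X$2$2 * k2)"
  if "W \<in> T" "X \<in> Sym" for X W
  unfolding f'_def[abs_def] g'_def[abs_def] using ddir_diff[OF fT(1) lin that] ddir_diff[OF fT(2) lin that] dlin by auto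
 have c1: "f' W = f' Z0" if "W \<in> Sym" "norm (W - Z0) < r / 4 / 4" for W
  by (rule constant_ball[OF gf(1) T_def Z0 _ _ _ that]) (use df k1 k2 d T in auto)
 have c2: "g' W = g' Z0" if "W \<in> Sym" "norm (W - Z0) < r / 4 / 4" for W
  by (rule constant_ball[OF gf(2) T_def Z0 _ _ _ that]) (use df k1 k2 d T in \<open>auto simp flip: d(3,4)\<close>)
 have "f W = f' Z0 + (W$1$1 * k1 + W$1$2 * k2) & g W = g' Z0 + (W$2$1 * k1 + W$2$2 * k2)"
  if W: "W \<in> Sym" "norm (W - Z0) < r / 16" for W
 proof -
  have n: "norm (W - Z0) < r / 4 / 4" using W(2) by simp
  show ?thesis using c1[OF W(1) n] c2[OF W(1) n] unfolding f'_def[of W] g'_def[of W] by (metis diff_add_cancel)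
 qed
 then show ?thesis by blast
qed

text \<open>Unique factorisation: the equations compare coefficients in
  \<open>(p + q T) (x1 + x2 T) = (r + s T) (y1 + y2 T)\<close>, where \<open>p + q T\<close> and
  \<open>r + s T\<close> are coprime because the determinant is nonzero.\<close>

lemma sym_product_core:
 fixes p q r s x1 x2 y1 y2 :: complex
 assumes D: "p * s - q * r ~= 0"
  and e: "p * x1 = r * y1" "q * x1 + p * x2 = s * y1 + r * y2" "q * x2 = s * y2"
 shows "\<exists>k. x1 = k * r & x2 = k * s & y1 = k * p & y2 = k * q"
proof -
 let ?D = "p * s - q * r"
 have "?D * (s * x1 - r * x2) = s * s * (p * x1) - s * r * (q * x1 + p * x2) + r * r * (q * x2)" by (simp add: algebra_simps)
 also have "\<dots> = 0" unfolding e by (simp add: algebra_simps)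
 finally have a: "s * x1 = r * x2" using D by simp
 have "?D * (p * y2 - q * y1) = p * p * (s * y2) - p * q * (s * y1 + r * y2) + q * q * (r * y1)" by (simp add: algebra_simps)
 also have "\<dots> = 0" unfolding e[symmetric] by (simp add: algebra_simps)
 finally have b: "p * y2 = q * y1" using D by simp
 define k where "k = (p * x2 - q * x1) / ?D"
 define l where "l = (s * y1 - r * y2) / ?D"
 have "k * ?D = p * x2 - q * x1" "l * ?D = s * y1 - r * y2" using D by (simp_all add: k_def l_def)
 then have "?D * (k * r) = ?D * x1" "?D * (k * s) = ?D * x2" "?D * (l * p) = ?D * y1" "?D * (l * q) = ?D * y2"
  using a b by algebra+
 then have x: "x1 = k * r" "x2 = k * s" "y1 = l * p" "y2 = l * q" using D by auto
 have "k = l"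
 proof (rule ccontr)
  assume kl: "k ~= l"
  have "(k - l) * (p * r) = 0" "(k - l) * (q * r + p * s) = 0" "(k - l) * (q * s) = 0"
   using e unfolding x by algebra+
  then have "p * r = 0" "q * r + p * s = 0" "q * s = 0" using kl by auto
  then have "?D * ?D = 0" by algebra
  then show False using D by simp
 qed
 then show ?thesis using x by blast
qed

text \<open>Along the curve of null matrices the determinant is a polynomial of degree 4 in
  \<open>t\<close> that vanishes identically. Its extreme coefficients are zero, and the values at
  1, -1 and \<i> dispose of the other three.\<close>

lemma null_cone_coeffs:
 fixes A1 A2 A3 :: mat2
 assumes S: "A1 \<in> Sym" "A2 \<in> Sym" "A3 \<in> Sym"
  and z: "!!t. dt (A1 + cscale t A2 + cscale (t\<^sup>2) A3) = 0" and z3: "dt A3 = 0"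
 shows "A1$1$1 * A1$2$2 = A1$1$2 * A1$1$2" "A1$1$1 * A2$2$2 + A2$1$1 * A1$2$2 = 2 * A1$1$2 * A2$1$2"
  "A2$1$1 * A2$2$2 - A2$1$2 * A2$1$2 + (A1$1$1 * A3$2$2 + A3$1$1 * A1$2$2 - 2 * A1$1$2 * A3$1$2) = 0"
  "A2$1$1 * A3$2$2 + A3$1$1 * A2$2$2 = 2 * A2$1$2 * A3$1$2"
proof -
 have S': "A1$2$1 = A1$1$2" "A2$2$1 = A2$1$2" "A3$2$1 = A3$1$2" using S by (auto simp: Sym_iff)
 define m12 where "m12 = A1$1$1 * A2$2$2 + A2$1$1 * A1$2$2 - 2 * A1$1$2 * A2$1$2"
 define m13 where "m13 = dt A2 + (A1$1$1 * A3$2$2 + A3$1$1 * A1$2$2 - 2 * A1$1$2 * A3$1$2)"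
 define m23 where "m23 = A2$1$1 * A3$2$2 + A3$1$1 * A2$2$2 - 2 * A2$1$2 * A3$1$2"
 have d1: "dt A1 = 0" using z[of 0] by simp
 have q: "dt A1 + t * m12 + t\<^sup>2 * m13 + t ^ 3 * m23 + t ^ 4 * dt A3 = 0" for t
 proof -
  have "dt A1 + t * m12 + t\<^sup>2 * m13 + t ^ 3 * m23 + t ^ 4 * dt A3 = dt (A1 + cscale t A2 + cscale (t\<^sup>2) A3)"
   unfolding m12_def m13_def m23_def
   by (simp add: S' power2_eq_square power3_eq_cube power4_eq_xxxx algebra_simps)
  then show ?thesis using z by simp
 qed
 have q': "t * m12 + t\<^sup>2 * m13 + t ^ 3 * m23 = 0" for t using q[of t] unfolding d1 z3 by simp
 have a: "m12 + m13 + m23 = 0" using q'[of 1] by simp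
 have b: "- m12 + m13 - m23 = 0" using q'[of "-1"] by simp
 have c: "\<i> * m12 - m13 - \<i> * m23 = 0" using q'[of \<i>] by (simp add: power3_eq_cube)
 have m13: "m13 = 0" using a b by algebra
 have m23: "m23 = - m12" using a m13 by algebra
 have "\<i> * (2 * m12) = 0" using c unfolding m13 m23 by (simp add: algebra_simps)
 then have m12: "m12 = 0" by simp
 show "A1$1$1 * A1$2$2 = A1$1$2 * A1$1$2" using d1 S' by simp
 show "A1$1$1 * A2$2$2 + A2$1$1 * A1$2$2 = 2 * A1$1$2 * A2$1$2" using m12 by (simp add: m12_def)
 show "A2$1$1 * A2$2$2 - A2$1$2 * A2$1$2 + (A1$1$1 * A3$2$2 + A3$1$1 * A1$2$2 - 2 * A1$1$2 * A3$1$2) = 0"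
  using m13 S' by (simp add: m13_def)
 show "A2$1$1 * A3$2$2 + A3$1$1 * A2$2$2 = 2 * A2$1$2 * A3$1$2" using m23 m12 by (simp add: m23_def)
qed

text \<open>The images of \<open>E1\<close> and \<open>E2\<close> determine that of
  \<open>E3\<close>. By the two linear equations its deviation from the square of
  \<open>(r, s)\<close> is a multiple of the square of \<open>(p, q)\<close>, and the requirement
  that the image be singular makes this multiple zero.\<close>

lemma third_column:
 fixes p q r s a b c :: complex
 assumes D: "p * s - q * r ~= 0"
  and e1: "(2 * p * r) * (2 * q * s) - (p * s + q * r) * (p * s + q * r) + (p * p * c + a * (q * q) - 2 * (p * q) * b) = 0"
  and e2: "(2 * p * r) * c + a * (2 * q * s) = 2 * (p * s + q * r) * b" and e3: "a * c = b * b"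
 shows "a = r * r & b = r * s & c = s * s"
proof -
 define A B C where "A = a - r * r" and "B = b - r * s" and "C = c - s * s"
 have abc: "a = A + r * r" "b = B + r * s" "c = C + s * s" by (simp_all add: A_def B_def C_def)
 let ?D = "p * s - q * r"
 define f1 where "f1 = s * s * A - 2 * r * s * B + r * r * C"
 have f3: "q * q * A - 2 * p * q * B + p * p * C = 0" using e1 unfolding abc by algebra
 have f2: "q * s * A - (p * s + q * r) * B + p * r * C = 0"
 proof -
  have "2 * (q * s * A - (p * s + q * r) * B + p * r * C) = 0" using e2 unfolding abc by algebra
  then show ?thesis by (simp only: mult_eq_0_iff) simp
 qed
 have A: "?D * ?D * A = p * p * f1" unfolding f1_def using f2 f3 by algebra
 have B: "?D * ?D * B = p * q * f1" unfolding f1_def using f2 f3 by algebra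
 have C: "?D * ?D * C = q * q * f1" unfolding f1_def using f2 f3 by algebra
 have "(?D * ?D * A) * (?D * ?D * C) - (?D * ?D * B) * (?D * ?D * B) = 0" unfolding A B C by (simp add: algebra_simps)
 then have "(?D * ?D * ?D * ?D) * (A * C - B * B) = 0" by (simp add: algebra_simps)
 then have AC: "A * C - B * B = 0" using D by simp
 have "f1 = 0" using e3 AC unfolding abc f1_def by algebra
 then have "A = 0" "B = 0" "C = 0" using A B C D by auto
 then show ?thesis using abc by simp
qed

text \<open>The linear fractional map \<open>(N + Z P)^-1 (R + Z E)\<close>, written without
  inverses. Comparing coefficients in the identity with independent \<open>Z\<close> and
  \<open>W\<close> yields the relations that make the block matrix of coefficients
  symplectic.\<close>

definition liouville_form :: "(mat2 => mat2) => mat2 => bool"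
 where "liouville_form F Z0 \<longleftrightarrow> (\<exists>N P R E r. r > 0 &
  (\<forall>Z\<in>Sym. norm (Z - Z0) < r --> (N + Z ** P) ** F Z = R + Z ** E) &
  (\<forall>Z\<in>Sym. \<forall>W\<in>Sym. (R + Z ** E) ** transpose (N + W ** P) - (N + Z ** P) ** transpose (R + W ** E) = Z - W))"

text \<open>The derivative has the form \<open>M^T X M\<close>, where \<open>M\<close> has rows
  \<open>(p, q)\<close> and \<open>(r, s)\<close>. Equality of mixed second derivatives expresses
  all derivatives of \<open>M\<close> by three functions \<open>t\<close>, \<open>u\<close>,
  \<open>v\<close>; this is what makes the inverse of \<open>M^T\<close> an affine function
  \<open>N + Z P\<close>, and then \<open>(N + Z P) F Z\<close> is affine too.\<close>

lemma liouville_aux: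
 assumes F: "hol F S" and S: "S = {W \<in> Sym. norm (W - Z0) < \<rho>}" and Z0: "Z0 \<in> Sym" and \<rho>: "\<rho> > 0"
  and null: "!!Z u. Z \<in> S ==> dt (dF F (nl u) Z) = 0"
  and inj: "!!Z X. Z \<in> S ==> X \<in> Sym ==> dF F X Z = 0 ==> X = 0"
  and ne: "dF F E1 Z0 $ 1 $ 1 ~= 0"
 shows "liouville_form F Z0"
proof -
 define w0 where "w0 = dF F E1 Z0 $ 1 $ 1"
 have Z0S: "Z0 \<in> S" using Z0 \<rho> by (simp add: S)
 have gF: "gholo (%Z. F Z $ i $ j) S" for i j by (rule hol_gholo[OF F])
 have "continuous_on S (%Z. ddir (%Z. F Z $ 1 $ 1) E1 Z)"
  by (intro gholo_continuous gholo_ddir gF) auto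
 then have "((%Z. ddir (%Z. F Z $ 1 $ 1) E1 Z) \<longlongrightarrow> w0) (at Z0 within S)"
  using Z0S by (simp add: continuous_on_def w0_def)
 moreover have w0: "w0 ~= 0" using ne by (simp only: w0_def not_False_eq_True)
 ultimately have "((%Z. Re (ddir (%Z. F Z $ 1 $ 1) E1 Z / w0)) \<longlongrightarrow> Re (w0 / w0)) (at Z0 within S)"
  by (intro tendsto_intros)
 then have "\<forall>\<^sub>F Z in at Z0 within S. Re (ddir (%Z. F Z $ 1 $ 1) E1 Z / w0) > 0"
  by (rule order_tendstoD) (use w0 in simp)
 then obtain d where d: "d > 0" "!!Z. Z \<in> S ==> Z ~= Z0 ==> dist Z Z0 < d ==> Re (ddir (%Z. F Z $ 1 $ 1) E1 Z / w0) > 0"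
  unfolding eventually_at by blast
 define \<tau> where "\<tau> = min d \<rho>"
 define U where "U = {W \<in> Sym. norm (W - Z0) < \<tau>}"
 have \<tau>: "\<tau> > 0" using d \<rho> by (simp add: \<tau>_def)
 have U: "open_Sym U" "U \<subseteq> S" "Z0 \<in> U"
  unfolding U_def by (rule open_Sym_ball) (use \<tau> Z0 in \<open>auto simp: S \<tau>_def\<close>)
 have FU: "hol F U" by (rule hol_subset[OF F U(2,1)])
 have pos: "Re (ddir (%Z. F Z $ 1 $ 1) E1 Z / w0) > 0" if "Z \<in> U" for Z
 proof (cases "Z = Z0")
  case True then show ?thesis using w0 dF_nth[of F E1 Z0 1 1] by (simp add: w0_def)
 next
  case False then show ?thesis using d(2)[of Z] that U(2) by (auto simp: U_def \<tau>_def dist_norm)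
 qed
 have gFU: "gholo (%Z. F Z $ i $ j) U" for i j by (rule hol_gholo[OF FU])
 define D where "D X i j Z = ddir (%Z. F Z $ i $ j) X Z" for X i j Z
 have gD: "gholo (D X i j) U" if "X \<in> Sym" for X i j unfolding D_def[abs_def] using gholo_ddir[OF gFU that] by (simp add: eta_contract_eq)
 \<comment> \<open>A holomorphic square root of the leading entry: division by \<open>w0\<close>
   moves the entry into the right half plane, away from the cut of \<open>csqrt\<close>.\<close>
 define p where "p Z = csqrt w0 * csqrt (D E1 1 1 Z / w0)" for Z
 have gp: "gholo p U"
 proof -
  have "gholo (%Z. (%w. csqrt w0 * csqrt (w / w0)) (D E1 1 1 Z)) U"
  proof (rule gholo_compose[OF gD, where T = "{w. Re (w / w0) > 0}"])
   show "open {w. Re (w / w0) > 0}" by (intro open_Collect_less continuous_intros) (use w0 in auto)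
   show "(%w. csqrt w0 * csqrt (w / w0)) holomorphic_on {w. 0 < Re (w / w0)}"
   proof -
    have "(%w. csqrt (w / w0)) holomorphic_on {w. 0 < Re (w / w0)}"
     using w0 by (intro holomorphic_on_compose_gen[of "%w. w / w0" _ csqrt "{w. 0 < Re w}", unfolded o_def])
      (auto intro!: holomorphic_intros simp: complex_nonpos_Reals_iff)
    then show ?thesis by (rule holomorphic_on_mult[OF holomorphic_on_const])
   qed
  qed (use pos in \<open>auto simp: D_def\<close>)
  then show ?thesis by (simp add: p_def[abs_def])
 qed
 have pp: "p Z * p Z = D E1 1 1 Z" for Z
 proof -
  have "p Z * p Z = (csqrt w0)\<^sup>2 * (csqrt (D E1 1 1 Z / w0))\<^sup>2" by (simp add: p_def power2_eq_square)
  then show ?thesis using w0 by simp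
 qed
 have p0: "p Z ~= 0" if "Z \<in> U" for Z
 proof
  assume "p Z = 0"
  then have "D E1 1 1 Z = 0" using pp[of Z] by simp
  then show False using pos[OF that] by (simp add: D_def)
 qed
 define q where "q Z = D E1 1 2 Z / p Z" for Z
 define r where "r Z = D E2 1 1 Z / (2 * p Z)" for Z
 define s where "s Z = (D E2 1 2 Z - q Z * r Z) / p Z" for Z
 note gi = gholo_add gholo_mult gholo_const gholo_diff gholo_divide gholo_minus
 have gq: "gholo q U" unfolding q_def[abs_def] using gD gp p0 by (intro gi) auto
 have gr: "gholo r U" unfolding r_def[abs_def] using gD gp p0 U(1) by (intro gi) auto
 have gs: "gholo s U" unfolding s_def[abs_def] using gD gp gq gr p0 U(1) by (intro gi) auto
 define \<Delta> where "\<Delta> Z = p Z * s Z - q Z * r Z" for Z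
 have g\<Delta>: "gholo \<Delta> U" unfolding \<Delta>_def[abs_def] using gp gq gr gs by (intro gi) auto
 have DS: "D X 2 1 Z = D X 1 2 Z" if "Z \<in> U" "X \<in> Sym" for X Z
  using hol_dF_Sym[OF FU that] by (simp add: D_def Sym_iff)
 have coef: "D E1 1 1 Z * D E1 2 2 Z = D E1 1 2 Z * D E1 1 2 Z"
  "D E1 1 1 Z * D E2 2 2 Z + D E2 1 1 Z * D E1 2 2 Z = 2 * D E1 1 2 Z * D E2 1 2 Z"
  "D E2 1 1 Z * D E2 2 2 Z - D E2 1 2 Z * D E2 1 2 Z + (D E1 1 1 Z * D E3 2 2 Z + D E3 1 1 Z * D E1 2 2 Z - 2 * D E1 1 2 Z * D E3 1 2 Z) = 0"
  "D E2 1 1 Z * D E3 2 2 Z + D E3 1 1 Z * D E2 2 2 Z = 2 * D E2 1 2 Z * D E3 1 2 Z"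
  "D E3 1 1 Z * D E3 2 2 Z = D E3 1 2 Z * D E3 1 2 Z" if Z: "Z \<in> U" for Z
 proof -
  have sy: "dF F E1 Z \<in> Sym" "dF F E2 Z \<in> Sym" "dF F E3 Z \<in> Sym" using hol_dF_Sym[OF FU Z] by auto
  have z: "dt (dF F E1 Z + cscale t (dF F E2 Z) + cscale (t\<^sup>2) (dF F E3 Z)) = 0" for t
  proof -
   have "nl (cvec 1 t) = symat 1 t (t\<^sup>2)" by (simp add: nl_def)
   then show ?thesis using null[of Z "cvec 1 t"] dF_symat[OF FU Z, of 1 t "t\<^sup>2"] Z U(2) by auto
  qed
  have z3: "dt (dF F E3 Z) = 0"
   using null[of Z "cvec 0 1"] Z U(2) by (auto simp: nl_def)
  show "D E1 1 1 Z * D E1 2 2 Z = D E1 1 2 Z * D E1 1 2 Z"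
  "D E1 1 1 Z * D E2 2 2 Z + D E2 1 1 Z * D E1 2 2 Z = 2 * D E1 1 2 Z * D E2 1 2 Z"
  "D E2 1 1 Z * D E2 2 2 Z - D E2 1 2 Z * D E2 1 2 Z + (D E1 1 1 Z * D E3 2 2 Z + D E3 1 1 Z * D E1 2 2 Z - 2 * D E1 1 2 Z * D E3 1 2 Z) = 0"
  "D E2 1 1 Z * D E3 2 2 Z + D E3 1 1 Z * D E2 2 2 Z = 2 * D E2 1 2 Z * D E3 1 2 Z"
   using null_cone_coeffs[OF sy z z3] by (simp_all add: D_def)
  show "D E3 1 1 Z * D E3 2 2 Z = D E3 1 2 Z * D E3 1 2 Z" using z3 sy(3) by (simp add: D_def Sym_iff)
 qed
 have d11: "D E1 1 1 Z = p Z * p Z" "D E1 1 2 Z = p Z * q Z" "D E1 2 2 Z = q Z * q Z"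
  and d2: "D E2 1 1 Z = 2 * p Z * r Z" "D E2 1 2 Z = p Z * s Z + q Z * r Z" "D E2 2 2 Z = 2 * q Z * s Z"
  and \<Delta>0: "\<Delta> Z ~= 0"
  and d3: "D E3 1 1 Z = r Z * r Z" "D E3 1 2 Z = r Z * s Z" "D E3 2 2 Z = s Z * s Z" if Z: "Z \<in> U" for Z
 proof -
  note n = p0[OF Z]
  show a: "D E1 1 1 Z = p Z * p Z" by (simp add: pp)
  show b: "D E1 1 2 Z = p Z * q Z" using n by (simp add: q_def)
  have "(p Z * p Z) * D E1 2 2 Z = (p Z * p Z) * (q Z * q Z)" using coef(1)[OF Z] unfolding a b by (simp add: mult_ac)
  then show c: "D E1 2 2 Z = q Z * q Z" using n by simp
  show a2: "D E2 1 1 Z = 2 * p Z * r Z" using n by (simp add: r_def)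
  show b2: "D E2 1 2 Z = p Z * s Z + q Z * r Z" using n by (simp add: s_def)
  have "(p Z * p Z) * D E2 2 2 Z = (p Z * p Z) * (2 * q Z * s Z)"
   using coef(2)[OF Z] unfolding a b c a2 b2 by algebra
  then show c2: "D E2 2 2 Z = 2 * q Z * s Z" using n by simp
  \<comment> \<open>Were the determinant of \<open>M\<close> zero, the derivatives in the directions
    \<open>E1\<close> and \<open>E2\<close> would be proportional, against injectivity.\<close>
  show D0: "\<Delta> Z ~= 0"
  proof
   assume "\<Delta> Z = 0"
   then have ps: "p Z * s Z = q Z * r Z" by (simp add: \<Delta>_def)
   define l where "l = 2 * r Z / p Z"
   have lp: "l * p Z = 2 * r Z" using n by (simp add: l_def)
   have "dF F E2 Z = cscale l (dF F E1 Z)"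
   proof -
    have "2 * p Z * r Z = l * (p Z * p Z)" using lp by algebra
    moreover have "p Z * s Z + q Z * r Z = l * (p Z * q Z)" using lp ps by algebra
    moreover have "2 * q Z * s Z = l * (q Z * q Z)"
    proof -
     have "p Z * (2 * q Z * s Z) = p Z * (l * (q Z * q Z))" using lp ps by algebra
     then show ?thesis using n by simp
    qed
    ultimately show ?thesis
     using a b c a2 b2 c2 DS[OF Z, of E1] DS[OF Z, of E2] by (simp add: mat2_eq_iff D_def)
   qed
   moreover have "dF F (E2 + cscale (- l) E1) Z = dF F E2 Z + cscale (- l) (dF F E1 Z)"
    by (simp only: dF_add[OF FU Z] dF_cscale[OF FU Z] Sym_simps)
   ultimately have "dF F (E2 + cscale (- l) E1) Z = 0" by (simp add: mat2_eq_iff)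
   then have "E2 + cscale (- l) E1 = 0" using inj[of Z] Z U(2) by auto
   then show False by (simp add: mat2_eq_iff)
  qed
  have "D E3 1 1 Z = r Z * r Z & D E3 1 2 Z = r Z * s Z & D E3 2 2 Z = s Z * s Z"
  proof (rule third_column)
   show "p Z * s Z - q Z * r Z ~= 0" using D0 by (simp add: \<Delta>_def)
  qed (use coef(3,4,5)[OF Z] in \<open>simp_all add: a b c a2 b2 c2\<close>)
  then show "D E3 1 1 Z = r Z * r Z" "D E3 1 2 Z = r Z * s Z" "D E3 2 2 Z = s Z * s Z" by auto
 qed
 have com: "ddir (D X i j) Y Z = ddir (D Y i j) X Z" if "Z \<in> U" "X \<in> Sym" "Y \<in> Sym" for X Y Z i j
  using ddir_commute[OF gFU that] by (simp add: D_def[abs_def] eta_contract_eq)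
 have cong: "ddir (D X i j) Y Z = ddir h Y Z" if "Z \<in> U" "Y \<in> Sym" "!!Z. Z \<in> U ==> D X i j Z = h Z" for X Y Z i j h
  by (rule ddir_cong[OF U(1) that])
 \<comment> \<open>Each symmetry of second derivatives is an instance of
   \<open>sym_product_core\<close>. The pair \<open>E1\<close>, \<open>E3\<close> gives
   \<open>t\<close>; the pairs \<open>E1\<close>, \<open>E2\<close> and \<open>E2\<close>,
   \<open>E3\<close> give \<open>u\<close> and \<open>v\<close> once the contribution of
   \<open>t\<close> is subtracted.\<close>
 have tuv: "\<exists>t u v. ddir p E1 Z = u * p Z & ddir q E1 Z = u * q Z & ddir r E1 Z = t * p Z & ddir s E1 Z = t * q Z &
   ddir p E2 Z = t * p Z + u * r Z & ddir q E2 Z = t * q Z + u * s Z & ddir r E2 Z = t * r Z + v * p Z & ddir s E2 Z = t * s Z + v * q Z &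
   ddir p E3 Z = t * r Z & ddir q E3 Z = t * s Z & ddir r E3 Z = v * r Z & ddir s E3 Z = v * s Z" if Z: "Z \<in> U" for Z
 proof -
  have m: "ddir (%Z. f Z * g Z) X Z = ddir f X Z * g Z + f Z * ddir g X Z" if "gholo f U" "gholo g U" "X \<in> Sym" for f g X
   by (rule ddir_mult[OF that(1,2) Z that(3)])
  have dd: "ddir (D E1 1 1) X Z = 2 * p Z * ddir p X Z" "ddir (D E1 1 2) X Z = ddir p X Z * q Z + p Z * ddir q X Z"
   "ddir (D E1 2 2) X Z = 2 * q Z * ddir q X Z"
   "ddir (D E2 1 1) X Z = 2 * (ddir p X Z * r Z + p Z * ddir r X Z)"
   "ddir (D E2 1 2) X Z = ddir p X Z * s Z + p Z * ddir s X Z + (ddir q X Z * r Z + q Z * ddir r X Z)"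
   "ddir (D E2 2 2) X Z = 2 * (ddir q X Z * s Z + q Z * ddir s X Z)"
   "ddir (D E3 1 1) X Z = 2 * r Z * ddir r X Z" "ddir (D E3 1 2) X Z = ddir r X Z * s Z + r Z * ddir s X Z"
   "ddir (D E3 2 2) X Z = 2 * s Z * ddir s X Z" if X: "X \<in> Sym" for X
  proof -
   have two: "ddir (%Z. 2 * f Z * g Z) X Z = 2 * (ddir f X Z * g Z + f Z * ddir g X Z)" if "gholo f U" "gholo g U" for f g
   proof -
    have "ddir (%Z. 2 * (f Z * g Z)) X Z = ddir (%Z. 2) X Z * (f Z * g Z) + 2 * ddir (%Z. f Z * g Z) X Z"
     by (rule m[OF gholo_const[OF U(1)] gholo_mult[OF that] X])
    then show ?thesis by (simp add: ddir_const m[OF that X] mult.assoc)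
   qed
   have cg: "ddir (D E1 1 1) X Z = ddir (%Z. p Z * p Z) X Z"
    "ddir (D E1 1 2) X Z = ddir (%Z. p Z * q Z) X Z"
    "ddir (D E1 2 2) X Z = ddir (%Z. q Z * q Z) X Z"
    "ddir (D E2 1 1) X Z = ddir (%Z. 2 * p Z * r Z) X Z"
    "ddir (D E2 1 2) X Z = ddir (%Z. p Z * s Z + q Z * r Z) X Z"
    "ddir (D E2 2 2) X Z = ddir (%Z. 2 * q Z * s Z) X Z"
    "ddir (D E3 1 1) X Z = ddir (%Z. r Z * r Z) X Z"
    "ddir (D E3 1 2) X Z = ddir (%Z. r Z * s Z) X Z"
    "ddir (D E3 2 2) X Z = ddir (%Z. s Z * s Z) X Z"
    by (rule cong[OF Z X]; simp add: d11 d2 d3)+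
   show "ddir (D E1 1 1) X Z = 2 * p Z * ddir p X Z" unfolding cg(1) m[OF gp gp X] by simp
   show "ddir (D E1 1 2) X Z = ddir p X Z * q Z + p Z * ddir q X Z" unfolding cg(2) m[OF gp gq X] by simp
   show "ddir (D E1 2 2) X Z = 2 * q Z * ddir q X Z" unfolding cg(3) m[OF gq gq X] by simp
   show "ddir (D E2 1 1) X Z = 2 * (ddir p X Z * r Z + p Z * ddir r X Z)" unfolding cg(4) two[OF gp gr] by simp
   show "ddir (D E2 1 2) X Z = ddir p X Z * s Z + p Z * ddir s X Z + (ddir q X Z * r Z + q Z * ddir r X Z)"
    unfolding cg(5) ddir_add[OF gholo_mult[OF gp gs] gholo_mult[OF gq gr] Z X] m[OF gp gs X] m[OF gq gr X] by simp
   show "ddir (D E2 2 2) X Z = 2 * (ddir q X Z * s Z + q Z * ddir s X Z)" unfolding cg(6) two[OF gq gs] by simp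
   show "ddir (D E3 1 1) X Z = 2 * r Z * ddir r X Z" unfolding cg(7) m[OF gr gr X] by simp
   show "ddir (D E3 1 2) X Z = ddir r X Z * s Z + r Z * ddir s X Z" unfolding cg(8) m[OF gr gs X] by simp
   show "ddir (D E3 2 2) X Z = 2 * s Z * ddir s X Z" unfolding cg(9) m[OF gs gs X] by simp
  qed
  have Es: "E1 \<in> Sym" "E2 \<in> Sym" "E3 \<in> Sym" by auto
  have D0: "p Z * s Z - q Z * r Z ~= 0" using \<Delta>0[OF Z] by (simp add: \<Delta>_def)
  note c13 = com[OF Z Es(1) Es(3)] and c12 = com[OF Z Es(1) Es(2)] and c23 = com[OF Z Es(2) Es(3)]
  obtain t where t: "ddir p E3 Z = t * r Z" "ddir q E3 Z = t * s Z" "ddir r E1 Z = t * p Z" "ddir s E1 Z = t * q Z"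
   using sym_product_core[OF D0, of "ddir p E3 Z" "ddir r E1 Z" "ddir q E3 Z" "ddir s E1 Z"]
    c13[of 1 1] c13[of 1 2] c13[of 2 2] unfolding dd[OF Es(1)] dd[OF Es(3)] by (auto simp: algebra_simps)
  have "\<exists>k. ddir p E2 Z - t * p Z = k * r Z & ddir q E2 Z - t * q Z = k * s Z & ddir p E1 Z = k * p Z & ddir q E1 Z = k * q Z"
  proof (rule sym_product_core[OF D0])
   have "2 * (p Z * (ddir p E2 Z - t * p Z)) = 2 * (r Z * ddir p E1 Z)"
    using c12[of 1 1] unfolding dd[OF Es(1)] dd[OF Es(2)] t by algebra
   then show "p Z * (ddir p E2 Z - t * p Z) = r Z * ddir p E1 Z" by simp
   show "q Z * (ddir p E2 Z - t * p Z) + p Z * (ddir q E2 Z - t * q Z) = s Z * ddir p E1 Z + r Z * ddir q E1 Z"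
    using c12[of 1 2] unfolding dd[OF Es(1)] dd[OF Es(2)] t by algebra
   have "2 * (q Z * (ddir q E2 Z - t * q Z)) = 2 * (s Z * ddir q E1 Z)"
    using c12[of 2 2] unfolding dd[OF Es(1)] dd[OF Es(2)] t by algebra
   then show "q Z * (ddir q E2 Z - t * q Z) = s Z * ddir q E1 Z" by simp
  qed
  then obtain u where u: "ddir p E2 Z = t * p Z + u * r Z" "ddir q E2 Z = t * q Z + u * s Z" "ddir p E1 Z = u * p Z" "ddir q E1 Z = u * q Z"
   by (auto simp: algebra_simps)
  have "\<exists>k. ddir r E3 Z = k * r Z & ddir s E3 Z = k * s Z & ddir r E2 Z - t * r Z = k * p Z & ddir s E2 Z - t * s Z = k * q Z"
  proof (rule sym_product_core[OF D0])
   have "2 * (p Z * ddir r E3 Z) = 2 * (r Z * (ddir r E2 Z - t * r Z))"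
    using c23[of 1 1] unfolding dd[OF Es(2)] dd[OF Es(3)] t by algebra
   then show "p Z * ddir r E3 Z = r Z * (ddir r E2 Z - t * r Z)" by simp
   show "q Z * ddir r E3 Z + p Z * ddir s E3 Z = s Z * (ddir r E2 Z - t * r Z) + r Z * (ddir s E2 Z - t * s Z)"
    using c23[of 1 2] unfolding dd[OF Es(2)] dd[OF Es(3)] t by algebra
   have "2 * (q Z * ddir s E3 Z) = 2 * (s Z * (ddir s E2 Z - t * s Z))"
    using c23[of 2 2] unfolding dd[OF Es(2)] dd[OF Es(3)] t by algebra
   then show "q Z * ddir s E3 Z = s Z * (ddir s E2 Z - t * s Z)" by simp
  qed
  then obtain v where v: "ddir r E3 Z = v * r Z" "ddir s E3 Z = v * s Z" "ddir r E2 Z = t * r Z + v * p Z" "ddir s E2 Z = t * s Z + v * q Z"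
   by (auto simp: algebra_simps)
  show ?thesis by (rule exI[of _ t], rule exI[of _ u], rule exI[of _ v]) (simp add: t u v)
 qed
 have d\<Delta>: "ddir \<Delta> X Z = ddir p X Z * s Z + p Z * ddir s X Z - (ddir q X Z * r Z + q Z * ddir r X Z)" if "Z \<in> U" "X \<in> Sym" for X Z
  unfolding \<Delta>_def[abs_def] ddir_diff[OF gholo_mult[OF gp gs] gholo_mult[OF gq gr] that] ddir_mult[OF gp gs that] ddir_mult[OF gq gr that] ..
 \<comment> \<open>The entries of the inverse of \<open>M^T\<close>, row by row.\<close>
 define \<alpha> \<beta> \<gamma> \<delta> where "\<alpha> Z = s Z / \<Delta> Z" and "\<beta> Z = - r Z / \<Delta> Z" and "\<gamma> Z = - q Z / \<Delta> Z" and "\<delta> Z = p Z / \<Delta> Z" for Z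
 have gN: "gholo \<alpha> U" "gholo \<beta> U" "gholo \<gamma> U" "gholo \<delta> U"
  unfolding \<alpha>_def[abs_def] \<beta>_def[abs_def] \<gamma>_def[abs_def] \<delta>_def[abs_def]
  using gp gq gr gs g\<Delta> \<Delta>0 by (intro gi; simp)+
 have dN: "\<exists>t u v. ddir \<alpha> E1 Z = (t * q Z - u * s Z) / \<Delta> Z & ddir \<alpha> E2 Z = (v * q Z - t * s Z) / \<Delta> Z & ddir \<alpha> E3 Z = 0 &
   ddir \<gamma> E1 Z = 0 & ddir \<gamma> E2 Z = (t * q Z - u * s Z) / \<Delta> Z & ddir \<gamma> E3 Z = (v * q Z - t * s Z) / \<Delta> Z &
   ddir \<beta> E1 Z = (u * r Z - t * p Z) / \<Delta> Z & ddir \<beta> E2 Z = (t * r Z - v * p Z) / \<Delta> Z & ddir \<beta> E3 Z = 0 &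
   ddir \<delta> E1 Z = 0 & ddir \<delta> E2 Z = (u * r Z - t * p Z) / \<Delta> Z & ddir \<delta> E3 Z = (t * r Z - v * p Z) / \<Delta> Z" if Z: "Z \<in> U" for Z
 proof -
  obtain t u v where tu: "ddir p E1 Z = u * p Z" "ddir q E1 Z = u * q Z" "ddir r E1 Z = t * p Z" "ddir s E1 Z = t * q Z"
   "ddir p E2 Z = t * p Z + u * r Z" "ddir q E2 Z = t * q Z + u * s Z" "ddir r E2 Z = t * r Z + v * p Z" "ddir s E2 Z = t * s Z + v * q Z"
   "ddir p E3 Z = t * r Z" "ddir q E3 Z = t * s Z" "ddir r E3 Z = v * r Z" "ddir s E3 Z = v * s Z" using tuv[OF Z] by blast
  have Es: "E1 \<in> Sym" "E2 \<in> Sym" "E3 \<in> Sym" by auto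
  have \<Delta>d: "ddir \<Delta> E1 Z = u * \<Delta> Z" "ddir \<Delta> E2 Z = 2 * t * \<Delta> Z" "ddir \<Delta> E3 Z = v * \<Delta> Z"
   unfolding d\<Delta>[OF Z Es(1)] d\<Delta>[OF Z Es(2)] d\<Delta>[OF Z Es(3)] tu by (simp_all add: \<Delta>_def algebra_simps)
  have qd: "ddir (%Z. f Z / \<Delta> Z) X Z = (ddir f X Z - f Z * k) / \<Delta> Z" if "gholo f U" "X \<in> Sym" "ddir \<Delta> X Z = k * \<Delta> Z" for f X k
  proof -
   have "ddir (%Z. f Z / \<Delta> Z) X Z = (ddir f X Z * \<Delta> Z - f Z * (k * \<Delta> Z)) / (\<Delta> Z)\<^sup>2"
    using ddir_divide[OF that(1) g\<Delta> \<Delta>0 Z that(2)] that(3) by simp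
   also have "\<dots> = (ddir f X Z - f Z * k) * \<Delta> Z / (\<Delta> Z * \<Delta> Z)" by (simp add: power2_eq_square algebra_simps)
   also have "\<dots> = (ddir f X Z - f Z * k) / \<Delta> Z" using \<Delta>0[OF Z] by simp
   finally show ?thesis .
  qed
  have mq: "ddir (%Z. - q Z) X Z = - ddir q X Z" "ddir (%Z. - r Z) X Z = - ddir r X Z" if "X \<in> Sym" for X
   using ddir_minus[OF gq Z that] ddir_minus[OF gr Z that] by auto
  show ?thesis
   unfolding \<alpha>_def[abs_def] \<beta>_def[abs_def] \<gamma>_def[abs_def] \<delta>_def[abs_def]
    qd[OF gs Es(1) \<Delta>d(1)] qd[OF gs Es(2) \<Delta>d(2)] qd[OF gs Es(3) \<Delta>d(3)]
    qd[OF gp Es(1) \<Delta>d(1)] qd[OF gp Es(2) \<Delta>d(2)] qd[OF gp Es(3) \<Delta>d(3)]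
    qd[OF gholo_minus[OF gq] Es(1) \<Delta>d(1)] qd[OF gholo_minus[OF gq] Es(2) \<Delta>d(2)] qd[OF gholo_minus[OF gq] Es(3) \<Delta>d(3)]
    qd[OF gholo_minus[OF gr] Es(1) \<Delta>d(1)] qd[OF gholo_minus[OF gr] Es(2) \<Delta>d(2)] qd[OF gholo_minus[OF gr] Es(3) \<Delta>d(3)]
    mq[OF Es(1)] mq[OF Es(2)] mq[OF Es(3)] tu
   by (rule exI[of _ t], rule exI[of _ u], rule exI[of _ v]) (simp add: algebra_simps)
 qed
 have Es: "E1 \<in> Sym" "E2 \<in> Sym" "E3 \<in> Sym" by auto
 have pN: "ddir \<alpha> E3 Z = 0" "ddir \<gamma> E1 Z = 0" "ddir \<alpha> E1 Z = ddir \<gamma> E2 Z" "ddir \<alpha> E2 Z = ddir \<gamma> E3 Z"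
  "ddir \<beta> E3 Z = 0" "ddir \<delta> E1 Z = 0" "ddir \<beta> E1 Z = ddir \<delta> E2 Z" "ddir \<beta> E2 Z = ddir \<delta> E3 Z" if "Z \<in> U" for Z
  using dN[OF that] by auto
 have NM: "\<alpha> Z * p Z + \<beta> Z * q Z = 1" "\<alpha> Z * r Z + \<beta> Z * s Z = 0" "\<gamma> Z * p Z + \<delta> Z * q Z = 0" "\<gamma> Z * r Z + \<delta> Z * s Z = 1"
  if Z: "Z \<in> U" for Z
  using \<Delta>0[OF Z] unfolding \<alpha>_def \<beta>_def \<gamma>_def \<delta>_def by (simp_all add: divide_simps) (simp_all add: \<Delta>_def algebra_simps)
 define R1 where "R1 j Z = \<alpha> Z * F Z $ 1 $ j + \<beta> Z * F Z $ 2 $ j" for j :: 2 and Z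
 define R2 where "R2 j Z = \<gamma> Z * F Z $ 1 $ j + \<delta> Z * F Z $ 2 $ j" for j :: 2 and Z
 have gR: "gholo (R1 j) U" "gholo (R2 j) U" for j
  unfolding R1_def[abs_def] R2_def[abs_def] using gN gFU by (intro gi; simp)+
 have dR: "ddir (R1 j) X Z = ddir \<alpha> X Z * F Z $ 1 $ j + \<alpha> Z * D X 1 j Z + (ddir \<beta> X Z * F Z $ 2 $ j + \<beta> Z * D X 2 j Z)"
  "ddir (R2 j) X Z = ddir \<gamma> X Z * F Z $ 1 $ j + \<gamma> Z * D X 1 j Z + (ddir \<delta> X Z * F Z $ 2 $ j + \<delta> Z * D X 2 j Z)"
  if "Z \<in> U" "X \<in> Sym" for X Z j
  unfolding R1_def[abs_def] R2_def[abs_def] D_def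
   ddir_add[OF gholo_mult[OF gN(1) gFU] gholo_mult[OF gN(2) gFU] that]
   ddir_add[OF gholo_mult[OF gN(3) gFU] gholo_mult[OF gN(4) gFU] that]
   ddir_mult[OF gN(1) gFU that] ddir_mult[OF gN(2) gFU that] ddir_mult[OF gN(3) gFU that] ddir_mult[OF gN(4) gFU that] by simp_all
 have ND: "\<alpha> Z * D E1 1 1 Z + \<beta> Z * D E1 2 1 Z = p Z" "\<alpha> Z * D E1 1 2 Z + \<beta> Z * D E1 2 2 Z = q Z"
  "\<gamma> Z * D E1 1 1 Z + \<delta> Z * D E1 2 1 Z = 0" "\<gamma> Z * D E1 1 2 Z + \<delta> Z * D E1 2 2 Z = 0"
  "\<alpha> Z * D E2 1 1 Z + \<beta> Z * D E2 2 1 Z = r Z" "\<alpha> Z * D E2 1 2 Z + \<beta> Z * D E2 2 2 Z = s Z"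
  "\<gamma> Z * D E2 1 1 Z + \<delta> Z * D E2 2 1 Z = p Z" "\<gamma> Z * D E2 1 2 Z + \<delta> Z * D E2 2 2 Z = q Z"
  "\<alpha> Z * D E3 1 1 Z + \<beta> Z * D E3 2 1 Z = 0" "\<alpha> Z * D E3 1 2 Z + \<beta> Z * D E3 2 2 Z = 0"
  "\<gamma> Z * D E3 1 1 Z + \<delta> Z * D E3 2 1 Z = r Z" "\<gamma> Z * D E3 1 2 Z + \<delta> Z * D E3 2 2 Z = s Z" if Z: "Z \<in> U" for Z
  using NM[OF Z] unfolding DS[OF Z Es(1)] DS[OF Z Es(2)] DS[OF Z Es(3)] d11[OF Z] d2[OF Z] d3[OF Z] by algebra+
 have pR: "ddir (R1 j) E3 Z = 0" "ddir (R2 j) E1 Z = 0" "ddir (R1 j) E1 Z = ddir (R2 j) E2 Z" "ddir (R1 j) E2 Z = ddir (R2 j) E3 Z"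
  if Z: "Z \<in> U" for Z j
  using exhaust_2[of j] pN[OF Z] ND[OF Z] unfolding dR[OF Z Es(1)] dR[OF Z Es(2)] dR[OF Z Es(3)]
  by (auto simp: algebra_simps)
 obtain a0 c0 x1 x2 where N1: "\<forall>W\<in>Sym. norm (W - Z0) < \<tau> / 16 --> \<alpha> W = a0 + (W$1$1 * x1 + W$1$2 * x2) & \<gamma> W = c0 + (W$2$1 * x1 + W$2$2 * x2)"
  using affine_pair[OF gN(1,3) U_def Z0 \<tau> pN(1-4)] by blast
 obtain b0 d0 y1 y2 where N2: "\<forall>W\<in>Sym. norm (W - Z0) < \<tau> / 16 --> \<beta> W = b0 + (W$1$1 * y1 + W$1$2 * y2) & \<delta> W = d0 + (W$2$1 * y1 + W$2$2 * y2)"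
  using affine_pair[OF gN(2,4) U_def Z0 \<tau> pN(5-8)] by blast
 obtain a0' c0' x1' x2' where RR1: "\<forall>W\<in>Sym. norm (W - Z0) < \<tau> / 16 --> R1 1 W = a0' + (W$1$1 * x1' + W$1$2 * x2') & R2 1 W = c0' + (W$2$1 * x1' + W$2$2 * x2')"
  using affine_pair[OF gR U_def Z0 \<tau> pR] by blast
 obtain b0' d0' y1' y2' where RR2: "\<forall>W\<in>Sym. norm (W - Z0) < \<tau> / 16 --> R1 2 W = b0' + (W$1$1 * y1' + W$1$2 * y2') & R2 2 W = d0' + (W$2$1 * y1' + W$2$2 * y2')"
  using affine_pair[OF gR U_def Z0 \<tau> pR] by blast
 define mk where "mk a b c d = (\<chi> i j. if i = (1::2) then (if j = (1::2) then a else b) else (if j = 1 then c else d))" for a b c d :: complex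
 have mk: "mk a b c d $1$1 = a" "mk a b c d $1$2 = b" "mk a b c d $2$1 = c" "mk a b c d $2$2 = d" for a b c d by (auto simp: mk_def)
 define N P R E where "N = mk a0 b0 c0 d0" and "P = mk x1 y1 x2 y2" and "R = mk a0' b0' c0' d0'" and "E = mk x1' y1' x2' y2'"
 define B where "B = {W \<in> Sym. norm (W - Z0) < \<tau> / 16}"
 have B: "open_Sym B" "B \<subseteq> U" "Z0 \<in> B"
  unfolding B_def by (rule open_Sym_ball) (use \<tau> Z0 in \<open>auto simp: U_def\<close>)
 have NB: "(N + Z ** P)$1$1 = \<alpha> Z" "(N + Z ** P)$1$2 = \<beta> Z" "(N + Z ** P)$2$1 = \<gamma> Z" "(N + Z ** P)$2$2 = \<delta> Z"
  and RB: "(R + Z ** E)$1$1 = R1 1 Z" "(R + Z ** E)$1$2 = R1 2 Z" "(R + Z ** E)$2$1 = R2 1 Z" "(R + Z ** E)$2$2 = R2 2 Z" if "Z \<in> B" for Z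
  using that N1 N2 RR1 RR2 by (auto simp: B_def N_def P_def R_def E_def mk)
 have NF: "(N + Z ** P) ** F Z = R + Z ** E" if Z: "Z \<in> B" for Z
  unfolding mat2_eq_iff mat2_mult_nth[of "N + Z ** P"] NB[OF Z] RB[OF Z] by (simp add: R1_def R2_def)
 define K where "K Z W = (R + Z ** E) ** transpose (N + W ** P) - (N + Z ** P) ** transpose (R + W ** E)" for Z W
 have KB: "K Z W = Z - W" if W: "W \<in> B" and Z: "Z \<in> Sym" for Z W
 proof -
  have WU: "W \<in> U" using W B by blast
  have Ws: "W \<in> Sym" using W by (simp add: B_def)
  have Fs: "F W $ 2 $ 1 = F W $ 1 $ 2" using hol_in_Sym[OF FU WU] by (simp add: Sym_iff)
  define X where "X = Z - W"
  have Xs: "X$2$1 = X$1$2" using Z Ws by (simp add: X_def Sym_iff)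
  have e1: "ddir (%Z. N$i$j + Z$i$1 * P$1$j + Z$i$2 * P$2$j) V W = V$i$1 * P$1$j + V$i$2 * P$2$j" for i j V N P
   unfolding ddir_def by (rule DERIV_imp_deriv) (auto intro!: derivative_eq_intros)
  have dn: "ddir f V W = V$i$1 * (P::mat2)$1$j + V$i$2 * P$2$j" if "V \<in> Sym" "!!Z. Z \<in> B ==> f Z = (N + Z ** P)$i$j" for f V i j P N
  proof -
   have "ddir f V W = ddir (%Z. N$i$j + Z$i$1 * P$1$j + Z$i$2 * P$2$j) V W"
    by (rule ddir_cong[OF B(1) W that(1)]) (use that(2) in \<open>simp add: add.assoc\<close>)
   then show ?thesis by (simp add: e1)
  qed
  have dal: "ddir \<alpha> V W = V$1$1 * P$1$1 + V$1$2 * P$2$1" "ddir \<beta> V W = V$1$1 * P$1$2 + V$1$2 * P$2$2"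
   "ddir \<gamma> V W = V$2$1 * P$1$1 + V$2$2 * P$2$1" "ddir \<delta> V W = V$2$1 * P$1$2 + V$2$2 * P$2$2"
   "ddir (R1 1) V W = V$1$1 * E$1$1 + V$1$2 * E$2$1" "ddir (R1 2) V W = V$1$1 * E$1$2 + V$1$2 * E$2$2"
   if "V \<in> Sym" for V
   using dn[OF that, of \<alpha> N P 1 1] dn[OF that, of \<beta> N P 1 2] dn[OF that, of \<gamma> N P 2 1] dn[OF that, of \<delta> N P 2 2]
    dn[OF that, of "R1 1" R E 1 1] dn[OF that, of "R1 2" R E 1 2] NB RB by auto
  define f1 f2 f3 where "f1 = F W $ 1 $ 1" and "f2 = F W $ 1 $ 2" and "f3 = F W $ 2 $ 2"
  \<comment> \<open>Differentiating \<open>R + W E = (N + W P) F W\<close> expresses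
    \<open>E\<close> as \<open>P F W + M\<close>.\<close>
  have q1: "E$1$1 = P$1$1 * f1 + P$1$2 * f2 + p W" "E$1$2 = P$1$1 * f2 + P$1$2 * f3 + q W"
   using dR(1)[OF WU Es(1), of 1] dR(1)[OF WU Es(1), of 2] ND[OF WU] dal[OF Es(1)]
   by (simp_all add: f1_def f2_def f3_def Fs algebra_simps)
  have q2: "E$2$1 = P$2$1 * f1 + P$2$2 * f2 + r W" "E$2$2 = P$2$1 * f2 + P$2$2 * f3 + s W"
   using dR(1)[OF WU Es(2), of 1] dR(1)[OF WU Es(2), of 2] ND[OF WU] dal[OF Es(2)]
   by (simp_all add: f1_def f2_def f3_def Fs algebra_simps)
  have rw: "R1 1 W = \<alpha> W * f1 + \<beta> W * f2" "R1 2 W = \<alpha> W * f2 + \<beta> W * f3" "R2 1 W = \<gamma> W * f1 + \<delta> W * f2" "R2 2 W = \<gamma> W * f2 + \<delta> W * f3"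
   by (simp_all add: R1_def R2_def f1_def f2_def f3_def Fs)
  have ZX: "R + Z ** E = (R + W ** E) + X ** E" "N + Z ** P = (N + W ** P) + X ** P"
   by (simp_all add: mat2_eq_iff X_def algebra_simps)
  show ?thesis
   unfolding K_def ZX X_def[symmetric] mat2_eq_iff
   unfolding vector_minus_component mat2_mult_nth[of "_ + _"] vector_add_component[of "R + W ** E"] vector_add_component[of "N + W ** P"]
    transpose_nth vector_add_component[of "(R + W ** E) $ _"] vector_add_component[of "(N + W ** P) $ _"]
    NB[OF W] RB[OF W] mat2_mult_nth rw q1 q2
   using NM[OF WU] Xs by algebra
 qed
 have KS: "K Z W = Z - W" if Z: "Z \<in> Sym" and W: "W \<in> Sym" for Z W
 proof -
  have "K Z W $ i $ j - (Z - W) $ i $ j = 0" for i j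
  proof (rule gholo_zero_convex[where S = Sym and U = B and f = "%W. K Z W $ i $ j - (Z - W) $ i $ j", OF _ _ B(1) _ _ _ W])
   have o: "open_Sym Sym" by simp
   show "gholo (%W. K Z W $ i $ j - (Z - W) $ i $ j) Sym"
    unfolding K_def vector_minus_component mat2_mult_nth vector_add_component transpose_nth
    using o by (intro gholo_add gholo_mult gholo_const gholo_diff gholo_nth)
   show "convex Sym" unfolding convex_def by (auto simp: Sym_iff)
   show "B \<subseteq> Sym" "B ~= {}" using B by (auto simp: B_def)
   show "K Z W $ i $ j - (Z - W) $ i $ j = 0" if "W \<in> B" for W using KB[OF that Z] by simp
  qed
  then show ?thesis by (simp add: mat2_eq_iff)
 qed
 show ?thesis
  unfolding liouville_form_def
  by (rule exI[of _ N], rule exI[of _ P], rule exI[of _ R], rule exI[of _ E], rule exI[of _ "\<tau> / 16"])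
   (use \<tau> NF KS in \<open>auto simp: B_def K_def\<close>)
qed

text \<open>Interchanging the two coordinates of the target replaces the leading entry of the
  derivative along \<open>E1\<close> by the other diagonal entry. If both vanished, singularity
  would annihilate the off-diagonal entry as well, contrary to injectivity.\<close>

lemma liouville:
 assumes F: "hol F S" and S: "S = {W \<in> Sym. norm (W - Z0) < \<rho>}" and Z0: "Z0 \<in> Sym" and \<rho>: "\<rho> > 0"
  and null: "!!Z u. Z \<in> S ==> dt (dF F (nl u) Z) = 0"
  and inj: "!!Z X. Z \<in> S ==> X \<in> Sym ==> dF F X Z = 0 ==> X = 0"
 shows "liouville_form F Z0"
proof (cases "dF F E1 Z0 $ 1 $ 1 = 0")
 case False
 show ?thesis by (rule liouville_aux[OF F S Z0 \<rho> null inj False])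
next
 case True
 let ?J = "symat 0 1 0" and ?F = "%Z. symat (F Z $ 2 $ 2) (F Z $ 1 $ 2) (F Z $ 1 $ 1)"
 have Z0S: "Z0 \<in> S" using Z0 \<rho> by (simp add: S)
 have sym: "dF F X Z $ 2 $ 1 = dF F X Z $ 1 $ 2" if "Z \<in> S" "X \<in> Sym" for X Z
  using hol_dF_Sym[OF F that] by (simp only: Sym_iff)
 have F': "hol ?F S"
  using F unfolding hol_def by (auto simp: forall_2)
 have d: "dF ?F X Z = symat (dF F X Z $ 2 $ 2) (dF F X Z $ 1 $ 2) (dF F X Z $ 1 $ 1)" for X Z
  by (simp add: mat2_eq_iff)
 have null': "dt (dF ?F (nl u) Z) = 0" if "Z \<in> S" for Z u
  unfolding d using null[OF that, of u] sym[OF that nl_Sym] by (simp add: mult.commute del: dF_nth)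
 have inj': "X = 0" if "Z \<in> S" "X \<in> Sym" "dF ?F X Z = 0" for Z X
 proof (rule inj[OF that(1,2)])
  show "dF F X Z = 0" using that(3) sym[OF that(1,2)] unfolding d by (simp add: mat2_eq_iff del: dF_nth)
 qed
 have ne: "dF ?F E1 Z0 $ 1 $ 1 ~= 0"
 proof
  assume "dF ?F E1 Z0 $ 1 $ 1 = 0"
  then have 22: "dF F E1 Z0 $ 2 $ 2 = 0" unfolding d by (simp del: dF_nth)
  have "nl (axis 1 1) = E1" by (simp add: mat2_eq_iff nl_def axis_def)
  then have "dt (dF F E1 Z0) = 0" using null[OF Z0S, of "axis 1 1"] by simp
  then have "dF F E1 Z0 $ 1 $ 2 = 0" using True sym[OF Z0S, of E1] by (simp del: dF_nth)
  then have "dF F E1 Z0 = 0" using True 22 sym[OF Z0S, of E1] by (simp add: mat2_eq_iff del: dF_nth)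
  then have "E1 = 0" by (rule inj[OF Z0S, rotated]) auto
  then show False by (simp add: mat2_eq_iff)
 qed
 have lf: "liouville_form ?F Z0" by (rule liouville_aux[OF F' S Z0 \<rho> null' inj' ne])
 then obtain N P R E r where r: "r > 0" and nf: "!!Z. Z \<in> Sym ==> norm (Z - Z0) < r ==> (N + Z ** P) ** ?F Z = R + Z ** E"
  and k: "!!Z W. Z \<in> Sym ==> W \<in> Sym ==> (R + Z ** E) ** transpose (N + W ** P) - (N + Z ** P) ** transpose (R + W ** E) = Z - W"
  unfolding liouville_form_def by blast
 have J: "N ** ?J + Z ** (P ** ?J) = (N + Z ** P) ** ?J" for N P Z :: mat2
  by (simp add: mat2_eq_iff algebra_simps)
 have JJ: "(A ** ?J) ** transpose (B ** ?J) = A ** transpose B" for A B :: mat2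
  by (simp add: mat2_eq_iff algebra_simps)
 have JF: "(A ** ?J) ** F Z = (A ** ?F Z) ** ?J" if "Z \<in> S" for A :: mat2 and Z
  using hol_in_Sym[OF F that] unfolding Sym_iff mat2_eq_iff mat2_mult_nth by (simp add: algebra_simps)
 show ?thesis unfolding liouville_form_def
  by (rule exI[of _ "N ** ?J"], rule exI[of _ "P ** ?J"], rule exI[of _ "R ** ?J"], rule exI[of _ "E ** ?J"], rule exI[of _ "min r \<rho>"])
   (simp add: J JJ k \<rho> r, use JF nf S in \<open>force\<close>)
qed

section \<open>The starting configuration\<close>

text \<open>Scaled pairings of \<open>z \<omega> *v v\<close> with a fixed vector \<open>u\<close>
  are self-maps of the disc vanishing at 0. For \<open>u\<close> the value itself, Schwarz's lemma
  bounds the length; for \<open>u = w *v v\<close> the derivative at 0 is almost unimodular, so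
  \<open>schwarz_linear\<close> fixes the component along \<open>w *v v\<close>. The length bound
  then leaves little room for an orthogonal remainder.\<close>

lemma disc_near_linear:
 fixes z :: "complex => mat2" and w :: mat2 and v :: "complex^2"
 assumes hz: "!!i j. (%\<omega>. z \<omega> $ i $ j) holomorphic_on ball 0 (1 - \<epsilon>)"
  and ud: "!!\<omega>. cmod \<omega> < 1 - \<epsilon> ==> z \<omega> \<in> udisc" and z0: "z 0 = 0"
  and d: "!!i j. ((%\<omega>. z \<omega> $ i $ j) has_field_derivative w $ i $ j) (at 0)"
  and \<epsilon>: "0 < \<epsilon>" "\<epsilon> <= \<eta> / 4" "\<eta> <= 1"
  and w: "!!x. (1 - \<epsilon>) * norm x <= norm (w *v x)" "!!x. norm (w *v x) <= (1 + \<epsilon>) * norm x"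
  and \<omega>: "cmod \<omega> <= 1 - \<eta> / 2"
 shows "norm (z \<omega> *v v) <= cmod \<omega> / (1 - \<epsilon>) * norm v"
  "(norm (z \<omega> *v v - \<omega> *s (w *v v)))\<^sup>2 <= 72 * \<epsilon> / \<eta> * (norm v)\<^sup>2"
proof -
 define \<sigma> where "\<sigma> = 1 - \<epsilon>"
 have s: "0 < \<sigma>" "\<sigma> < 1" "3/4 <= \<sigma>" using \<epsilon> by (auto simp: \<sigma>_def)
 define \<zeta> where "\<zeta> = \<omega> / of_real \<sigma>"
 have \<zeta>: "of_real \<sigma> * \<zeta> = \<omega>" "cmod \<zeta> = cmod \<omega> / \<sigma>" using s by (auto simp: \<zeta>_def norm_divide)
 have "1 - \<eta> / 2 <= (1 - \<eta> / 4) * \<sigma>"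
 proof -
  have "\<epsilon> * \<eta> >= 0" using \<epsilon> by simp
  moreover have "(1 - \<eta> / 4) * \<sigma> = 1 - \<epsilon> - \<eta> / 4 + \<epsilon> * \<eta> / 4" by (simp add: \<sigma>_def field_simps)
  ultimately show ?thesis using \<epsilon> by linarith
 qed
 then have "cmod \<omega> <= (1 - \<eta> / 4) * \<sigma>" using \<omega> by linarith
 then have \<zeta>4: "cmod \<zeta> <= 1 - \<eta> / 4" using s unfolding \<zeta>(2) by (simp add: pos_divide_le_eq)
 have \<eta>: "0 < \<eta>" using \<epsilon> by linarith
 then have \<zeta>1: "cmod \<zeta> < 1" using \<zeta>4 by linarith
 define p where "p u x = hin u (z (of_real \<sigma> * x) *v v) / of_real (norm u * norm v)" for u x
 have p: "p u holomorphic_on ball 0 1" "p u 0 = 0" "!!x. cmod x < 1 ==> cmod (p u x) < 1"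
  "deriv (p u) 0 = of_real \<sigma> * hin u (w *v v) / of_real (norm u * norm v)" if u: "u ~= 0" and v: "v ~= 0" for u
 proof -
  have sb: "cmod (of_real \<sigma> * x) < \<sigma>" if "cmod x < 1" for x using s that by (simp add: norm_mult)
  have "(%x. hin u (z x *v v)) holomorphic_on ball 0 \<sigma>" using hin_holomorphic[of z, OF hz] by (simp add: \<sigma>_def)
  moreover have "(%x::complex. of_real \<sigma> * x) ` ball 0 1 \<subseteq> ball 0 \<sigma>"
   by (rule image_subsetI) (use sb in \<open>simp only: mem_ball_0\<close>)
  ultimately have "(%x. hin u (z (of_real \<sigma> * x) *v v)) holomorphic_on ball 0 1"
   using holomorphic_on_compose_gen[of "%x. of_real \<sigma> * x" "ball 0 1" "%x. hin u (z x *v v)" "ball 0 \<sigma>"]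
   by (simp add: o_def holomorphic_intros)
  then show "p u holomorphic_on ball 0 1" unfolding p_def[abs_def] using u v by (intro holomorphic_intros) auto
  show "p u 0 = 0" by (simp add: p_def z0 hin_def)
  show "cmod (p u x) < 1" if "cmod x < 1" for x
  proof -
   have "z (of_real \<sigma> * x) \<in> udisc" using ud sb[OF that] by (simp add: \<sigma>_def)
   then have "norm (z (of_real \<sigma> * x) *v v) < norm v" using v by (simp add: udisc_def)
   then have "norm u * norm (z (of_real \<sigma> * x) *v v) < norm u * norm v" using u by simp
   then have "cmod (hin u (z (of_real \<sigma> * x) *v v)) < norm u * norm v"
    using hin_bound[of u "z (of_real \<sigma> * x) *v v"] by linarith
   then show ?thesis using u v by (simp add: p_def norm_divide norm_mult pos_divide_less_eq)
  qed
  have "((%x. hin u (z x *v v)) has_field_derivative hin u (w *v v)) (at (of_real \<sigma> * 0))"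
   using hin_deriv[of z w 0 u v] d by simp
  then have "((%x. hin u (z (of_real \<sigma> * x) *v v)) has_field_derivative hin u (w *v v) * of_real \<sigma>) (at 0)"
   by (rule DERIV_chain2) (auto intro!: derivative_eq_intros)
  then have "(p u has_field_derivative hin u (w *v v) * of_real \<sigma> / of_real (norm u * norm v)) (at 0)"
   unfolding p_def[abs_def] using DERIV_cdivide by blast
  then show "deriv (p u) 0 = of_real \<sigma> * hin u (w *v v) / of_real (norm u * norm v)"
   by (simp add: DERIV_imp_deriv mult.commute)
 qed
 have A: "norm (z \<omega> *v v) <= cmod \<omega> / \<sigma> * norm v"
 proof (cases "z \<omega> *v v = 0 \<or> v = 0")
  case False
  then have u: "z \<omega> *v v ~= 0" "v ~= 0" by auto
  have "cmod (p (z \<omega> *v v) \<zeta>) <= cmod \<zeta>"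
   by (rule Schwarz_Lemma(1)[OF p(1)[OF u] p(2)[OF u] _ \<zeta>1]) (use p(3)[OF u] in auto)
  then have "norm (z \<omega> *v v) / norm v <= cmod \<zeta>"
   using u by (simp add: p_def \<zeta>(1) hin_self norm_divide norm_mult power2_eq_square)
  then show ?thesis using u by (simp add: \<zeta>(2) pos_divide_le_eq)
 qed (use s in auto)
 then show "norm (z \<omega> *v v) <= cmod \<omega> / (1 - \<epsilon>) * norm v" by (simp add: \<sigma>_def)
 show "(norm (z \<omega> *v v - \<omega> *s (w *v v)))\<^sup>2 <= 72 * \<epsilon> / \<eta> * (norm v)\<^sup>2"
 proof (cases "v = 0")
  case False
  define a where "a = norm v" define b where "b = norm (w *v v)"
  have a: "0 < a" using False by (simp add: a_def)
  have ba: "\<sigma> * a <= b" "b <= (1 + \<epsilon>) * a" using w[of v] by (simp_all add: a_def b_def \<sigma>_def)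
  have b: "0 < b" using ba(1) a s mult_pos_pos[of \<sigma> a] by linarith
  have wv: "w *v v ~= 0" using b by (auto simp: b_def)
  define m where "m = b / a"
  have m: "\<sigma> <= m" "m <= 1 + \<epsilon>" using ba a by (simp_all add: m_def pos_le_divide_eq pos_divide_le_eq)
  have dp: "deriv (p (w *v v)) 0 = of_real (\<sigma> * m)"
   unfolding p(4)[OF wv False] hin_self using a b by (simp add: m_def a_def[symmetric] b_def[symmetric] power2_eq_square)
  have "cmod (p (w *v v) \<zeta> - of_real (\<sigma> * m) * \<zeta>) <= (1 - (cmod (of_real (\<sigma> * m)))\<^sup>2) * (cmod \<zeta>)\<^sup>2 / (1 - cmod \<zeta>)"
   by (rule schwarz_linear(2)[OF p(1)[OF wv False] p(2)[OF wv False] _ dp[symmetric] \<zeta>1]) (use p(3)[OF wv False] in auto)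
  also have "\<dots> <= (4 * \<epsilon>) * 1 / (\<eta> / 4)"
  proof (rule frac_le)
   have "\<sigma>\<^sup>2 <= \<sigma> * m" using m s by (simp add: power2_eq_square)
   moreover have "1 - 2 * \<epsilon> <= \<sigma>\<^sup>2" by (simp add: \<sigma>_def power2_eq_square algebra_simps)
   ultimately have sm: "1 - 2 * \<epsilon> <= \<sigma> * m" by linarith
   have "1 - 4 * \<epsilon> <= (1 - 2 * \<epsilon>)\<^sup>2" by (simp add: power2_eq_square algebra_simps)
   also have "\<dots> <= (\<sigma> * m)\<^sup>2" using sm \<epsilon> by (intro power_mono) auto
   finally have "1 - (cmod (of_real (\<sigma> * m)))\<^sup>2 <= 4 * \<epsilon>" by (simp only: norm_of_real power2_abs)
   moreover have "(cmod \<zeta>)\<^sup>2 <= 1" using \<zeta>1 by (simp add: abs_square_le_1)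
   ultimately show "(1 - (cmod (of_real (\<sigma> * m)))\<^sup>2) * (cmod \<zeta>)\<^sup>2 <= 4 * \<epsilon> * 1"
    using \<epsilon> by (meson mult_left_mono mult_right_mono order_trans zero_le_power2 mult_nonneg_nonneg less_imp_le zero_le_numeral)
  qed (use \<epsilon> \<eta> \<zeta>4 in auto)
  finally have c: "cmod (p (w *v v) \<zeta> - of_real (\<sigma> * m) * \<zeta>) <= 16 * \<epsilon> / \<eta>" by simp
  define h where "h = hin (w *v v) (z \<omega> *v v)"
  have "of_real (a * b) * (p (w *v v) \<zeta> - of_real (\<sigma> * m) * \<zeta>) = h - \<omega> * of_real (b\<^sup>2)"
  proof -
   have "p (w *v v) \<zeta> = h / of_real (b * a)" by (simp add: p_def \<zeta>(1) h_def a_def b_def)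
   moreover have "of_real (\<sigma> * m) * \<zeta> = \<omega> * of_real m" using \<zeta>(1) by (metis mult.commute mult.assoc of_real_mult)
   ultimately show ?thesis using a b by (simp add: m_def field_simps power2_eq_square)
  qed
  then have "cmod (h - \<omega> * of_real (b\<^sup>2)) = a * b * cmod (p (w *v v) \<zeta> - of_real (\<sigma> * m) * \<zeta>)"
   using a b by (metis norm_mult norm_of_real abs_of_pos mult_pos_pos)
  also have "\<dots> <= a * b * (16 * \<epsilon> / \<eta>)" using c a b by (intro mult_left_mono) auto
  finally have hb: "cmod (h - \<omega> * of_real (b\<^sup>2)) <= a * b * (16 * \<epsilon> / \<eta>)" .
  have w1: "cmod \<omega> <= 1" using \<omega> \<eta> by linarith
  have "Re (\<omega> * cnj (h - \<omega> * of_real (b\<^sup>2))) >= - (1 * (a * b * (16 * \<epsilon> / \<eta>)))"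
  proof -
   have "cmod (\<omega> * cnj (h - \<omega> * of_real (b\<^sup>2))) <= 1 * (a * b * (16 * \<epsilon> / \<eta>))"
    unfolding norm_mult complex_mod_cnj using w1 hb by (intro mult_mono) auto
   then show ?thesis using abs_Re_le_cmod[of "\<omega> * cnj (h - \<omega> * of_real (b\<^sup>2))"] by linarith
  qed
  moreover have "\<omega> * cnj (h - \<omega> * of_real (b\<^sup>2)) = \<omega> * cnj h - of_real ((cmod \<omega>)\<^sup>2 * b\<^sup>2)"
   unfolding of_real_mult complex_norm_square by (simp add: algebra_simps)
  then have "Re (\<omega> * cnj (h - \<omega> * of_real (b\<^sup>2))) = Re (\<omega> * cnj h) - (cmod \<omega>)\<^sup>2 * b\<^sup>2"
   by (simp only: minus_complex.sel Re_complex_of_real)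
  ultimately have Re1: "Re (\<omega> * cnj h) >= (cmod \<omega>)\<^sup>2 * b\<^sup>2 - a * b * (16 * \<epsilon> / \<eta>)" by linarith
  have "Re (hin (z \<omega> *v v) (\<omega> *s (w *v v))) = Re (\<omega> * cnj h)"
   unfolding hin_scale h_def using hin_cnj[of "z \<omega> *v v" "w *v v"] by simp
  then have "(norm (z \<omega> *v v - \<omega> *s (w *v v)))\<^sup>2 = (norm (z \<omega> *v v))\<^sup>2 + (cmod \<omega>)\<^sup>2 * b\<^sup>2 - 2 * Re (\<omega> * cnj h)"
   unfolding norm_diff_sq norm_smult_vec2 b_def by (simp add: power_mult_distrib)
  also have "\<dots> <= (cmod \<omega> / \<sigma> * a)\<^sup>2 - (cmod \<omega>)\<^sup>2 * b\<^sup>2 + 2 * (a * b * (16 * \<epsilon> / \<eta>))"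
   using Re1 power_mono[OF A norm_ge_zero, of 2] unfolding a_def by linarith
  also have "\<dots> <= 12 * \<epsilon> * a\<^sup>2 + 2 * (a * ((1 + \<epsilon>) * a) * (16 * \<epsilon> / \<eta>))"
  proof (intro add_mono)
   have "(\<sigma> * a)\<^sup>2 <= b\<^sup>2" using ba a s by (intro power_mono) auto
   then have "(cmod \<omega>)\<^sup>2 * (\<sigma> * a)\<^sup>2 <= (cmod \<omega>)\<^sup>2 * b\<^sup>2" by (intro mult_left_mono) auto
   then have "(cmod \<omega> / \<sigma> * a)\<^sup>2 - (cmod \<omega>)\<^sup>2 * b\<^sup>2 <= (cmod \<omega>)\<^sup>2 * ((1 / \<sigma>\<^sup>2 - \<sigma>\<^sup>2) * a\<^sup>2)"
    by (simp add: power_mult_distrib power_divide algebra_simps)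
   also have "\<dots> <= 1 * ((12 * \<epsilon>) * a\<^sup>2)"
   proof (intro mult_mono)
    have s2: "1 - 2 * \<epsilon> <= \<sigma>\<^sup>2" by (simp add: \<sigma>_def power2_eq_square algebra_simps)
    have "1 / \<sigma>\<^sup>2 <= 1 / (1 - 2 * \<epsilon>)" using s2 \<epsilon> by (intro divide_left_mono mult_pos_pos) auto
    also have "\<dots> <= 1 + 4 * \<epsilon>"
    proof -
     have "\<epsilon> * \<epsilon> <= \<epsilon> * (1/4)" using \<epsilon> by (intro mult_left_mono) auto
     then show ?thesis using \<epsilon> by (simp add: pos_divide_le_eq algebra_simps)
    qed
    finally show "1 / \<sigma>\<^sup>2 - \<sigma>\<^sup>2 <= 12 * \<epsilon>" using s2 \<epsilon>(1) by linarith
    have "\<sigma>\<^sup>2 <= 1 / \<sigma>\<^sup>2"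
    proof -
     have "\<sigma>\<^sup>2 <= 1" using s by (simp add: abs_square_le_1)
     then have "\<sigma>\<^sup>2 * \<sigma>\<^sup>2 <= 1" using mult_le_one[of "\<sigma>\<^sup>2" "\<sigma>\<^sup>2"] by simp
     then show ?thesis using s by (simp add: pos_le_divide_eq)
    qed
    then show "0 <= (1 / \<sigma>\<^sup>2 - \<sigma>\<^sup>2) * a\<^sup>2" by simp
   qed (use w1 \<epsilon>(1) in \<open>auto simp: abs_square_le_1\<close>)
   finally show "(cmod \<omega> / \<sigma> * a)\<^sup>2 - (cmod \<omega>)\<^sup>2 * b\<^sup>2 <= 12 * \<epsilon> * a\<^sup>2" by simp
   show "2 * (a * b * (16 * \<epsilon> / \<eta>)) <= 2 * (a * ((1 + \<epsilon>) * a) * (16 * \<epsilon> / \<eta>))"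
    using ba a \<epsilon> \<eta> by (intro mult_left_mono mult_right_mono) auto
  qed
  also have "\<dots> <= 72 * \<epsilon> / \<eta> * a\<^sup>2"
  proof -
   have "\<epsilon> * \<eta> <= \<epsilon> * 1" using \<epsilon> by (intro mult_left_mono) auto
   moreover have "\<epsilon> * \<epsilon> <= \<epsilon> * (1/4)" using \<epsilon> by (intro mult_left_mono) auto
   moreover have "12 * \<epsilon> * \<eta> + 32 * \<epsilon> * (1 + \<epsilon>) = 12 * (\<epsilon> * \<eta>) + 32 * \<epsilon> + 32 * (\<epsilon> * \<epsilon>)" by (simp add: algebra_simps)
   ultimately have "12 * \<epsilon> * \<eta> + 32 * \<epsilon> * (1 + \<epsilon>) <= 72 * \<epsilon>" using \<epsilon>(1) by linarith
   then have "(12 * \<epsilon> * \<eta> + 32 * \<epsilon> * (1 + \<epsilon>)) / \<eta> * a\<^sup>2 <= 72 * \<epsilon> / \<eta> * a\<^sup>2"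
    using \<eta> by (intro mult_right_mono divide_right_mono) auto
   then show ?thesis using \<eta> by (simp add: field_simps power2_eq_square)
  qed
  finally show ?thesis by (simp add: a_def)
 qed simp
qed

section \<open>Renormalisation near the boundary of a disc\<close>

lemma polarise:
 assumes w: "!!x. \<bar>(norm (w *v x))\<^sup>2 - (norm x)\<^sup>2\<bar> <= c * (norm (x::complex^2))\<^sup>2"
 shows "cmod (hin (w *v x) (w *v y) - hin x y) <= c * ((norm x)\<^sup>2 + (norm y)\<^sup>2)"
proof -
 have R: "\<bar>Re (hin (w *v x) (w *v y) - hin x y)\<bar> <= c / 2 * ((norm x)\<^sup>2 + (norm y)\<^sup>2)" for x y :: "complex^2"
 proof -
  have "4 * Re (hin (w *v x) (w *v y) - hin x y) =
   ((norm (w *v (x + y)))\<^sup>2 - (norm (x + y))\<^sup>2) - ((norm (w *v (x - y)))\<^sup>2 - (norm (x - y))\<^sup>2)"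
   unfolding mat2_vec_lin norm_add_sq norm_diff_sq by simp
  moreover have "c * (norm (x + y))\<^sup>2 + c * (norm (x - y))\<^sup>2 = 2 * c * ((norm x)\<^sup>2 + (norm y)\<^sup>2)"
   unfolding norm_add_sq norm_diff_sq by (simp add: algebra_simps)
  ultimately have "\<bar>4 * Re (hin (w *v x) (w *v y) - hin x y)\<bar> <= 2 * c * ((norm x)\<^sup>2 + (norm y)\<^sup>2)"
   using w[of "x + y"] w[of "x - y"] by linarith
  then show ?thesis by (simp only: abs_mult abs_numeral)
 qed
 have "Im (hin (w *v x) (w *v y) - hin x y) = - Re (hin (w *v x) (w *v (\<i> *s y)) - hin x (\<i> *s y))"
  unfolding mat2_vec_lin hin_scale by simp
 then have "\<bar>Im (hin (w *v x) (w *v y) - hin x y)\<bar> <= c / 2 * ((norm x)\<^sup>2 + (norm y)\<^sup>2)"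
  using R[of x "\<i> *s y"] by (simp add: norm_smult_vec2 abs_minus_commute)
 then show ?thesis using R[of x y] cmod_le[of "hin (w *v x) (w *v y) - hin x y"] by linarith
qed

lemma cay_solve:
 assumes "den z ~= 0" obtains v where "v + z *v v = x"
proof -
 have "den (cay z) ~= 0" using assms by (simp add: den_cay)
 from cay_mult[OF this, of x] have z: "z *v (x + cay z *v x) = x - cay z *v x" by (simp add: cay_cay[OF assms])
 have "(1/2) *s (x + cay z *v x) + z *v ((1/2) *s (x + cay z *v x)) = x"
  unfolding mat2_vec_lin(3) z by (simp add: vec_eq_iff)
 then show ?thesis by (rule that)
qed

lemma den_close:
 assumes z: "opb 1 z" and w: "opb 2 w" and d: "opb c (z - w)" and c: "0 <= c"
 shows "cmod (den z - den w) <= 8 * c"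
proof -
 have e: "cmod (z$i$j - w$i$j) <= c" for i j using opb_nth[OF d, of i j] by simp
 have z1: "cmod (z$i$j) <= 1" and w2: "cmod (w$i$j) <= 2" for i j using opb_nth[OF z] opb_nth[OF w] by auto
 have eq: "den z - den w = (z$1$1 - w$1$1) + (z$2$2 - w$2$2) + z$1$1 * (z$2$2 - w$2$2) + (z$1$1 - w$1$1) * w$2$2
  - z$1$2 * (z$2$1 - w$2$1) - (z$1$2 - w$1$2) * w$2$1"
  by (simp add: den_def algebra_simps)
 have "cmod (z$1$1 * (z$2$2 - w$2$2)) <= 1 * c" "cmod ((z$1$1 - w$1$1) * w$2$2) <= c * 2"
  "cmod (z$1$2 * (z$2$1 - w$2$1)) <= 1 * c" "cmod ((z$1$2 - w$1$2) * w$2$1) <= c * 2"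
  unfolding norm_mult using e z1 w2 c by (intro mult_mono; simp)+
 then show ?thesis unfolding eq using e[of 1 1] e[of 2 2]
  norm_triangle_ineq4[of "(z$1$1 - w$1$1) + (z$2$2 - w$2$2) + z$1$1 * (z$2$2 - w$2$2) + (z$1$1 - w$1$1) * w$2$2 - z$1$2 * (z$2$1 - w$2$1)" "(z$1$2 - w$1$2) * w$2$1"]
  norm_triangle_ineq4[of "(z$1$1 - w$1$1) + (z$2$2 - w$2$2) + z$1$1 * (z$2$2 - w$2$2) + (z$1$1 - w$1$1) * w$2$2" "z$1$2 * (z$2$1 - w$2$1)"]
  norm_triangle_ineq[of "(z$1$1 - w$1$1) + (z$2$2 - w$2$2) + z$1$1 * (z$2$2 - w$2$2)" "(z$1$1 - w$1$1) * w$2$2"]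
  norm_triangle_ineq[of "(z$1$1 - w$1$1) + (z$2$2 - w$2$2)" "z$1$1 * (z$2$2 - w$2$2)"]
  norm_triangle_ineq[of "z$1$1 - w$1$1" "z$2$2 - w$2$2"] by linarith
qed

lemma norm_sq_close:
 fixes a b :: real
 assumes "\<bar>a - b\<bar> <= d" "\<bar>a + b\<bar> <= m"
 shows "\<bar>a\<^sup>2 - b\<^sup>2\<bar> <= d * m"
proof -
 have "a\<^sup>2 - b\<^sup>2 = (a - b) * (a + b)" by (simp add: power2_eq_square algebra_simps)
 then have "\<bar>a\<^sup>2 - b\<^sup>2\<bar> = \<bar>a - b\<bar> * \<bar>a + b\<bar>" by (simp add: abs_mult)
 also have "\<dots> <= d * m" using assms by (intro mult_mono) auto
 finally show ?thesis .
qed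

text \<open>For \<open>z = q = w\<close> unitary the pairing of \<open>v + w v\<close> with
  \<open>u\<close> is exactly the squared norm of \<open>v\<close>, because the adjoint of
  \<open>1 + w\<close> is \<open>w^-1 (1 + w)\<close>. Here \<open>z\<close> is close to
  \<open>(1 - \<eta>) w\<close>, so both sides are close to \<open>1 - (1 - \<eta>)^2\<close> times
  that squared norm, with a relative error of order \<eta> whichever nearly unitary \<open>w\<close>
  occurs, as long as \<open>1 + w\<close> stays invertible.\<close>

lemma pre_state_core:
 fixes z q w :: mat2 and t :: complex and v u :: "complex^2"
 assumes z: "z \<in> udisc"
  and zw: "!!v. norm (z *v v - of_real (1 - \<eta>) *s (w *v v)) <= \<delta> * norm v"
  and qw: "!!v. norm (q *v v - w *v v) <= \<delta> * norm v"
  and w: "!!x. (1 - \<delta>) * norm x <= norm (w *v x)" "!!x. norm (w *v x) <= (1 + \<delta>) * norm x"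
  and dw: "1/2 <= cmod (den w)" and t: "cmod t = 1" "0 <= Re t"
  and \<eta>: "0 < \<eta>" "\<eta> <= 1/1000" and \<delta>: "0 <= \<delta>" "\<delta> <= \<eta> / 1000"
  and e: "72 * \<eta>\<^sup>2 + 4 * \<delta> <= e0 / 2 * (\<eta> - 4 * \<delta>)"
  and u: "u + z *v u = q *v v"
  and \<kappa>: "\<kappa> = (1 + of_real (1 - \<eta>) * t) / (t * (1 + of_real (1 - \<eta>) * cnj t))"
 shows "cmod (\<kappa> * of_real (1 - (1 - \<eta>)\<^sup>2) * hin (v + z *v v) u - of_real ((norm v)\<^sup>2 - (norm (z *v v))\<^sup>2))
  <= e0 / 2 * ((norm v)\<^sup>2 - (norm (z *v v))\<^sup>2)"
proof -
 define \<omega> where "\<omega> = 1 - \<eta>"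
 have \<omega>: "0 < \<omega>" "\<omega> <= 1" using \<eta> by (auto simp: \<omega>_def)
 define n where "n = norm v"
 have n0: "0 <= n" by (simp add: n_def)
 have \<delta>1: "\<delta> <= 1/1000000" using \<delta> \<eta> by linarith
 have zle: "norm (z *v x) <= norm x" for x using z by (cases "x = 0") (auto simp: udisc_def less_imp_le)
 have wle: "norm (w *v x) <= 2 * norm x" for x
  using w(2)[of x] \<delta>1 mult_right_mono[of "1 + \<delta>" 2 "norm x"] by simp
 have z1: "\<bar>norm (z *v v) - \<omega> * n\<bar> <= 2 * \<delta> * n"
 proof -
  have "\<bar>norm (z *v v) - norm (of_real \<omega> *s (w *v v))\<bar> <= \<delta> * n"
   using norm_triangle_ineq3[of "z *v v" "of_real \<omega> *s (w *v v)"] zw[of v] by (simp add: \<omega>_def n_def)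
  moreover have "norm (of_real \<omega> *s (w *v v)) = \<omega> * norm (w *v v)" unfolding norm_smult_vec2 using \<omega> by simp
  moreover have "\<bar>\<omega> * norm (w *v v) - \<omega> * n\<bar> <= 1 * (\<delta> * n)"
  proof -
   have "\<bar>norm (w *v v) - n\<bar> <= \<delta> * n" using w[of v] by (simp add: n_def algebra_simps)
   then have "\<omega> * \<bar>norm (w *v v) - n\<bar> <= 1 * (\<delta> * n)" using \<omega> by (intro mult_mono) auto
   moreover have "\<bar>\<omega> * norm (w *v v) - \<omega> * n\<bar> = \<omega> * \<bar>norm (w *v v) - n\<bar>"
    using \<omega> by (simp add: abs_mult right_diff_distrib[symmetric])
   ultimately show ?thesis by simp
  qed
  ultimately show ?thesis by linarith
 qed
 have z2: "\<bar>(norm (z *v v))\<^sup>2 - (\<omega> * n)\<^sup>2\<bar> <= 2 * \<delta> * n * (2 * n)"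
 proof (rule norm_sq_close[OF z1])
  have "\<omega> * n <= 1 * n" using \<omega> n0 by (intro mult_right_mono) auto
  then show "\<bar>norm (z *v v) + \<omega> * n\<bar> <= 2 * n" using zle[of v] \<omega> n0 by (simp add: n_def abs_of_nonneg)
 qed
 have dz: "1/4 <= cmod (den z)"
 proof -
  have "opb (3 * \<eta>) (z - w)" unfolding opb_def
  proof
   fix x :: "complex^2"
   have "(z - w) *v x = (z *v x - of_real \<omega> *s (w *v x)) - of_real \<eta> *s (w *v x)"
    by (simp add: mat2_vec_lin \<omega>_def vec_eq_iff algebra_simps)
   then have "norm ((z - w) *v x) <= norm (z *v x - of_real \<omega> *s (w *v x)) + norm (of_real \<eta> *s (w *v x))"
    using norm_triangle_ineq4 by metis
   also have "\<dots> <= \<delta> * norm x + \<eta> * (2 * norm x)"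
    unfolding norm_smult_vec2 using zw[of x] wle[of x] \<eta> by (intro add_mono mult_mono) (auto simp: \<omega>_def)
   also have "\<dots> <= 3 * \<eta> * norm x" using mult_right_mono[of \<delta> \<eta> "norm x"] \<delta> \<eta> by simp
   finally show "norm ((z - w) *v x) <= 3 * \<eta> * norm x" .
  qed
  then have "cmod (den z - den w) <= 8 * (3 * \<eta>)"
   by (intro den_close) (use zle wle \<eta> in \<open>auto simp: opb_def\<close>)
  then show ?thesis using norm_triangle_ineq2[of "den w" "den w - den z"] dw \<eta> by (simp add: norm_minus_commute)
 qed
 have un: "norm u <= 16 * n"
 proof -
  have zS: "mat 1 + z \<in> Sym" using z udisc_Sym by auto
  have o2: "opb 2 (mat 1 + z)" unfolding opb_def
  proof
   fix x :: "complex^2"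
   have "norm ((mat 1 + z) *v x) <= norm x + norm (z *v x)" by (simp add: mat2_vec_lin norm_triangle_ineq)
   then show "norm ((mat 1 + z) *v x) <= 2 * norm x" using zle[of x] by simp
  qed
  have "cmod (den z) * norm u <= 2 * norm (q *v v)"
   using dt_le[OF zS o2, of u] by (simp add: den_dt mat2_vec_lin u)
  moreover have "1/4 * norm u <= cmod (den z) * norm u" using dz by (intro mult_right_mono) auto
  moreover have "norm (q *v v) <= 2 * n"
  proof -
   have "norm (q *v v) <= norm (w *v v) + norm (q *v v - w *v v)" using norm_triangle_ineq[of "w *v v" "q *v v - w *v v"] by simp
   then show ?thesis using w(2)[of v] qw[of v] \<delta>1 mult_right_mono[of "\<delta>" "1/2" n] n0 by (simp add: n_def algebra_simps)
  qed
  ultimately show ?thesis by linarith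
 qed
 have un0: "0 <= norm u" by simp
 \<comment> \<open>The equation for \<open>u\<close> says that \<open>u\<close> is
   \<open>w *v y\<close> up to the small vector \<open>d\<close>; this removes the inverse of
   \<open>1 + z\<close> from the estimate.\<close>
 define y where "y = v - of_real \<omega> *s u"
 have yn: "norm y <= 17 * n"
 proof -
  have "norm (of_real \<omega> *s u) <= 1 * norm u" unfolding norm_smult_vec2 using \<omega> by (intro mult_right_mono) auto
  then show ?thesis using norm_triangle_ineq4[of v "of_real \<omega> *s u"] un by (simp add: y_def n_def)
 qed
 have ea: "cmod (hin (z *v v) u - of_real \<omega> * hin (w *v v) u) <= 16 * \<delta> * n\<^sup>2"
 proof -
  have "hin (z *v v) u - of_real \<omega> * hin (w *v v) u = hin (z *v v - of_real \<omega> *s (w *v v)) u"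
   by (simp add: hin_add hin_scale)
  also have "cmod \<dots> <= (\<delta> * n) * (16 * n)"
   by (rule order_trans[OF hin_bound], intro mult_mono) (use zw[of v] un \<delta> n0 in \<open>auto simp: n_def \<omega>_def\<close>)
  finally show ?thesis by (simp add: power2_eq_square algebra_simps)
 qed
 define d where "d = u - w *v y"
 have dn: "norm d <= 17 * \<delta> * n"
 proof -
  have "d = (q *v v - w *v v) - (z *v u - of_real \<omega> *s (w *v u))"
   using u by (simp add: d_def y_def mat2_vec_lin algebra_simps)
  then have "norm d <= norm (q *v v - w *v v) + norm (z *v u - of_real \<omega> *s (w *v u))" using norm_triangle_ineq4 by metis
  also have "\<dots> <= \<delta> * n + \<delta> * norm u" using qw[of v] zw[of u] by (simp add: n_def \<omega>_def)
  also have "\<dots> <= \<delta> * n + \<delta> * (16 * n)" using un \<delta> by (intro add_mono mult_left_mono) auto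
  finally show ?thesis by simp
 qed
 have ec: "cmod (hin (w *v v) d) <= 34 * \<delta> * n\<^sup>2"
 proof -
  have "cmod (hin (w *v v) d) <= (2 * n) * (17 * \<delta> * n)"
   by (rule order_trans[OF hin_bound], intro mult_mono) (use wle[of v] dn n0 in \<open>auto simp: n_def\<close>)
  then show ?thesis by (simp add: power2_eq_square algebra_simps)
 qed
 have eb: "cmod (hin (w *v v) (w *v y) - hin v y) <= 870 * \<delta> * n\<^sup>2"
 proof -
  have "\<bar>(norm (w *v x))\<^sup>2 - (norm x)\<^sup>2\<bar> <= (3 * \<delta>) * (norm x)\<^sup>2" for x
  proof -
   have "\<bar>(norm (w *v x))\<^sup>2 - (norm x)\<^sup>2\<bar> <= (\<delta> * norm x) * (3 * norm x)"
    by (rule norm_sq_close) (use w[of x] wle[of x] in \<open>auto simp: algebra_simps abs_le_iff\<close>)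
   then show ?thesis by (simp add: power2_eq_square algebra_simps)
  qed
  then have "cmod (hin (w *v v) (w *v y) - hin v y) <= (3 * \<delta>) * ((norm v)\<^sup>2 + (norm y)\<^sup>2)" by (rule polarise)
  also have "\<dots> <= (3 * \<delta>) * (n\<^sup>2 + (17 * n)\<^sup>2)"
   using yn \<delta> by (intro mult_left_mono add_mono power_mono) (auto simp: n_def)
  finally show ?thesis by (simp add: power_mult_distrib algebra_simps)
 qed
 define H where "H = hin (v + z *v v) u"
 have hu: "cmod (hin v u) <= 16 * n\<^sup>2"
  using order_trans[OF hin_bound mult_left_mono[OF un, of "norm v"]] by (simp add: n_def power2_eq_square algebra_simps)
 have \<omega>2: "0 <= 1 - \<omega>\<^sup>2" "1 - \<omega>\<^sup>2 <= 2 * \<eta>" "\<eta> <= 1 - \<omega>\<^sup>2"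
 proof -
  have "\<eta> * \<eta> <= \<eta> * 1" using \<eta> by (intro mult_left_mono) auto
  then show "0 <= 1 - \<omega>\<^sup>2" "1 - \<omega>\<^sup>2 <= 2 * \<eta>" "\<eta> <= 1 - \<omega>\<^sup>2" using \<eta>
   by (auto simp: \<omega>_def power2_eq_square algebra_simps)
 qed
 have n2: "0 <= n\<^sup>2" by simp
 have Hn: "cmod (H - of_real (n\<^sup>2)) <= 34 * \<eta> * n\<^sup>2"
 proof -
  have uy: "u = w *v y + d" by (simp add: d_def)
  have hy: "hin v y = of_real (n\<^sup>2) - of_real \<omega> * hin v u" by (simp add: y_def hin_add hin_scale hin_self n_def)
  define ea' where "ea' = hin (z *v v) u - of_real \<omega> * hin (w *v v) u"
  define eb' where "eb' = hin (w *v v) (w *v y) - hin v y"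
  define ec' where "ec' = hin (w *v v) d"
  have wu: "hin (w *v v) u = hin v y + eb' + ec'"
  proof -
   have "hin (w *v v) u = hin (w *v v) (w *v y + d)" using uy by (rule arg_cong)
   then show ?thesis by (simp add: hin_add eb'_def ec'_def)
  qed
  have "H = hin v u + of_real \<omega> * (hin v y + eb' + ec') + ea'"
   unfolding wu[symmetric] ea'_def H_def hin_add by simp
  also have "\<dots> = of_real (n\<^sup>2) + (of_real (1 - \<omega>\<^sup>2) * hin v u + of_real \<omega> * (eb' + ec') + ea' - of_real (\<eta> * n\<^sup>2))"
   unfolding hy by (simp add: \<omega>_def power2_eq_square algebra_simps)
  finally have eq: "H - of_real (n\<^sup>2) = of_real (1 - \<omega>\<^sup>2) * hin v u + of_real \<omega> * (eb' + ec') + ea' - of_real (\<eta> * n\<^sup>2)" by simp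
  define p r where "p = \<eta> * n\<^sup>2" and "r = \<delta> * n\<^sup>2"
  have "cmod (of_real (1 - \<omega>\<^sup>2) * hin v u) <= (2 * \<eta>) * (16 * n\<^sup>2)"
   unfolding norm_mult norm_of_real using \<omega>2 hu by (intro mult_mono) auto
  also have "\<dots> = 32 * p" by (simp add: p_def)
  finally have 1: "cmod (of_real (1 - \<omega>\<^sup>2) * hin v u) <= 32 * p" .
  have "cmod (of_real \<omega> * (eb' + ec')) <= 1 * (870 * \<delta> * n\<^sup>2 + 34 * \<delta> * n\<^sup>2)"
   unfolding norm_mult norm_of_real using \<omega> norm_triangle_ineq[of eb' ec'] eb ec
   by (intro mult_mono) (auto simp: eb'_def ec'_def)
  also have "\<dots> = 904 * r" by (simp add: r_def)
  finally have 2: "cmod (of_real \<omega> * (eb' + ec')) <= 904 * r" .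
  have 3: "cmod (of_real (\<eta> * n\<^sup>2)) = p" unfolding norm_of_real using \<eta> by (simp add: p_def)
  have 4: "1000 * r <= p" using mult_right_mono[of "1000 * \<delta>" \<eta> "n\<^sup>2"] \<delta> by (simp add: p_def r_def)
  have 5: "0 <= r" using \<delta> by (simp add: r_def)
  have 6: "cmod ea' <= 16 * r" using ea by (simp add: ea'_def r_def)
  have "cmod (H - of_real (n\<^sup>2)) <= 34 * p" unfolding eq using 1 2 3 4 5 6
   norm_triangle_ineq4[of "of_real (1 - \<omega>\<^sup>2) * hin v u + of_real \<omega> * (eb' + ec') + ea'" "of_real (\<eta> * n\<^sup>2)"]
   norm_triangle_ineq[of "of_real (1 - \<omega>\<^sup>2) * hin v u + of_real \<omega> * (eb' + ec')" ea']
   norm_triangle_ineq[of "of_real (1 - \<omega>\<^sup>2) * hin v u" "of_real \<omega> * (eb' + ec')"]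
   by linarith
  then show ?thesis by (simp add: p_def)
 qed
 \<comment> \<open>For \<eta> = 0 the phase would be 1. Since \<open>Re t\<close> is nonnegative,
   its denominator has modulus at least 1, so the deviation is of order \<eta>.\<close>
 have k: "cmod \<kappa> = 1" "cmod (\<kappa> - 1) <= 2 * \<eta>"
 proof -
  have c: "1 + of_real \<omega> * cnj t = cnj (1 + of_real \<omega> * t)" by simp
  have "1 <= Re (1 + of_real \<omega> * cnj t)" using t \<omega> by simp
  then have g: "1 <= cmod (1 + of_real \<omega> * cnj t)" using complex_Re_le_cmod order_trans by blast
  have eq: "cmod (1 + of_real \<omega> * cnj t) = cmod (1 + of_real \<omega> * t)" unfolding c complex_mod_cnj ..
  have \<kappa>': "\<kappa> = (1 + of_real \<omega> * t) / (t * (1 + of_real \<omega> * cnj t))" by (simp add: \<kappa> \<omega>_def)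
  show "cmod \<kappa> = 1" unfolding \<kappa>' norm_divide norm_mult t(1) eq using g[unfolded eq] by fastforce
  have tc: "t * cnj t = 1" using t(1) by (simp add: complex_norm_square[symmetric])
  have nz: "t * (1 + of_real \<omega> * cnj t) ~= 0" using t g by auto
  have "\<kappa> - 1 = (1 + of_real \<omega> * t - t * (1 + of_real \<omega> * cnj t)) / (t * (1 + of_real \<omega> * cnj t))"
   unfolding \<kappa>' using nz by (simp add: diff_divide_distrib)
  also have "1 + of_real \<omega> * t - t * (1 + of_real \<omega> * cnj t) = of_real \<eta> * (1 - t)"
   using tc unfolding \<omega>_def of_real_diff of_real_1 by algebra
  finally have "cmod (\<kappa> - 1) = \<eta> * cmod (1 - t) / cmod (1 + of_real \<omega> * cnj t)"
   using t \<eta> by (simp add: norm_divide norm_mult)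
  also have "\<dots> <= \<eta> * 2 / 1"
   using g \<eta> norm_triangle_ineq4[of 1 t] t by (intro frac_le mult_left_mono) auto
  finally show "cmod (\<kappa> - 1) <= 2 * \<eta>" by simp
 qed
 have kH: "cmod (\<kappa> * H - of_real (n\<^sup>2)) <= 36 * \<eta> * n\<^sup>2"
 proof -
  have "\<kappa> * H - of_real (n\<^sup>2) = \<kappa> * (H - of_real (n\<^sup>2)) + (\<kappa> - 1) * of_real (n\<^sup>2)" by (simp add: algebra_simps)
  then have "cmod (\<kappa> * H - of_real (n\<^sup>2)) <= cmod (\<kappa> * (H - of_real (n\<^sup>2))) + cmod ((\<kappa> - 1) * of_real (n\<^sup>2))"
   using norm_triangle_ineq by metis
  also have "\<dots> <= 34 * \<eta> * n\<^sup>2 + (2 * \<eta>) * n\<^sup>2"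
  proof (rule add_mono)
   show "cmod (\<kappa> * (H - of_real (n\<^sup>2))) <= 34 * \<eta> * n\<^sup>2" unfolding norm_mult k(1) using Hn by simp
   show "cmod ((\<kappa> - 1) * of_real (n\<^sup>2)) <= (2 * \<eta>) * n\<^sup>2"
    unfolding norm_mult norm_of_real using k(2) \<eta> by (intro mult_mono) auto
  qed
  finally show ?thesis by simp
 qed
 let ?D = "n\<^sup>2 - (norm (z *v v))\<^sup>2"
 have D: "\<bar>?D - (1 - \<omega>\<^sup>2) * n\<^sup>2\<bar> <= 4 * \<delta> * n\<^sup>2"
  using z2 by (simp add: power2_eq_square algebra_simps abs_le_iff)
 have "cmod (\<kappa> * of_real (1 - \<omega>\<^sup>2) * H - of_real ?D)
  <= cmod (of_real (1 - \<omega>\<^sup>2) * (\<kappa> * H - of_real (n\<^sup>2))) + cmod (of_real ((1 - \<omega>\<^sup>2) * n\<^sup>2 - ?D))"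
 proof -
  have "\<kappa> * of_real (1 - \<omega>\<^sup>2) * H - of_real ?D = of_real (1 - \<omega>\<^sup>2) * (\<kappa> * H - of_real (n\<^sup>2)) + of_real ((1 - \<omega>\<^sup>2) * n\<^sup>2 - ?D)"
   by (simp add: algebra_simps)
  then show ?thesis using norm_triangle_ineq by metis
 qed
 also have "\<dots> <= (2 * \<eta>) * (36 * \<eta> * n\<^sup>2) + 4 * \<delta> * n\<^sup>2"
 proof (rule add_mono)
  show "cmod (of_real (1 - \<omega>\<^sup>2) * (\<kappa> * H - of_real (n\<^sup>2))) <= (2 * \<eta>) * (36 * \<eta> * n\<^sup>2)"
   unfolding norm_mult norm_of_real using \<omega>2 kH by (intro mult_mono) auto
  show "cmod (of_real ((1 - \<omega>\<^sup>2) * n\<^sup>2 - ?D)) <= 4 * \<delta> * n\<^sup>2" unfolding norm_of_real using D by linarith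
 qed
 also have "\<dots> = (72 * \<eta>\<^sup>2 + 4 * \<delta>) * n\<^sup>2" by (simp add: power2_eq_square algebra_simps)
 also have "\<dots> <= (e0 / 2 * (\<eta> - 4 * \<delta>)) * n\<^sup>2" using e by (intro mult_right_mono) auto
 also have "\<dots> = e0 / 2 * (\<eta> * n\<^sup>2 - 4 * \<delta> * n\<^sup>2)" by (simp add: algebra_simps)
 also have "\<dots> <= e0 / 2 * ?D"
 proof (rule mult_left_mono)
  have "\<eta> * n\<^sup>2 <= (1 - \<omega>\<^sup>2) * n\<^sup>2" using \<omega>2 by (intro mult_right_mono) auto
  then show "\<eta> * n\<^sup>2 - 4 * \<delta> * n\<^sup>2 <= ?D" using D by linarith
 qed (simp add: e0_def)
 finally show ?thesis unfolding H_def n_def \<omega>_def .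
qed

text \<open>\<open>F'\<close> is \<open>F\<close> seen through real affine changes of source and
  target; extensions of \<open>F'\<close> are carried back to \<open>F\<close> along this
  relation.\<close>

definition reduces :: "(mat2 => mat2) => real => (mat2 => mat2) => (mat2 => mat2) => real => bool"
 where "reduces F r F' G' R \<longleftrightarrow> pair F' G' R & (\<exists>a b c a' b' c' X X'. a > 0 & c > 0 & a' > 0 & c' > 0 & realm X & realm X' &
  (\<forall>V\<in>HB R. tri a b c V + X \<in> HB r & F (tri a b c V + X) = tri a' b' c' (F' V) + X'))"

text \<open>The quantity is the determinant of \<open>1 + t w0\<close> when \<open>T\<close> and
  \<open>D\<close> are trace and determinant of \<open>w0\<close>. Were it small for 1, \<i> and
  \<open>- \<i>\<close> at once, the sum of the last two would put \<open>D\<close> near 1 and their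
  difference would make \<open>T\<close> small, so that the first would be near 2.\<close>

lemma choose_rotation:
 fixes T D :: complex
 assumes D: "3/4 <= cmod D"
 obtains t where "cmod t = 1" "0 <= Re t" "1/2 <= cmod (1 + t * T + t\<^sup>2 * D)"
proof -
 have "1/2 <= cmod (1 + T + D) \<or> 1/2 <= cmod (1 + \<i> * T - D) \<or> 1/2 <= cmod (1 - \<i> * T - D)"
 proof (rule ccontr)
  assume "\<not> ?thesis"
  then have l: "cmod (1 + T + D) < 1/2" "cmod (1 + \<i> * T - D) < 1/2" "cmod (1 - \<i> * T - D) < 1/2" by auto
  have "cmod (2 * (1 - D)) <= cmod (1 + \<i> * T - D) + cmod (1 - \<i> * T - D)"
   using norm_triangle_ineq[of "1 + \<i> * T - D" "1 - \<i> * T - D"] by (simp add: algebra_simps)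
  then have 1: "cmod (1 - D) < 1/2" using l unfolding norm_mult by simp
  have "cmod (2 * \<i> * T) <= cmod (1 + \<i> * T - D) + cmod (1 - \<i> * T - D)"
   using norm_triangle_ineq4[of "1 + \<i> * T - D" "1 - \<i> * T - D"] by (simp add: algebra_simps)
  then have 2: "cmod T < 1/2" using l unfolding norm_mult by simp
  have "2 = (1 + T + D) - T + (1 - D)" by simp
  then have "2 <= cmod (1 + T + D) + cmod T + cmod (1 - D)"
   using norm_triangle_ineq[of "(1 + T + D) - T" "1 - D"] norm_triangle_ineq4[of "1 + T + D" T] by (metis add_right_mono norm_numeral order_trans)
  then show False using l 1 2 by linarith
 qed
 then show thesis using that[of 1] that[of \<i>] that[of "- \<i>"] by (auto simp: algebra_simps power2_eq_square)
qed

lemma cay_scalar: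
 assumes "1 + \<tau> ~= 0"
 shows "den (cscale \<tau> (mat 1)) = (1 + \<tau>)\<^sup>2" "cay (cscale \<tau> (mat 1)) = cscale ((1 - \<tau>) / (1 + \<tau>)) (mat 1)"
proof -
 show d: "den (cscale \<tau> (mat 1)) = (1 + \<tau>)\<^sup>2" by (simp add: den_def power2_eq_square algebra_simps)
 have "(1 - \<tau> * \<tau>) / (1 + \<tau>)\<^sup>2 = (1 - \<tau>) / (1 + \<tau>)"
 proof -
  have "1 - \<tau> * \<tau> = (1 - \<tau>) * (1 + \<tau>)" by (simp add: algebra_simps)
  then show ?thesis using assms by (simp add: power2_eq_square)
 qed
 then show "cay (cscale \<tau> (mat 1)) = cscale ((1 - \<tau>) / (1 + \<tau>)) (mat 1)"
  unfolding mat2_eq_iff cay_nth d by (simp add: power2_eq_square)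
qed

lemma dF_C_map:
 assumes "z \<in> udisc" "X \<in> Sym"
 shows "dF C_map X z = cscale \<i> (dF cay X z)"
proof -
 have "dF (%z. cscale \<i> (cay z)) X z = dF (cscale \<i>) (dF cay X z) (cay z)"
  by (rule dF_comp[OF hol_cay hol_cscale[of Sym]]) (use assms udisc_den udisc_Sym cay_Sym in auto)
 then show ?thesis by (simp add: C_map_def[abs_def] dF_linear_cscale)
qed

text \<open>Cauchy's estimate for the pairing with the error vector \<open>u\<close> itself: the
  derivative at the centre is then its squared norm.\<close>

lemma disc_derivative_close:
 fixes z :: "complex => mat2" and w :: mat2
 assumes hz: "!!i j. (%\<omega>. z \<omega> $ i $ j) holomorphic_on ball s r" and r: "0 < r"
  and d: "!!i j. ((%\<omega>. z \<omega> $ i $ j) has_field_derivative q $ i $ j) (at s)"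
  and b: "!!\<omega> v. \<omega> \<in> ball s r ==> norm (z \<omega> *v v - \<omega> *s (w *v v)) <= \<delta> * norm v"
 shows "norm (q *v v - w *v v) <= 2 * \<delta> / r * norm v"
proof -
 define u where "u = q *v v - w *v v"
 define g where "g \<omega> = hin u (z \<omega> *v v) - \<omega> * hin u (w *v v)" for \<omega>
 have hg: "g holomorphic_on ball s r" unfolding g_def[abs_def] using hin_holomorphic[of z, OF hz] by (intro holomorphic_intros) auto
 have bd: "cmod (g \<omega>) <= norm u * (\<delta> * norm v)" if "\<omega> \<in> ball s r" for \<omega>
 proof -
  have "g \<omega> = hin u (z \<omega> *v v - \<omega> *s (w *v v))" by (simp add: g_def hin_add hin_scale)
  then show ?thesis using order_trans[OF hin_bound mult_left_mono[OF b[OF that]]] by simp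
 qed
 have "(g has_field_derivative hin u (q *v v) - hin u (w *v v)) (at s)"
  unfolding g_def[abs_def] by (rule derivative_eq_intros hin_deriv[of z q s u v] d refl | simp)+
 then have "deriv g s = of_real ((norm u)\<^sup>2)" unfolding hin_self[symmetric] by (simp add: DERIV_imp_deriv u_def hin_add)
 then have "cmod (deriv g s) = (norm u)\<^sup>2" by (simp only: norm_of_real abs_power2)
 then have "(norm u)\<^sup>2 <= 2 * (norm u * (\<delta> * norm v)) / r" using deriv_bound[OF hg r bd] by simp
 then have m: "norm u * norm u <= norm u * (2 * \<delta> / r * norm v)" by (simp add: power2_eq_square algebra_simps)
 show ?thesis unfolding u_def[symmetric]
 proof (cases "norm u = 0")
  case True
  have "0 <= \<delta> * norm v" using b[of s v] r norm_ge_zero order_trans by (metis centre_in_ball)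
  then show "norm u <= 2 * \<delta> / r * norm v" using True r by (simp add: mult.commute)
 next
  case False
  show "norm u <= 2 * \<delta> / r * norm v" by (rule mult_left_le_imp_le[OF m]) (use False in simp)
 qed
qed

text \<open>The lifted disc in the direction of a scalar matrix \<open>t\<close> is almost linear
  with nearly unitary coefficient \<open>w\<close>. The new base point lies at radius
  \<open>1 - \<eta>\<close> on it, where \<open>pre_state_core\<close> applies; the choice of
  \<open>t\<close> keeps \<open>1 + w\<close> invertible.\<close>

lemma start_pair:
 assumes R: "R > 2"
 obtains \<rho>0 where "\<rho>0 > 2" "!!F G \<rho>. pair F G \<rho> ==> \<rho>0 <= \<rho> ==> \<exists>F' G'. reduces F \<rho> F' G' R & pre_state F'"
proof -
 \<comment> \<open>\<open>\<delta>'\<close> bounds the deviation of the disc from linearity, its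
   derivative loses a factor \<open>4 / \<eta>\<close> to Cauchy's estimate and so is accurate up to
   \<delta>, and \<epsilon> is fitted so that \<open>72 * \<epsilon> / \<eta>\<close> is the square
   of \<open>\<delta>'\<close>.\<close>
 define \<eta> where "\<eta> = e0 / 1000"
 define \<delta> where "\<delta> = e0\<^sup>2 / 100000"
 define \<delta>' where "\<delta>' = \<delta> * \<eta> / 4"
 define \<epsilon> where "\<epsilon> = \<delta>'\<^sup>2 * \<eta> / 72"
 have nums: "0 < \<eta>" "\<eta> <= 1/1000" "0 < \<delta>" "\<delta> <= \<eta> / 1000" "72 * \<eta>\<^sup>2 + 4 * \<delta> <= e0 / 2 * (\<eta> - 4 * \<delta>)"
  by (simp_all add: \<eta>_def \<delta>_def e0_def power2_eq_square)
 have \<delta>': "0 < \<delta>'" "\<delta>' <= \<delta>" "\<delta>' <= 1" "4 * \<delta>' / \<eta> = \<delta>"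
  by (simp_all add: \<delta>'_def \<eta>_def \<delta>_def e0_def power2_eq_square)
 have \<epsilon>: "0 < \<epsilon>" "\<epsilon> <= \<eta> / 4" "\<epsilon> <= \<delta>" "\<epsilon> <= 1/4"
  by (simp_all add: \<epsilon>_def \<delta>'_def \<eta>_def \<delta>_def e0_def power2_eq_square)
 have e72: "72 * \<epsilon> / \<eta> = \<delta>'\<^sup>2" using nums by (simp add: \<epsilon>_def)
 obtain \<rho>u where \<rho>u: "\<rho>u > 2" "!!F G \<rho>. pair F G \<rho> ==> \<rho>u <= \<rho> ==>
  opb (1 + \<epsilon>) (dF F (mat 1) ii) & (\<forall>x. (1 - \<epsilon>) * norm x <= norm (dF F (mat 1) ii *v x)) &
  (\<forall>v. cmod (dt (dF F (nl v) ii)) <= \<epsilon> * norm v ^ 4) & 1 - \<epsilon> <= cmod (dt (dF F (mat 1) ii))"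
  using near_unitary[OF \<epsilon>(1)] by blast
 \<comment> \<open>This is \<open>24 / (\<eta> / 4)^2\<close>, the value of \<open>cay_bound\<close>
   for norm at most \<open>1 - \<eta> / 4\<close>; it bounds the new base point and its
   image.\<close>
 define M where "M = 384 / \<eta>\<^sup>2"
 have M: "0 < M" using nums by (simp add: M_def)
 define \<rho>0 where "\<rho>0 = \<rho>u + 24 / \<epsilon>\<^sup>2 + 2 * M + 12 * M * R + 1"
 have MR: "0 < M * R" using M R by simp
 have \<rho>0: "\<rho>u <= \<rho>0" "24 / \<epsilon>\<^sup>2 < \<rho>0" "2 * M < \<rho>0" "12 * M * R <= \<rho>0"
  using \<rho>u(1) \<epsilon>(1) M MR by (auto simp: \<rho>0_def add_pos_pos add_nonneg_pos intro!: add_nonneg_nonneg)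
 show thesis
 proof (rule that[of \<rho>0])
  show "2 < \<rho>0" using \<rho>0 \<rho>u by linarith
  fix F G \<rho> assume P: "pair F G \<rho>" and \<rho>: "\<rho>0 <= \<rho>"
  define w0 where "w0 = dF F (mat 1) ii"
  have w0: "opb (1 + \<epsilon>) w0" "!!x. (1 - \<epsilon>) * norm x <= norm (w0 *v x)" "1 - \<epsilon> <= cmod (dt w0)"
   using \<rho>u(2)[OF P] \<rho> \<rho>0 unfolding w0_def by auto
  have FP: "hol F (HB \<rho>)" "!!V. V \<in> HB \<rho> ==> F V \<in> siegel" "F ii = ii" "\<rho> > 2" "prepair F G \<rho>"
   using P by (auto simp: pair_def prepair_def)
  have "3/4 <= cmod (dt w0)" using w0(3) \<epsilon>(4) by linarith
  from choose_rotation[OF this, of "w0$1$1 + w0$2$2"]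
  obtain t where t: "cmod t = 1" "0 <= Re t" "1/2 <= cmod (1 + t * (w0$1$1 + w0$2$2) + t\<^sup>2 * dt w0)" .
  define X where "X = cscale t (mat 1)"
  define w where "w = dF F X ii"
  have m1: "mat 1 \<in> Sym" by (auto simp: Sym_iff)
  have X: "X \<in> Sym" "opb 1 X" using m1 t(1) by (auto simp: X_def opb_def mat2_vec_lin norm_smult_vec2)
  have iB: "ii \<in> HB \<rho>" using FP(4) by (rule ii_HB)
  have ww: "w = cscale t w0" unfolding w_def X_def w0_def by (rule dF_cscale[OF FP(1) iB m1])
  have wx: "norm (w *v x) = norm (w0 *v x)" for x by (simp add: ww mat2_vec_lin norm_smult_vec2 t)
  have w: "(1 - \<epsilon>) * norm x <= norm (w *v x)" "norm (w *v x) <= (1 + \<epsilon>) * norm x" for x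
   using w0 unfolding wx by (auto simp: opb_def)
  have wd: "(1 - \<delta>) * norm x <= norm (w *v x)" "norm (w *v x) <= (1 + \<delta>) * norm x" for x
   using w[of x] \<epsilon>(3) mult_right_mono[of \<epsilon> \<delta> "norm x"] by (auto simp: algebra_simps)
  have dw: "1/2 <= cmod (den w)"
   using t(3) by (simp add: ww den_def algebra_simps power2_eq_square)
  define z where "z \<omega> = C_inv (F (C_map (cscale \<omega> X)))" for \<omega>
  have \<sigma>: "0 < 1 - \<epsilon>" "1 - \<epsilon> < 1" "24 / (1 - (1 - \<epsilon>))\<^sup>2 < \<rho>" using \<epsilon> \<rho>0 \<rho> by auto
  note L = cay_lift[OF P X \<sigma>, folded z_def w_def]
  define \<omega>0 where "\<omega>0 = complex_of_real (1 - \<eta>)"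
  have \<omega>0: "cmod \<omega>0 = 1 - \<eta>" unfolding \<omega>0_def norm_of_real using nums by simp
  have in_b: "cmod \<omega> <= 1 - \<eta> / 2" if "\<omega> \<in> ball \<omega>0 (\<eta> / 2)" for \<omega>
   using that \<omega>0 norm_triangle_ineq[of \<omega>0 "\<omega> - \<omega>0"] by (simp add: dist_norm norm_minus_commute)
  have lt\<sigma>: "cmod \<omega> < 1 - \<epsilon>" if "cmod \<omega> <= 1 - \<eta> / 2" for \<omega> using that \<epsilon>(2) nums(1) by linarith
  have dl: "norm (z \<omega> *v v) <= cmod \<omega> / (1 - \<epsilon>) * norm v" "norm (z \<omega> *v v - \<omega> *s (w *v v)) <= \<delta>' * norm v"
   if "cmod \<omega> <= 1 - \<eta> / 2" for \<omega> v
  proof -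
   note D = disc_near_linear[OF L(1,2,3,4) \<epsilon>(1,2) _ w that, of v]
   show "norm (z \<omega> *v v) <= cmod \<omega> / (1 - \<epsilon>) * norm v" using D(1) nums by simp
   have "(norm (z \<omega> *v v - \<omega> *s (w *v v)))\<^sup>2 <= (\<delta>' * norm v)\<^sup>2" using D(2) nums unfolding e72 by (simp add: power_mult_distrib)
   then show "norm (z \<omega> *v v - \<omega> *s (w *v v)) <= \<delta>' * norm v" using \<delta>' by (simp add: power2_le_iff_abs_le)
  qed
  have \<omega>0': "cmod \<omega>0 <= 1 - \<eta> / 2" "cmod \<omega>0 < 1 - \<epsilon>" using \<omega>0 nums lt\<sigma>[of \<omega>0] by auto
  define B where "B = ball \<omega>0 (\<eta> / 2)"
  have B: "open B" "\<omega>0 \<in> B" "!!\<omega>. \<omega> \<in> B ==> cmod \<omega> < 1 - \<epsilon>" using nums in_b lt\<sigma> by (auto simp: B_def)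
  have hB: "(%\<omega>. z \<omega> $ i $ j) holomorphic_on B" for i j
   by (rule holomorphic_on_subset[OF L(1)]) (use B(3) in auto)
  define q where "q = (\<chi> i j. deriv (%\<omega>. z \<omega> $ i $ j) \<omega>0)"
  have q: "((%\<omega>. z \<omega> $ i $ j) has_field_derivative q $ i $ j) (at \<omega>0)" for i j
   using holomorphic_derivI[OF hB B(1,2)] by (simp add: q_def)
  have zS: "z \<omega> \<in> udisc" if "\<omega> \<in> B" for \<omega> by (rule L(2)[OF B(3)[OF that]])
  have qS: "q \<in> Sym"
  proof -
   have "((%\<omega>. z \<omega> $ 2 $ 1) has_field_derivative q $ 1 $ 2) (at \<omega>0)"
    by (rule has_field_derivative_transform_within_open[OF q B(1,2)]) (use zS udisc_Sym in \<open>simp add: Sym_iff\<close>)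
   then show ?thesis unfolding Sym_iff using q DERIV_unique by blast
  qed
  have qw: "norm (q *v v - w *v v) <= \<delta> * norm v" for v
  proof -
   have "norm (q *v v - w *v v) <= 2 * \<delta>' / (\<eta> / 2) * norm v"
    by (rule disc_derivative_close[OF hB[unfolded B_def] _ q]) (use nums dl(2) in_b in auto)
   moreover have "2 * \<delta>' / (\<eta> / 2) = \<delta>" using \<delta>'(4) by simp
   ultimately show ?thesis by (simp only:)
  qed
  have zw: "norm (z \<omega>0 *v v - of_real (1 - \<eta>) *s (w *v v)) <= \<delta> * norm v" for v
   using dl(2)[OF \<omega>0'(1), of v] \<delta>'(2) mult_right_mono[of \<delta>' \<delta> "norm v"] by (simp add: \<omega>0_def)
  define \<tau> where "\<tau> = \<omega>0 * t"
  have rt: "1 <= Re (1 + \<omega> * t)" if "\<omega> = of_real s" "0 <= s" for \<omega> s using that t(2) by simp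
  have nz: "1 + \<omega> * t ~= 0" if "cmod \<omega> < 1" for \<omega>
  proof
   assume "1 + \<omega> * t = 0"
   then have "cmod (\<omega> * t) = 1" by (metis add_eq_0_iff norm_minus_cancel norm_one)
   then show False using that t by (simp add: norm_mult)
  qed
  have lt1: "cmod \<omega> < 1" if "\<omega> \<in> B" for \<omega> using B(3)[OF that] \<epsilon> by linarith
  have \<tau>: "1 + \<tau> ~= 0" using nz lt1 B(2) by (simp add: \<tau>_def)
  define f where "f \<omega> = \<i> * ((1 - \<omega> * t) / (1 + \<omega> * t))" for \<omega>
  have Cf: "C_map (cscale \<omega> X) = cscale (f \<omega>) (mat 1)" if "\<omega> \<in> B" for \<omega>
   using cay_scalar(2)[OF nz[OF lt1[OF that]]] by (simp add: C_map_def X_def f_def mat2_eq_iff)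
  define Z0 where "Z0 = cscale (f \<omega>0) (mat 1)"
  have Z0: "Z0 = C_map (cscale \<omega>0 X)" using Cf B by (simp add: Z0_def)
  have Z0B: "Z0 \<in> HB \<rho>" using L(5)[OF \<omega>0'(2)] Z0 by simp
  have FZ0: "F Z0 = C_map (z \<omega>0)" unfolding z_def Z0[symmetric] using C_map_C_inv FP(2)[OF Z0B] by simp
  have nC: "norm (C_map y) <= M" if "y \<in> Sym" "opb (1 - \<eta> / 4) y" for y
  proof -
   have "norm (cay y) <= 24 / (1 - (1 - \<eta> / 4))\<^sup>2" by (rule cay_bound) (use that nums in auto)
   then show ?thesis by (simp add: C_map_def norm_cscale M_def power2_eq_square)
  qed
  have nZ: "norm Z0 <= M" unfolding Z0
  proof (rule nC)
   show "opb (1 - \<eta> / 4) (cscale \<omega>0 X)" using opb_cscale[OF X(2), of \<omega>0] \<omega>0 nums opb_mono by auto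
  qed (use X in auto)
  have nFZ: "norm (F Z0) <= M" unfolding FZ0
  proof (rule nC)
   have "opb (cmod \<omega>0 / (1 - \<epsilon>)) (z \<omega>0)" using dl(1)[OF \<omega>0'(1)] by (simp add: opb_def)
   moreover have "cmod \<omega>0 / (1 - \<epsilon>) <= 1 - \<eta> / 4"
   proof -
    have "0 <= \<epsilon> * \<eta>" using \<epsilon> nums by simp
    moreover have "(1 - \<eta> / 4) * (1 - \<epsilon>) = 1 - \<eta> / 4 - \<epsilon> + \<epsilon> * \<eta> / 4" by (simp add: field_simps)
    ultimately have "1 - \<eta> <= (1 - \<eta> / 4) * (1 - \<epsilon>)" using \<epsilon>(2) nums(1) by linarith
    then show ?thesis using \<sigma>(1) \<omega>0 by (simp add: pos_divide_le_eq)
   qed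
   ultimately show "opb (1 - \<eta> / 4) (z \<omega>0)" by (rule opb_mono)
   show "z \<omega>0 \<in> Sym" using zS[OF B(2)] udisc_Sym by blast
  qed
  have tr: "Im (Y$1$1) + Im (Y$2$2) <= 2 * norm Y" for Y :: mat2
   using order_trans[OF abs_Im_le_cmod cmod_nth_le[of Y 1 1]] order_trans[OF abs_Im_le_cmod cmod_nth_le[of Y 2 2]] by linarith
  have "Z0 \<in> HB (\<rho>/2)" "F Z0 \<in> HB (\<rho>/2)" using Z0B FP(2)[OF Z0B] nZ nFZ \<rho>0 \<rho> by (auto simp: HB_def)
  moreover have "Im (Z0$1$1) + Im (Z0$2$2) <= 2 * M" "Im (F Z0$1$1) + Im (F Z0$2$2) <= 2 * M"
   using tr[of Z0] tr[of "F Z0"] nZ nFZ by linarith+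
  moreover have "3 * (2 * M) * R <= \<rho> / 2" using \<rho>0 \<rho> by simp
  ultimately obtain a b c a' b' c' F' G' where N: "a > 0" "c > 0" "a' > 0" "c' > 0"
   "tri a b c (mat 1) = imm Z0" "tri a' b' c' (mat 1) = imm (F Z0)" "pair F' G' R"
   "!!V. V \<in> Sym ==> tri a' b' c' (dF F' V ii) = dF F (tri a b c V) Z0"
   "!!V. V \<in> HB R ==> tri a b c V + rem Z0 \<in> HB \<rho>"
   "!!V. V \<in> HB R ==> F (tri a b c V + rem Z0) = tri a' b' c' (F' V) + rem (F Z0)"
   using normalise[OF FP(5) _ _ _ _ R] by metis
  have "reduces F \<rho> F' G' R" unfolding reduces_def
   using N(1-4,7,9,10) rem_realm by blast
  moreover have "pre_state F'" unfolding pre_state_def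
  proof
   fix x' :: "complex^2"
   define x where "x = cvec ((x'$1 - of_real b' * x'$2 / of_real c') / of_real a') (x'$2 / of_real c')"
   have x': "trv a' b' c' x = x'" using N(3,4) by (simp add: trv_def x_def vec2_eq_iff)
   have dz: "den (z \<omega>0) ~= 0" using zS[OF B(2)] udisc_den by blast
   obtain v where v: "v + z \<omega>0 *v v = x" using cay_solve[OF dz] by blast
   obtain u where u: "u + z \<omega>0 *v u = q *v v" using cay_solve[OF dz] by blast
   have fd: "(f has_field_derivative - 2 * \<i> * t / (1 + \<tau>)\<^sup>2) (at \<omega>0)"
    unfolding f_def[abs_def] using \<tau> unfolding \<tau>_def
    by (auto intro!: derivative_eq_intros simp: power2_eq_square divide_simps) (simp add: algebra_simps)
   define f' where "f' = - 2 * \<i> * t / (1 + \<tau>)\<^sup>2"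
   \<comment> \<open>The derivative of one curve at \<open>\<omega>0\<close> computed twice: through
     the scalar curve in the source and through the disc \<open>z\<close> in the target.\<close>
   have chain: "cscale f' (dF F (mat 1) Z0) = cscale \<i> (dF cay q (z \<omega>0))"
   proof -
    have "dF F (cscale f' (mat 1)) Z0 $ i $ j = dF C_map q (z \<omega>0) $ i $ j" for i j
    proof (rule DERIV_unique)
     have "((%\<omega>. F (cscale (f \<omega>) (mat 1)) $ i $ j) has_field_derivative dF F (cscale f' (mat 1)) (cscale (f \<omega>0) (mat 1)) $ i $ j) (at \<omega>0)"
     proof (rule hol_curve[OF FP(1) B(1,2)])
      show "cscale (f \<omega>) (mat 1) \<in> HB \<rho>" if "\<omega> \<in> B" for \<omega> using L(5)[OF B(3)[OF that]] Cf[OF that] by simp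
      show "((%\<omega>. cscale (f \<omega>) (mat 1) $ i $ j) has_field_derivative cscale f' (mat 1) $ i $ j) (at \<omega>0)" for i j
       unfolding cscale_nth f'_def by (rule DERIV_cmult_right[OF fd])
     qed (use m1 in auto)
     then show "((%\<omega>. F (cscale (f \<omega>) (mat 1)) $ i $ j) has_field_derivative dF F (cscale f' (mat 1)) Z0 $ i $ j) (at \<omega>0)"
      by (simp only: Z0_def)
     have "((%\<omega>. C_map (z \<omega>) $ i $ j) has_field_derivative dF C_map q (z \<omega>0) $ i $ j) (at \<omega>0)"
      by (rule hol_curve[OF hol_C_map B(1,2) _ q qS]) (use zS udisc_Sym udisc_den in blast)
     then show "((%\<omega>. F (cscale (f \<omega>) (mat 1)) $ i $ j) has_field_derivative dF C_map q (z \<omega>0) $ i $ j) (at \<omega>0)"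
     proof (rule has_field_derivative_transform_within_open[OF _ B(1,2)])
      fix \<omega> assume o: "\<omega> \<in> B"
      have "F (C_map (cscale \<omega> X)) \<in> siegel" using L(5)[OF B(3)[OF o]] FP(2) by blast
      then show "C_map (z \<omega>) $ i $ j = F (cscale (f \<omega>) (mat 1)) $ i $ j"
       unfolding z_def Cf[OF o, symmetric] by (simp add: C_map_C_inv)
     qed
    qed
    then have "dF F (cscale f' (mat 1)) Z0 = dF C_map q (z \<omega>0)" by (simp only: mat2_eq_iff)
    then show ?thesis unfolding dF_C_map[OF zS[OF B(2)] qS] dF_cscale[OF FP(1) Z0B m1] .
   qed
   \<comment> \<open>Solving \<open>x\<close> and \<open>q *v v\<close> as values of
     \<open>1 + z \<omega>0\<close> is what lets \<open>dF_cay\<close> and \<open>cay_mult\<close>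
     evaluate this without an inverse.\<close>
   have cu: "dF cay q (z \<omega>0) *v x = - (2 *s u)"
   proof -
    have "dF cay q (z \<omega>0) *v x = - (q *v v + cay (z \<omega>0) *v (q *v v))"
     using dF_cay[OF udisc_Sym[OF zS[OF B(2)]] dz qS, of v] by (simp add: v)
    also have "cay (z \<omega>0) *v (q *v v) = u - z \<omega>0 *v u" using cay_mult[OF dz, of u] by (simp add: u)
    finally show ?thesis using u[symmetric] by (simp add: vec_eq_iff algebra_simps)
   qed
   have hF: "f' * hin x (dF F (mat 1) Z0 *v x) = - 2 * \<i> * hin x u"
   proof -
    have "f' * hin x (dF F (mat 1) Z0 *v x) = hin x (cscale f' (dF F (mat 1) Z0) *v x)" by (simp add: mat2_vec_lin hin_scale)
    also have "\<dots> = \<i> * hin x (dF cay q (z \<omega>0) *v x)" unfolding chain by (simp add: mat2_vec_lin hin_scale)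
    also have "\<dots> = - 2 * \<i> * hin x u" unfolding cu by (simp add: hin_add hin_scale)
    finally show ?thesis .
   qed
   have t0: "t ~= 0" using t by auto
   have hF': "hin x (dF F (mat 1) Z0 *v x) = (1 + \<tau>)\<^sup>2 / t * hin x u"
   proof -
    have "- 2 * \<i> * t * hin x (dF F (mat 1) Z0 *v x) = - 2 * \<i> * (1 + \<tau>)\<^sup>2 * hin x u"
     using hF \<tau> unfolding f'_def by (simp add: field_simps)
    then show ?thesis using t0 by (simp add: field_simps)
   qed
   define y0 where "y0 = Im (f \<omega>0)"
   have iZ: "imm Z0 = cscale (of_real y0) (mat 1)" by (simp add: Z0_def imm_def y0_def mat2_eq_iff)
   have y0: "of_real y0 * ((1 + \<tau>) * cnj (1 + \<tau>)) = complex_of_real (1 - (1 - \<eta>)\<^sup>2)"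
   proof -
    have "f \<omega>0 = \<i> * ((1 - \<tau>) * cnj (1 + \<tau>)) / ((1 + \<tau>) * cnj (1 + \<tau>))"
    proof -
     have "cnj (1 + \<tau>) ~= 0" using \<tau> by (metis complex_cnj_zero_iff)
     then have A: "(1 - \<tau>) / (1 + \<tau>) = ((1 - \<tau>) * cnj (1 + \<tau>)) / ((1 + \<tau>) * cnj (1 + \<tau>))"
      by (rule mult_divide_mult_cancel_right[symmetric])
     show ?thesis unfolding f_def \<tau>_def[symmetric] A by (simp only: times_divide_eq_right)
    qed
    also have "(1 + \<tau>) * cnj (1 + \<tau>) = of_real ((cmod (1 + \<tau>))\<^sup>2)" by (simp only: complex_norm_square)
    finally have "y0 = Re ((1 - \<tau>) * cnj (1 + \<tau>)) / (cmod (1 + \<tau>))\<^sup>2" unfolding y0_def by (simp only: Im_divide_of_real Im_i_times)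
    also have "Re ((1 - \<tau>) * cnj (1 + \<tau>)) = 1 - (cmod \<tau>)\<^sup>2" unfolding cmod_power2 by (simp add: algebra_simps power2_eq_square)
    also have "cmod \<tau> = 1 - \<eta>" using \<omega>0 t by (simp add: \<tau>_def norm_mult)
    finally have "y0 * (cmod (1 + \<tau>))\<^sup>2 = 1 - (1 - \<eta>)\<^sup>2" using \<tau> by simp
    then show ?thesis by (metis complex_norm_square of_real_mult)
   qed
   define \<kappa> where "\<kappa> = (1 + of_real (1 - \<eta>) * t) / (t * (1 + of_real (1 - \<eta>) * cnj t))"
   have \<kappa>: "\<kappa> = (1 + \<tau>) / (t * cnj (1 + \<tau>))" by (simp add: \<kappa>_def \<tau>_def \<omega>0_def)
   have A: "hin x' (dF F' (mat 1) ii *v x') = \<kappa> * of_real (1 - (1 - \<eta>)\<^sup>2) * hin (v + z \<omega>0 *v v) u"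
   proof -
    have iH: "ii \<in> HB R" using R by (rule ii_HB)
    have hF'R: "hol F' (HB R)" using N(7) by (simp add: pair_def prepair_def)
    have S': "dF F' (mat 1) ii \<in> Sym" by (rule hol_dF_Sym[OF hF'R iH m1])
    have "hin x' (dF F' (mat 1) ii *v x') = hin x (tri a' b' c' (dF F' (mat 1) ii) *v x)"
     using hin_tri[OF S', of x a' b' c'] by (simp only: x')
    also have "\<dots> = hin x (cscale (of_real y0) (dF F (mat 1) Z0) *v x)"
     unfolding N(8)[OF m1] N(5) iZ dF_cscale[OF FP(1) Z0B m1] ..
    also have "\<dots> = of_real y0 * ((1 + \<tau>)\<^sup>2 / t * hin x u)" by (simp add: mat2_vec_lin hin_scale hF')
    also have "\<dots> = \<kappa> * (of_real y0 * ((1 + \<tau>) * cnj (1 + \<tau>))) * hin x u"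
    proof -
     have gen: "g * (b\<^sup>2 / t * h) = b / (t * w) * (g * (b * w)) * h" if "w ~= 0" for b g h w :: complex
      using that t0 by (simp add: power2_eq_square field_simps)
     have "cnj (1 + \<tau>) ~= 0" using \<tau> by (metis complex_cnj_zero_iff)
     then show ?thesis unfolding \<kappa> by (rule gen)
    qed
    finally show ?thesis unfolding y0 v .
   qed
   have Bn: "(norm x')\<^sup>2 = (norm v)\<^sup>2 - (norm (z \<omega>0 *v v))\<^sup>2"
   proof -
    have "of_real ((norm x')\<^sup>2) = hin x' (mat 1 *v x')" by (simp add: hin_self)
    also have "\<dots> = hin x (tri a' b' c' (mat 1) *v x)" using hin_tri[OF m1, of x a' b' c'] by (simp only: x')
    also have "\<dots> = of_real (Im (hin x (F Z0 *v x)))" unfolding N(6) by (rule hin_imm) (use FP(2)[OF Z0B] siegel_Sym in blast)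
    finally have "(norm x')\<^sup>2 = Im (hin x (F Z0 *v x))" by (simp only: of_real_eq_iff)
    also have "hin x (F Z0 *v x) = \<i> * hin (v + z \<omega>0 *v v) (v - z \<omega>0 *v v)"
     unfolding FZ0 C_map_def hin_ii v[symmetric] cay_mult[OF dz] ..
    also have "Im \<dots> = (norm v)\<^sup>2 - (norm (z \<omega>0 *v v))\<^sup>2"
     using hin_cnj[of v "z \<omega>0 *v v"] by (simp add: hin_add hin_self del: of_real_power)
    finally show ?thesis .
   qed
   show "cmod (hin x' (dF F' (mat 1) ii *v x') - of_real ((norm x')\<^sup>2)) <= e0 / 2 * (norm x')\<^sup>2"
    unfolding A Bn
    by (rule pre_state_core[OF zS[OF B(2)] zw qw wd dw t(1,2) nums(1,2) _ nums(4,5) u \<kappa>_def]) (use nums in simp)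
  qed
  ultimately show "\<exists>F' G'. reduces F \<rho> F' G' R & pre_state F'" by blast
 qed
qed

section \<open>The boundary map is real\<close>

declare transpose_matrix_vector [simp del]

lemma prepair_inverse:
 assumes P: "prepair F G R" and Z: "Z \<in> HB R" "F Z \<in> HB R" and X: "X \<in> Sym"
 shows "dF G (dF F X Z) (F Z) = X"
proof -
 have FP: "hol F (HB R)" "hol G (HB R)" "!!V. V \<in> HB R ==> F V \<in> HB R ==> G (F V) = V"
  using P by (auto simp: prepair_def)
 define S where "S = HB R \<inter> F -` HB R"
 have "openin (top_of_set (HB R)) S" unfolding S_def
  by (rule continuous_openin_preimage[OF hol_continuous[OF FP(1)] _ open_Sym_HB])
   (use hol_in_Sym[OF FP(1)] in auto)
 then have So: "open_Sym S" using open_Sym_HB openin_trans by blast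
 have hS: "hol F S" by (rule hol_subset[OF FP(1) _ So]) (auto simp: S_def)
 have ZS: "Z \<in> S" using Z by (simp add: S_def)
 have "dF G (dF F X Z) (F Z) = dF (%Z. G (F Z)) X Z"
  by (rule dF_comp[symmetric, OF hS FP(2) _ ZS X]) (simp add: S_def)
 also have "\<dots> $ i $ j = X $ i $ j" for i j
 proof -
  have "ddir (%Z. G (F Z) $ i $ j) X Z = ddir (%Z. Z $ i $ j) X Z"
   by (rule ddir_cong[OF So ZS X]) (use FP(3) in \<open>auto simp: S_def\<close>)
  then show ?thesis by (simp add: ddir_nth)
 qed
 then have "dF (%Z. G (F Z)) X Z = X" by (simp only: mat2_eq_iff)
 finally show ?thesis .
qed

text \<open>Eliminating the auxiliary matrices shows that \<open>k ** transpose k\<close> is the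
  identity and that \<open>k\<close> commutes with the reflection \<open>symat 1 0 (-1)\<close> and
  the exchange \<open>symat 0 1 0\<close>; only scalar matrices commute with both.\<close>

lemma commuting_scalar:
 fixes k :: mat2
 assumes one: "!!S. S \<in> {mat 1, symat 1 0 (-1), symat 0 1 0} ==>
  \<exists>p m. p ** S ** transpose k = S & m ** S ** transpose k = S & p ** S ** transpose m = S"
 shows "\<exists>l. l * l = 1 & k = cscale l (mat 1)" "!!p. p ** transpose k = mat 1 ==> p = k"
proof -
 obtain p m where pm: "p ** transpose k = mat 1" "m ** transpose k = mat 1" "p ** transpose m = mat 1"
  using one[of "mat 1"] by auto
 have qp: "transpose k ** p = mat 1" using pm(1) matrix_left_right_inverse by blast
 have uq: "x = p" if "x ** transpose k = mat 1" for x
  using that qp by (metis matrix_mul_assoc matrix_mul_lid matrix_mul_rid)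
 have "transpose p = transpose k" using pm(3) uq[OF pm(2)] qp by (metis matrix_mul_assoc matrix_mul_lid matrix_mul_rid)
 then have kp: "k = p" by (metis transpose_transpose)
 then show "!!p. p ** transpose k = mat 1 ==> p = k" using uq by blast
 have kk: "k ** transpose k = mat 1" "transpose k ** k = mat 1" using pm qp kp by auto
 have com: "S ** k = k ** S" if S: "S \<in> {mat 1, symat 1 0 (-1), symat 0 1 0}" "S ** S = mat 1" for S
 proof -
  obtain p m where p: "p ** S ** transpose k = S" "m ** S ** transpose k = S" "p ** S ** transpose m = S" using one[OF S(1)] by blast
  have a: "p ** S = S ** k" "m ** S = S ** k" using p(1,2) kk(2) by (metis matrix_mul_assoc matrix_mul_rid)+
  have "S ** (S ** k ** transpose m) = S ** S" using p(3) a(1) by simp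
  then have "k ** transpose m = mat 1" using S(2) by (metis matrix_mul_assoc matrix_mul_lid)
  then have "transpose m = transpose k" using kk(2) by (metis matrix_mul_assoc matrix_mul_lid matrix_mul_rid)
  then have "m = k" by (metis transpose_transpose)
  then show ?thesis using a(2) by simp
 qed
 have c: "symat 1 0 (-1) ** k = k ** symat 1 0 (-1)" "symat 0 1 0 ** k = k ** symat 0 1 0"
  by (rule com; simp add: mat2_eq_iff)+
 have "k$1$2 = - k$1$2" "- k$2$1 = k$2$1" using arg_cong[OF c(1), of "%A. A$1$2"] arg_cong[OF c(1), of "%A. A$2$1"] by (simp_all only: mat2_mult_nth) simp_all
 then have "k$1$2 = 0" "k$2$1 = 0" by algebra+
 moreover have "k$1$1 = k$2$2" using arg_cong[OF c(2), of "%A. A$1$2"] by (simp only: mat2_mult_nth) simp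
 moreover have "k$1$1 * k$1$1 + k$1$2 * k$1$2 = 1" using kk(1) unfolding mat2_eq_iff by simp
 ultimately show "\<exists>l. l * l = 1 & k = cscale l (mat 1)" by (intro exI[of _ "k$1$1"]) (simp add: mat2_eq_iff)
qed

definition cj :: "mat2 => mat2" where "cj A = map_matrix cnj A"

lemma cj_nth [simp]: "cj A $ i $ j = cnj (A $ i $ j)"
 by (simp add: cj_def map_matrix_def)

lemma cj_simps: "cj (A ** B) = cj A ** cj B" "cj (A + B) = cj A + cj B" "cj (A - B) = cj A - cj B"
 "cj (transpose A) = transpose (cj A)" "cj (cj A) = A"
 by (simp_all add: mat2_eq_iff)

lemma cj_realm: "realm X ==> cj X = X"
 by (simp add: realm_def mat2_eq_iff complex_eq_iff)

lemma transpose_Sym: "Z \<in> Sym ==> transpose Z = Z" by (simp add: Sym_def)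

lemma realm_scale: "realm X ==> realm (cscale (of_real c) X)"
 by (auto simp: realm_def Sym_iff)

text \<open>At real \<open>X\<close> the value is real, so conjugating \<open>n X\<close> and
  \<open>s X\<close> amounts to multiplying both from the left by one matrix \<open>k X\<close>. The
  polarised relation gives \<open>k X (X - Y) (k Y)^T = X - Y\<close>, and
  \<open>commuting_scalar\<close> forces \<open>k\<close> to be the same scalar, 1 or -1, at 0 and
  at \<open>X1\<close>; the fixed point \<open>ii\<close> excludes -1. Then \<open>K\<close> at
  \<open>W = cj Z\<close> is the claim.\<close>

lemma mobius_real:
 fixes N P R E :: mat2
 defines "n \<equiv> %Z. N + Z ** P" and "s \<equiv> %Z. R + Z ** E"
 assumes K: "!!Z W. Z \<in> Sym ==> W \<in> Sym ==> s Z ** transpose (n W) - n Z ** transpose (s W) = Z - W"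
  and r: "r > 0" and bd: "!!X. realm X ==> norm X < r ==> \<exists>T. realm T & n X ** T = s X"
  and ii: "n ii ** ii = s ii"
 shows "!!Z. Z \<in> Sym ==> s Z ** transpose (cj (n Z)) - n Z ** transpose (cj (s Z)) = Z - cj Z"
proof -
 let ?g = "%X. realm X & norm X < r"
 have "\<exists>T. \<forall>X. ?g X --> realm (T X) & n X ** T X = s X" using bd by metis
 then obtain T where T: "!!X. ?g X ==> realm (T X)" "!!X. ?g X ==> n X ** T X = s X" by metis
 have TS: "transpose (T X) = T X" if "?g X" for X using T(1)[OF that] realm_Sym transpose_Sym by blast
 have "\<exists>B. B ** n X = mat 1 & n X ** B = mat 1" if X: "?g X" for X
 proof -
  have S: "X \<in> Sym" "X + mat 1 \<in> Sym" using X realm_Sym by (auto simp: Sym_iff)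
  have "transpose (s X) = T X ** transpose (n X)" unfolding T(2)[OF X, symmetric] matrix_transpose_mul TS[OF X] ..
  then have "(s (X + mat 1) - n (X + mat 1) ** T X) ** transpose (n X) = mat 1"
   using K[OF S(2,1)] by (simp add: matrix_mul_assoc mat2_eq_iff algebra_simps)
  then have "transpose (n X) ** (s (X + mat 1) - n (X + mat 1) ** T X) = mat 1" using matrix_left_right_inverse by blast
  then have "transpose (transpose (n X) ** (s (X + mat 1) - n (X + mat 1) ** T X)) = transpose (mat 1)" by simp
  then have "transpose (s (X + mat 1) - n (X + mat 1) ** T X) ** n X = mat 1" by (simp add: matrix_transpose_mul transpose_mat)
  then show ?thesis using matrix_left_right_inverse by blast
 qed
 then have "\<exists>B. \<forall>X. ?g X --> B X ** n X = mat 1 & n X ** B X = mat 1" by metis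
 then obtain B where B: "!!X. ?g X ==> B X ** n X = mat 1" "!!X. ?g X ==> n X ** B X = mat 1" by metis
 define k where "k X = cj (n X) ** B X" for X
 have kn: "k X ** n X = cj (n X)" if "?g X" for X unfolding k_def using B(1)[OF that] by (metis matrix_mul_assoc matrix_mul_rid)
 have ks: "k X ** s X = cj (s X)" if X: "?g X" for X
  using kn[OF X] T[OF X] cj_realm by (metis matrix_mul_assoc cj_simps(1))
 have Kr: "n X ** (T X - T Y) ** transpose (n Y) = X - Y" if "?g X" "?g Y" for X Y
 proof -
  have "transpose (s Y) = T Y ** transpose (n Y)" unfolding T(2)[OF that(2), symmetric] matrix_transpose_mul TS[OF that(2)] ..
  moreover have "X \<in> Sym" "Y \<in> Sym" using that realm_Sym by auto
  ultimately have "n X ** T X ** transpose (n Y) - n X ** (T Y ** transpose (n Y)) = X - Y" using K[of X Y] T(2)[OF that(1)] by simp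
  moreover have "A ** (C - D) ** U = A ** C ** U - A ** (D ** U)" for A C D U :: mat2 by (simp add: mat2_eq_iff algebra_simps)
  ultimately show ?thesis by metis
 qed
 have kk: "k X ** (X - Y) ** transpose (k Y) = X - Y" if X: "?g X" and Y: "?g Y" for X Y
 proof -
  have "k X ** (X - Y) ** transpose (k Y) = (k X ** n X) ** (T X - T Y) ** transpose (k Y ** n Y)"
   unfolding Kr[OF X Y, symmetric] matrix_transpose_mul by (simp add: matrix_mul_assoc)
  also have "\<dots> = cj (n X ** (T X - T Y) ** transpose (n Y))"
   unfolding kn[OF X] kn[OF Y] cj_simps using T(1)[OF X] T(1)[OF Y] cj_realm by simp
  also have "\<dots> = X - Y" unfolding Kr[OF X Y] using X Y cj_realm by (simp add: cj_simps)
  finally show ?thesis .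
 qed
 \<comment> \<open>The three test matrices have norm below 4, so their multiples by \<open>c\<close>
   and \<open>-c\<close> lie where real values are known.\<close>
 define c where "c = r / 4"
 have c: "c > 0" using r by (simp add: c_def)
 have g0: "?g 0" using r by (simp add: realm_def Sym_iff)
 have gS: "?g (cscale (of_real c) S)" "?g (cscale (of_real (-c)) S)" if "realm S" "norm S < 4" for S
 proof -
  have "c * norm S < c * 4" using that c by (intro mult_strict_left_mono) auto
  then have n: "c * norm S < r" by (simp add: c_def)
  show "?g (cscale (of_real c) S)" "?g (cscale (of_real (-c)) S)"
   by (intro conjI realm_scale that; use n c in \<open>simp add: norm_cscale\<close>)+
 qed
 have rS: "realm S" "norm S < 4" if "S \<in> {mat 1, symat 1 0 (-1), symat 0 1 0}" for S
  using that by (auto simp: realm_def Sym_iff forall_2 norm_mat2 intro!: real_sqrt_less_iff[THEN iffD2, of _ 16, simplified])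
 have can: "p ** S ** q = S" if "d ~= 0" "p ** cscale d S ** q = cscale d S" for p q S :: mat2 and d
 proof -
  have "p ** cscale d S ** q = cscale d (p ** S ** q)" by (simp add: mat2_eq_iff algebra_simps)
  then show ?thesis using that by (simp add: mat2_eq_iff)
 qed
 have cc: "complex_of_real c ~= 0" "complex_of_real (- c) ~= 0" "complex_of_real (2 * c) ~= 0" using c by auto
 have hyp: "\<exists>p m. p ** S ** transpose (k 0) = S & m ** S ** transpose (k 0) = S & p ** S ** transpose m = S"
  and hyp1: "k (cscale (of_real c) S) ** S ** transpose (k 0) = S"
  if S: "S \<in> {mat 1, symat 1 0 (-1), symat 0 1 0}" for S
 proof -
  note g = gS[OF rS[OF S]]
  have 1: "k (cscale (of_real c) S) ** S ** transpose (k 0) = S"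
   by (rule can[OF cc(1)]) (use kk[OF g(1) g0] in simp)
  have 2: "k (cscale (of_real (-c)) S) ** S ** transpose (k 0) = S"
   by (rule can[OF cc(2)]) (use kk[OF g(2) g0] in simp)
  have e: "cscale (of_real c) S - cscale (of_real (-c)) S = cscale (of_real (2 * c)) S" by (simp add: mat2_eq_iff)
  have 3: "k (cscale (of_real c) S) ** S ** transpose (k (cscale (of_real (-c)) S)) = S"
   by (rule can[OF cc(3)]) (use kk[OF g] in \<open>simp only: e\<close>)
  show "k (cscale (of_real c) S) ** S ** transpose (k 0) = S" by (rule 1)
  show "\<exists>p m. p ** S ** transpose (k 0) = S & m ** S ** transpose (k 0) = S & p ** S ** transpose m = S" using 1 2 3 by blast
 qed
 define X1 where "X1 = cscale (of_real c) (mat 1)"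
 obtain l where l: "l * l = 1" "k 0 = cscale l (mat 1)" using commuting_scalar(1)[OF hyp] by blast
 have k1: "k X1 = k 0" unfolding X1_def by (rule commuting_scalar(2)[OF hyp]) (use hyp1[of "mat 1"] in simp_all)
 have g1: "?g X1" using gS rS[of "mat 1"] by (simp add: X1_def)
 have lm: "cscale l (mat 1) ** A = cscale l A" for A :: mat2 by (simp add: mat2_eq_iff)
 have cX: "cj X1 = X1" using g1 cj_realm by blast
 have nl0: "cj N = cscale l N" "cj R = cscale l R" using kn[OF g0] ks[OF g0] unfolding l lm by (simp_all add: n_def s_def)
 \<comment> \<open>The values at 0 and at the invertible matrix \<open>X1\<close> determine both
   coefficients of such an affine expression.\<close>
 have aff: "cj A' = cscale l A'" if "cj (A + X1 ** A') = cscale l (A + X1 ** A')" "cj A = cscale l A" for A A' :: mat2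
 proof -
  have "X1 ** cj A' = X1 ** cscale l A'" using that unfolding cj_simps cX by (simp add: mat2_eq_iff algebra_simps)
  then show ?thesis using c unfolding X1_def by (simp add: mat2_eq_iff)
 qed
 have nl1: "cj P = cscale l P" "cj E = cscale l E"
  using aff[OF _ nl0(1), of P] aff[OF _ nl0(2), of E] kn[OF g1] ks[OF g1] unfolding k1 l(2) lm by (simp_all add: n_def s_def)
 have cn: "cj (n Z) = cscale l (n (cj Z))" "cj (s Z) = cscale l (s (cj Z))" for Z
  unfolding n_def s_def cj_simps nl0 nl1 by (simp_all add: mat2_eq_iff algebra_simps)
 have main: "cscale l (s Z ** transpose (cj (n Z)) - n Z ** transpose (cj (s Z))) = Z - cj Z" if "Z \<in> Sym" for Z
 proof -
  have "cj Z \<in> Sym" using that by (auto simp: Sym_iff)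
  then have "s Z ** transpose (n (cj Z)) - n Z ** transpose (s (cj Z)) = Z - cj Z" using K that by blast
  moreover have "cscale l (A ** transpose (cscale l B) - C ** transpose (cscale l D)) = A ** transpose B - C ** transpose D" for A B C D :: mat2
  proof -
   have "cscale l (A ** transpose (cscale l B) - C ** transpose (cscale l D)) = cscale (l * l) (A ** transpose B - C ** transpose D)"
    by (simp add: mat2_eq_iff algebra_simps)
   then show ?thesis unfolding l(1) by (simp add: mat2_eq_iff)
  qed
  ultimately show ?thesis unfolding cn by metis
 qed
 \<comment> \<open>At \<open>ii\<close> the relation says that \<open>l\<close> times a sum of
   squares equals 1.\<close>
 have "l = 1"
 proof -
  define A where "A = n ii"
  have iS: "ii \<in> Sym" using ii_siegel siegel_Sym by blast
  have sA: "s ii = cscale \<i> A" unfolding ii[symmetric] A_def[symmetric] by (simp add: mat2_eq_iff)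
  have "(cscale l (cscale \<i> A ** transpose (cj A) - A ** transpose (cj (cscale \<i> A)))) $ 1 $ 1 = (ii - cj ii) $ 1 $ 1"
   using main[OF iS] unfolding sA A_def[symmetric] by (rule arg_cong)
  then have "2 * \<i> * (l * (A$1$1 * cnj (A$1$1) + A$1$2 * cnj (A$1$2))) = 2 * \<i>" by (simp add: algebra_simps)
  then have "l * of_real ((cmod (A$1$1))\<^sup>2 + (cmod (A$1$2))\<^sup>2) = 1" unfolding of_real_add complex_norm_square by simp
  moreover have "l = 1 \<or> l = -1" using l(1) by (metis square_eq_1_iff)
  moreover have "- of_real ((cmod (A$1$1))\<^sup>2 + (cmod (A$1$2))\<^sup>2) ~= (1::complex)"
  proof
   assume "- of_real ((cmod (A$1$1))\<^sup>2 + (cmod (A$1$2))\<^sup>2) = (1::complex)"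
   then have "- ((cmod (A$1$1))\<^sup>2 + (cmod (A$1$2))\<^sup>2) = 1" by (metis of_real_eq_1_iff of_real_minus)
   then show False using zero_le_power2[of "cmod (A$1$1)"] zero_le_power2[of "cmod (A$1$2)"] by linarith
  qed
  ultimately show "l = 1" by auto
 qed
 then show "!!Z. Z \<in> Sym ==> s Z ** transpose (cj (n Z)) - n Z ** transpose (cj (s Z)) = Z - cj Z"
  using main by (simp add: mat2_eq_iff)
qed

lemma hin_adjoint: "hin x (A *v y) = hin (transpose (cj A) *v x) y"
 unfolding hin_def mat2_vec_nth transpose_nth cj_nth by (simp add: algebra_simps)

lemma hin_minus_cj: "Z \<in> Sym ==> hin x ((Z - cj Z) *v x) = 2 * \<i> * of_real (Im (hin x (Z *v x)))"
proof -
 assume Z: "Z \<in> Sym"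
 have "hin x (cj Z *v x) = cnj (hin x (Z *v x))"
  using Z by (simp add: hin_def mat2_vec_nth Sym_iff algebra_simps)
 then show ?thesis by (simp add: mat2_vec_lin hin_add complex_eq_iff)
qed

text \<open>With \<open>n^*\<close> the adjoint of \<open>n Z\<close> and \<open>n^* y = x\<close>,
  the relation \<open>H\<close> identifies \<open>Im (hin x (\<Phi> Z *v x))\<close> with
  \<open>Im (hin y (Z *v y))\<close>. Applied to a kernel vector of \<open>n^*\<close> it shows that
  \<open>n Z\<close> is invertible. The relation \<open>K\<close> makes the quotient
  symmetric.\<close>

lemma mobius_siegel:
 fixes N P R E :: mat2
 defines "n \<equiv> %Z. N + Z ** P" and "s \<equiv> %Z. R + Z ** E"
 assumes K: "!!Z. Z \<in> Sym ==> s Z ** transpose (n Z) - n Z ** transpose (s Z) = 0"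
  and H: "!!Z. Z \<in> Sym ==> s Z ** transpose (cj (n Z)) - n Z ** transpose (cj (s Z)) = Z - cj Z"
 obtains \<Phi> where "hol \<Phi> siegel" "\<Phi> ` siegel \<subseteq> siegel"
  "!!Z W. Z \<in> siegel ==> n Z ** W = s Z ==> \<Phi> Z = W"
proof -
 have dn: "dt (n Z) ~= 0" if Z: "Z \<in> siegel" for Z
 proof
  assume "dt (n Z) = 0"
  then have "cnj (dt (n Z)) = 0" by (simp only: complex_cnj_zero)
  then have "dt (transpose (cj (n Z))) = 0" by (simp add: mult.commute)
  then obtain v where v: "v ~= 0" "transpose (cj (n Z)) *v v = 0" by (rule dt_zero_kernel)
  have Zs: "Z \<in> Sym" using Z siegel_Sym by blast
  have "hin v ((Z - cj Z) *v v) = hin v (s Z *v (transpose (cj (n Z)) *v v)) - hin v (n Z *v (transpose (cj (s Z)) *v v))"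
   unfolding H[OF Zs, symmetric] mat2_vec_lin(6) hin_add by (simp add: matrix_vector_mul_assoc)
  also have "\<dots> = 0" unfolding hin_adjoint[of v "n Z"] v(2) by (simp add: hin_def)
  finally show False using hin_minus_cj[OF Zs, of v] siegel_pos[OF Z v(1)] by simp
 qed
 define ad where "ad A = (\<chi> i j. if i = (1::2) then (if j = (1::2) then A$2$2 else - A$1$2) else (if j = 1 then - A$2$1 else A$1$1))" for A :: mat2
 have ad: "ad A $1$1 = A$2$2" "ad A $1$2 = - A$1$2" "ad A $2$1 = - A$2$1" "ad A $2$2 = A$1$1" for A by (auto simp: ad_def)
 define iv where "iv A = cscale (1 / dt A) (ad A)" for A
 have iv: "iv A ** A = mat 1" "A ** iv A = mat 1" if "dt A ~= 0" for A
  using that by (simp_all add: mat2_eq_iff iv_def ad divide_simps)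
 define \<Phi> where "\<Phi> Z = iv (n Z) ** s Z" for Z
 have n\<Phi>: "n Z ** \<Phi> Z = s Z" if "Z \<in> siegel" for Z
  using iv(2)[OF dn[OF that]] by (metis \<Phi>_def matrix_mul_assoc matrix_mul_lid)
 have \<Phi>S: "\<Phi> Z \<in> Sym" if Z: "Z \<in> siegel" for Z
 proof -
  let ?T = "transpose (n Z)" and ?I = "iv (n Z)"
  have Zs: "Z \<in> Sym" using Z siegel_Sym by blast
  have "s Z ** ?T = n Z ** transpose (s Z)" using K[OF Zs] by simp
  then have "?I ** (s Z ** ?T) = ?I ** (n Z ** transpose (s Z))" by simp
  then have 1: "\<Phi> Z ** ?T = transpose (s Z)" using iv(1)[OF dn[OF Z]] by (metis \<Phi>_def matrix_mul_assoc matrix_mul_lid)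
  have "transpose (\<Phi> Z ** ?T) = s Z" unfolding 1 by simp
  then have "n Z ** transpose (\<Phi> Z) = s Z" by (simp add: matrix_transpose_mul)
  then have "transpose (\<Phi> Z) = \<Phi> Z" using iv(1)[OF dn[OF Z]] by (metis \<Phi>_def matrix_mul_assoc matrix_mul_lid)
  then show ?thesis by (simp add: Sym_def)
 qed
 have "\<Phi> Z \<in> siegel" if Z: "Z \<in> siegel" for Z
  unfolding siegel_def
 proof (intro CollectI conjI allI impI \<Phi>S[OF Z])
  fix x :: "complex^2" assume x: "x ~= 0"
  have Zs: "Z \<in> Sym" using Z siegel_Sym by blast
  let ?A = "transpose (cj (n Z))"
  have "dt ?A = cnj (dt (n Z))" by (simp add: mult.commute)
  then have dA: "dt ?A ~= 0" using dn[OF Z] by (metis complex_cnj_zero_iff)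
  define y where "y = iv ?A *v x"
  have y: "?A *v y = x" using iv(2)[OF dA] by (simp add: y_def matrix_vector_mul_assoc)
  have y0: "y ~= 0" using x y by auto
  have "hin y ((Z - cj Z) *v y) = hin y (s Z *v (?A *v y)) - hin y (n Z *v (transpose (cj (s Z)) *v y))"
   unfolding H[OF Zs, symmetric] mat2_vec_lin(6) hin_add by (simp add: matrix_vector_mul_assoc)
  also have "hin y (s Z *v (?A *v y)) = hin x (\<Phi> Z *v x)"
   unfolding n\<Phi>[OF Z, symmetric] y matrix_vector_mul_assoc[symmetric] hin_adjoint[of y "n Z"] y ..
  also have "hin y (n Z *v (transpose (cj (s Z)) *v y)) = hin x (cj (\<Phi> Z) *v x)"
   unfolding hin_adjoint[of y "n Z"] y n\<Phi>[OF Z, symmetric] cj_simps matrix_transpose_mul matrix_vector_mul_assoc[symmetric] y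
   using \<Phi>S[OF Z] by (simp add: transpose_Sym cj_simps flip: cj_simps(4))
  also have "hin x (\<Phi> Z *v x) - hin x (cj (\<Phi> Z) *v x) = 2 * \<i> * of_real (Im (hin x (\<Phi> Z *v x)))"
   using hin_minus_cj[OF \<Phi>S[OF Z], of x] by (simp add: mat2_vec_lin hin_add)
  finally have "Im (hin x (\<Phi> Z *v x)) = Im (hin y (Z *v y))" unfolding hin_minus_cj[OF Zs] by simp
  then show "0 < Im (hin x (\<Phi> Z *v x))" using siegel_pos[OF Z y0] by simp
 qed
 moreover have "hol \<Phi> siegel"
 proof -
  have sn: "shol (%Z. n Z $ i $ j) siegel" "shol (%Z. s Z $ i $ j) siegel" for i j
   unfolding n_def s_def vector_add_component mat2_mult_nth by (intro shol_intros open_Sym_siegel)+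
  have "shol (%Z. ad (n Z) $ i $ j) siegel" for i j
   using exhaust_2[of i] exhaust_2[of j] by (auto simp: ad intro!: sn shol_intros)
  then have "shol (%Z. \<Phi> Z $ i $ j) siegel" for i j
   unfolding \<Phi>_def mat2_mult_nth iv_def cscale_nth by (intro shol_intros sn open_Sym_siegel) (use dn in auto)
  then show ?thesis using \<Phi>S open_Sym_siegel by (simp add: hol_def)
 qed
 moreover have "\<Phi> Z = W" if "Z \<in> siegel" "n Z ** W = s Z" for Z W
  using iv(1)[OF dn[OF that(1)]] that(2) by (metis \<Phi>_def matrix_mul_assoc matrix_mul_lid)
 ultimately show thesis using that by blast
qed

section \<open>Extension of local maps to the whole half space\<close>

definition ext :: "(mat2 => mat2) => real => bool"
 where "ext F R \<longleftrightarrow> (\<exists>\<Phi>. hol \<Phi> siegel & \<Phi> ` siegel \<subseteq> siegel & (\<forall>Z\<in>HB R. \<Phi> Z = F Z))"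

lemma realmI:
 assumes Z: "Z \<in> Sym" and h: "!!x. Im (hin x (Z *v x)) = 0"
 shows "realm Z"
proof -
 have "Im (Z$1$1) = 0" "Im (Z$2$2) = 0" "Im (Z$1$1) + Im (Z$2$2) + 2 * Im (Z$1$2) = 0"
  using h[of "cvec 1 0"] h[of "cvec 0 1"] h[of "cvec 1 1"] unfolding Im_hin[OF Z] by simp_all
 then show ?thesis using Z by (simp add: realm_def Sym_iff forall_2)
qed

text \<open>A bounded family has a limit point \<open>T\<close> as the height tends to 0. The
  equation passes to the limit, and the imaginary part of the form of \<open>T\<close> is squeezed
  between 0 and every positive number.\<close>

lemma boundary_limit:
 fixes f g :: "real => mat2" and n s :: "mat2 => mat2"
 assumes f: "!!y. 0 < y ==> y <= 1 ==> f y \<in> siegel & norm (f y) <= K"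
  and g: "(g \<longlongrightarrow> X) (at_right 0)" and n: "continuous_on UNIV n" "continuous_on UNIV s"
  and eq: "!!y. 0 < y ==> y <= 1 ==> n (g y) ** f y = s (g y)"
  and z: "!!\<epsilon>. \<epsilon> > 0 ==> \<exists>y0>0. \<forall>y x. 0 < y --> y <= y0 --> Im (hin x (f y *v x)) <= \<epsilon> * (norm x)\<^sup>2"
 shows "\<exists>T. realm T & n X ** T = s X"
proof -
 define y where "y m = 1 / (real m + 1)" for m
 have y: "0 < y m" "y m <= 1" for m by (auto simp: y_def)
 have y0: "y \<longlonglongrightarrow> 0" unfolding y_def[abs_def] by real_asymp
 have h: "\<forall>m. f (y m) \<in> cball 0 K" using f y by simp
 have sc: "seq_compact (cball (0::mat2) K)" by (simp add: compact_imp_seq_compact)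
 obtain T \<sigma> where T: "T \<in> cball 0 K" "strict_mono \<sigma>" "((%m. f (y m)) \<circ> \<sigma>) \<longlonglongrightarrow> T"
  by (rule seq_compactE[OF sc h])
 have lim: "(%m. f (y (\<sigma> m))) \<longlonglongrightarrow> T" using T(3) by (simp add: o_def)
 have ys: "(%m. y (\<sigma> m)) \<longlonglongrightarrow> 0" using LIMSEQ_subseq_LIMSEQ[OF y0 T(2)] by (simp add: o_def)
 have "filterlim (%m. y (\<sigma> m)) (at_right 0) sequentially"
  unfolding filterlim_at using ys y(1) less_imp_neq[OF y(1)] by (auto intro!: always_eventually)
 then have gl: "(%m. g (y (\<sigma> m))) \<longlonglongrightarrow> X" using g by (rule filterlim_compose[rotated])
 have cl: "(%m. h (g (y (\<sigma> m)))) \<longlonglongrightarrow> h X" if "continuous_on UNIV h" for h :: "mat2 => mat2"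
 proof -
  have "isCont h X" using that by (simp add: continuous_on_eq_continuous_at)
  then show ?thesis using gl by (rule isCont_tendsto_compose)
 qed
 have "(%m. (n (g (y (\<sigma> m))) ** f (y (\<sigma> m)))) \<longlonglongrightarrow> n X ** T"
  by (rule tendsto_mat2I) (unfold mat2_mult_nth, intro tendsto_intros tendsto_nth2 cl[OF n(1)] lim)
 moreover have "(%m. (n (g (y (\<sigma> m))) ** f (y (\<sigma> m)))) \<longlonglongrightarrow> s X"
  using cl[OF n(2)] eq y by simp
 ultimately have nT: "n X ** T = s X" by (rule LIMSEQ_unique)
 have fS: "f (y (\<sigma> m)) \<in> Sym" for m using f[of "y (\<sigma> m)"] y siegel_Sym by simp
 have TS: "T \<in> Sym" by (rule closed_sequentially[OF closed_Sym fS lim])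
 have "realm T"
 proof (rule realmI[OF TS])
  fix x :: "complex^2"
  have hl: "(%m. Im (hin x (f (y (\<sigma> m)) *v x))) \<longlonglongrightarrow> Im (hin x (T *v x))"
   unfolding hin_def mat2_vec_nth by (intro tendsto_intros tendsto_nth2 lim)
  have "0 <= Im (hin x (T *v x))"
  proof (rule LIMSEQ_le_const[OF hl], intro exI allI impI)
   fix m show "0 <= Im (hin x (f (y (\<sigma> m)) *v x))"
    using siegel_pos[of "f (y (\<sigma> m))" x] f y by (cases "x = 0") (auto simp: hin_def less_imp_le)
  qed
  moreover have "Im (hin x (T *v x)) <= 0 + e" if "e > 0" for e
  proof -
   define \<epsilon> where "\<epsilon> = e / ((norm x)\<^sup>2 + 1)"
   have p: "(norm x)\<^sup>2 + 1 > 0" by (simp add: add_nonneg_pos)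
   have "\<epsilon> > 0" using that p by (simp add: \<epsilon>_def)
   from z[OF this] obtain b where b: "b > 0" "!!y x. 0 < y ==> y <= b ==> Im (hin x (f y *v x)) <= \<epsilon> * (norm x)\<^sup>2" by blast
   have "\<epsilon> * (norm x)\<^sup>2 <= \<epsilon> * ((norm x)\<^sup>2 + 1)" using \<open>\<epsilon> > 0\<close> by (intro mult_left_mono) auto
   also have "\<dots> = e" using p by (simp add: \<epsilon>_def)
   finally have le: "\<epsilon> * (norm x)\<^sup>2 <= e" .
   have "\<forall>\<^sub>F m in sequentially. y (\<sigma> m) < b" using ys b(1) by (rule order_tendstoD)
   then obtain m0 where m0: "!!m. m >= m0 ==> y (\<sigma> m) < b" unfolding eventually_sequentially by blast
   show ?thesis
   proof (rule LIMSEQ_le_const2[OF hl], rule exI[of _ m0], intro allI impI)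
    fix m assume "m0 <= m"
    then have "y (\<sigma> m) <= b" using m0 by (simp add: less_imp_le)
    then show "Im (hin x (f (y (\<sigma> m)) *v x)) <= 0 + e" using b(2)[of "y (\<sigma> m)" x] y le by (meson add_increasing order_refl order_trans)
   qed
  qed
  then have "Im (hin x (T *v x)) <= 0" using field_le_epsilon by blast
  ultimately show "Im (hin x (T *v x)) = 0" by simp
 qed
 then show ?thesis using nT by blast
qed

text \<open>Liouville's theorem applies near \<open>ii\<close>, where the derivative is injective
  because the inverse map is differentiable at the image. The identity theorem carries the resulting
  equation to the whole half ball, and vertical limits over small real \<open>X\<close> supply the
  real values required by \<open>mobius_real\<close>.\<close>

lemma ext_pre_state:
 obtains R1 where "R1 > 2" "!!F G R. pair F G R ==> R1 <= R ==> pre_state F ==> ext F R"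
proof -
 obtain R1 where R1: "R1 > 2" "!!F G R. pair F G R ==> R1 <= R ==> pre_state F ==>
  \<exists>r>0. \<forall>Z\<in>Sym. norm (Z - ii) < r --> Z \<in> HB R & (\<forall>u. dt (dF F (nl u) Z) = 0) &
   (\<forall>y. 0 < y --> y <= 1 --> rem Z + cscale (\<i> * of_real y) (imm Z) \<in> HB R) &
   (\<exists>K. \<forall>y. 0 < y --> y <= 1 --> norm (F (rem Z + cscale (\<i> * of_real y) (imm Z))) <= K) &
   (\<forall>\<epsilon>>0. \<exists>y0>0. \<forall>y x. 0 < y --> y <= y0 --> Im (hin x (F (rem Z + cscale (\<i> * of_real y) (imm Z)) *v x)) <= \<epsilon> * (norm x)\<^sup>2)"
  using conformal_near by blast
 show thesis
 proof (rule that[OF R1(1)])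
  fix F G R assume P: "pair F G R" and R: "R1 <= R" and st: "pre_state F"
  have FP: "hol F (HB R)" "!!V. V \<in> HB R ==> F V \<in> siegel" "F ii = ii" "R > 2" "prepair F G R" "hol G (HB R)"
   using P by (auto simp: pair_def prepair_def)
  have iB: "ii \<in> HB R" using FP(4) by (rule ii_HB)
  have iS: "ii \<in> Sym" using iB HB_Sym by blast
  obtain r where r0: "r > 0 & (\<forall>Z\<in>Sym. norm (Z - ii) < r --> Z \<in> HB R & (\<forall>u. dt (dF F (nl u) Z) = 0) &
   (\<forall>y. 0 < y --> y <= 1 --> rem Z + cscale (\<i> * of_real y) (imm Z) \<in> HB R) &
   (\<exists>K. \<forall>y. 0 < y --> y <= 1 --> norm (F (rem Z + cscale (\<i> * of_real y) (imm Z))) <= K) &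
   (\<forall>\<epsilon>>0. \<exists>y0>0. \<forall>y x. 0 < y --> y <= y0 --> Im (hin x (F (rem Z + cscale (\<i> * of_real y) (imm Z)) *v x)) <= \<epsilon> * (norm x)\<^sup>2))"
   using R1(2)[OF P R st] by (rule exE)
  note r = conjunct1[OF r0]
  have c: "Z \<in> HB R" "dt (dF F (nl u) Z) = 0" "0 < y ==> y <= 1 ==> rem Z + cscale (\<i> * of_real y) (imm Z) \<in> HB R"
   "\<exists>K. \<forall>y. 0 < y --> y <= 1 --> norm (F (rem Z + cscale (\<i> * of_real y) (imm Z))) <= K"
   "\<epsilon> > 0 ==> \<exists>y0>0. \<forall>y x. 0 < y --> y <= y0 --> Im (hin x (F (rem Z + cscale (\<i> * of_real y) (imm Z)) *v x)) <= \<epsilon> * (norm x)\<^sup>2"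
   if Z: "Z \<in> Sym" "norm (Z - ii) < r" for Z u y \<epsilon>
  proof -
   note 1 = mp[OF bspec[OF conjunct2[OF r0] Z(1)] Z(2)]
   note 2 = conjunct2[OF 1] note 3 = conjunct2[OF 2] note 4 = conjunct2[OF 3]
   show "Z \<in> HB R" by (rule conjunct1[OF 1])
   show "dt (dF F (nl u) Z) = 0" by (rule spec[OF conjunct1[OF 2]])
   show "rem Z + cscale (\<i> * of_real y) (imm Z) \<in> HB R" if "0 < y" "y <= 1" using conjunct1[OF 3] that by blast
   show "\<exists>K. \<forall>y. 0 < y --> y <= 1 --> norm (F (rem Z + cscale (\<i> * of_real y) (imm Z))) <= K" by (rule conjunct1[OF 4])
   show "\<exists>y0>0. \<forall>y x. 0 < y --> y <= y0 --> Im (hin x (F (rem Z + cscale (\<i> * of_real y) (imm Z)) *v x)) <= \<epsilon> * (norm x)\<^sup>2" if "\<epsilon> > 0"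
    by (rule mp[OF spec[OF conjunct2[OF 4], of \<epsilon>] that])
  qed
  define S0 where "S0 = HB R \<inter> F -` HB R"
  have "openin (top_of_set (HB R)) S0" unfolding S0_def
   by (rule continuous_openin_preimage[OF hol_continuous[OF FP(1)] _ open_Sym_HB])
    (use hol_in_Sym[OF FP(1)] in auto)
  then have "open_Sym S0" using open_Sym_HB openin_trans by blast
  moreover have "ii \<in> S0" using iB FP(3) by (simp add: S0_def)
  ultimately obtain r' where r': "r' > 0" "!!W. W \<in> Sym ==> norm (W - ii) < r' ==> W \<in> S0"
   using open_SymD by metis
  define \<rho> where "\<rho> = min r r'"
  have \<rho>: "\<rho> > 0" using r r' by (simp add: \<rho>_def)
  define S where "S = {W \<in> Sym. norm (W - ii) < \<rho>}"
  have So: "open_Sym S" unfolding S_def by (rule open_Sym_ball)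
  have SH: "S \<subseteq> HB R" using c(1) by (auto simp: S_def \<rho>_def)
  have FS: "hol F S" by (rule hol_subset[OF FP(1) SH So])
  have lf: "liouville_form F ii"
  proof (rule liouville[OF FS S_def iS \<rho>])
   show "dt (dF F (nl u) Z) = 0" if "Z \<in> S" for Z u using c(2)[of Z u] that by (simp add: S_def \<rho>_def)
   show "X = 0" if Z: "Z \<in> S" and X: "X \<in> Sym" and z: "dF F X Z = 0" for Z X
   proof -
    have b: "Z \<in> HB R" "F Z \<in> HB R" using Z r'(2)[of Z] by (auto simp: S_def \<rho>_def S0_def)
    have "dF G (dF F X Z) (F Z) = X" by (rule prepair_inverse[OF FP(5) b X])
    moreover have "dF G 0 (F Z) = 0" by (simp add: mat2_eq_iff ddir_def cscale_def map_matrix_def zero_vec_def[symmetric])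
    ultimately show ?thesis using z by simp
   qed
  qed
  then obtain N P' R' E t where t: "t > 0" and nf: "!!Z. Z \<in> Sym ==> norm (Z - ii) < t ==> (N + Z ** P') ** F Z = R' + Z ** E"
   and K: "!!Z W. Z \<in> Sym ==> W \<in> Sym ==> (R' + Z ** E) ** transpose (N + W ** P') - (N + Z ** P') ** transpose (R' + W ** E) = Z - W"
   unfolding liouville_form_def by blast
  have nH: "(N + Z ** P') ** F Z = R' + Z ** E" if Z: "Z \<in> HB R" for Z
  proof -
   have "((N + Z ** P') ** F Z) $ i $ j - (R' + Z ** E) $ i $ j = 0" for i j
   proof (rule gholo_zero_convex[OF _ convex_HB[of R] _ _ _ _ Z, of "%Z. ((N + Z ** P') ** F Z) $ i $ j - (R' + Z ** E) $ i $ j" "{W \<in> Sym. norm (W - ii) < min t \<rho>}"])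
    show "gholo (%Z. ((N + Z ** P') ** F Z) $ i $ j - (R' + Z ** E) $ i $ j) (HB R)"
     unfolding mat2_mult_nth vector_add_component
     by (intro gholo_add gholo_mult gholo_const gholo_diff gholo_nth hol_gholo[OF FP(1)] open_Sym_HB)
    show "open_Sym {W \<in> Sym. norm (W - ii) < min t \<rho>}" by (rule open_Sym_ball)
    show "{W \<in> Sym. norm (W - ii) < min t \<rho>} \<subseteq> HB R" using SH by (auto simp: S_def)
    have "ii \<in> {W \<in> Sym. norm (W - ii) < min t \<rho>}" using iS t \<rho> by simp
    then show "{W \<in> Sym. norm (W - ii) < min t \<rho>} ~= {}" by blast
    show "((N + Z ** P') ** F Z) $ i $ j - (R' + Z ** E) $ i $ j = 0" if "Z \<in> {W \<in> Sym. norm (W - ii) < min t \<rho>}" for Z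
     using nf[of Z] that by simp
   qed
   then show ?thesis by (simp only: mat2_eq_iff right_minus_eq)
  qed
  have bd: "\<exists>T. realm T & (N + X ** P') ** T = R' + X ** E" if X: "realm X" "norm X < r" for X
  proof -
   define Z where "Z = X + ii"
   have Zs: "Z \<in> Sym" "norm (Z - ii) < r" using X realm_Sym iS by (auto simp: Z_def)
   have rZ: "rem Z = X" "imm Z = mat 1" using X(1) by (auto simp: Z_def rem_def imm_def mat2_eq_iff realm_def Sym_iff complex_eq_iff)
   define g where "g y = X + cscale (\<i> * of_real y) (mat 1)" for y
   obtain K where K: "!!y. 0 < y ==> y <= 1 ==> norm (F (g y)) <= K"
    using c(4)[OF Zs] unfolding rZ g_def by blast
   have gH: "g y \<in> HB R" if "0 < y" "y <= 1" for y using c(3)[OF Zs that] unfolding rZ g_def .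
   show ?thesis
   proof (rule boundary_limit[where f = "%y. F (g y)" and g = g and K = K and X = X and n = "%X. N + X ** P'" and s = "%X. R' + X ** E"])
    show "F (g y) \<in> siegel & norm (F (g y)) <= K" if "0 < y" "y <= 1" for y using FP(2) gH K that by blast
    have "((%y. X + cscale (\<i> * of_real y) (mat 1)) \<longlongrightarrow> X + cscale (\<i> * of_real 0) (mat 1)) (at_right 0)"
     by (rule tendsto_mat2I) (simp only: vector_add_component cscale_nth, intro tendsto_intros)
    then show "(g \<longlongrightarrow> X) (at_right 0)" by (simp add: g_def[abs_def] mat2_eq_iff cscale_def map_matrix_def zero_vec_def[symmetric])
    show "continuous_on UNIV (%X. N + X ** P')" "continuous_on UNIV (%X. R' + X ** E)"
     by (rule continuous_on_mat2I; simp only: vector_add_component mat2_mult_nth; intro continuous_intros)+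
    show "(N + g y ** P') ** F (g y) = R' + g y ** E" if "0 < y" "y <= 1" for y using nH gH that by blast
    show "\<exists>y0>0. \<forall>y x. 0 < y --> y <= y0 --> Im (hin x (F (g y) *v x)) <= \<epsilon> * (norm x)\<^sup>2" if "\<epsilon> > 0" for \<epsilon>
     using c(5)[OF Zs that] unfolding rZ g_def .
   qed
  qed
  have K0: "(R' + Z ** E) ** transpose (N + Z ** P') - (N + Z ** P') ** transpose (R' + Z ** E) = 0" if "Z \<in> Sym" for Z
   using K[OF that that] by simp
  have iie: "(N + ii ** P') ** ii = R' + ii ** E" using nH[OF iB] FP(3) by simp
  obtain \<Phi> where \<Phi>: "hol \<Phi> siegel" "\<Phi> ` siegel \<subseteq> siegel"
   "!!Z W. Z \<in> siegel ==> (N + Z ** P') ** W = R' + Z ** E ==> \<Phi> Z = W"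
   using mobius_siegel[OF K0 mobius_real[OF K r bd iie]] by blast
  show "ext F R" unfolding ext_def using \<Phi> nH HB_siegel by blast
 qed
qed

text \<open>Undoing the affine changes gives a self-map of the half space that agrees with
  \<open>F\<close> on the open image of \<open>HB R\<close>, hence on the convex set
  \<open>HB r\<close>.\<close>

lemma reduces_ext:
 assumes F: "hol F (HB r)" and red: "reduces F r F' G' R" and ext: "ext F' R"
 shows "ext F r"
proof -
 obtain a b c a' b' c' X X' where p: "a > 0" "c > 0" "a' > 0" "c' > 0" "realm X" "realm X'"
  and eq: "!!V. V \<in> HB R ==> tri a b c V + X \<in> HB r & F (tri a b c V + X) = tri a' b' c' (F' V) + X'"
  and P: "pair F' G' R" using red unfolding reduces_def by blast
 obtain \<Phi> where \<Phi>: "hol \<Phi> siegel" "\<Phi> ` siegel \<subseteq> siegel" "!!Z. Z \<in> HB R ==> \<Phi> Z = F' Z" using ext unfolding ext_def by blast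
 define T where "T Z = tri (1/a) (- (b / (a * c))) (1/c) (Z - X)" for Z
 define \<Psi> where "\<Psi> Z = tri a' b' c' (\<Phi> (T Z)) + X'" for Z
 have XS: "X \<in> Sym" "X' \<in> Sym" using p realm_Sym by auto
 have Ts: "T Z \<in> siegel" if "Z \<in> siegel" for Z
  unfolding T_def by (rule tri_siegel(2)[OF that]) (use p in auto)
 have hT: "hol T siegel" unfolding T_def[abs_def] by (rule hol_tri(2)[OF open_Sym_siegel XS(1)])
 have h: "hol \<Psi> siegel" unfolding \<Psi>_def[abs_def]
  by (rule hol_comp[OF hol_comp[OF hT \<Phi>(1) Ts] hol_tri(1)[OF open_Sym_siegel XS(2)]]) (use Ts \<Phi>(2) in auto)
 have s: "\<Psi> Z \<in> siegel" if "Z \<in> siegel" for Z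
  unfolding \<Psi>_def by (rule tri_siegel(1)) (use Ts[OF that] \<Phi>(2) p in auto)
 have iR: "ii \<in> HB R" using P ii_HB by (auto simp: pair_def)
 have HBs: "HB R \<subseteq> siegel" "HB r \<subseteq> siegel" using HB_siegel by auto
 define U where "U = HB r \<inter> T -` HB R"
 have hTr: "hol T (HB r)" by (rule hol_subset[OF hT HBs(2) open_Sym_HB])
 have "openin (top_of_set (HB r)) U" unfolding U_def
  by (rule continuous_openin_preimage[OF hol_continuous[OF hTr] _ open_Sym_HB]) (use hol_in_Sym[OF hTr] in auto)
 then have Uo: "open_Sym U" using open_Sym_HB openin_trans by blast
 have TT: "T (tri a b c V + X) = V" "V \<in> Sym ==> tri a b c (T V) + X = V" if "V \<in> Sym" for V
  unfolding T_def using tri_inv[of a c _ b] p that XS by simp_all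
 have "tri a b c ii + X \<in> U" using eq[OF iR] TT(1) iR HB_Sym by (simp add: U_def)
 then have Une: "U ~= {}" by blast
 have "\<Psi> Z = F Z" if Z: "Z \<in> HB r" for Z
 proof (rule hol_eqI_convex[OF hol_subset[OF h HBs(2) open_Sym_HB] F convex_HB Uo _ Une _ Z])
  show "U \<subseteq> HB r" by (auto simp: U_def)
  fix W assume W: "W \<in> U"
  then have "T W \<in> HB R" "W \<in> Sym" using HB_Sym by (auto simp: U_def)
  then show "\<Psi> W = F W" using eq[of "T W"] TT(2)[of W] \<Phi>(3)[of "T W"] by (simp add: \<Psi>_def)
 qed
 then show ?thesis unfolding ext_def using h s by blast
qed

theorem local_extension:
 assumes P: "prepair F G r" and r: "r > 0" and a: "!!k. a k \<in> HB r" "a \<longlonglongrightarrow> 0" "(%k. F (a k)) \<longlonglongrightarrow> 0"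
 shows "ext F r"
proof -
 obtain R1 where R1: "R1 > 2" "!!F G R. pair F G R ==> R1 <= R ==> pre_state F ==> ext F R" by (rule ext_pre_state) blast
 obtain \<rho>0 where \<rho>0: "\<rho>0 > 2" "!!F G \<rho>. pair F G \<rho> ==> \<rho>0 <= \<rho> ==> \<exists>F' G'. reduces F \<rho> F' G' R1 & pre_state F'"
  by (rule start_pair[OF R1(1)]) blast
 have FP: "hol F (HB r)" "!!V. V \<in> HB r ==> F V \<in> siegel" using P by (auto simp: prepair_def)
 \<comment> \<open>Points near 0 have imaginary parts of trace at most \<open>s\<close>, and this
   value lets \<open>normalise\<close> produce a pair on the half ball of radius
   \<open>\<rho>0\<close>.\<close>
 define s where "s = r / (6 * \<rho>0)"
 have s: "s > 0" "3 * s * \<rho>0 <= r / 2" using r \<rho>0 by (auto simp: s_def)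
 define m where "m = min (s / 2) (r / 2)"
 have m: "m > 0" using s r by (simp add: m_def)
 have "\<forall>\<^sub>F k in sequentially. norm (a k) < m & norm (F (a k)) < m"
  using tendstoD[OF a(2) m] tendstoD[OF a(3) m] by eventually_elim (simp add: dist_norm)
 then obtain k where k: "norm (a k) < m" "norm (F (a k)) < m" unfolding eventually_sequentially by blast
 have tr: "Im (Y$1$1) + Im (Y$2$2) <= s" if "norm Y < m" for Y :: mat2
  using order_trans[OF abs_Im_le_cmod cmod_nth_le[of Y 1 1]] order_trans[OF abs_Im_le_cmod cmod_nth_le[of Y 2 2]] that unfolding m_def by linarith
 have "a k \<in> HB (r/2)" "F (a k) \<in> HB (r/2)" using a(1)[of k] FP(2)[OF a(1)[of k]] k by (auto simp: HB_def m_def)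
 then obtain u b c u' b' c' F' G' where N: "u > 0" "c > 0" "u' > 0" "c' > 0" "pair F' G' \<rho>0"
   "!!V. V \<in> HB \<rho>0 ==> tri u b c V + rem (a k) \<in> HB r"
   "!!V. V \<in> HB \<rho>0 ==> F (tri u b c V + rem (a k)) = tri u' b' c' (F' V) + rem (F (a k))"
  using normalise[OF P _ _ tr[OF k(1)] tr[OF k(2)] \<rho>0(1) s(2)] by metis
 have red: "reduces F r F' G' \<rho>0" unfolding reduces_def using N rem_realm by blast
 obtain F'' G'' where F'': "reduces F' \<rho>0 F'' G'' R1" "pre_state F''" using \<rho>0(2)[OF N(5)] by blast
 have "pair F'' G'' R1" using F''(1) by (simp add: reduces_def)
 then have "ext F'' R1" using R1(2) F''(2) by blast
 moreover have "hol F' (HB \<rho>0)" using N(5) by (simp add: pair_def prepair_def)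
 ultimately have "ext F' \<rho>0" using reduces_ext F''(1) by blast
 then show ?thesis using reduces_ext[OF FP(1) red] by blast
qed

section \<open>Extension to the bounded domain\<close>

lemma bounded_linear_mat2_vec: "bounded_linear (%x. (z::mat2) *v x)"
proof (rule bounded_linear_intro[where K = "4 * norm z"])
 show "z *v (x + y) = z *v x + z *v y" for x y by (rule mat2_vec_lin(1))
 show "z *v (r *\<^sub>R x) = r *\<^sub>R (z *v x)" for r x
  unfolding vec2_eq_iff mat2_vec_nth vector_scaleR_component by (simp add: scaleR_conv_of_real algebra_simps)
 show "norm (z *v x) <= norm x * (4 * norm z)" for x using norm_opb[of z x] by (simp add: mult.commute)
qed

text \<open>The norm of \<open>z *v x\<close> attains its maximum on the compact unit sphere, so
  strictness for every vector gives an operator norm strictly below 1.\<close>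

lemma R_II_eq_udisc: "R_II = udisc"
proof (intro set_eqI iffI)
 fix z assume z: "z \<in> R_II"
 have "norm (z *v x) < norm x" if "x ~= 0" for x
 proof -
  have "norm (z *v x) <= onorm (%x. z *v x) * norm x" by (rule onorm[OF bounded_linear_mat2_vec])
  also have "\<dots> < 1 * norm x" using z that by (intro mult_strict_right_mono) (auto simp: R_II_def)
  finally show ?thesis by simp
 qed
 then show "z \<in> udisc" using z by (simp add: R_II_def udisc_def)
next
 fix z assume z: "z \<in> udisc"
 have "continuous_on (sphere 0 1) (%x. norm (z *v x))"
  by (intro continuous_on_norm linear_continuous_on bounded_linear_mat2_vec)
 moreover have "axis 1 1 \<in> (sphere 0 1 :: (complex^2) set)" by simp
 then have "sphere 0 1 ~= ({} :: (complex^2) set)" by blast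
 ultimately obtain x0 :: "complex^2" where x0: "norm x0 = 1" "!!x. norm x = 1 ==> norm (z *v x) <= norm (z *v x0)"
  using continuous_attains_sup[OF compact_sphere] by (metis mem_sphere_0)
 have "onorm (%x. z *v x) <= norm (z *v x0)"
 proof (rule onorm_bound)
  fix x :: "complex^2"
  show "norm (z *v x) <= norm (z *v x0) * norm x"
  proof (cases "x = 0")
   case False
   have "norm ((1 / norm x) *\<^sub>R x) = 1" using False by simp
   from x0(2)[OF this] have "norm ((1 / norm x) *\<^sub>R (z *v x)) <= norm (z *v x0)"
    using bounded_linear.linear[OF bounded_linear_mat2_vec[of z]] linear_scale by metis
   then show ?thesis using False by (simp add: pos_divide_le_eq)
  qed simp
 qed simp
 also have "x0 ~= 0" using x0(1) by auto
 then have "norm (z *v x0) < 1" using z x0(1) by (auto simp: udisc_def)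
 finally show "z \<in> R_II" using z by (simp add: R_II_def udisc_def)
qed

text \<open>By Cayley-Hamilton \<open>(a + s)^2 = (tr a + 2 s) a\<close> whenever \<open>s^2\<close>
  is the determinant of \<open>a\<close>, so \<open>k = (a + s) / \<tau>\<close> with
  \<open>\<tau>^2 = tr a + 2 s\<close> is a square root. As the determinant is nonzero, one of the
  two signs of \<open>s\<close> makes \<tau> nonzero.\<close>

lemma sqrt_unitary:
 assumes a: "a \<in> Sym" "unitary_matrix a"
 obtains k where "k \<in> Sym" "k ** k = a" "k ** cj k = mat 1" "cj k ** k = mat 1"
proof -
 define p q r where "p = a$1$1" and "q = a$1$2" and "r = a$2$2"
 have a21: "a$2$1 = q" using a(1) by (simp add: q_def Sym_iff)
 have "a ** cj a = mat 1"
  using a transpose_Sym[OF a(1)] by (simp add: unitary_matrix_def cj_def)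
 then have u: "p * cnj p + q * cnj q = 1" "q * cnj p + r * cnj q = 0" "p * cnj q + q * cnj r = 0" "q * cnj q + r * cnj r = 1"
  unfolding mat2_eq_iff by (simp_all add: a21 p_def[symmetric] q_def[symmetric] r_def[symmetric])
 define D where "D = p * r - q * q"
 have D: "D * cnj p = r" "D * cnj q = - q" "D * cnj r = p" unfolding D_def using u by algebra+
 have DD: "D * cnj D = 1"
 proof -
  have "D * cnj D = (D * cnj p) * cnj r - (D * cnj q) * cnj q" by (simp add: D_def algebra_simps)
  also have "\<dots> = 1" unfolding D using u by algebra
  finally show ?thesis .
 qed
 obtain s where s: "s * s = D" "p + r + 2 * s ~= 0"
 proof (cases "p + r + 2 * csqrt D = 0")
  case False
  then show ?thesis using that[of "csqrt D"] by (metis power2_csqrt power2_eq_square)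
 next
  case True
  have "csqrt D ~= 0" using DD by auto
  moreover have "p + r + 2 * (- csqrt D) = - 4 * csqrt D" using True by algebra
  ultimately show ?thesis using that[of "- csqrt D"] by (metis power2_csqrt power2_eq_square minus_mult_minus mult_eq_0_iff neg_equal_0_iff_equal zero_neq_numeral)
 qed
 have ss: "s * cnj s = 1"
 proof -
  have "(cmod s)\<^sup>2 * (cmod s)\<^sup>2 = 1"
  proof -
   have "of_real ((cmod s)\<^sup>2 * (cmod s)\<^sup>2) = (s * cnj s) * (s * cnj s)" by (simp only: of_real_mult complex_norm_square)
   also have "\<dots> = D * cnj D" unfolding s(1)[symmetric] complex_cnj_mult by (simp add: algebra_simps)
   finally show ?thesis using DD by (metis of_real_eq_1_iff)
  qed
  then have "(cmod s)\<^sup>2 = 1" by (metis abs_norm_cancel power2_eq_square real_sqrt_abs2 real_sqrt_one abs_power2)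
  then show ?thesis unfolding complex_norm_square[symmetric] by simp
 qed
 have sc: "s * cnj p = cnj s * r" "s * cnj q = - cnj s * q" "s * cnj r = cnj s * p"
 proof -
  have g: "s * x = cnj s * y" if "D * x = y" for x y
  proof -
   have "s * x = (s * cnj s) * (s * x)" by (simp add: ss)
   also have "\<dots> = cnj s * y" unfolding that[symmetric] s(1)[symmetric] by (simp add: algebra_simps)
   finally show ?thesis .
  qed
  show "s * cnj p = cnj s * r" "s * cnj r = cnj s * p" by (rule g[OF D(1)], rule g[OF D(3)])
  show "s * cnj q = - cnj s * q" using g[OF D(2)] by simp
 qed
 define \<tau> where "\<tau> = csqrt (p + r + 2 * s)"
 have \<tau>: "\<tau> * \<tau> = p + r + 2 * s" "\<tau> ~= 0" using s(2) by (simp_all add: \<tau>_def flip: power2_eq_square)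
 \<comment> \<open>The product of \<open>a + s\<close> with its adjoint is the scalar
   \<open>c\<close>. It equals \<open>cnj s * \<tau> * \<tau>\<close> and is a nonnegative real
   number, hence equals \<open>\<tau> * cnj \<tau>\<close>; so \<open>k\<close> is unitary.\<close>
 define c where "c = 2 + cnj s * (p + r)"
 have c1: "c = cnj s * (\<tau> * \<tau>)" unfolding \<tau>(1) c_def using ss by algebra
 have c2: "c = (p + s) * cnj (p + s) + q * cnj q" unfolding c_def complex_cnj_add using u(1) ss sc by algebra
 have "c = of_real ((cmod (p + s))\<^sup>2 + (cmod q)\<^sup>2)" unfolding c2 of_real_add complex_norm_square ..
 then have "c = of_real (cmod c)" by (metis abs_of_nonneg add_nonneg_nonneg norm_of_real zero_le_power2)
 also have "cmod c = (cmod \<tau>)\<^sup>2"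
 proof -
  have "cmod s = 1" using ss by (metis complex_norm_square complex_mod_cnj norm_mult norm_one power2_eq_square real_sqrt_abs2 real_sqrt_one abs_norm_cancel)
  then show ?thesis unfolding c1 by (simp add: norm_mult power2_eq_square)
 qed
 finally have c: "c = \<tau> * cnj \<tau>" by (simp only: complex_norm_square)
 define k where "k = symat ((p + s) / \<tau>) (q / \<tau>) ((r + s) / \<tau>)"
 have n0: "\<tau> * cnj \<tau> ~= 0" using \<tau> by simp
 have "k ** k = a"
 proof -
  have e: "(p + s) * (p + s) + q * q = (\<tau> * \<tau>) * p" "(p + s) * q + q * (r + s) = (\<tau> * \<tau>) * q" "q * q + (r + s) * (r + s) = (\<tau> * \<tau>) * r"
  proof -
   have q2: "q * q = p * r - s * s" using s(1) by (simp add: D_def)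
   show "(p + s) * (p + s) + q * q = (\<tau> * \<tau>) * p" "(p + s) * q + q * (r + s) = (\<tau> * \<tau>) * q" "q * q + (r + s) * (r + s) = (\<tau> * \<tau>) * r"
    unfolding \<tau>(1) q2 by (simp_all add: algebra_simps)
  qed
  have d: "x / \<tau> * (y / \<tau>) + z / \<tau> * (w / \<tau>) = v" if "x * y + z * w = (\<tau> * \<tau>) * v" for x y z w v
  proof -
   have "x / \<tau> * (y / \<tau>) + z / \<tau> * (w / \<tau>) = (x * y + z * w) / (\<tau> * \<tau>)" by (simp add: add_divide_distrib)
   then show ?thesis unfolding that using \<tau>(2) by simp
  qed
  have e': "q * (p + s) + (r + s) * q = (\<tau> * \<tau>) * q" using e(2) by algebra
  show ?thesis unfolding mat2_eq_iff mat2_mult_nth k_def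
   using d[OF e(1)] d[OF e(2)] d[OF e'] d[OF e(3)] a21 by (simp add: p_def[symmetric] q_def[symmetric] r_def[symmetric])
 qed
 moreover have kk: "k ** cj k = mat 1"
 proof -
  have e: "(p + s) * cnj (p + s) + q * cnj q = \<tau> * cnj \<tau> * 1" "(p + s) * cnj q + q * cnj (r + s) = \<tau> * cnj \<tau> * 0"
   "q * cnj (p + s) + (r + s) * cnj q = \<tau> * cnj \<tau> * 0" "q * cnj q + (r + s) * cnj (r + s) = \<tau> * cnj \<tau> * 1"
   unfolding c[symmetric] c_def complex_cnj_add using u ss sc by algebra+
  have d: "x / \<tau> * (y / cnj \<tau>) + z / \<tau> * (w / cnj \<tau>) = v" if "x * y + z * w = (\<tau> * cnj \<tau>) * v" for x y z w v
  proof -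
   have "x / \<tau> * (y / cnj \<tau>) + z / \<tau> * (w / cnj \<tau>) = (x * y + z * w) / (\<tau> * cnj \<tau>)" by (simp add: add_divide_distrib)
   then show ?thesis unfolding that by (simp only: nonzero_mult_div_cancel_left[OF n0])
  qed
  show ?thesis unfolding mat2_eq_iff mat2_mult_nth k_def cj_nth
   using d[OF e(1)] d[OF e(2)] d[OF e(3)] d[OF e(4)] by simp
 qed
 moreover have "cj k ** k = mat 1" using kk matrix_left_right_inverse by blast
 moreover have "k \<in> Sym" by (simp add: k_def)
 ultimately show thesis using that by blast
qed

lemma isometry_unitary:
 assumes "k \<in> Sym" "cj k ** k = mat 1"
 shows "norm (k *v v) = norm v"
proof -
 have "hin (k *v v) (k *v v) = hin v v"
  unfolding hin_adjoint[of "k *v v" k] using assms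
  by (simp add: matrix_vector_mul_assoc transpose_Sym cj_simps flip: cj_simps(4))
 then have "(norm (k *v v))\<^sup>2 = (norm v)\<^sup>2" unfolding hin_self by (simp only: of_real_eq_iff)
 then show ?thesis by (simp add: power2_eq_iff_nonneg)
qed

text \<open>\<open>k\<close> is an isometry on vectors, so multiplying by it on both sides leaves
  the operator norm unchanged; its inverse is \<open>cj k\<close>.\<close>

lemma conj_action:
 assumes k: "k \<in> Sym" "k ** cj k = mat 1" "cj k ** k = mat 1"
 shows "open_Sym S ==> hol (%z. k ** z ** k) S" "z \<in> udisc ==> k ** z ** k \<in> udisc"
  "cj k \<in> Sym" "k ** (cj k ** z ** cj k) ** k = z"
proof -
 have S: "k ** z ** k \<in> Sym" if "z \<in> Sym" for z
  using that k(1) unfolding Sym_def by (simp add: matrix_transpose_mul matrix_mul_assoc)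
 show "hol (%z. k ** z ** k) S" if "open_Sym S"
  unfolding hol_def
 proof (intro conjI ballI allI that)
  show "k ** z ** k \<in> Sym" if "z \<in> S" for z using S that open_Sym_subset[OF \<open>open_Sym S\<close>] by blast
  show "shol (%z. (k ** z ** k) $ i $ j) S" for i j
   unfolding mat2_mult_nth by (intro shol_intros that)
 qed
 show "k ** z ** k \<in> udisc" if z: "z \<in> udisc"
  unfolding udisc_def
 proof (intro CollectI conjI allI impI)
  fix x :: "complex^2" assume x: "x ~= 0"
  note i = isometry_unitary[OF k(1,3)]
  have "k *v x ~= 0" using i[of x] x by auto
  then have "norm (z *v (k *v x)) < norm (k *v x)" using z by (simp add: udisc_def)
  then show "norm ((k ** z ** k) *v x) < norm x" by (simp add: i flip: matrix_vector_mul_assoc)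
 qed (use S z udisc_Sym in blast)
 show "cj k \<in> Sym" using k(1) by (simp add: Sym_iff)
 have "k ** (cj k ** z ** cj k) ** k = (k ** cj k) ** z ** (cj k ** k)" by (simp only: matrix_mul_assoc)
 then show "k ** (cj k ** z ** cj k) ** k = z" unfolding k(2,3) by simp
qed

text \<open>With \<open>k^2 = a\<close> and \<open>l\<close> the inverse of \<open>k\<close>, the
  automorphism \<open>l z l\<close> moves the boundary point \<open>a\<close> to
  \<open>mat 1\<close>, which the Cayley map sends to 0. The last two conclusions express continuity
  of \<open>B\<close> at 0 and of \<open>A\<close> at \<open>a\<close>, which is all that is needed
  at these boundary points.\<close>

lemma chart:
 assumes a: "a \<in> Sym" "unitary_matrix a"
 obtains A B where "hol A udisc" "A ` udisc \<subseteq> siegel" "hol B siegel" "B ` siegel \<subseteq> udisc"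
  "!!z. z \<in> udisc ==> B (A z) = z" "!!Z. Z \<in> siegel ==> A (B Z) = Z"
  "!!U. openin (top_of_set Sym) U ==> a \<in> U ==> \<exists>r>0. \<forall>Z\<in>HB r. B Z \<in> U"
  "!!r. r > 0 ==> \<exists>d>0. \<forall>z\<in>udisc. norm (z - a) < d --> A z \<in> HB r"
proof -
 obtain k where k: "k \<in> Sym" "k ** k = a" "k ** cj k = mat 1" "cj k ** k = mat 1" using sqrt_unitary[OF a] by blast
 define l where "l = cj k"
 have l: "l \<in> Sym" "l ** cj l = mat 1" "cj l ** l = mat 1" using k conj_action(3)[of k] by (auto simp: l_def cj_simps)
 note ck = conj_action[OF k(1,3,4)] and cl = conj_action[OF l]
 define A where "A z = C_map (l ** z ** l)" for z
 define B where "B Z = k ** C_inv Z ** k" for Z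
 have cjl: "cj l = k" by (simp add: l_def cj_simps)
 have o: "open_Sym Sym" by simp
 have la: "l ** a ** l = mat 1"
 proof -
  have "l ** a ** l = (l ** k) ** (k ** l)" unfolding k(2)[symmetric] by (simp only: matrix_mul_assoc)
  then show ?thesis using k(3,4) by (simp add: l_def)
 qed
 have 1: "hol A udisc" unfolding A_def[abs_def]
  by (rule hol_comp[OF cl(1)[OF open_Sym_udisc] hol_C_map]) (use cl(2) udisc_Sym udisc_den in blast)
 have 2: "A ` udisc \<subseteq> siegel" using cl(2) C_map_siegel by (auto simp: A_def)
 have 4: "B ` siegel \<subseteq> udisc" using ck(2) C_inv_udisc by (auto simp: B_def)
 have hCi: "hol C_inv siegel" by (rule hol_subset[OF hol_C_inv _ open_Sym_siegel]) (use siegel_den siegel_Sym in blast)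
 have 3: "hol B siegel" unfolding B_def[abs_def]
  by (rule hol_comp[OF hCi ck(1)[OF o]]) (use hol_in_Sym[OF hCi] in blast)
 have 5: "B (A z) = z" if "z \<in> udisc" for z
  unfolding A_def B_def C_inv_C_map[OF cl(2)[OF that]] using ck(4)[of z] by (simp add: l_def)
 have 6: "A (B Z) = Z" if "Z \<in> siegel" for Z
  unfolding A_def B_def using cl(4)[of "C_inv Z"] C_map_C_inv[OF that] by (simp add: cjl)
 have A0: "A a = 0" unfolding A_def la by (simp add: C_map_def mat2_eq_iff)
 have c0: "cscale (-\<i>) 0 = 0" by (simp add: mat2_eq_iff)
 have B0: "B 0 = a" unfolding B_def C_inv_def c0 using k(2) by simp
 have z0: "0 \<in> Sym" by (simp add: Sym_iff)
 have 7: "\<exists>r>0. \<forall>Z\<in>HB r. B Z \<in> U" if U: "openin (top_of_set Sym) U" "a \<in> U" for U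
 proof -
  let ?D = "{Z \<in> Sym. den (cscale (-\<i>) Z) ~= 0}"
  have hB: "hol B ?D" unfolding B_def[abs_def]
   by (rule hol_comp[OF hol_C_inv ck(1)[OF o]]) (use hol_in_Sym[OF hol_C_inv] in blast)
  have D0: "0 \<in> ?D" unfolding mem_Collect_eq c0 using z0 by simp
  have "openin (top_of_set ?D) (?D \<inter> B -` U)"
   by (rule continuous_openin_preimage[OF hol_continuous[OF hB] _ U(1)]) (use hol_in_Sym[OF hB] in blast)
  then have o': "open_Sym (?D \<inter> B -` U)" using open_Sym_C_inv openin_trans by blast
  have m: "0 \<in> ?D \<inter> B -` U" using D0 B0 U(2) by simp
  obtain r where r: "r > 0" "!!W. W \<in> Sym ==> norm (W - 0) < r ==> W \<in> ?D \<inter> B -` U" by (rule open_SymD[OF o' m]) blast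
  have "B Z \<in> U" if "Z \<in> HB r" for Z using r(2)[of Z] that siegel_Sym by (simp add: HB_def)
  then show ?thesis using r(1) by blast
 qed
 have 8: "\<exists>d>0. \<forall>z\<in>udisc. norm (z - a) < d --> A z \<in> HB r" if r: "r > 0" for r
 proof -
  let ?D = "Sym \<inter> (%z. l ** z ** l) -` {z \<in> Sym. den z ~= 0}"
  have hl: "hol (%z. l ** z ** l) Sym" by (rule cl(1)[OF o])
  have Do: "open_Sym ?D"
   by (rule continuous_openin_preimage[OF hol_continuous[OF hl] _ open_Sym_den]) (use hol_in_Sym[OF hl] in blast)
  have hA: "hol A ?D" unfolding A_def[abs_def]
   by (rule hol_comp[OF hol_subset[OF hl _ Do] hol_C_map]) auto
  have aD: "a \<in> ?D" unfolding Int_iff vimage_eq la using a(1) by (auto simp: Sym_iff)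
  from hol_continuous[OF hA] aD r obtain d where d: "d > 0" "!!z. z \<in> ?D ==> dist z a < d ==> dist (A z) (A a) < r"
   unfolding continuous_on_iff by blast
  have uD: "z \<in> ?D" if "z \<in> udisc" for z using that cl(2)[OF that] udisc_Sym udisc_den by blast
  show ?thesis
   by (rule exI[of _ d]) (use d uD A0 2 in \<open>auto simp: HB_def dist_norm\<close>)
 qed
 show thesis by (rule that[OF 1 2 3 4 5 6 7 8])
qed

text \<open>The composition is the identity near \<open>p\<close>, hence on the whole convex half
  space.\<close>

lemma ext_inverse:
 assumes P: "prepair F G r" and p: "p \<in> HB r" "F p \<in> HB r"
  and \<Phi>: "hol \<Phi> siegel" "\<Phi> ` siegel \<subseteq> siegel" "!!Z. Z \<in> HB r ==> \<Phi> Z = F Z"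
  and \<Psi>: "hol \<Psi> siegel" "!!Z. Z \<in> HB r ==> \<Psi> Z = G Z" and Z: "Z \<in> siegel"
 shows "\<Psi> (\<Phi> Z) = Z"
proof -
 have FP: "hol F (HB r)" "!!V. V \<in> HB r ==> F V \<in> HB r ==> G (F V) = V"
  using P by (auto simp: prepair_def)
 define S where "S = HB r \<inter> F -` HB r"
 have "openin (top_of_set (HB r)) S" unfolding S_def
  by (rule continuous_openin_preimage[OF hol_continuous[OF FP(1)] _ open_Sym_HB])
   (use hol_in_Sym[OF FP(1)] in auto)
 then have So: "open_Sym S" using open_Sym_HB openin_trans by blast
 have hid: "hol (%Z. Z) siegel"
  unfolding hol_def using siegel_Sym shol_nth open_Sym_siegel by auto
 show ?thesis
 proof (rule hol_eqI_convex[OF hol_comp[OF \<Phi>(1) \<Psi>(1)] hid convex_siegel So _ _ _ Z])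
  show "\<Phi> Z \<in> siegel" if "Z \<in> siegel" for Z using \<Phi>(2) that by blast
  show "S \<subseteq> siegel" using HB_siegel by (auto simp: S_def)
  show "S ~= {}" using p by (auto simp: S_def)
  show "\<Psi> (\<Phi> W) = W" if "W \<in> S" for W using that FP(2) \<Phi>(3) \<Psi>(2) by (simp add: S_def)
 qed
qed

lemma holomorphic_Sym_cong:
 assumes "holomorphic_Sym f S" "!!z. z \<in> S ==> g z = f z" shows "holomorphic_Sym g S"
 using assms has_derivative_transform[of _ S g f] unfolding holomorphic_Sym_def by metis

text \<open>\<open>Sym\<close> is convex, hence locally connected, and so are its open
  subsets.\<close>

lemma open_Sym_component:
 assumes "open_Sym S" "C \<in> components S" shows "open_Sym C"
proof -
 have "convex Sym" unfolding convex_def by (auto simp: Sym_iff)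
 then have "locally connected S" using convex_imp_locally_connected locally_open_subset assms(1) by blast
 then have "openin (top_of_set S) C" using openin_components_locally_connected assms(2) by blast
 then show ?thesis using assms(1) openin_trans by blast
qed

theorem lemma15:
  fixes a0 b0 :: mat2
    and U V :: "mat2 set"
    and \<phi> :: "mat2 \<Rightarrow> mat2"
    and a :: "nat \<Rightarrow> mat2"
  assumes "a0 \<in> Sym" and "unitary_matrix a0"
    and "b0 \<in> Sym" and "unitary_matrix b0"
    and "openin (top_of_set Sym) U" and "a0 \<in> U"
    and "openin (top_of_set Sym) V" and "b0 \<in> V"
    and "biholomorphic_Sym (U \<inter> R_II) (V \<inter> R_II) \<phi>"
    and "\<And>k. a k \<in> U \<inter> R_II"
    and "a \<longlonglongrightarrow> a0"
    and "(\<lambda>k. \<phi> (a k)) \<longlonglongrightarrow> b0"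
  shows "\<exists>\<Phi>. automorphism_R_II \<Phi> \<and> extends_from a0 (U \<inter> R_II) \<phi> \<Phi>"
proof -
 obtain A B where A: "hol A udisc" "A ` udisc \<subseteq> siegel" "hol B siegel" "B ` siegel \<subseteq> udisc"
  "!!z. z \<in> udisc ==> B (A z) = z" "!!Z. Z \<in> siegel ==> A (B Z) = Z"
  "!!U. openin (top_of_set Sym) U ==> a0 \<in> U ==> \<exists>r>0. \<forall>Z\<in>HB r. B Z \<in> U"
  "!!r. r > 0 ==> \<exists>d>0. \<forall>z\<in>udisc. norm (z - a0) < d --> A z \<in> HB r"
  by (rule chart[OF assms(1,2)]) blast
 obtain A' B' where A': "hol A' udisc" "A' ` udisc \<subseteq> siegel" "hol B' siegel" "B' ` siegel \<subseteq> udisc"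
  "!!z. z \<in> udisc ==> B' (A' z) = z" "!!Z. Z \<in> siegel ==> A' (B' Z) = Z"
  "!!U. openin (top_of_set Sym) U ==> b0 \<in> U ==> \<exists>r>0. \<forall>Z\<in>HB r. B' Z \<in> U"
  "!!r. r > 0 ==> \<exists>d>0. \<forall>z\<in>udisc. norm (z - b0) < d --> A' z \<in> HB r"
  by (rule chart[OF assms(3,4)]) blast
 obtain r1 where r1: "r1 > 0" "!!Z. Z \<in> HB r1 ==> B Z \<in> U" using A(7)[OF assms(5,6)] by blast
 obtain r2 where r2: "r2 > 0" "!!Z. Z \<in> HB r2 ==> B' Z \<in> V" using A'(7)[OF assms(7,8)] by blast
 define r where "r = min r1 r2"
 have r: "r > 0" using r1 r2 by (simp add: r_def)
 define S T where "S = U \<inter> udisc" and "T = V \<inter> udisc"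
 have So: "open_Sym S" and To: "open_Sym T" using assms(5,7) open_Sym_udisc by (auto simp: S_def T_def)
 define \<psi> where "\<psi> = inv_into S \<phi>"
 have bi: "bij_betw \<phi> S T" "holomorphic_Sym \<phi> S" "holomorphic_Sym \<psi> T"
  using assms(9) by (auto simp: biholomorphic_Sym_def S_def T_def R_II_eq_udisc \<psi>_def)
 have bj: "\<phi> z \<in> T" "\<psi> (\<phi> z) = z" if "z \<in> S" for z
  using bij_betwE[OF bi(1)] bij_betw_inv_into_left[OF bi(1)] that by (auto simp: \<psi>_def)
 have bj': "\<psi> w \<in> S" "\<phi> (\<psi> w) = w" if "w \<in> T" for w
  using bij_betwE[OF bij_betw_inv_into[OF bi(1)]] bij_betw_inv_into_right[OF bi(1)] that by (auto simp: \<psi>_def)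
 have TS: "S \<subseteq> Sym" "T \<subseteq> Sym" "S \<subseteq> udisc" "T \<subseteq> udisc" using udisc_Sym by (auto simp: S_def T_def)
 have h\<phi>: "hol \<phi> S" using hol_iff_holomorphic_Sym[OF So] bi(2) bj(1) TS by blast
 have h\<psi>: "hol \<psi> T" using hol_iff_holomorphic_Sym[OF To] bi(3) bj'(1) TS by blast
 have BS: "B Z \<in> S" "B' Z \<in> T" if "Z \<in> HB r" for Z
  using that r1(2)[of Z] r2(2)[of Z] A(4) A'(4) by (auto simp: HB_def r_def S_def T_def)
 define F G where "F Z = A' (\<phi> (B Z))" and "G Z = A (\<psi> (B' Z))" for Z
 have HBs: "HB r \<subseteq> siegel" using HB_siegel by auto
 have \<phi>u: "\<phi> z \<in> udisc" if "z \<in> S" for z using bj(1)[OF that] TS(4) by blast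
 have \<psi>u: "\<psi> w \<in> udisc" if "w \<in> T" for w using bj'(1)[OF that] TS(3) by blast
 have As: "A z \<in> siegel" "A' z \<in> siegel" if "z \<in> udisc" for z using A(2) A'(2) that by auto
 have Bu: "B Z \<in> udisc" "B' Z \<in> udisc" if "Z \<in> siegel" for Z using A(4) A'(4) that by auto
 have FG: "F Z \<in> siegel" "G Z \<in> siegel" if "Z \<in> HB r" for Z
  unfolding F_def G_def by (rule As(2)[OF \<phi>u[OF BS(1)[OF that]]], rule As(1)[OF \<psi>u[OF BS(2)[OF that]]])
 have hF: "hol F (HB r)" unfolding F_def[abs_def]
  by (rule hol_comp[OF hol_comp[OF hol_subset[OF A(3) HBs open_Sym_HB] h\<phi>] A'(1)]) (simp_all add: BS \<phi>u)
 have hG: "hol G (HB r)" unfolding G_def[abs_def]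
  by (rule hol_comp[OF hol_comp[OF hol_subset[OF A'(3) HBs open_Sym_HB] h\<psi>] A(1)]) (simp_all add: BS \<psi>u)
 have GF: "G (F Z) = Z" if "Z \<in> HB r" for Z
 proof -
  have "B' (F Z) = \<phi> (B Z)" unfolding F_def by (rule A'(5)[OF \<phi>u[OF BS(1)[OF that]]])
  then show ?thesis unfolding G_def using bj(2)[OF BS(1)[OF that]] A(6) HBs that by auto
 qed
 have FG': "F (G Z) = Z" if "Z \<in> HB r" for Z
 proof -
  have "B (G Z) = \<psi> (B' Z)" unfolding G_def by (rule A(5)[OF \<psi>u[OF BS(2)[OF that]]])
  then show ?thesis unfolding F_def using bj'(2)[OF BS(2)[OF that]] A'(6) HBs that by auto
 qed
 have P: "prepair F G r" unfolding prepair_def using hF hG FG GF FG' by blast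
 have aS: "a k \<in> S" for k using assms(10)[of k] by (simp add: S_def R_II_eq_udisc)
 have aU: "a k \<in> udisc" for k using aS TS(3) by blast
 have evA: "\<forall>\<^sub>F k in sequentially. A (a k) \<in> HB e" if e: "e > 0" for e
 proof -
  obtain d where d: "d > 0" "!!z. z \<in> udisc ==> norm (z - a0) < d ==> A z \<in> HB e" using A(8)[OF e] by blast
  show ?thesis using tendstoD[OF assms(11) d(1)] by eventually_elim (use d(2)[OF aU] in \<open>simp add: dist_norm\<close>)
 qed
 have evA': "\<forall>\<^sub>F k in sequentially. A' (\<phi> (a k)) \<in> HB e" if e: "e > 0" for e
 proof -
  obtain d where d: "d > 0" "!!z. z \<in> udisc ==> norm (z - b0) < d ==> A' z \<in> HB e" using A'(8)[OF e] by blast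
  show ?thesis using tendstoD[OF assms(12) d(1)] by eventually_elim (use d(2)[OF \<phi>u[OF aS]] in \<open>simp add: dist_norm\<close>)
 qed
 have lim: "f \<longlonglongrightarrow> 0" if "!!e. e > 0 ==> \<forall>\<^sub>F k in sequentially. f k \<in> HB e" for f
  by (rule tendstoI, drule that) (erule eventually_mono, simp add: HB_def dist_norm)
 have "\<forall>\<^sub>F k in sequentially. A (a k) \<in> HB r & A' (\<phi> (a k)) \<in> HB r" using evA[OF r] evA'[OF r] by eventually_elim simp
 then obtain m where m: "!!k. k >= m ==> A (a k) \<in> HB r & A' (\<phi> (a k)) \<in> HB r" unfolding eventually_sequentially by blast
 \<comment> \<open>Only from some index on do the charts carry the points and their images into
   \<open>HB r\<close>; hence the shift by \<open>m\<close>.\<close>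
 define x where "x k = A (a (k + m))" for k
 define y where "y k = A' (\<phi> (a (k + m)))" for k
 have xy: "x k \<in> HB r" "y k \<in> HB r" for k using m[of "k + m"] by (auto simp: x_def y_def)
 have x0: "x \<longlonglongrightarrow> 0" unfolding x_def[abs_def] by (rule LIMSEQ_ignore_initial_segment[OF lim[OF evA]])
 have y0: "y \<longlonglongrightarrow> 0" unfolding y_def[abs_def] by (rule LIMSEQ_ignore_initial_segment[OF lim[OF evA']])
 have Fx: "F (x k) = y k" for k using A(5)[of "a (k + m)"] aS[of "k + m"] TS(3) by (auto simp: F_def x_def y_def)
 have Gy: "G (y k) = x k" for k using GF[OF xy(1)] unfolding Fx .
 \<comment> \<open>The inverse \<open>G\<close> is extended in the same way, with the roles of the
   two sequences exchanged, so that the two self-maps of the half space turn out to be mutually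
   inverse.\<close>
 have "ext F r" using local_extension[OF P r xy(1) x0] y0 unfolding Fx by blast
 then obtain \<Phi>1 where \<Phi>1: "hol \<Phi>1 siegel" "\<Phi>1 ` siegel \<subseteq> siegel" "!!Z. Z \<in> HB r ==> \<Phi>1 Z = F Z" unfolding ext_def by blast
 have "ext G r" using local_extension[OF prepair_sym[OF P] r xy(2) y0] x0 unfolding Gy by blast
 then obtain \<Phi>2 where \<Phi>2: "hol \<Phi>2 siegel" "\<Phi>2 ` siegel \<subseteq> siegel" "!!Z. Z \<in> HB r ==> \<Phi>2 Z = G Z" unfolding ext_def by blast
 have i1: "\<Phi>2 (\<Phi>1 Z) = Z" if "Z \<in> siegel" for Z
  by (rule ext_inverse[OF P xy(1)[of 0] _ \<Phi>1 \<Phi>2(1,3) that]) (simp add: Fx xy)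
 have i2: "\<Phi>1 (\<Phi>2 Z) = Z" if "Z \<in> siegel" for Z
  by (rule ext_inverse[OF prepair_sym[OF P] xy(2)[of 0] _ \<Phi>2 \<Phi>1(1,3) that]) (simp add: Gy xy)
 have \<Phi>s: "\<Phi>1 Z \<in> siegel" "\<Phi>2 Z \<in> siegel" if "Z \<in> siegel" for Z using \<Phi>1(2) \<Phi>2(2) that by auto
 define \<Phi> \<Psi> where "\<Phi> z = B' (\<Phi>1 (A z))" and "\<Psi> z = B (\<Phi>2 (A' z))" for z
 have \<Phi>u: "\<Phi> z \<in> udisc" "\<Psi> z \<in> udisc" if "z \<in> udisc" for z
  unfolding \<Phi>_def \<Psi>_def by (simp_all add: Bu As \<Phi>s that)
 have \<Phi>\<Psi>: "\<Psi> (\<Phi> z) = z" "\<Phi> (\<Psi> z) = z" if "z \<in> udisc" for z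
 proof -
  have s: "A z \<in> siegel" "A' z \<in> siegel" "\<Phi>1 (A z) \<in> siegel" "\<Phi>2 (A' z) \<in> siegel" by (simp_all add: As \<Phi>s that)
  show "\<Psi> (\<Phi> z) = z" unfolding \<Phi>_def \<Psi>_def A'(6)[OF s(3)] i1[OF s(1)] by (rule A(5)[OF that])
  show "\<Phi> (\<Psi> z) = z" unfolding \<Phi>_def \<Psi>_def A(6)[OF s(4)] i2[OF s(2)] by (rule A'(5)[OF that])
 qed
 have h\<Phi>: "hol \<Phi> udisc" unfolding \<Phi>_def[abs_def]
  by (rule hol_comp[OF hol_comp[OF A(1) \<Phi>1(1)] A'(3)]) (simp_all add: As \<Phi>s)
 have h\<Psi>: "hol \<Psi> udisc" unfolding \<Psi>_def[abs_def]
  by (rule hol_comp[OF hol_comp[OF A'(1) \<Phi>2(1)] A(3)]) (simp_all add: As \<Phi>s)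
 have bij: "bij_betw \<Phi> udisc udisc" by (rule bij_betw_byWitness[where f' = \<Psi>]) (use \<Phi>u \<Phi>\<Psi> in auto)
 have hs: "holomorphic_Sym \<Phi> udisc" "holomorphic_Sym \<Psi> udisc"
  by (rule conjunct1[OF iffD1[OF hol_iff_holomorphic_Sym[OF open_Sym_udisc] h\<Phi>]],
    rule conjunct1[OF iffD1[OF hol_iff_holomorphic_Sym[OF open_Sym_udisc] h\<Psi>]])
 have inv: "inv_into udisc \<Phi> z = \<Psi> z" if "z \<in> udisc" for z
  using bij_betw_inv_into_left[OF bij \<Phi>u(2)[OF that]] \<Phi>\<Psi>(2)[OF that] by simp
 have hi: "holomorphic_Sym (inv_into udisc \<Phi>) udisc" by (rule holomorphic_Sym_cong[OF hs(2) inv])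
 have aut: "automorphism_R_II \<Phi>"
  unfolding automorphism_R_II_def biholomorphic_Sym_def R_II_eq_udisc
  using bij hs(1) hi by blast
 have agree: "\<Phi> (B Z) = \<phi> (B Z)" if "Z \<in> HB r" for Z
 proof -
  have "A (B Z) = Z" using A(6) HBs that by blast
  moreover have "B' (F Z) = \<phi> (B Z)" unfolding F_def by (rule A'(5)[OF \<phi>u[OF BS(1)[OF that]]])
  ultimately show ?thesis unfolding \<Phi>_def using \<Phi>1(3)[OF that] by simp
 qed
 have ext: "extends_from a0 S \<phi> \<Phi>"
  unfolding extends_from_def
 proof (intro ballI impI)
  fix C z assume C: "C \<in> components S" "a0 \<in> closure C" and z: "z \<in> C"
  have Co: "open_Sym C" by (rule open_Sym_component[OF So C(1)])
  have CS: "C \<subseteq> S" using C(1) in_components_subset by blast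
  \<comment> \<open>\<open>W\<close> is connected, lies in \<open>S\<close> and contains all points
    of the domain close to \<open>a0\<close>. Hence every component of \<open>S\<close> adherent to
    \<open>a0\<close> contains it, and agreement on the open part \<open>N\<close> spreads over that
    component by the identity theorem.\<close>
  define W where "W = B ` HB r"
  have WS: "W \<subseteq> S" using BS by (auto simp: W_def)
  have Wc: "connected W" unfolding W_def
   by (rule connected_continuous_image[OF hol_continuous[OF hol_subset[OF A(3) HBs open_Sym_HB]] convex_connected[OF convex_HB]])
  obtain d where d: "d > 0" "!!z. z \<in> udisc ==> norm (z - a0) < d ==> A z \<in> HB r" using A(8)[OF r] by blast
  obtain c where c: "c \<in> C" "dist c a0 < d" using C(2) d(1) unfolding closure_approachable by blast
  have "c \<in> udisc" using c CS TS by blast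
  then have "A c \<in> HB r" "B (A c) = c" using d(2)[of c] c(2) A(5) by (auto simp: dist_norm)
  then have cW: "c \<in> W" unfolding W_def by (metis imageI)
  have "W \<subseteq> C" by (rule components_maximal[OF C(1) Wc WS]) (use c cW in blast)
  define N where "N = C \<inter> A -` HB r"
  have hAC: "hol A C" by (rule hol_subset[OF A(1) _ Co]) (use CS TS in blast)
  have "openin (top_of_set C) N" unfolding N_def
   by (rule continuous_openin_preimage[OF hol_continuous[OF hAC] _ open_Sym_HB]) (use hol_in_Sym[OF hAC] in blast)
  then have No: "open_Sym N" using Co openin_trans by blast
  show "\<Phi> z = \<phi> z"
  proof (rule hol_eqI_connected[OF _ hol_subset[OF h\<phi> CS Co] in_components_connected[OF C(1)] No _ _ _ z])
   show "hol \<Phi> C" by (rule hol_subset[OF h\<Phi> _ Co]) (use CS TS in blast)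
   show "N \<subseteq> C" by (auto simp: N_def)
   show "N ~= {}" using c \<open>A c \<in> HB r\<close> by (auto simp: N_def)
   fix w assume w: "w \<in> N"
   then have "B (A w) = w" "A w \<in> HB r" using A(5) CS TS by (auto simp: N_def)
   then show "\<Phi> w = \<phi> w" using agree[of "A w"] by simp
  qed
 qed
 show ?thesis using aut ext by (intro exI[of _ \<Phi>]) (simp add: S_def R_II_eq_udisc)
qed

end
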